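(* In the setting of the context, let $B$ be a monomial set closed under division and suppose that $B$ is regular. Let $\mathbf f=(f_1,\dots,f_N)\in\mathbb C[x_1,\dots,x_n]^N$, let $F_0(\mathbf x,\mu)$ be the square system and $F_1(\mathbf x,\mu)$ the remaining equations described in the context, and let $(\xi_0,\mu_0)$ be a point (with $\xi_0\in\mathbb C^n$ and $\mu_0$ a complex value of the vector of unknowns $\mu$) at which the Jacobian $DF_0$ is invertible. Put $$\tilde\beta:=2\,\|DF_0^{-1}(\xi_0,\mu_0)\,F_0(\xi_0,\mu_0)\|,\qquad \tilde\gamma:=\sup_{k\ge2}\Big\|DF_0^{-1}(\xi_0,\mu_0)\,\frac{D^kF_0(\xi_0,\mu_0)}{k!}\Big\|^{\frac1{k-1}},\qquad \tilde\alpha:=\tilde\beta\,\tilde\gamma .$$ Suppose that 1. $\tilde\alpha<\tilde\alpha_0:=0.26141$; 2. $\mathcal L_1(K_{o+1};\xi_0,\mu_0;\tilde\beta)\,\tilde\beta<\sigma_{\min}(K_{o+1}(\xi_0,\mu_0))$; 3. $\mathcal L_1(A^{\mathrm{reg}}_t;\mu_0;\tilde\beta)\,\tilde\beta<\sigma_{\min}(A^{\mathrm{reg}}_t(\mu_0))$ for $t=1,\dots,o$. Then the Newton iteration on the square system $F_0$ starting from $(\xi_0,\mu_0)$ converges quadratically to a point $(\xi^*,\mu^* )$ corresponding to a multiple point $\xi^*$ with multiplicity structure $\mu^*$ of a perturbed system $\mathbf f_{\epsilon^*}=\mathbf f-\epsilon^*B_{\xi^*}$, where $B_{\xi^*}=\{(\mathbf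 x-\xi^* )^{\beta_1},\dots,(\mathbf x-\xi^* )^{\beta_r}\}$ (viewed as a column vector) and $\epsilon^*\in\mathbb C^{N\times r}$, such that $$\|\epsilon^*\|\le\|F_1(\xi_0,\mu_0)\|+\mathcal L_1(F_1;\xi_0,\mu_0;\tilde\beta)\,\tilde\beta .$$
   Context: **Dual polynomials.** Let $\mathbf x=(x_1,\dots,x_n)$, $\mathbf d=(d_1,\dots,d_n)$, and let $e_1,\dots,e_n$ be the standard basis of $\mathbb N^n$. For $\xi\in\mathbb C^n$, $\mathbb C[\mathbf d_\xi]$ is the polynomial ring $\mathbb C[\mathbf d]$ whose elements act as linear functionals on $\mathbb C[\mathbf x]$ by $\mathbf d_\xi^{\beta}(p)=\partial^{|\beta|}p/\partial\mathbf x^\beta(\xi)$; for $\xi=0$ write $\mathbf d$. $\mathbb C[\mathbf d]_t$ is the space of polynomials of degree $\le t$. For $\Lambda\in\mathbb C[\mathbf d]$ and $1\le k\le n$, $I_k(\Lambda)$ is the unique polynomial divisible by $d_k$ with $\partial_{d_k}I_k(\Lambda)=\Lambda(d_1,\dots,d_k,0,\dots,0)$. **Monomial set.** $B=\{\mathbf x^{\beta_1},\dots,\mathbf x^{\beta_r}\}$, $E=\{\beta_1,\dots,\beta_r\}$, ordered by increasing degree, $\beta_1=0$. Closed under division: $\beta\in E$ and $\beta_k>0$ (the $k$-th entry) imply $\beta-e_k\in E$. $B_t$ (resp. $B_{[t]}$) is the set of elements of $B$ of degree $\le t$ (resp. $=t$), $r_t=|B_t|$, $h_t=|B_{[t]}|$,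 $o=\deg B=|\beta_r|$. **Unknowns.** For $|\beta_j|<|\beta_i|$ and $1\le k\le n$ there is a scalar $\mu_{i,j}^k$ (written $\mu_{\beta_i,\beta_j+e_k}$ in the paper); by convention $\mu_{i,j}^k=0$ if $|\beta_j|\ge|\beta_i|$. Parametric dual elements are $\Lambda_1=1$ and $\Lambda_i=\sum_{|\beta_j|<|\beta_i|}\sum_{k=1}^n\mu_{i,j}^k\,I_k(\Lambda_j)$ for $i\ge2$. The equations (a) are, for all $i,s$ with $|\beta_s|<|\beta_i|$ and all $k\ne l$, $$\sum_{j:\,|\beta_s|<|\beta_j|<|\beta_i|}\big(\mu_{i,j}^k\mu_{j,s}^l-\mu_{i,j}^l\mu_{j,s}^k\big)=0 .\tag{a}$$ **The matrices $H_t$, $K_t$.** For $t\ge1$ consider the linear equations in the variables $\nu_j^k$ ($1\le j\le r_{t-1}$, $1\le k\le n$): (1) $\sum_{j:\,|\beta_s|<|\beta_j|<t}(\nu_j^k\mu_{j,s}^l-\nu_j^l\mu_{j,s}^k)=0$ for $1\le s\le r_{t-1}$, $1\le k<l\le n$; (2) $\nu_j^k=0$ whenever $\beta_j+e_k=\beta_l$ for some $1\le l\le r_{t-1}$; (3) $\big(\sum_{j,k}\nu_j^kI_k(\Lambda_j)\big)(f_l)=0$ for $l=1,\dots,N$, the functionals being taken at $\xi$. $H_t(\mu)$ is the coefficient matrix of (1)–(2), $K_t(\xi,\mu)$ that of (1)–(3). **Regular basis.** Let $\mathrm{Hilb}_m$ be the set of $m$-dimensional subspaces $\mathcal D\subset\mathbb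 C[\mathbf d]_{m-1}$ stable under all $\partial_{d_k}$; $\mathcal D_t=\mathcal D\cap\mathbb C[\mathbf d]_t$. $\mathrm{Hilb}_{B_t}$ is the set of $\mathcal D\in\mathrm{Hilb}_{r_t}$ such that $B_s$ is a basis of $\mathbb C[\mathbf x]/(\mathcal D^\perp+\mathfrak m^{s+1})$ for $s=0,\dots,t$, where $\mathfrak m=(x_1,\dots,x_n)$ and $\mathcal D^\perp=\{p:\Lambda(p)=0\ \forall\Lambda\in\mathcal D\}$. For $\mathcal D\in\mathrm{Hilb}_{B_t}$ let $\Lambda_1,\dots,\Lambda_{r_t}$ be its basis dual to $B_t$; its $\mu$-coordinates are $\mu_{i,j}^k=\Lambda_i(\mathbf x^{\beta_j+e_k})$, and $H_{t+1}(\mathcal D)$ is $H_{t+1}$ evaluated at them. Define $\mathrm{Hilb}^{reg}_{\mathbf h_0}=\{\mathrm{span}(1)\}$ and inductively: let $W_t$ be the set of pairs $(\mathcal D_{t-1},\mathcal E_t)$ with $\mathcal E_t\subset\mathbb C[\mathbf d]_t$ of dimension $r_t$, $\mathcal D_{t-1}\subset\mathcal E_t$ and $\partial_{d_k}\mathcal E_t\subset\mathcal D_{t-1}$ for all $k$; $W_{t,reg}$ is the irreducible component mapping onto $\mathrm{Hilb}^{reg}_{\mathbf h_{t-1}}$, i.e. the Zariski closure of the part of $W_t$ over the dense open set of those $\mathcal D_{t-1}\in\mathrm{Hilb}^{reg}_{\mathbf h_{t-1}}$ for which $\{\Lambda\in\mathbb C[\mathbf d]_t:\partial_{d_k}\Lambda\in\mathcal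 D_{t-1}\ \forall k\}$ has minimal dimension; $\mathrm{Hilb}^{reg}_{\mathbf h_t}$ is the projection of $W_{t,reg}$ to the second factor. Let $\rho_t$ be the generic (maximal) rank of $H_t(\mathcal D_{t-1})$ for $\mathcal D_{t-1}\in\mathrm{Hilb}^{reg}_{\mathbf h_{t-1}}\cap\mathrm{Hilb}_{B_{t-1}}$. Then $\mathcal D_t\in\mathrm{Hilb}^{reg}_{\mathbf h_t}$ is regular for $B_t$ if $\dim\mathcal D_t=r_t$, $\mathcal D_t\in\mathrm{Hilb}_{B_t}$ (nonvanishing of the Plücker coordinates of $B$ in each degree) and $\mathrm{rank}\,H_t(\mathcal D_{t-1})=\rho_t$. $B$ is regular if for every $t=1,\dots,o$ such a $\mathcal D_t$ exists. **$A^{reg}_t$.** For $B$ regular and $t=1,\dots,o$, choose for each $\mathbf x^\beta\in B_{[t]}$ one variable $\nu_j^k$ with $\beta_j+e_k=\beta$; these $h_t$ variables form $\nu''_t$. $A^{reg}_t(\mu)$ is a chosen $\rho_t\times\rho_t$ submatrix of $H_t(\mu)$ whose columns $\nu'_t$ are disjoint from $\nu''_t$ and whose determinant is not identically zero on $\mathrm{Hilb}^{reg}_{\mathbf h_{t-1}}\cap\mathrm{Hilb}_{B_{t-1}}$. (If $\rho_t=0$ the matrix is empty and counts as invertible.) **The systems $F_0,F_1$.** The duality values are substituted: for each $i$ with $|\beta_i|=t\ge1$, $\mu_{i,j}^k:=0$ if $\mathbf x^{\beta_j+e_k}\in B_{t-1}$, and for $\nu_j^k\in\nu''_t$, $\mu_{i,j}^k:=1$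 if $\beta_j+e_k=\beta_i$ and $0$ otherwise. From now on $\mu$ is the vector of the remaining unknowns. The equations (c) are $\Lambda_j(f_i)=0$ ($1\le j\le r$, $1\le i\le N$), polynomials in $(\mathbf x,\mu)$ when functionals are taken at $\mathbf x$. $G_0$ consists, for every $t=1,\dots,o$ and every $i$ with $|\beta_i|=t$, of those equations (a) obtained from the rows of type (1) of $A^{reg}_t$ by putting $\nu_j^k=\mu_{i,j}^k$. $F_0$ consists of $G_0$ together with equations chosen from (c) so that $F_0$ is square in the unknowns $(\mathbf x,\mu)$ with invertible Jacobian at $(\xi_0,\mu_0)$. $F_1$ is the list of remaining polynomials in (c), and $\Omega=\{(i,j):\Lambda_j(f_i)\in F_1\}$. The matrix $\epsilon^*$ has entries $\epsilon^*_{i,j}=\Lambda_j^*(f_i)$ for $(i,j)\in\Omega$ and $0$ otherwise, where $\Lambda^*_1,\dots,\Lambda_r^*\in\mathbb C[\mathbf d_{\xi^*}]$ are the $\Lambda_j$ evaluated at $(\xi^*,\mu^* )$. **Multiplicity structure.** "$\xi^*$ is a multiple point of $\mathbf f_{\epsilon^*}$ with multiplicity structure $\mu^*$" means that $\xi^*$ is an isolated root of $\mathbf f_{\epsilon^*}$ of multiplicity $r$ whose inverse system $\{\Lambda\in\mathbb C[\mathbf d_{\xi^*}]:\Lambda(p)=0\ \forall p\in(\mathbf f_{\epsilon^*})\}$ has basis $\Lambda_1^*,\dots,\Lambda_r^*$, dual to $B_{\xi^*}$. **Norms.** Vectors carry the Euclidean norm, (multi)linear maps the operator norm, and $\|\epsilon^*\|$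 is the Euclidean norm of the vector of entries. $\mathcal L_1(A;\xi_0,\mu_0;b)$ is a number with $\|A(\xi,\mu)-A(\xi_0,\mu_0)\|\le\mathcal L_1(A;\xi_0,\mu_0;b)\|(\xi,\mu)-(\xi_0,\mu_0)\|$ for all $(\xi,\mu)$ in the closed ball of radius $b$ about $(\xi_0,\mu_0)$ (similarly $\mathcal L_1(A;\mu_0;b)$ when $A$ depends only on $\mu$). $\sigma_{\min}(M)=\min_{\|v\|=1}\|Mv\|$ is the smallest singular value. *)

theory Defs
  imports
    "HOL-Analysis.Analysis"
    "HOL-Library.Poly_Mapping"
    "HOL-Library.Function_Algebras"
begin

section \<open>Coordinate spaces over finite index sets\<close>

text \<open>
  The number of unknowns depends on the monomial set, so vectors are functions on an index type
  and \<open>\<complex>\<^sup>S\<close> is the set of functions vanishing outside the finite set \<open>S\<close>. A matrix with rows \<open>R\<close> and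
  columns \<open>C\<close> is a function \<open>M\<close> of which only the entries \<open>M \<rho> c\<close> with \<open>\<rho> \<in> R\<close>, \<open>c \<in> C\<close> matter.
\<close>

definition cspace :: "'a set \<Rightarrow> ('a \<Rightarrow> complex) set"
  where "cspace S = {v. \<forall>a. a \<notin> S \<longrightarrow> v a = 0}"

definition vnorm :: "'a set \<Rightarrow> ('a \<Rightarrow> complex) \<Rightarrow> real"
  where "vnorm S v = L2_set (\<lambda>a. cmod (v a)) S"

definition mat_apply ::
    "'r set \<Rightarrow> 'c set \<Rightarrow> ('r \<Rightarrow> 'c \<Rightarrow> complex) \<Rightarrow> ('c \<Rightarrow> complex) \<Rightarrow> 'r \<Rightarrow> complex"
  where "mat_apply R C M v = (\<lambda>\<rho>. if \<rho> \<in> R then \<Sum>c\<in>C. M \<rho> c * v c else 0)"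

definition mat_norm :: "'r set \<Rightarrow> 'c set \<Rightarrow> ('r \<Rightarrow> 'c \<Rightarrow> complex) \<Rightarrow> real"
  where "mat_norm R C M =
    Sup {vnorm R (mat_apply R C M v) | v. v \<in> cspace C \<and> vnorm C v \<le> 1}"

definition sigma_min :: "'r set \<Rightarrow> 'c set \<Rightarrow> ('r \<Rightarrow> 'c \<Rightarrow> complex) \<Rightarrow> real"
  where "sigma_min R C M =
    Inf {vnorm R (mat_apply R C M v) | v. v \<in> cspace C \<and> vnorm C v = 1}"

interpretation cvec: vector_space "\<lambda>(c::complex) (v::'i \<Rightarrow> complex) i. c * v i"
  by unfold_locales (auto simp: fun_eq_iff algebra_simps)

definition mat_rank :: "'r set \<Rightarrow> 'c set \<Rightarrow> ('r \<Rightarrow> 'c \<Rightarrow> complex) \<Rightarrow> nat"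
  where "mat_rank R C M = cvec.dim ((\<lambda>c \<rho>. if \<rho> \<in> R then M \<rho> c else 0) ` C)"

text \<open>Determinant (Leibniz formula) of the square submatrix with the listed rows and columns.\<close>

definition sub_det :: "('r \<Rightarrow> 'c \<Rightarrow> complex) \<Rightarrow> 'r list \<Rightarrow> 'c list \<Rightarrow> complex"
  where "sub_det M rs cs =
    (\<Sum>\<pi> | \<pi> permutes {..<length rs}.
       of_int (sign \<pi>) * (\<Prod>a<length rs. M (rs ! a) (cs ! \<pi> a)))"

text \<open>
  \<open>L\<close> is a Lipschitz constant \<open>\<L>\<^sub>1(A; p\<^sub>0; b)\<close>, where \<open>d p\<close> stands for \<open>\<parallel>A p - A p\<^sub>0\<parallel>\<close> and only the
  coordinates in \<open>U\<close> (those on which \<open>A\<close> depends) are varied.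
\<close>

definition lipschitz_bound ::
    "'u set \<Rightarrow> ('u \<Rightarrow> complex) \<Rightarrow> real \<Rightarrow> (('u \<Rightarrow> complex) \<Rightarrow> real) \<Rightarrow> real \<Rightarrow> bool"
  where "lipschitz_bound U p0 b d L \<longleftrightarrow>
    (\<forall>p. (\<forall>a. a \<notin> U \<longrightarrow> p a = p0 a) \<and> vnorm U (p - p0) \<le> b \<longrightarrow> d p \<le> L * vnorm U (p - p0))"


section \<open>Newton's method and the alpha-theoretic quantities\<close>

text \<open>
  A system is a family \<open>F\<close> of functions of the unknowns \<open>V\<close>, indexed by a set \<open>E\<close> of labels.
  \<open>D\<^sup>kF(p)[v\<^sub>1,\<dots>,v\<^sub>k]\<close> is the iterated directional derivative; all the systems below are polynomial.
\<close>

definition dir_deriv ::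
    "('u \<Rightarrow> complex) \<Rightarrow> (('u \<Rightarrow> complex) \<Rightarrow> complex) \<Rightarrow> ('u \<Rightarrow> complex) \<Rightarrow> complex"
  where "dir_deriv v g = (\<lambda>p. deriv (\<lambda>z. g (\<lambda>a. p a + z * v a)) 0)"

definition sys_val ::
    "'e set \<Rightarrow> ('e \<Rightarrow> ('u \<Rightarrow> complex) \<Rightarrow> complex) \<Rightarrow> ('u \<Rightarrow> complex) \<Rightarrow> 'e \<Rightarrow> complex"
  where "sys_val E F p = (\<lambda>e. if e \<in> E then F e p else 0)"

definition sys_deriv ::
    "'e set \<Rightarrow> ('e \<Rightarrow> ('u \<Rightarrow> complex) \<Rightarrow> complex) \<Rightarrow> ('u \<Rightarrow> complex) \<Rightarrow> ('u \<Rightarrow> complex) list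
      \<Rightarrow> 'e \<Rightarrow> complex"
  where "sys_deriv E F p vs = (\<lambda>e. if e \<in> E then foldr dir_deriv vs (F e) p else 0)"

definition jac_invertible ::
    "'u set \<Rightarrow> 'e set \<Rightarrow> ('e \<Rightarrow> ('u \<Rightarrow> complex) \<Rightarrow> complex) \<Rightarrow> ('u \<Rightarrow> complex) \<Rightarrow> bool"
  where "jac_invertible V E F p \<longleftrightarrow>
    bij_betw (\<lambda>v. sys_deriv E F p [v]) (cspace V) (cspace E)"

definition jac_inv ::
    "'u set \<Rightarrow> 'e set \<Rightarrow> ('e \<Rightarrow> ('u \<Rightarrow> complex) \<Rightarrow> complex) \<Rightarrow> ('u \<Rightarrow> complex)
      \<Rightarrow> ('e \<Rightarrow> complex) \<Rightarrow> 'u \<Rightarrow> complex"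
  where "jac_inv V E F p = the_inv_into (cspace V) (\<lambda>v. sys_deriv E F p [v])"

definition multilinear_norm ::
    "'u set \<Rightarrow> 'w set \<Rightarrow> nat \<Rightarrow> (('u \<Rightarrow> complex) list \<Rightarrow> 'w \<Rightarrow> complex) \<Rightarrow> real"
  where "multilinear_norm V W k T =
    Sup {vnorm W (T vs) | vs. length vs = k \<and> (\<forall>v\<in>set vs. v \<in> cspace V \<and> vnorm V v \<le> 1)}"

definition beta_tilde ::
    "'u set \<Rightarrow> 'e set \<Rightarrow> ('e \<Rightarrow> ('u \<Rightarrow> complex) \<Rightarrow> complex) \<Rightarrow> ('u \<Rightarrow> complex) \<Rightarrow> real"
  where "beta_tilde V E F p = 2 * vnorm V (jac_inv V E F p (sys_val E F p))"

definition gamma_tilde ::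
    "'u set \<Rightarrow> 'e set \<Rightarrow> ('e \<Rightarrow> ('u \<Rightarrow> complex) \<Rightarrow> complex) \<Rightarrow> ('u \<Rightarrow> complex) \<Rightarrow> real"
  where "gamma_tilde V E F p =
    (SUP k\<in>{2..}. root (k - 1)
       (multilinear_norm V V k (\<lambda>vs. jac_inv V E F p (\<lambda>e. sys_deriv E F p vs e / fact k))))"

definition newton_step ::
    "'u set \<Rightarrow> 'e set \<Rightarrow> ('e \<Rightarrow> ('u \<Rightarrow> complex) \<Rightarrow> complex) \<Rightarrow> ('u \<Rightarrow> complex) \<Rightarrow> 'u \<Rightarrow> complex"
  where "newton_step V E F p = p - jac_inv V E F p (sys_val E F p)"

definition newton_converges_quadratically ::
    "'u set \<Rightarrow> 'e set \<Rightarrow> ('e \<Rightarrow> ('u \<Rightarrow> complex) \<Rightarrow> complex) \<Rightarrow> ('u \<Rightarrow> complex) \<Rightarrow> ('u \<Rightarrow> complex) \<Rightarrow> bool"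
  where "newton_converges_quadratically V E F p0 p \<longleftrightarrow>
    (\<forall>m. jac_invertible V E F ((newton_step V E F ^^ m) p0)) \<and>
    (\<lambda>m. vnorm V ((newton_step V E F ^^ m) p0 - p)) \<longlonglongrightarrow> 0 \<and>
    (\<exists>C. \<forall>m. vnorm V ((newton_step V E F ^^ Suc m) p0 - p)
            \<le> C * (vnorm V ((newton_step V E F ^^ m) p0 - p))\<^sup>2)"


section \<open>Polynomials and dual polynomials\<close>

type_synonym 'v mon = "'v \<Rightarrow>\<^sub>0 nat"
type_synonym 'v mpoly = "('v \<Rightarrow>\<^sub>0 nat) \<Rightarrow>\<^sub>0 complex"

text \<open>
  The type \<open>'n mpoly\<close> with \<open>'n\<close> finite is used both for \<open>\<complex>[x\<^sub>1,\<dots>,x\<^sub>n]\<close> and for the dual ring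
  \<open>\<complex>[d\<^sub>1,\<dots>,d\<^sub>n]\<close>; the linear order on \<open>'n\<close> is the numbering of the variables.
\<close>

definition Const :: "complex \<Rightarrow> 'v mpoly"
  where "Const c = Poly_Mapping.single 0 c"

definition unit_mon :: "'v \<Rightarrow> 'v mon"
  where "unit_mon k = Poly_Mapping.single k 1"

definition monom_poly :: "'v mon \<Rightarrow> 'v mpoly"
  where "monom_poly m = Poly_Mapping.single m 1"

definition Var :: "'v \<Rightarrow> 'v mpoly"
  where "Var k = monom_poly (unit_mon k)"

definition mdeg :: "'n::finite mon \<Rightarrow> nat"
  where "mdeg m = (\<Sum>k\<in>UNIV. Poly_Mapping.lookup m k)"

definition polys_le :: "nat \<Rightarrow> 'n::finite mpoly set"
  where "polys_le t = {p. \<forall>m\<in>Poly_Mapping.keys p. mdeg m \<le> t}"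

definition ev :: "'v mpoly \<Rightarrow> ('v \<Rightarrow> complex) \<Rightarrow> complex"
  where "ev p x = (\<Sum>m\<in>Poly_Mapping.keys p. Poly_Mapping.lookup p m *
                     (\<Prod>v\<in>Poly_Mapping.keys m. x v ^ Poly_Mapping.lookup m v))"

definition pd :: "'v \<Rightarrow> 'v mpoly \<Rightarrow> 'v mpoly"
  where "pd k p = (\<Sum>m\<in>Poly_Mapping.keys p. Poly_Mapping.single (m - unit_mon k)
                     (of_nat (Poly_Mapping.lookup m k) * Poly_Mapping.lookup p m))"

definition pd_mon :: "'n::{finite,linorder} mon \<Rightarrow> 'n mpoly \<Rightarrow> 'n mpoly"
  where "pd_mon m = fold (\<lambda>k. pd k ^^ Poly_Mapping.lookup m k) (sorted_list_of_set UNIV)"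

text \<open>The functional \<open>\<Lambda>(d\<^sub>\<xi>)\<close>; there is no division by factorials.\<close>

definition act :: "('n \<Rightarrow> complex) \<Rightarrow> 'n::{finite,linorder} mpoly \<Rightarrow> 'n mpoly \<Rightarrow> complex"
  where "act \<xi> \<Lambda> p = (\<Sum>m\<in>Poly_Mapping.keys \<Lambda>. Poly_Mapping.lookup \<Lambda> m * ev (pd_mon m p) \<xi>)"

text \<open>\<open>\<Lambda>(d\<^sub>1,\<dots>,d\<^sub>k,0,\<dots>,0)\<close>\<close>

definition trunc_vars :: "'n::linorder \<Rightarrow> 'n mpoly \<Rightarrow> 'n mpoly"
  where "trunc_vars k \<Lambda> =
    (\<Sum>m\<in>{m \<in> Poly_Mapping.keys \<Lambda>. \<forall>l>k. Poly_Mapping.lookup m l = 0}.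
       Poly_Mapping.single m (Poly_Mapping.lookup \<Lambda> m))"

text \<open>\<open>I\<^sub>k(\<Lambda>)\<close>; the description determines it by \<open>dint_ex1\<close>.\<close>

definition dint :: "'n::linorder \<Rightarrow> 'n mpoly \<Rightarrow> 'n mpoly"
  where "dint k \<Lambda> = (THE P. Var k dvd P \<and> pd k P = trunc_vars k \<Lambda>)"

lemma lookup_pd:
  "Poly_Mapping.lookup (pd k p) m =
    of_nat (Suc (Poly_Mapping.lookup m k)) * Poly_Mapping.lookup p (m + unit_mon k)"
proof -
  have eq: "Poly_Mapping.lookup (Poly_Mapping.single (m' - unit_mon k)
        (of_nat (Poly_Mapping.lookup m' k) * Poly_Mapping.lookup p m')) m
      = (if m' = m + unit_mon k
         then of_nat (Suc (Poly_Mapping.lookup m k)) * Poly_Mapping.lookup p (m + unit_mon k) else 0)"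
    for m'
  proof (cases "m' = m + unit_mon k")
    case True
    then show ?thesis by (simp add: unit_mon_def lookup_add lookup_single)
  next
    case False
    have "Poly_Mapping.lookup m' k = 0" if "m' - unit_mon k = m"
    proof (rule ccontr)
      assume "Poly_Mapping.lookup m' k \<noteq> 0"
      then have "m' = m' - unit_mon k + unit_mon k"
        by (intro poly_mapping_eqI)
          (auto simp: unit_mon_def lookup_add lookup_minus lookup_single when_def)
      with that False show False by simp
    qed
    with False show ?thesis by (auto simp: lookup_single when_def)
  qed
  show ?thesis
    by (auto simp: pd_def lookup_sum eq not_in_keys_iff_lookup_eq_zero)
qed

lemma Var_dvd_iff:
  fixes p :: "'a mpoly"
  shows "Var k dvd p \<longleftrightarrow> (\<forall>m. Poly_Mapping.lookup m k = 0 \<longrightarrow> Poly_Mapping.lookup p m = 0)"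
proof
  assume "Var k dvd p"
  then obtain q where p: "p = Var k * q" by blast
  show "\<forall>m. Poly_Mapping.lookup m k = 0 \<longrightarrow> Poly_Mapping.lookup p m = 0"
  proof (intro allI impI)
    fix m :: "'a mon" assume "Poly_Mapping.lookup m k = 0"
    then have "m \<notin> Poly_Mapping.keys p"
      using keys_mult[of "Var k" q]
      by (auto simp: p Var_def monom_poly_def unit_mon_def lookup_add)
    then show "Poly_Mapping.lookup p m = 0" by (simp add: not_in_keys_iff_lookup_eq_zero)
  qed
next
  assume *: "\<forall>m. Poly_Mapping.lookup m k = 0 \<longrightarrow> Poly_Mapping.lookup p m = 0"
  have "p = (\<Sum>m\<in>Poly_Mapping.keys p. Poly_Mapping.single m (Poly_Mapping.lookup p m))"
    by (rule poly_mapping_eqI)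
      (simp add: lookup_sum lookup_single when_def in_keys_iff
        del: lookup_not_eq_zero_eq_in_keys)
  also have "\<dots> = (\<Sum>m\<in>Poly_Mapping.keys p. Var k *
      Poly_Mapping.single (m - unit_mon k) (Poly_Mapping.lookup p m))"
  proof (rule sum.cong)
    fix m assume "m \<in> Poly_Mapping.keys p"
    with * have "Poly_Mapping.lookup m k \<noteq> 0"
      using lookup_eq_zero_in_keys_contradict by metis
    then have "unit_mon k + (m - unit_mon k) = m"
      by (intro poly_mapping_eqI)
        (auto simp: unit_mon_def lookup_add lookup_minus lookup_single when_def)
    then show "Poly_Mapping.single m (Poly_Mapping.lookup p m) =
        Var k * Poly_Mapping.single (m - unit_mon k) (Poly_Mapping.lookup p m)"
      by (simp add: Var_def monom_poly_def mult_single)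
  qed simp
  also have "\<dots> = Var k * (\<Sum>m\<in>Poly_Mapping.keys p.
      Poly_Mapping.single (m - unit_mon k) (Poly_Mapping.lookup p m))"
    by (simp only: sum_distrib_left)
  finally show "Var k dvd p" by (rule dvdI)
qed

lemma dint_ex1: "\<exists>!P. Var k dvd P \<and> pd k P = T"
proof (rule ex1I)
  define P where "P = (\<Sum>m\<in>Poly_Mapping.keys T. Poly_Mapping.single (m + unit_mon k)
    (Poly_Mapping.lookup T m / of_nat (Suc (Poly_Mapping.lookup m k))))"
  have "Var k dvd P"
    by (auto simp: Var_dvd_iff P_def lookup_sum lookup_single when_def unit_mon_def lookup_add
        intro!: sum.neutral)
  moreover have pd_P: "pd k P = T"
  proof (rule poly_mapping_eqI)
    fix m
    have "Poly_Mapping.lookup P (m + unit_mon k) =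
        Poly_Mapping.lookup T m / of_nat (Suc (Poly_Mapping.lookup m k))"
      by (simp add: P_def lookup_sum lookup_single when_def in_keys_iff
          del: lookup_not_eq_zero_eq_in_keys of_nat_Suc)
    then show "Poly_Mapping.lookup (pd k P) m = Poly_Mapping.lookup T m"
      by (simp add: lookup_pd del: of_nat_Suc)
  qed
  ultimately show "Var k dvd P \<and> pd k P = T" by simp
  fix Q assume Q: "Var k dvd Q \<and> pd k Q = T"
  show "Q = P"
  proof (rule poly_mapping_eqI)
    fix m
    show "Poly_Mapping.lookup Q m = Poly_Mapping.lookup P m"
    proof (cases "Poly_Mapping.lookup m k = 0")
      case True
      with Q \<open>Var k dvd P\<close> show ?thesis by (simp add: Var_dvd_iff)
    next
      case False
      then have "m - unit_mon k + unit_mon k = m"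
        by (intro poly_mapping_eqI)
          (auto simp: unit_mon_def lookup_add lookup_minus lookup_single when_def)
      moreover have "Poly_Mapping.lookup (pd k Q) (m - unit_mon k) =
          Poly_Mapping.lookup (pd k P) (m - unit_mon k)"
        using Q pd_P by simp
      ultimately show ?thesis by (simp add: lookup_pd del: of_nat_Suc)
    qed
  qed
qed

lemma dint_props: "Var k dvd dint k \<Lambda>" "pd k (dint k \<Lambda>) = trunc_vars k \<Lambda>"
  using theI'[OF dint_ex1[of k "trunc_vars k \<Lambda>"]] by (auto simp: dint_def)

interpretation pvec: vector_space "\<lambda>(c::complex) (p::'v mpoly). Const c * p"
  by unfold_locales
    (auto simp: Const_def algebra_simps single_add mult_single simp flip: mult.assoc)

interpretation pideal: module "(*) :: 'v mpoly \<Rightarrow> 'v mpoly \<Rightarrow> 'v mpoly"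
  by unfold_locales (auto simp: algebra_simps)

text \<open>The polynomials in \<open>S\<close> are (pairwise distinct and) a basis of the quotient by the subspace \<open>J\<close>.\<close>

definition basis_mod :: "'v mpoly set \<Rightarrow> 'v mpoly set \<Rightarrow> bool"
  where "basis_mod J S \<longleftrightarrow> finite S \<and>
    (\<forall>p. \<exists>!c::'v mpoly \<Rightarrow> complex. c \<in> cspace S \<and> p - (\<Sum>s\<in>S. Const (c s) * s) \<in> J)"


section \<open>Monomial sets and parametric dual elements\<close>

definition monomial_set :: "nat \<Rightarrow> (nat \<Rightarrow> 'n::finite mon) \<Rightarrow> bool"
  where "monomial_set r \<beta> \<longleftrightarrow>
    r \<ge> 1 \<and> \<beta> 1 = 0 \<and> inj_on \<beta> {1..r} \<and>
    (\<forall>i\<in>{1..r}. \<forall>j\<in>{1..r}. i \<le> j \<longrightarrow> mdeg (\<beta> i) \<le> mdeg (\<beta> j))"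

definition closed_under_division :: "nat \<Rightarrow> (nat \<Rightarrow> 'n::finite mon) \<Rightarrow> bool"
  where "closed_under_division r \<beta> \<longleftrightarrow>
    (\<forall>i\<in>{1..r}. \<forall>k. Poly_Mapping.lookup (\<beta> i) k > 0 \<longrightarrow> \<beta> i - unit_mon k \<in> \<beta> ` {1..r})"

definition num_le :: "nat \<Rightarrow> (nat \<Rightarrow> 'n::finite mon) \<Rightarrow> nat \<Rightarrow> nat"
  where "num_le r \<beta> t = card {i\<in>{1..r}. mdeg (\<beta> i) \<le> t}"

definition monoms_le :: "nat \<Rightarrow> (nat \<Rightarrow> 'n::finite mon) \<Rightarrow> nat \<Rightarrow> 'n mpoly set"
  where "monoms_le r \<beta> t = {monom_poly (\<beta> i) | i. i \<in> {1..r} \<and> mdeg (\<beta> i) \<le> t}"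

text \<open>\<open>o = deg B\<close>\<close>

definition top_deg :: "nat \<Rightarrow> (nat \<Rightarrow> 'n::finite mon) \<Rightarrow> nat"
  where "top_deg r \<beta> = mdeg (\<beta> r)"

text \<open>The argument \<open>\<mu> i j k\<close> is \<open>\<mu>\<^sub>i\<^sub>,\<^sub>j\<^sup>k\<close>.\<close>

function lam ::
    "nat \<Rightarrow> (nat \<Rightarrow> 'n::{finite,linorder} mon) \<Rightarrow> (nat \<Rightarrow> nat \<Rightarrow> 'n \<Rightarrow> complex) \<Rightarrow> nat \<Rightarrow> 'n mpoly"
  where "lam r \<beta> \<mu> i =
    (if i = 1 then 1
     else \<Sum>j\<in>{j\<in>{1..r}. mdeg (\<beta> j) < mdeg (\<beta> i)}. \<Sum>k\<in>UNIV.
            Const (\<mu> i j k) * dint k (lam r \<beta> \<mu> j))"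
  by pat_completeness auto
termination
  by (relation "Wellfounded.measure (\<lambda>(r, \<beta>, \<mu>, i). mdeg (\<beta> i))") auto

declare lam.simps [simp del]


section \<open>The matrices \<open>H\<^sub>t\<close> and \<open>K\<^sub>t\<close>\<close>

text \<open>
  Rows: \<open>RComm s k l\<close> is the equation (1) for \<open>s, k < l\<close>, \<open>RDual j k\<close> the equation \<open>\<nu>\<^sub>j\<^sup>k = 0\<close> of type (2)
  and \<open>REval l\<close> the equation (3) for \<open>f\<^sub>l\<close>. The column \<open>(j, k)\<close> belongs to the variable \<open>\<nu>\<^sub>j\<^sup>k\<close>.
\<close>

datatype 'n row = RComm nat 'n 'n | RDual nat 'n | REval nat

definition cols :: "nat \<Rightarrow> (nat \<Rightarrow> 'n::finite mon) \<Rightarrow> nat \<Rightarrow> (nat \<times> 'n) set"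
  where "cols r \<beta> t = {1..num_le r \<beta> (t - 1)} \<times> UNIV"

definition H_rows :: "nat \<Rightarrow> (nat \<Rightarrow> 'n::{finite,linorder} mon) \<Rightarrow> nat \<Rightarrow> 'n row set"
  where "H_rows r \<beta> t =
    {RComm s k l | s k l. s \<in> {1..num_le r \<beta> (t - 1)} \<and> k < l} \<union>
    {RDual j k | j k. j \<in> {1..num_le r \<beta> (t - 1)} \<and>
                      (\<exists>l\<in>{1..num_le r \<beta> (t - 1)}. \<beta> j + unit_mon k = \<beta> l)}"

definition K_rows :: "nat \<Rightarrow> (nat \<Rightarrow> 'n::{finite,linorder} mon) \<Rightarrow> nat \<Rightarrow> nat \<Rightarrow> 'n row set"
  where "K_rows r \<beta> N t = H_rows r \<beta> t \<union> {REval l | l. l \<in> {1..N}}"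

fun H_entry ::
    "(nat \<Rightarrow> 'n::finite mon) \<Rightarrow> nat \<Rightarrow> (nat \<Rightarrow> nat \<Rightarrow> 'n \<Rightarrow> complex) \<Rightarrow> 'n row \<Rightarrow> nat \<times> 'n \<Rightarrow> complex"
  where
    "H_entry \<beta> t \<mu> (RComm s k l) (j, m) =
       (if mdeg (\<beta> s) < mdeg (\<beta> j) \<and> mdeg (\<beta> j) < t
        then (if m = k then \<mu> j s l else 0) - (if m = l then \<mu> j s k else 0)
        else 0)"
  | "H_entry \<beta> t \<mu> (RDual i k) (j, m) = (if i = j \<and> k = m then 1 else 0)"
  | "H_entry \<beta> t \<mu> (REval l) (j, m) = 0"

fun K_entry ::
    "nat \<Rightarrow> (nat \<Rightarrow> 'n::{finite,linorder} mon) \<Rightarrow> (nat \<Rightarrow> 'n mpoly) \<Rightarrow> nat \<Rightarrow> ('n \<Rightarrow> complex)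
      \<Rightarrow> (nat \<Rightarrow> nat \<Rightarrow> 'n \<Rightarrow> complex) \<Rightarrow> 'n row \<Rightarrow> nat \<times> 'n \<Rightarrow> complex"
  where
    "K_entry r \<beta> f t \<xi> \<mu> (REval l) (j, m) = act \<xi> (dint m (lam r \<beta> \<mu> j)) (f l)"
  | "K_entry r \<beta> f t \<xi> \<mu> \<rho> c = H_entry \<beta> t \<mu> \<rho> c"


section \<open>Regular bases\<close>

definition annihilator :: "'n::{finite,linorder} mpoly set \<Rightarrow> 'n mpoly set"
  where "annihilator D = {p. \<forall>\<Lambda>\<in>D. act (\<lambda>_. 0) \<Lambda> p = 0}"

definition max_ideal_power :: "nat \<Rightarrow> 'n mpoly set"
  where "max_ideal_power s = pideal.span {prod_list (map Var ks) | ks. length ks = s}"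

definition Hilb :: "nat \<Rightarrow> 'n::finite mpoly set set"
  where "Hilb m =
    {D. pvec.subspace D \<and> pvec.dim D = m \<and> D \<subseteq> polys_le (m - 1) \<and> (\<forall>k. pd k ` D \<subseteq> D)}"

definition Hilb_B :: "nat \<Rightarrow> (nat \<Rightarrow> 'n::{finite,linorder} mon) \<Rightarrow> nat \<Rightarrow> 'n mpoly set set"
  where "Hilb_B r \<beta> t =
    {D \<in> Hilb (num_le r \<beta> t). \<forall>s\<le>t.
       basis_mod {p + q | p q. p \<in> annihilator D \<and> q \<in> max_ideal_power (s + 1)}
         (monoms_le r \<beta> s)}"

definition dual_basis ::
    "nat \<Rightarrow> (nat \<Rightarrow> 'n::{finite,linorder} mon) \<Rightarrow> nat \<Rightarrow> 'n mpoly set \<Rightarrow> nat \<Rightarrow> 'n mpoly"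
  where "dual_basis r \<beta> t D i =
    (THE \<Lambda>. \<Lambda> \<in> D \<and> (\<forall>j\<in>{1..num_le r \<beta> t}.
        act (\<lambda>_. 0) \<Lambda> (monom_poly (\<beta> j)) = (if i = j then 1 else 0)))"

definition mu_coord ::
    "nat \<Rightarrow> (nat \<Rightarrow> 'n::{finite,linorder} mon) \<Rightarrow> nat \<Rightarrow> 'n mpoly set \<Rightarrow> nat \<Rightarrow> nat \<Rightarrow> 'n \<Rightarrow> complex"
  where "mu_coord r \<beta> t D i j k =
    act (\<lambda>_. 0) (dual_basis r \<beta> t D i) (monom_poly (\<beta> j + unit_mon k))"

text \<open>Intended for \<open>t \<ge> 1\<close>: the matrix \<open>H\<^sub>t(D)\<close> of \<open>D\<close> in \<open>Hilb_B r \<beta> (t - 1)\<close>.\<close>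

definition H_at ::
    "nat \<Rightarrow> (nat \<Rightarrow> 'n::{finite,linorder} mon) \<Rightarrow> nat \<Rightarrow> 'n mpoly set \<Rightarrow> 'n row \<Rightarrow> nat \<times> 'n \<Rightarrow> complex"
  where "H_at r \<beta> t D = H_entry \<beta> t (mu_coord r \<beta> (t - 1) D)"

definition H_rank :: "nat \<Rightarrow> (nat \<Rightarrow> 'n::{finite,linorder} mon) \<Rightarrow> nat \<Rightarrow> 'n mpoly set \<Rightarrow> nat"
  where "H_rank r \<beta> t D = mat_rank (H_rows r \<beta> t) (cols r \<beta> t) (H_at r \<beta> t D)"

definition Gr :: "nat \<Rightarrow> nat \<Rightarrow> 'n::finite mpoly set set"
  where "Gr m t = {D. pvec.subspace D \<and> D \<subseteq> polys_le t \<and> pvec.dim D = m}"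

definition basis_list :: "'v mpoly set \<Rightarrow> 'v mpoly list \<Rightarrow> bool"
  where "basis_list D us \<longleftrightarrow>
    distinct us \<and> pvec.independent (set us) \<and> pvec.span (set us) = D"

text \<open>Plucker coordinates, indexed by lists of monomials, of the space spanned by \<open>us\<close>.\<close>

definition pluecker :: "'v mpoly list \<Rightarrow> 'v mon list \<Rightarrow> complex"
  where "pluecker us ms = sub_det (\<lambda>a m. Poly_Mapping.lookup (us ! a) m) [0..<length us] ms"

text \<open>
  Zariski closure in \<open>Gr a s \<times> Gr b t\<close>, embedded by Plucker coordinates in a product of two projective
  spaces. Vanishing of \<open>Q\<close> is required for all choices of bases, that is, for all homogeneous coordinate
  vectors of the point; a polynomial with this property has all its bihomogeneous components
  vanishing at the point, so that there is no need to restrict to bihomogeneous \<open>Q\<close>.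
\<close>

definition vanishes_at ::
    "('n mon list + 'n mon list) mpoly \<Rightarrow> 'n mpoly set \<Rightarrow> 'n mpoly set \<Rightarrow> bool"
  where "vanishes_at Q D E \<longleftrightarrow>
    (\<forall>us ws. basis_list D us \<and> basis_list E ws \<longrightarrow> ev Q (case_sum (pluecker us) (pluecker ws)) = 0)"

definition zariski_closure ::
    "nat \<Rightarrow> nat \<Rightarrow> nat \<Rightarrow> nat \<Rightarrow> ('n::finite mpoly set \<times> 'n mpoly set) set
      \<Rightarrow> ('n mpoly set \<times> 'n mpoly set) set"
  where "zariski_closure a s b t S =
    {(D, E). D \<in> Gr a s \<and> E \<in> Gr b t \<and>
       (\<forall>Q. (\<forall>(D', E')\<in>S. vanishes_at Q D' E') \<longrightarrow> vanishes_at Q D E)}"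

definition integrals :: "nat \<Rightarrow> 'n::finite mpoly set \<Rightarrow> 'n mpoly set"
  where "integrals t D = {\<Lambda> \<in> polys_le t. \<forall>k. pd k \<Lambda> \<in> D}"

primrec Hilb_reg :: "nat \<Rightarrow> (nat \<Rightarrow> 'n::finite mon) \<Rightarrow> nat \<Rightarrow> 'n mpoly set set"
  where
    "Hilb_reg r \<beta> 0 = {pvec.span {1}}"
  | "Hilb_reg r \<beta> (Suc t) =
       snd ` zariski_closure (num_le r \<beta> t) t (num_le r \<beta> (Suc t)) (Suc t)
         {(D, E). D \<in> Hilb_reg r \<beta> t \<and>
            (\<forall>D'\<in>Hilb_reg r \<beta> t.
               pvec.dim (integrals (Suc t) D) \<le> pvec.dim (integrals (Suc t) D')) \<and>
            E \<in> Gr (num_le r \<beta> (Suc t)) (Suc t) \<and> D \<subseteq> E \<and> (\<forall>k. pd k ` E \<subseteq> D)}"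

definition generic_rank :: "nat \<Rightarrow> (nat \<Rightarrow> 'n::{finite,linorder} mon) \<Rightarrow> nat \<Rightarrow> nat"
  where "generic_rank r \<beta> t =
    Max (H_rank r \<beta> t ` (Hilb_reg r \<beta> (t - 1) \<inter> Hilb_B r \<beta> (t - 1)))"

definition regular_at :: "nat \<Rightarrow> (nat \<Rightarrow> 'n::{finite,linorder} mon) \<Rightarrow> nat \<Rightarrow> 'n mpoly set \<Rightarrow> bool"
  where "regular_at r \<beta> t D \<longleftrightarrow>
    D \<in> Hilb_reg r \<beta> t \<and> pvec.dim D = num_le r \<beta> t \<and> D \<in> Hilb_B r \<beta> t \<and>
    H_rank r \<beta> t (D \<inter> polys_le (t - 1)) = generic_rank r \<beta> t"

definition regular_set :: "nat \<Rightarrow> (nat \<Rightarrow> 'n::{finite,linorder} mon) \<Rightarrow> bool"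
  where "regular_set r \<beta> \<longleftrightarrow> (\<forall>t\<in>{1..top_deg r \<beta>}. \<exists>D. regular_at r \<beta> t D)"


section \<open>The chosen variables and submatrices\<close>

text \<open>
  \<open>piv i\<close> is the variable \<open>\<nu>\<^sub>j\<^sup>k\<close> chosen for the monomial \<open>\<beta> i\<close>; \<open>A\<^sub>t\<^sup>r\<^sup>e\<^sup>g\<close> is the submatrix of \<open>H\<^sub>t\<close> with
  rows \<open>rs t\<close> and columns \<open>cs t\<close>.
\<close>

definition nu2 :: "nat \<Rightarrow> (nat \<Rightarrow> 'n::finite mon) \<Rightarrow> (nat \<Rightarrow> nat \<times> 'n) \<Rightarrow> nat \<Rightarrow> (nat \<times> 'n) set"
  where "nu2 r \<beta> piv t = piv ` {i\<in>{1..r}. mdeg (\<beta> i) = t}"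

definition pivot_choice :: "nat \<Rightarrow> (nat \<Rightarrow> 'n::finite mon) \<Rightarrow> (nat \<Rightarrow> nat \<times> 'n) \<Rightarrow> bool"
  where "pivot_choice r \<beta> piv \<longleftrightarrow>
    (\<forall>i\<in>{1..r}. mdeg (\<beta> i) \<ge> 1 \<longrightarrow>
       fst (piv i) \<in> {1..num_le r \<beta> (mdeg (\<beta> i) - 1)} \<and>
       \<beta> (fst (piv i)) + unit_mon (snd (piv i)) = \<beta> i)"

definition submatrix_choice ::
    "nat \<Rightarrow> (nat \<Rightarrow> 'n::{finite,linorder} mon) \<Rightarrow> (nat \<Rightarrow> nat \<times> 'n) \<Rightarrow> (nat \<Rightarrow> 'n row list)
      \<Rightarrow> (nat \<Rightarrow> (nat \<times> 'n) list) \<Rightarrow> bool"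
  where "submatrix_choice r \<beta> piv rs cs \<longleftrightarrow>
    (\<forall>t\<in>{1..top_deg r \<beta>}.
       distinct (rs t) \<and> set (rs t) \<subseteq> H_rows r \<beta> t \<and> length (rs t) = generic_rank r \<beta> t \<and>
       distinct (cs t) \<and> set (cs t) \<subseteq> cols r \<beta> t - nu2 r \<beta> piv t \<and>
       length (cs t) = generic_rank r \<beta> t \<and>
       (\<exists>D \<in> Hilb_reg r \<beta> (t - 1) \<inter> Hilb_B r \<beta> (t - 1). sub_det (H_at r \<beta> t D) (rs t) (cs t) \<noteq> 0))"


section \<open>The systems \<open>F\<^sub>0\<close> and \<open>F\<^sub>1\<close>\<close>

datatype 'n unk = X 'n | Mu nat nat 'n

definition in_prev :: "nat \<Rightarrow> (nat \<Rightarrow> 'n::finite mon) \<Rightarrow> nat \<Rightarrow> nat \<Rightarrow> 'n \<Rightarrow> bool"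
  where "in_prev r \<beta> i j k \<longleftrightarrow>
    (\<exists>l\<in>{1..r}. mdeg (\<beta> l) \<le> mdeg (\<beta> i) - 1 \<and> \<beta> l = \<beta> j + unit_mon k)"

text \<open>The values of all the \<open>\<mu>\<^sub>i\<^sub>,\<^sub>j\<^sup>k\<close> at a point of the space of remaining unknowns.\<close>

definition mu_of ::
    "nat \<Rightarrow> (nat \<Rightarrow> 'n::finite mon) \<Rightarrow> (nat \<Rightarrow> nat \<times> 'n) \<Rightarrow> ('n unk \<Rightarrow> complex)
      \<Rightarrow> nat \<Rightarrow> nat \<Rightarrow> 'n \<Rightarrow> complex"
  where "mu_of r \<beta> piv p i j k =
    (if mdeg (\<beta> j) \<ge> mdeg (\<beta> i) then 0
     else if in_prev r \<beta> i j k then 0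
     else if (j, k) \<in> nu2 r \<beta> piv (mdeg (\<beta> i)) then (if \<beta> j + unit_mon k = \<beta> i then 1 else 0)
     else p (Mu i j k))"

definition xi_of :: "('n unk \<Rightarrow> complex) \<Rightarrow> 'n \<Rightarrow> complex"
  where "xi_of p = (\<lambda>k. p (X k))"

definition mu_unknowns ::
    "nat \<Rightarrow> (nat \<Rightarrow> 'n::finite mon) \<Rightarrow> (nat \<Rightarrow> nat \<times> 'n) \<Rightarrow> 'n unk set"
  where "mu_unknowns r \<beta> piv =
    {Mu i j k | i j k. i \<in> {1..r} \<and> j \<in> {1..r} \<and> mdeg (\<beta> j) < mdeg (\<beta> i) \<and>
       \<not> in_prev r \<beta> i j k \<and> (j, k) \<notin> nu2 r \<beta> piv (mdeg (\<beta> i))}"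

definition unknowns ::
    "nat \<Rightarrow> (nat \<Rightarrow> 'n::finite mon) \<Rightarrow> (nat \<Rightarrow> nat \<times> 'n) \<Rightarrow> 'n unk set"
  where "unknowns r \<beta> piv = range X \<union> mu_unknowns r \<beta> piv"

text \<open>
  \<open>Compat i s k l\<close> labels the equation (a) for \<open>i, s, k, l\<close>; \<open>Vanish j i\<close> labels the equation
  \<open>\<Lambda>\<^sub>j(f\<^sub>i) = 0\<close> of (c).
\<close>

datatype 'n eqn = Compat nat nat 'n 'n | Vanish nat nat

fun eqn_val ::
    "nat \<Rightarrow> (nat \<Rightarrow> 'n::{finite,linorder} mon) \<Rightarrow> (nat \<Rightarrow> nat \<times> 'n) \<Rightarrow> (nat \<Rightarrow> 'n mpoly)
      \<Rightarrow> 'n eqn \<Rightarrow> ('n unk \<Rightarrow> complex) \<Rightarrow> complex"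
  where
    "eqn_val r \<beta> piv f (Compat i s k l) p =
       (\<Sum>j\<in>{j\<in>{1..r}. mdeg (\<beta> s) < mdeg (\<beta> j) \<and> mdeg (\<beta> j) < mdeg (\<beta> i)}.
          mu_of r \<beta> piv p i j k * mu_of r \<beta> piv p j s l
          - mu_of r \<beta> piv p i j l * mu_of r \<beta> piv p j s k)"
  | "eqn_val r \<beta> piv f (Vanish j i) p = act (xi_of p) (lam r \<beta> (mu_of r \<beta> piv p) j) (f i)"

definition G0 :: "nat \<Rightarrow> (nat \<Rightarrow> 'n::finite mon) \<Rightarrow> (nat \<Rightarrow> 'n row list) \<Rightarrow> 'n eqn set"
  where "G0 r \<beta> rs =
    {Compat i s k l | i s k l. i \<in> {1..r} \<and> mdeg (\<beta> i) \<ge> 1 \<and> RComm s k l \<in> set (rs (mdeg (\<beta> i)))}"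

definition vanish_eqns :: "nat \<Rightarrow> nat \<Rightarrow> 'n eqn set"
  where "vanish_eqns r N = {Vanish j i | j i. j \<in> {1..r} \<and> i \<in> {1..N}}"

definition K_at ::
    "nat \<Rightarrow> (nat \<Rightarrow> 'n::{finite,linorder} mon) \<Rightarrow> (nat \<Rightarrow> nat \<times> 'n) \<Rightarrow> (nat \<Rightarrow> 'n mpoly) \<Rightarrow> nat
      \<Rightarrow> ('n unk \<Rightarrow> complex) \<Rightarrow> 'n row \<Rightarrow> nat \<times> 'n \<Rightarrow> complex"
  where "K_at r \<beta> piv f t p = K_entry r \<beta> f t (xi_of p) (mu_of r \<beta> piv p)"

definition A_at ::
    "nat \<Rightarrow> (nat \<Rightarrow> 'n::{finite,linorder} mon) \<Rightarrow> (nat \<Rightarrow> nat \<times> 'n) \<Rightarrow> nat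
      \<Rightarrow> ('n unk \<Rightarrow> complex) \<Rightarrow> 'n row \<Rightarrow> nat \<times> 'n \<Rightarrow> complex"
  where "A_at r \<beta> piv t p = H_entry \<beta> t (mu_of r \<beta> piv p)"


section \<open>Multiplicity structure\<close>

definition isolated_root :: "nat \<Rightarrow> (nat \<Rightarrow> 'n::finite mpoly) \<Rightarrow> ('n \<Rightarrow> complex) \<Rightarrow> bool"
  where "isolated_root N g \<xi> \<longleftrightarrow>
    (\<forall>i\<in>{1..N}. ev (g i) \<xi> = 0) \<and>
    (\<exists>e>0. \<forall>\<zeta>. vnorm UNIV (\<zeta> - \<xi>) < e \<and> (\<forall>i\<in>{1..N}. ev (g i) \<zeta> = 0) \<longrightarrow> \<zeta> = \<xi>)"

text \<open>
  The kernel of \<open>\<complex>[x] \<rightarrow> \<complex>[x]\<^sub>\<xi> / I \<complex>[x]\<^sub>\<xi>\<close> (localization at \<open>\<xi>\<close>); for an isolated root \<open>\<xi>\<close> it is the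
  primary component of \<open>I\<close> at \<open>\<xi>\<close>, whose codimension is the multiplicity of \<open>\<xi>\<close>.
\<close>

definition local_component :: "'n mpoly set \<Rightarrow> ('n \<Rightarrow> complex) \<Rightarrow> 'n mpoly set"
  where "local_component I \<xi> = {p. \<exists>g. ev g \<xi> \<noteq> 0 \<and> g * p \<in> I}"

definition has_multiplicity :: "'n mpoly set \<Rightarrow> ('n \<Rightarrow> complex) \<Rightarrow> nat \<Rightarrow> bool"
  where "has_multiplicity I \<xi> m \<longleftrightarrow> (\<exists>S. card S = m \<and> basis_mod (local_component I \<xi>) S)"

definition inverse_system ::
    "'n::{finite,linorder} mpoly set \<Rightarrow> ('n \<Rightarrow> complex) \<Rightarrow> 'n mpoly set"
  where "inverse_system I \<xi> = {\<Lambda>. \<forall>p\<in>I. act \<xi> \<Lambda> p = 0}"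

definition shifted_monom :: "('n::finite \<Rightarrow> complex) \<Rightarrow> 'n mon \<Rightarrow> 'n mpoly"
  where "shifted_monom \<xi> m = (\<Prod>k\<in>UNIV. (Var k - Const (\<xi> k)) ^ Poly_Mapping.lookup m k)"

definition multiple_point_with_structure ::
    "nat \<Rightarrow> (nat \<Rightarrow> 'n::{finite,linorder} mon) \<Rightarrow> nat \<Rightarrow> (nat \<Rightarrow> 'n mpoly) \<Rightarrow> ('n \<Rightarrow> complex)
      \<Rightarrow> (nat \<Rightarrow> 'n mpoly) \<Rightarrow> bool"
  where "multiple_point_with_structure r \<beta> N g \<xi> \<Lambda> \<longleftrightarrow>
    (let I = pideal.span (g ` {1..N}) in
      isolated_root N g \<xi> \<and> has_multiplicity I \<xi> r \<and>
      inj_on \<Lambda> {1..r} \<and> pvec.independent (\<Lambda> ` {1..r}) \<and>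
      pvec.span (\<Lambda> ` {1..r}) = inverse_system I \<xi> \<and>
      (\<forall>i\<in>{1..r}. \<forall>j\<in>{1..r}. act \<xi> (\<Lambda> i) (shifted_monom \<xi> (\<beta> j)) = (if i = j then 1 else 0)))"

definition perturbed ::
    "nat \<Rightarrow> (nat \<Rightarrow> 'n::finite mon) \<Rightarrow> (nat \<Rightarrow> 'n mpoly) \<Rightarrow> (nat \<times> nat \<Rightarrow> complex) \<Rightarrow> ('n \<Rightarrow> complex)
      \<Rightarrow> nat \<Rightarrow> 'n mpoly"
  where "perturbed r \<beta> f \<epsilon> \<xi> i = f i - (\<Sum>j\<in>{1..r}. Const (\<epsilon> (i, j)) * shifted_monom \<xi> (\<beta> j))"

end

theory Submission
  imports Defs "Jordan_Normal_Form.Determinant"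
begin

hide_const (open) Matrix.cols Matrix.rows

text \<open>
  Smale's alpha theory gives a zero \<open>p = (\<xi>\<^sup>*, \<mu>\<^sup>*)\<close> of \<open>F\<^sub>0\<close> within distance \<open>\<beta>\<close> of the starting point,
  so by the Lipschitz bounds the matrices \<open>A\<^sub>t\<close> and \<open>K\<^sub>o\<^sub>+\<^sub>1\<close> are still injective at \<open>p\<close>. One then climbs
  the tower degree by degree. If \<open>\<Lambda>\<^sub>1, \<dots>, \<Lambda>\<^sub>m\<close> with \<open>m = r\<^sub>t\<close> span a space \<open>\<D>\<^sub>t\<close> in the regular part,
  then its matrix \<open>H\<^sub>t\<^sub>+\<^sub>1\<close> has at most the generic rank, and injectivity of \<open>A\<^sub>t\<^sub>+\<^sub>1\<close> shows that the selected
  rows already span all its rows; so the few equations (a) in \<open>G\<^sub>0\<close> imply all of them, the space of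
  integrals of \<open>\<D>\<^sub>t\<close> has minimal dimension, and \<open>\<D>\<^sub>t\<^sub>+\<^sub>1\<close> lies in the regular part again. At the top,
  \<open>\<epsilon>\<^sup>*\<close> is chosen so that \<open>\<Lambda>\<^sub>1, \<dots>, \<Lambda>\<^sub>r\<close> kill the perturbed system, and injectivity of \<open>K\<^sub>o\<^sub>+\<^sub>1\<close>
  excludes further elements of its inverse system. By Nakayama's lemma the local component at \<open>\<xi>\<^sup>*\<close> is
  then the annihilator of \<open>\<D>\<^sub>o\<close>, so \<open>\<xi>\<^sup>*\<close> is isolated of multiplicity \<open>r\<close>.
\<close>

section \<open>Euclidean norms of coordinate vectors\<close>

text \<open>The obstacle is the closure in \<open>Hilb_reg\<close>: a point of it need not lie over
  the minimal locus, and all that is known about it are polynomial identities among Plucker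
  coordinates. On the chart where the coordinate of \<open>B\<close> is nonzero these identities
  control the dual basis, so all work is done there. However, minimality of the dimension of
  \<open>integrals\<close> is demanded against the whole of \<open>Hilb_reg\<close>, also off the
  chart. The bridge is \<open>dim_integrals\<close>: on the chart the dimension of the integrals and
  the rank of \<open>H\<close> have a constant sum, so maximal rank means minimal dimension among
  chart points, and regularity of \<open>B\<close> supplies one chart point that is minimal
  globally. Hence the climb takes no limits: each new pair lies in the tower itself, not only in its
  closure. The analytic part produces the zero within 5/4 of half of \<open>beta_tilde\<close>, well
  inside the ball of radius \<open>beta_tilde\<close> on which the Lipschitz bounds hold.
  Localization is avoided at the end as well: denominators are replaced by polynomial multipliers
  with value 1 at the root.\<close>

lemma vnorm_nonneg [simp]: "0 \<le> vnorm S v"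
  by (simp add: vnorm_def)

lemma vnorm_cong: "(\<And>a. a \<in> S \<Longrightarrow> v a = w a) \<Longrightarrow> vnorm S v = vnorm S w"
  by (auto simp: vnorm_def intro!: L2_set_cong)

lemma vnorm_triangle: "vnorm S (\<lambda>a. v a + w a) \<le> vnorm S v + vnorm S w"
proof -
  have "vnorm S (\<lambda>a. v a + w a) \<le> L2_set (\<lambda>a. cmod (v a) + cmod (w a)) S"
    unfolding vnorm_def by (intro L2_set_mono norm_triangle_ineq) auto
  also have "\<dots> \<le> vnorm S v + vnorm S w"
    unfolding vnorm_def by (rule L2_set_triangle_ineq)
  finally show ?thesis .
qed

lemma vnorm_scale: "vnorm S (\<lambda>a. c * v a) = cmod c * vnorm S v"
  by (simp add: vnorm_def norm_mult L2_set_right_distrib)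

lemma vnorm_zero [simp]: "vnorm S (\<lambda>a. 0) = 0" "vnorm S 0 = 0"
  by (simp_all add: vnorm_def L2_set_0')

lemma vnorm_minus_commute: "vnorm S (\<lambda>a. v a - w a) = vnorm S (\<lambda>a. w a - v a)"
  by (simp add: vnorm_def norm_minus_commute)

lemma vnorm_diff_triangle:
  "vnorm S (\<lambda>a. u a - w a) \<le> vnorm S (\<lambda>a. u a - v a) + vnorm S (\<lambda>a. v a - w a)"
  using vnorm_triangle[of S "\<lambda>a. u a - v a" "\<lambda>a. v a - w a"] by simp

lemma vnorm_sum: "vnorm S (\<lambda>a. \<Sum>i\<in>I. f i a) \<le> (\<Sum>i\<in>I. vnorm S (f i))"
proof (induction I rule: infinite_finite_induct)
  case (insert i I)
  then show ?case
    using vnorm_triangle[of S "f i" "\<lambda>a. \<Sum>i\<in>I. f i a"] by simp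
qed simp_all

lemma cmod_le_vnorm: "finite S \<Longrightarrow> a \<in> S \<Longrightarrow> cmod (v a) \<le> vnorm S v"
  unfolding vnorm_def by (rule member_le_L2_set)

lemma vnorm_le_sum: "vnorm S v \<le> (\<Sum>a\<in>S. cmod (v a))"
  unfolding vnorm_def by (rule L2_set_le_sum) simp

lemma vnorm_eq_0_iff: "finite S \<Longrightarrow> vnorm S v = 0 \<longleftrightarrow> (\<forall>a\<in>S. v a = 0)"
  by (simp add: vnorm_def L2_set_eq_0_iff)

lemma vnorm_mono_set: "finite T \<Longrightarrow> S \<subseteq> T \<Longrightarrow> vnorm S v \<le> vnorm T v"
  by (auto simp: vnorm_def L2_set_def intro!: sum_mono2)

lemma cspace_zero_iff: "v \<in> cspace S \<Longrightarrow> finite S \<Longrightarrow> vnorm S v = 0 \<longleftrightarrow> v = (\<lambda>a. 0)"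
  by (auto simp: vnorm_eq_0_iff cspace_def fun_eq_iff)

lemma cspace_add [intro]: "v \<in> cspace S \<Longrightarrow> w \<in> cspace S \<Longrightarrow> (\<lambda>a. v a + w a) \<in> cspace S"
  and cspace_diff [intro]: "v \<in> cspace S \<Longrightarrow> w \<in> cspace S \<Longrightarrow> (\<lambda>a. v a - w a) \<in> cspace S"
  and cspace_scale [intro]: "v \<in> cspace S \<Longrightarrow> (\<lambda>a. c * v a) \<in> cspace S"
  and cspace_0 [simp, intro]: "(\<lambda>a. 0) \<in> cspace S"
  by (auto simp: cspace_def)

text \<open>Pairing a difference with its own conjugate reduces the vector-valued case to a real-valued one.\<close>

lemma vnorm_mean_value:
  assumes deriv: "\<And>a t. a \<in> S \<Longrightarrow> 0 \<le> t \<Longrightarrow> t \<le> 1 \<Longrightarrow>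
      ((\<lambda>t. g t a) has_vector_derivative g' t a) (at t)"
    and bound: "\<And>t. 0 \<le> t \<Longrightarrow> t \<le> 1 \<Longrightarrow> vnorm S (g' t) \<le> B"
  shows "vnorm S (\<lambda>a. g 1 a - g (0::real) a) \<le> B"
proof -
  define d where "d = (\<lambda>a. g 1 a - g 0 a)"
  define \<phi> where "\<phi> t = (\<Sum>a\<in>S. Re (cnj (d a) * g t a))" for t
  define \<phi>' where "\<phi>' t = (\<Sum>a\<in>S. Re (cnj (d a) * g' t a))" for t
  have der: "(\<phi> has_real_derivative \<phi>' t) (at t)" if "0 \<le> t" "t \<le> 1" for t
  proof -
    have "((\<lambda>t. cnj (d a) * g t a) has_vector_derivative cnj (d a) * g' t a) (at t)"
      if "a \<in> S" for a
      by (intro has_vector_derivative_mult_right deriv) (use that \<open>0 \<le> t\<close> \<open>t \<le> 1\<close> in auto)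
    then have "((\<lambda>t. Re (cnj (d a) * g t a)) has_real_derivative Re (cnj (d a) * g' t a)) (at t)"
      if "a \<in> S" for a
      using that by (auto simp: has_vector_derivative_complex_iff)
    then show ?thesis
      unfolding \<phi>_def \<phi>'_def by (intro DERIV_sum) auto
  qed
  then obtain z where z: "0 < z" "z < 1" "\<phi> 1 - \<phi> 0 = \<phi>' z"
    using MVT2[of 0 1 \<phi> \<phi>'] by auto
  have "(vnorm S d)\<^sup>2 = (\<Sum>a\<in>S. (cmod (d a))\<^sup>2)"
    by (simp add: vnorm_def L2_set_def sum_nonneg)
  also have "\<dots> = \<phi> 1 - \<phi> 0"
    unfolding \<phi>_def sum_subtractf[symmetric]
  proof (rule sum.cong)
    fix a
    have "Re (cnj (d a) * g 1 a) - Re (cnj (d a) * g 0 a) = Re (cnj (d a) * d a)"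
      by (simp add: d_def algebra_simps)
    then show "(cmod (d a))\<^sup>2 = Re (cnj (d a) * g 1 a) - Re (cnj (d a) * g 0 a)"
      by (simp only: cmod_power2) (simp add: power2_eq_square)
  qed simp
  also have "\<dots> = \<phi>' z" by (rule z)
  also have "\<dots> \<le> (\<Sum>a\<in>S. \<bar>cmod (d a)\<bar> * \<bar>cmod (g' z a)\<bar>)"
    unfolding \<phi>'_def by (intro sum_mono) (metis complex_Re_le_cmod norm_mult complex_mod_cnj abs_norm_cancel)
  also have "\<dots> \<le> vnorm S d * vnorm S (g' z)"
    unfolding vnorm_def by (rule L2_set_mult_ineq)
  also have "\<dots> \<le> vnorm S d * B"
    using z by (intro mult_left_mono bound) auto
  finally have "vnorm S d * vnorm S d \<le> vnorm S d * B" by (simp add: power2_eq_square)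
  moreover have "0 \<le> B" using order_trans[OF vnorm_nonneg bound[of 0]] by simp
  ultimately have "vnorm S d \<le> B"
    by (cases "vnorm S d = 0") (auto simp: mult_le_cancel_left_pos less_le)
  then show ?thesis by (simp add: d_def)
qed

text \<open>Banach's fixed point theorem on a closed ball of \<open>cspace S\<close>. As
  \<open>vnorm\<close> is no type-class norm, the limit of the iterates of \<open>0\<close> is taken
  coordinatewise and then shown to be a limit for \<open>vnorm\<close>.\<close>

lemma vnorm_contraction_fixpoint:
  assumes fin: "finite S" and L: "0 \<le> L" "L < 1" and \<rho>: "0 \<le> \<rho>"
    and maps: "\<And>v. v \<in> cspace S \<Longrightarrow> vnorm S v \<le> \<rho> \<Longrightarrow> T v \<in> cspace S \<and> vnorm S (T v) \<le> \<rho>"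
    and contr: "\<And>v w. v \<in> cspace S \<Longrightarrow> w \<in> cspace S \<Longrightarrow> vnorm S v \<le> \<rho> \<Longrightarrow> vnorm S w \<le> \<rho> \<Longrightarrow>
        vnorm S (\<lambda>a. T v a - T w a) \<le> L * vnorm S (\<lambda>a. v a - w a)"
  shows "\<exists>v. v \<in> cspace S \<and> vnorm S v \<le> \<rho> \<and> T v = v"
proof -
  define x where "x n = (T ^^ n) (\<lambda>a. 0)" for n
  have xS: "x (Suc n) = T (x n)" for n by (simp add: x_def)
  have x: "x n \<in> cspace S \<and> vnorm S (x n) \<le> \<rho>" for n
  proof (induction n)
    case 0
    show ?case using \<rho> by (simp add: x_def)
  next
    case (Suc n)
    then show ?case unfolding xS using maps by blast
  qed
  define c where "c = vnorm S (\<lambda>a. x 1 a - x 0 a)"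
  have step: "vnorm S (\<lambda>a. x (Suc n) a - x n a) \<le> L ^ n * c" for n
  proof (induction n)
    case (Suc n)
    have "vnorm S (\<lambda>a. x (Suc (Suc n)) a - x (Suc n) a) \<le> L * vnorm S (\<lambda>a. x (Suc n) a - x n a)"
      unfolding xS[of "Suc n"] xS[of n] using x contr by (metis xS)
    also have "\<dots> \<le> L * (L ^ n * c)" using Suc L by (intro mult_left_mono)
    finally show ?case by simp
  qed (simp add: c_def)
  have "\<exists>l. (\<lambda>n. x n a) \<longlonglongrightarrow> l" for a
  proof (cases "a \<in> S")
    case True
    have "summable (\<lambda>n. x (Suc n) a - x n a)"
    proof (rule summable_comparison_test)
      show "\<exists>N. \<forall>n\<ge>N. norm (x (Suc n) a - x n a) \<le> L ^ n * c"
        using cmod_le_vnorm[OF fin True] step by (meson order_trans)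
      show "summable (\<lambda>n. L ^ n * c)"
        using L by (intro summable_mult2 summable_geometric) simp
    qed
    then have "convergent (\<lambda>n. \<Sum>i<n. x (Suc i) a - x i a)"
      by (simp add: summable_iff_convergent)
    then have "convergent (\<lambda>n. x n a - x 0 a)"
      by (simp add: sum_lessThan_telescope[of "\<lambda>i. x i a"])
    then have "convergent (\<lambda>n. (x n a - x 0 a) + x 0 a)"
      by (rule convergent_add[OF _ convergent_const])
    then show ?thesis by (simp add: convergent_def)
  next
    case False
    then have "(\<lambda>n. x n a) = (\<lambda>n. 0)" using x by (auto simp: cspace_def)
    then show ?thesis by auto
  qed
  then obtain l where l: "\<And>a. (\<lambda>n. x n a) \<longlonglongrightarrow> l a" by metis
  have lim: "(\<lambda>n. vnorm S (\<lambda>a. x n a - l a)) \<longlonglongrightarrow> 0"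
  proof (rule tendsto_sandwich[OF _ _ tendsto_const])
    have "(\<lambda>n. \<Sum>a\<in>S. cmod (x n a - l a)) \<longlonglongrightarrow> (\<Sum>a\<in>S. cmod (l a - l a))"
      by (intro tendsto_intros l)
    then show "(\<lambda>n. \<Sum>a\<in>S. cmod (x n a - l a)) \<longlonglongrightarrow> 0" by simp
  qed (auto intro!: always_eventually vnorm_le_sum)
  have "l a = 0" if "a \<notin> S" for a
    using l[of a] x that by (auto simp: cspace_def dest: LIMSEQ_unique)
  then have lS: "l \<in> cspace S" by (auto simp: cspace_def)
  have l\<rho>: "vnorm S l \<le> \<rho>"
  proof (rule field_le_epsilon)
    fix e :: real assume "0 < e"
    then obtain n where "vnorm S (\<lambda>a. x n a - l a) < e"
      using order_tendstoD(2)[OF lim] by (meson eventually_happens trivial_limit_sequentially)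
    then show "vnorm S l \<le> \<rho> + e"
      using vnorm_triangle[of S "\<lambda>a. l a - x n a" "x n"] x[of n] vnorm_minus_commute[of S l "x n"] by simp
  qed
  have "vnorm S (\<lambda>a. T l a - l a) \<le> 0"
  proof (rule field_le_epsilon)
    fix e :: real assume "0 < e"
    then have "\<forall>\<^sub>F n in sequentially. vnorm S (\<lambda>a. x n a - l a) < e / 2"
      by (intro order_tendstoD(2)[OF lim] half_gt_zero)
    then obtain N where N: "\<And>n. N \<le> n \<Longrightarrow> vnorm S (\<lambda>a. x n a - l a) < e / 2"
      by (auto simp: eventually_sequentially)
    have "vnorm S (\<lambda>a. T l a - l a) \<le> vnorm S (\<lambda>a. T l a - x (Suc N) a) + vnorm S (\<lambda>a. x (Suc N) a - l a)"
      by (rule vnorm_diff_triangle)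
    also have "vnorm S (\<lambda>a. T l a - x (Suc N) a) \<le> L * vnorm S (\<lambda>a. l a - x N a)"
      unfolding xS using contr lS l\<rho> x by blast
    also have "\<dots> \<le> 1 * vnorm S (\<lambda>a. x N a - l a)"
      using L by (subst vnorm_minus_commute) (intro mult_right_mono, auto)
    finally show "vnorm S (\<lambda>a. T l a - l a) \<le> 0 + e" using N[of N] N[of "Suc N"] by simp
  qed
  moreover have "T l \<in> cspace S" using maps lS l\<rho> by blast
  ultimately have "(\<lambda>a. T l a - l a) = (\<lambda>a. 0)"
    using cspace_zero_iff[OF cspace_diff fin] lS by (metis vnorm_nonneg order_antisym)
  then show ?thesis using lS l\<rho> by (auto simp: fun_eq_iff)
qed

section \<open>Polynomial functions and their directional derivatives\<close>

text \<open>The index bounds the degree from above and need not equal it. The predicate speaks of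
  functions because \<open>dir_deriv\<close> differentiates functions; the bound turns all Taylor
  expansions below into finite sums.\<close>

inductive polyfun :: "nat \<Rightarrow> (('u \<Rightarrow> complex) \<Rightarrow> complex) \<Rightarrow> bool" where
  const: "polyfun d (\<lambda>p. c)"
| coord: "polyfun (Suc d) (\<lambda>p. p a)"
| add: "polyfun d g \<Longrightarrow> polyfun d h \<Longrightarrow> polyfun d (\<lambda>p. g p + h p)"
| mult: "polyfun d g \<Longrightarrow> polyfun e h \<Longrightarrow> polyfun (d + e) (\<lambda>p. g p * h p)"

lemma polyfun_cmult: "polyfun d g \<Longrightarrow> polyfun d (\<lambda>p. c * g p)"
  using polyfun.mult[OF polyfun.const[of 0 c]] by fastforce

lemma polyfun_mono: "polyfun d g \<Longrightarrow> d \<le> e \<Longrightarrow> polyfun e g"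
  using polyfun.mult[OF _ polyfun.const[of "e - d" 1], of d g] by simp

lemma polyfun_sum: "(\<And>i. i \<in> I \<Longrightarrow> polyfun d (g i)) \<Longrightarrow> polyfun d (\<lambda>p. \<Sum>i\<in>I. g i p)"
proof (induction I rule: infinite_finite_induct)
  case (insert i I)
  then show ?case using polyfun.add[of d "g i" "\<lambda>p. \<Sum>i\<in>I. g i p"] by simp
qed (simp_all add: polyfun.const)

lemma polyfun_diff:
  assumes "polyfun d g" "polyfun d h"
  shows "polyfun d (\<lambda>p. g p - h p)"
proof -
  have "polyfun d (\<lambda>p. - 1 * h p)" by (rule polyfun_cmult[OF assms(2)])
  then have "polyfun d (\<lambda>p. g p + - 1 * h p)" by (rule polyfun.add[OF assms(1)])
  moreover have "(\<lambda>p. g p + - 1 * h p) = (\<lambda>p. g p - h p)" by (simp add: fun_eq_iff)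
  ultimately show ?thesis by metis
qed

text \<open>Induction over the construction gives the chain rule with finitely many partial
  derivatives \<open>h a\<close>, whence linearity in the direction \<open>v\<close>. The clause for
  \<open>d = 0\<close> is there because \<open>d - 1\<close> is then again \<open>0\<close>, so that
  the degree bound alone would not make the derivative of a constant vanish.\<close>

lemma polyfun_partials:
  assumes "polyfun d g"
  shows "\<exists>A h. finite A \<and> (\<forall>a. polyfun (d - 1) (h a)) \<and> (\<forall>a. a \<notin> A \<longrightarrow> h a = (\<lambda>p. 0)) \<and>
      (d = 0 \<longrightarrow> A = {}) \<and>
      (\<forall>p v z. ((\<lambda>z. g (\<lambda>a. p a + z * v a)) has_field_derivative
        (\<Sum>a\<in>A. v a * h a (\<lambda>a. p a + z * v a))) (at z))"
  using assms
proof induction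
    case (const d c)
    show ?case by (rule exI[of _ "{}"], rule exI[of _ "\<lambda>a p. 0"]) (auto intro: polyfun.const)
  next
    case (coord d b)
    have "((\<lambda>z. p b + z * v b) has_field_derivative v b * 1) (at z)" for p v z
      by (auto intro!: derivative_eq_intros)
    then show ?case
      by (intro exI[of _ "{b}"] exI[of _ "\<lambda>a p. if a = b then 1 else 0"])
        (auto intro: polyfun.const)
  next
    case (add d g1 g2)
    then obtain A1 h1 A2 h2 where 1: "finite A1" "\<And>a. polyfun (d - 1) (h1 a)"
        "\<And>a. a \<notin> A1 \<Longrightarrow> h1 a = (\<lambda>p. 0)" "d = 0 \<longrightarrow> A1 = {}"
        "\<And>p v z. ((\<lambda>z. g1 (\<lambda>a. p a + z * v a)) has_field_derivative
          (\<Sum>a\<in>A1. v a * h1 a (\<lambda>a. p a + z * v a))) (at z)"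
      and 2: "finite A2" "\<And>a. polyfun (d - 1) (h2 a)"
        "\<And>a. a \<notin> A2 \<Longrightarrow> h2 a = (\<lambda>p. 0)" "d = 0 \<longrightarrow> A2 = {}"
        "\<And>p v z. ((\<lambda>z. g2 (\<lambda>a. p a + z * v a)) has_field_derivative
          (\<Sum>a\<in>A2. v a * h2 a (\<lambda>a. p a + z * v a))) (at z)"
      by blast
    have e1: "(\<Sum>a\<in>A1. v a * h1 a q) = (\<Sum>a\<in>A1\<union>A2. v a * h1 a q)" for v q
      by (rule sum.mono_neutral_left) (use 1 2 in auto)
    have e2: "(\<Sum>a\<in>A2. v a * h2 a q) = (\<Sum>a\<in>A1\<union>A2. v a * h2 a q)" for v q
      by (rule sum.mono_neutral_left) (use 1 2 in auto)
    have "((\<lambda>z. g1 (\<lambda>a. p a + z * v a) + g2 (\<lambda>a. p a + z * v a)) has_field_derivative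
        (\<Sum>a\<in>A1\<union>A2. v a * (h1 a (\<lambda>a. p a + z * v a) + h2 a (\<lambda>a. p a + z * v a)))) (at z)" for p v z
      using DERIV_add[OF 1(5)[of p v z] 2(5)[of p v z]]
      by (simp add: e1 e2 sum.distrib algebra_simps)
    then show ?case
      using 1 2 by (intro exI[of _ "A1 \<union> A2"] exI[of _ "\<lambda>a p. h1 a p + h2 a p"])
        (auto intro: polyfun.add)
  next
    case (mult d g1 e g2)
    then obtain A1 h1 A2 h2 where 1: "finite A1" "\<And>a. polyfun (d - 1) (h1 a)"
        "\<And>a. a \<notin> A1 \<Longrightarrow> h1 a = (\<lambda>p. 0)" "d = 0 \<longrightarrow> A1 = {}"
        "\<And>p v z. ((\<lambda>z. g1 (\<lambda>a. p a + z * v a)) has_field_derivative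
          (\<Sum>a\<in>A1. v a * h1 a (\<lambda>a. p a + z * v a))) (at z)"
      and 2: "finite A2" "\<And>a. polyfun (e - 1) (h2 a)"
        "\<And>a. a \<notin> A2 \<Longrightarrow> h2 a = (\<lambda>p. 0)" "e = 0 \<longrightarrow> A2 = {}"
        "\<And>p v z. ((\<lambda>z. g2 (\<lambda>a. p a + z * v a)) has_field_derivative
          (\<Sum>a\<in>A2. v a * h2 a (\<lambda>a. p a + z * v a))) (at z)"
      by blast
    have e1: "(\<Sum>a\<in>A1. v a * h1 a q) = (\<Sum>a\<in>A1\<union>A2. v a * h1 a q)" for v q
      by (rule sum.mono_neutral_left) (use 1 2 in auto)
    have e2: "(\<Sum>a\<in>A2. v a * h2 a q) = (\<Sum>a\<in>A1\<union>A2. v a * h2 a q)" for v q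
      by (rule sum.mono_neutral_left) (use 1 2 in auto)
    define h where "h a p = h1 a p * g2 p + g1 p * h2 a p" for a p
    have "((\<lambda>z. g1 (\<lambda>a. p a + z * v a) * g2 (\<lambda>a. p a + z * v a)) has_field_derivative
        (\<Sum>a\<in>A1\<union>A2. v a * h a (\<lambda>a. p a + z * v a))) (at z)" for p v z
      using DERIV_mult[OF 1(5)[of p v z] 2(5)[of p v z]]
      by (simp add: h_def e1 e2 sum.distrib algebra_simps sum_distrib_left sum_distrib_right)
    moreover have "polyfun (d + e - 1) (h a)" for a
    proof -
      \<comment> \<open>For \<open>d = 0\<close> truncated subtraction turns the expected bound
        \<open>(d - 1) + e\<close> into \<open>e\<close>, possibly one too large; but then the
        summand is zero.\<close>
      have "polyfun (d + e - 1) (\<lambda>p. h1 a p * g2 p)"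
      proof (cases "d = 0")
        case True
        then show ?thesis using 1(3,4) by (auto intro: polyfun.const)
      next
        case False
        then have "d + e - 1 = (d - 1) + e" by simp
        then show ?thesis using polyfun.mult[OF 1(2) mult.hyps(2)] by simp
      qed
      moreover have "polyfun (d + e - 1) (\<lambda>p. g1 p * h2 a p)"
      proof (cases "e = 0")
        case True
        then show ?thesis using 2(3,4) by (auto intro: polyfun.const)
      next
        case False
        then have "d + e - 1 = d + (e - 1)" by simp
        then show ?thesis using polyfun.mult[OF mult.hyps(1) 2(2)] by simp
      qed
      ultimately show ?thesis
        unfolding h_def[abs_def] by (rule polyfun.add)
    qed
    moreover have "h a = (\<lambda>p. 0)" if "a \<notin> A1 \<union> A2" for a
      using that 1(3) 2(3) by (auto simp: h_def)
    ultimately show ?case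
      using 1(1,4) 2(1,4) by (intro exI[of _ "A1 \<union> A2"] exI[of _ h]) auto
qed

lemma dir_deriv_partials:
  assumes "polyfun d g"
  shows "\<exists>A h. finite A \<and> (\<forall>a. polyfun (d - 1) (h a)) \<and> (d = 0 \<longrightarrow> A = {}) \<and>
    (\<forall>v. dir_deriv v g = (\<lambda>p. \<Sum>a\<in>A. v a * h a p))"
proof -
  obtain A h where Ah: "finite A" "\<forall>a. polyfun (d - 1) (h a)" "d = 0 \<longrightarrow> A = {}"
    and der: "\<forall>p v z. ((\<lambda>z. g (\<lambda>a. p a + z * v a)) has_field_derivative
       (\<Sum>a\<in>A. v a * h a (\<lambda>a. p a + z * v a))) (at z)"
    using polyfun_partials[OF assms] by blast
  have "dir_deriv v g = (\<lambda>p. \<Sum>a\<in>A. v a * h a p)" for v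
    using der[rule_format, of _ v 0] by (auto simp: dir_deriv_def fun_eq_iff intro!: DERIV_imp_deriv)
  then show ?thesis using Ah by blast
qed

lemma polyfun_dir_deriv: "polyfun d g \<Longrightarrow> polyfun (d - 1) (dir_deriv v g)"
  by (drule dir_deriv_partials, elim exE conjE) (auto intro!: polyfun_sum polyfun_cmult)

lemma dir_deriv_degree_0: "polyfun 0 g \<Longrightarrow> dir_deriv v g = (\<lambda>p. 0)"
  by (drule dir_deriv_partials, elim exE conjE) auto

lemma has_field_derivative_line:
  assumes "polyfun d g"
  shows "((\<lambda>z. g (\<lambda>a. p a + z * v a)) has_field_derivative dir_deriv v g (\<lambda>a. p a + z * v a)) (at z)"
proof -
  obtain A h where der: "\<forall>p v z. ((\<lambda>z. g (\<lambda>a. p a + z * v a)) has_field_derivative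
       (\<Sum>a\<in>A. v a * h a (\<lambda>a. p a + z * v a))) (at z)"
    using polyfun_partials[OF assms] by blast
  have "dir_deriv v g q = (\<Sum>a\<in>A. v a * h a q)" for q
    using der[rule_format, of q v 0] by (auto simp: dir_deriv_def intro!: DERIV_imp_deriv)
  then show ?thesis using der by simp
qed

lemma dir_deriv_scale: "polyfun d g \<Longrightarrow> dir_deriv (\<lambda>a. c * v a) g = (\<lambda>p. c * dir_deriv v g p)"
  by (drule dir_deriv_partials, elim exE conjE) (simp add: sum_distrib_left algebra_simps)

lemma dir_deriv_add_arg:
  "polyfun d g \<Longrightarrow> dir_deriv (\<lambda>a. v a + w a) g = (\<lambda>p. dir_deriv v g p + dir_deriv w g p)"
  by (drule dir_deriv_partials, elim exE conjE) (simp add: sum.distrib algebra_simps)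

lemma dir_deriv_lincomb:
  assumes "\<And>i. i \<in> I \<Longrightarrow> polyfun d (g i)"
  shows "dir_deriv v (\<lambda>p. \<Sum>i\<in>I. c i * g i p) = (\<lambda>p. \<Sum>i\<in>I. c i * dir_deriv v (g i) p)"
proof
  fix p
  have "((\<lambda>z. \<Sum>i\<in>I. c i * g i (\<lambda>a. p a + z * v a)) has_field_derivative
      (\<Sum>i\<in>I. c i * dir_deriv v (g i) (\<lambda>a. p a + 0 * v a))) (at 0)"
    by (intro DERIV_sum DERIV_cmult has_field_derivative_line[of d] assms)
  then show "dir_deriv v (\<lambda>p. \<Sum>i\<in>I. c i * g i p) p = (\<Sum>i\<in>I. c i * dir_deriv v (g i) p)"
    by (simp add: dir_deriv_def[of v "\<lambda>p. \<Sum>i\<in>I. c i * g i p"] DERIV_imp_deriv)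
qed

lemma polyfun_foldr_dir_deriv: "polyfun d g \<Longrightarrow> polyfun (d - length vs) (foldr dir_deriv vs g)"
proof (induction vs)
  case (Cons v vs)
  then have "polyfun (d - length vs - 1) (dir_deriv v (foldr dir_deriv vs g))"
    by (intro polyfun_dir_deriv) simp
  then show ?case by simp
qed simp

lemma polyfun_foldr_dir_deriv': "polyfun d g \<Longrightarrow> polyfun d (foldr dir_deriv vs g)"
  using polyfun_foldr_dir_deriv polyfun_mono diff_le_self by blast

lemma foldr_dir_deriv_eq_0:
  assumes "polyfun d g" "d < length vs"
  shows "foldr dir_deriv vs g = (\<lambda>p. 0)"
  using assms(2)
proof (induction vs)
  case (Cons v vs)
  show ?case
  proof (cases "d < length vs")
    case True
    then show ?thesis using Cons by (simp add: dir_deriv_degree_0 polyfun.const)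
  next
    case False
    then have "polyfun 0 (foldr dir_deriv vs g)"
      using Cons.prems polyfun_foldr_dir_deriv[OF assms(1), of vs] by simp
    then show ?thesis by (simp add: dir_deriv_degree_0)
  qed
qed simp

lemma foldr_dir_deriv_lincomb:
  assumes "\<And>i. i \<in> I \<Longrightarrow> polyfun d (g i)"
  shows "foldr dir_deriv vs (\<lambda>p. \<Sum>i\<in>I. c i * g i p) =
    (\<lambda>p. \<Sum>i\<in>I. c i * foldr dir_deriv vs (g i) p)"
proof (induction vs)
  case (Cons v vs)
  show ?case
    using dir_deriv_lincomb[of I d "\<lambda>i. foldr dir_deriv vs (g i)"] assms
    by (simp add: Cons polyfun_foldr_dir_deriv'[of d])
qed simp

lemma dir_deriv_cmult:
  assumes "polyfun d g"
  shows "dir_deriv v (\<lambda>p. c * g p) = (\<lambda>p. c * dir_deriv v g p)"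
proof -
  have "dir_deriv v (\<lambda>p. \<Sum>i\<in>{()}. c * g p) = (\<lambda>p. \<Sum>i\<in>{()}. c * dir_deriv v g p)"
    by (rule dir_deriv_lincomb) (rule assms)
  then show ?thesis by simp
qed

lemma foldr_dir_deriv_scale:
  assumes "polyfun d g"
  shows "foldr dir_deriv (map (\<lambda>v a. c v * u v a) vs) g =
    (\<lambda>p. (\<Prod>v\<leftarrow>vs. c v) * foldr dir_deriv (map u vs) g p)"
proof (induction vs)
  case (Cons v vs)
  have pf: "polyfun d (foldr dir_deriv (map u vs) g)"
    by (rule polyfun_foldr_dir_deriv'[OF assms])
  have "foldr dir_deriv (map (\<lambda>v a. c v * u v a) (v # vs)) g =
      dir_deriv (\<lambda>a. c v * u v a) (\<lambda>p. (\<Prod>v\<leftarrow>vs. c v) * foldr dir_deriv (map u vs) g p)"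
    by (simp only: list.map foldr_Cons o_def Cons)
  also have "\<dots> = (\<lambda>p. (\<Prod>v\<leftarrow>vs. c v) * (c v * dir_deriv (u v) (foldr dir_deriv (map u vs) g) p))"
    by (simp only: dir_deriv_cmult[OF pf] dir_deriv_scale[OF pf])
  also have "\<dots> = (\<lambda>p. (\<Prod>v\<leftarrow>v # vs. c v) * foldr dir_deriv (map u (v # vs)) g p)"
    by (simp only: list.map foldr_Cons o_def prod_list.Cons mult_ac)
  finally show ?case .
qed simp

text \<open>Along the line through \<open>p\<close> in direction \<open>v\<close> the derivative of
  order \<open>Suc d\<close> vanishes identically, so the remainder in the complex Taylor theorem is
  zero and the expansion exact. The list \<open>ws\<close> allows derivatives to be expanded
  too.\<close>

lemma polyfun_taylor:
  assumes "polyfun d g"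
  shows "foldr dir_deriv ws g (\<lambda>a. p a + v a) =
    (\<Sum>k\<le>d. foldr dir_deriv (replicate k v @ ws) g p / fact k)"
proof -
  define f where "f i z = foldr dir_deriv (replicate i v @ ws) g (\<lambda>a. p a + z * v a)" for i and z :: complex
  have "cmod (f 0 1 - (\<Sum>i\<le>d. f i 0 * (1 - 0) ^ i / fact i)) \<le> 0 * cmod (1 - 0) ^ Suc d / fact d"
  proof (rule complex_Taylor[where S = UNIV])
    show "(f i has_field_derivative f (Suc i) z) (at z within UNIV)" for i z
      unfolding f_def
      using has_field_derivative_line[OF polyfun_foldr_dir_deriv'[OF assms, of "replicate i v @ ws"], of p v z]
      by simp
    have "foldr dir_deriv (replicate (Suc d) v @ ws) g = (\<lambda>p. 0)"
      by (rule foldr_dir_deriv_eq_0[OF assms]) simp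
    then show "cmod (f (Suc d) x) \<le> 0" for x unfolding f_def by simp
  qed auto
  then show ?thesis by (simp add: f_def)
qed

text \<open>Supplies the boundedness that gives the suprema in \<open>multilinear_norm\<close> a
  meaning. The innermost direction is the last list element; splitting it off leaves finitely many
  partial derivatives with coefficients of modulus at most 1.\<close>

lemma foldr_dir_deriv_bounded:
  assumes "polyfun d g" "finite V"
  shows "\<exists>C. \<forall>vs. length vs = k \<longrightarrow> (\<forall>v\<in>set vs. v \<in> cspace V \<and> vnorm V v \<le> 1) \<longrightarrow>
    cmod (foldr dir_deriv vs g p) \<le> C"
  using assms(1)
proof (induction k arbitrary: g)
  case 0
  then show ?case by (intro exI[of _ "cmod (g p)"]) auto
next
  case (Suc k)
  obtain A h where A: "finite A" "\<And>a. polyfun (d - 1) (h a)"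
    and dd: "\<And>v. dir_deriv v g = (\<lambda>p. \<Sum>a\<in>A. v a * h a p)"
    using dir_deriv_partials[OF Suc.prems] by blast
  have "polyfun d (h a)" for a using A(2) polyfun_mono diff_le_self by blast
  then have "\<exists>C. \<forall>vs. length vs = k \<longrightarrow> (\<forall>v\<in>set vs. v \<in> cspace V \<and> vnorm V v \<le> 1) \<longrightarrow>
      cmod (foldr dir_deriv vs (h a) p) \<le> C" for a by (rule Suc.IH)
  then obtain C where C: "\<And>a. \<forall>vs. length vs = k \<longrightarrow> (\<forall>v\<in>set vs. v \<in> cspace V \<and> vnorm V v \<le> 1) \<longrightarrow>
      cmod (foldr dir_deriv vs (h a) p) \<le> C a"
    using choice[of "\<lambda>a C. \<forall>vs. length vs = k \<longrightarrow> (\<forall>v\<in>set vs. v \<in> cspace V \<and> vnorm V v \<le> 1) \<longrightarrow>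
      cmod (foldr dir_deriv vs (h a) p) \<le> C"] by auto
  have "cmod (foldr dir_deriv vs g p) \<le> (\<Sum>a\<in>A. C a)"
    if vs: "length vs = Suc k" "\<forall>v\<in>set vs. v \<in> cspace V \<and> vnorm V v \<le> 1" for vs
  proof -
    obtain us v where us: "vs = us @ [v]" "length us = k"
      using vs(1) by (metis length_Suc_conv_rev)
    have v: "cmod (v a) \<le> 1" for a
      using vs(2) us cmod_le_vnorm[OF assms(2), of a v] by (cases "a \<in> V") (auto simp: cspace_def)
    have "foldr dir_deriv vs g p = (\<Sum>a\<in>A. v a * foldr dir_deriv us (h a) p)"
      using foldr_dir_deriv_lincomb[of A "d - 1" h us v] A by (simp add: us dd)
    also have "cmod \<dots> \<le> (\<Sum>a\<in>A. cmod (v a * foldr dir_deriv us (h a) p))"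
      by (rule norm_sum)
    also have "\<dots> \<le> (\<Sum>a\<in>A. C a)"
    proof (rule sum_mono)
      fix a
      have "cmod (foldr dir_deriv us (h a) p) \<le> C a" using C us vs(2) by auto
      then show "cmod (v a * foldr dir_deriv us (h a) p) \<le> C a"
        using v[of a] by (simp add: norm_mult) (metis mult_left_le_one_le norm_ge_zero order_trans)
    qed
    finally show ?thesis .
  qed
  then show ?case by blast
qed

section \<open>Newton's method under the alpha condition\<close>

lemma sum_power_le:
  fixes x :: real assumes "0 \<le> x" "x < 1"
  shows "(\<Sum>k\<le>d. x ^ k) \<le> 1 / (1 - x)"
proof -
  have "(1 - x) * (\<Sum>k\<le>d. x ^ k) = 1 - x ^ Suc d"
    by (rule sum_gp_basic)
  also have "\<dots> \<le> 1" using assms by simp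
  finally show ?thesis using assms by (simp add: pos_le_divide_eq mult.commute)
qed

text \<open>Multiplication by \<open>1 - x\<close> lowers the order of the weight by one, so the
  bounds for the once and twice differentiated geometric series follow from each other.\<close>

lemma sum_Suc_mult_power_le:
  fixes x :: real assumes "0 \<le> x" "x < 1"
  shows "(\<Sum>k\<le>d. real (Suc k) * x ^ k) \<le> 1 / (1 - x)\<^sup>2"
proof -
  have "(1 - x) * (\<Sum>k\<le>d. real (Suc k) * x ^ k) = (\<Sum>k\<le>d. x ^ k) - real (Suc d) * x ^ Suc d"
    by (induction d) (auto simp: algebra_simps)
  also have "\<dots> \<le> (\<Sum>k\<le>d. x ^ k)" using assms by simp
  also have "\<dots> \<le> 1 / (1 - x)" by (rule sum_power_le[OF assms])
  finally have "(1 - x) * (\<Sum>k\<le>d. real (Suc k) * x ^ k) \<le> 1 / (1 - x)" .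
  then have "(\<Sum>k\<le>d. real (Suc k) * x ^ k) \<le> 1 / (1 - x) / (1 - x)"
    using assms by (subst pos_le_divide_eq) (simp_all only: mult.commute diff_gt_0_iff_gt)
  then show ?thesis by (simp add: power2_eq_square)
qed

lemma sum_Suc_Suc_mult_power_le:
  fixes x :: real assumes "0 \<le> x" "x < 1"
  shows "(\<Sum>k\<le>d. real (Suc (Suc k)) * real (Suc k) * x ^ k) \<le> 2 / (1 - x) ^ 3"
proof -
  have "(1 - x) * (\<Sum>k\<le>d. real (Suc (Suc k)) * real (Suc k) * x ^ k) =
      2 * (\<Sum>k\<le>d. real (Suc k) * x ^ k) - real (Suc (Suc d)) * real (Suc d) * x ^ Suc d"
    by (induction d) (auto simp: algebra_simps)
  also have "\<dots> \<le> 2 * (\<Sum>k\<le>d. real (Suc k) * x ^ k)" using assms by simp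
  also have "\<dots> \<le> 2 / (1 - x)\<^sup>2" using sum_Suc_mult_power_le[OF assms, of d] by simp
  finally have "(1 - x) * (\<Sum>k\<le>d. real (Suc (Suc k)) * real (Suc k) * x ^ k) \<le> 2 / (1 - x)\<^sup>2" .
  then have "(\<Sum>k\<le>d. real (Suc (Suc k)) * real (Suc k) * x ^ k) \<le> 2 / (1 - x)\<^sup>2 / (1 - x)"
    using assms by (subst pos_le_divide_eq) (simp_all only: mult.commute diff_gt_0_iff_gt)
  then show ?thesis by (simp add: power2_eq_square power3_eq_cube mult.assoc)
qed

lemma vnorm_divide_fact: "vnorm S (\<lambda>a. v a / fact k) = vnorm S v / fact k"
  using vnorm_scale[of S "complex_of_real (1 / fact k)" v] unfolding norm_of_real by simp

lemma has_vector_derivative_line: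
  assumes "polyfun d g"
  shows "((\<lambda>t::real. g (\<lambda>a. p a + of_real t * v a)) has_vector_derivative
    dir_deriv v g (\<lambda>a. p a + of_real t * v a)) (at t)"
  by (rule has_vector_derivative_real_field, rule has_field_derivative_line[OF assms])

lemma dir_deriv_sum_arg:
  assumes "polyfun d g"
  shows "dir_deriv (\<lambda>a. \<Sum>i\<in>I. c i * v i a) g = (\<lambda>p. \<Sum>i\<in>I. c i * dir_deriv (v i) g p)"
proof -
  obtain A h where "\<And>v. dir_deriv v g = (\<lambda>p. \<Sum>a\<in>A. v a * h a p)"
    using dir_deriv_partials[OF assms] by blast
  moreover have "(\<Sum>a\<in>A. (\<Sum>i\<in>I. c i * v i a) * h a p) = (\<Sum>i\<in>I. c i * (\<Sum>a\<in>A. v i a * h a p))" for p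
    unfolding sum_distrib_left sum_distrib_right by (subst sum.swap) (simp add: mult_ac)
  ultimately show ?thesis by simp
qed

lemma dir_deriv_diff_arg:
  assumes "polyfun d g"
  shows "dir_deriv (\<lambda>a. v a - w a) g = (\<lambda>p. dir_deriv v g p - dir_deriv w g p)"
  using dir_deriv_add_arg[OF assms, of v "\<lambda>a. (-1) * w a"] dir_deriv_scale[OF assms, of "-1" w]
  by simp

text \<open>
  Here \<open>\<beta>\<close> is half of \<open>beta_tilde\<close>, and \<open>0.26141 / 2 < 2 / 15\<close>; thus \<open>\<gamma> * \<rho> \<le> 1 / 5\<close> for the
  radius \<open>\<rho> = 3 / 2 * \<beta>\<close> in which the iteration stays.
\<close>

locale normalised_system =
  fixes V :: "'u set" and G :: "'u \<Rightarrow> ('u \<Rightarrow> complex) \<Rightarrow> complex" and p0 :: "'u \<Rightarrow> complex"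
    and d :: nat and \<beta> \<gamma> :: real
  assumes finite_V: "finite V"
    and polyfun_G: "a \<in> V \<Longrightarrow> polyfun d (G a)"
    and deriv_p0: "v \<in> cspace V \<Longrightarrow> a \<in> V \<Longrightarrow> dir_deriv v (G a) p0 = v a"
    and \<gamma>_nonneg: "0 \<le> \<gamma>"
    and higher: "2 \<le> length vs \<Longrightarrow> (\<forall>v\<in>set vs. v \<in> cspace V) \<Longrightarrow>
      vnorm V (\<lambda>a. foldr dir_deriv vs (G a) p0)
        \<le> fact (length vs) * \<gamma> ^ (length vs - 1) * (\<Prod>v\<leftarrow>vs. vnorm V v)"
    and \<beta>: "\<beta> = vnorm V (\<lambda>a. G a p0)"
    and \<alpha>: "\<beta> * \<gamma> \<le> 2 / 15"
begin

text \<open>The derivative at \<open>p0\<close> is the identity, so the terms of order 0 and 1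
  cancel. The term of order \<open>k + 2\<close> is at most \<open>vnorm V v * x ^ (k + 1)\<close>
  with \<open>x = \<gamma> * vnorm V v\<close>, and a geometric series remains.\<close>

lemma vnorm_remainder_0:
  assumes "v \<in> cspace V" "\<gamma> * vnorm V v < 1"
  shows "vnorm V (\<lambda>a. G a (\<lambda>b. p0 b + v b) - G a p0 - v a)
    \<le> vnorm V v * (\<gamma> * vnorm V v / (1 - \<gamma> * vnorm V v))"
proof -
  define x where "x = \<gamma> * vnorm V v"
  have x: "0 \<le> x" "x < 1" using assms \<gamma>_nonneg by (auto simp: x_def)
  define t where "t k a = foldr dir_deriv (replicate k v) (G a) p0 / fact k" for k a
  have t: "vnorm V (t (Suc (Suc k))) \<le> vnorm V v * x * x ^ k" for k
  proof -
    have "vnorm V (t (Suc (Suc k))) = vnorm V (\<lambda>a. foldr dir_deriv (replicate (Suc (Suc k)) v) (G a) p0) / fact (Suc (Suc k))"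
      by (simp only: t_def[abs_def] vnorm_divide_fact)
    also have "\<dots> \<le> (fact (Suc (Suc k)) * \<gamma> ^ Suc k * vnorm V v ^ Suc (Suc k)) / fact (Suc (Suc k))"
      using higher[of "replicate (Suc (Suc k)) v"] assms(1)
      by (intro divide_right_mono) (auto simp: prod_list_replicate simp del: fact_Suc)
    also have "\<dots> = vnorm V v * x * x ^ k"
      by (simp add: x_def power_mult_distrib mult_ac del: fact_Suc)
    finally show ?thesis .
  qed
  \<comment> \<open>Expanding up to \<open>Suc (Suc d)\<close> instead of \<open>d\<close>
    guarantees that the terms of order 0 and 1 can be split off whatever \<open>d\<close>
    is.\<close>
  have "G a (\<lambda>b. p0 b + v b) = (\<Sum>k\<le>Suc (Suc d). t k a)" if "a \<in> V" for a
    using polyfun_taylor[OF polyfun_mono[OF polyfun_G[OF that]], of "Suc (Suc d)" "[]" p0 v]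
    by (simp add: t_def)
  then have "vnorm V (\<lambda>a. G a (\<lambda>b. p0 b + v b) - G a p0 - v a) = vnorm V (\<lambda>a. \<Sum>k\<le>d. t (Suc (Suc k)) a)"
    using deriv_p0[OF assms(1)]
    by (intro vnorm_cong) (simp add: sum.atMost_Suc_shift t_def[of 0] t_def[of "Suc 0"] del: sum.atMost_Suc)
  also have "\<dots> \<le> (\<Sum>k\<le>d. vnorm V (t (Suc (Suc k))))" by (rule vnorm_sum)
  also have "\<dots> \<le> (\<Sum>k\<le>d. vnorm V v * x * x ^ k)" by (intro sum_mono t)
  also have "\<dots> = vnorm V v * x * (\<Sum>k\<le>d. x ^ k)" by (simp add: sum_distrib_left)
  also have "\<dots> \<le> vnorm V v * x * (1 / (1 - x))"
    using x by (intro mult_left_mono sum_power_le) auto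
  finally show ?thesis by (simp add: x_def)
qed

text \<open>The term for \<open>k = 0\<close> is \<open>w\<close> itself; the others are dominated
  by the series of \<open>(k + 1) * x ^ k\<close> without its first term, hence the
  \<open>- 1\<close>.\<close>

lemma vnorm_remainder_1:
  assumes "v \<in> cspace V" "w \<in> cspace V" "\<gamma> * vnorm V v < 1"
  shows "vnorm V (\<lambda>a. dir_deriv w (G a) (\<lambda>b. p0 b + v b) - w a)
    \<le> (1 / (1 - \<gamma> * vnorm V v)\<^sup>2 - 1) * vnorm V w"
proof -
  define x where "x = \<gamma> * vnorm V v"
  have x: "0 \<le> x" "x < 1" using assms \<gamma>_nonneg by (auto simp: x_def)
  define t where "t k a = foldr dir_deriv (replicate k v @ [w]) (G a) p0 / fact k" for k a
  have t: "vnorm V (t (Suc k)) \<le> vnorm V w * (real (Suc (Suc k)) * x ^ Suc k)" for k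
  proof -
    have "vnorm V (t (Suc k)) = vnorm V (\<lambda>a. foldr dir_deriv (replicate (Suc k) v @ [w]) (G a) p0) / fact (Suc k)"
      by (simp only: t_def[abs_def] vnorm_divide_fact)
    also have "\<dots> \<le> (fact (Suc (Suc k)) * \<gamma> ^ Suc k * (vnorm V v ^ Suc k * vnorm V w)) / fact (Suc k)"
      using higher[of "replicate (Suc k) v @ [w]"] assms(1,2)
      by (intro divide_right_mono) (auto simp: prod_list_replicate simp del: fact_Suc)
    also have "\<dots> = vnorm V w * (real (Suc (Suc k)) * x ^ Suc k)"
      by (simp add: x_def power_mult_distrib mult_ac fact_Suc[of "Suc k"] del: fact_Suc of_nat_Suc)
    finally show ?thesis .
  qed
  have "dir_deriv w (G a) (\<lambda>b. p0 b + v b) = (\<Sum>k\<le>Suc d. t k a)" if "a \<in> V" for a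
    using polyfun_taylor[OF polyfun_mono[OF polyfun_G[OF that]], of "Suc d" "[w]" p0 v]
    by (simp add: t_def)
  then have "vnorm V (\<lambda>a. dir_deriv w (G a) (\<lambda>b. p0 b + v b) - w a) = vnorm V (\<lambda>a. \<Sum>k\<le>d. t (Suc k) a)"
    using deriv_p0[OF assms(2)]
    by (intro vnorm_cong) (simp add: sum.atMost_Suc_shift t_def[of 0] del: sum.atMost_Suc)
  also have "\<dots> \<le> (\<Sum>k\<le>d. vnorm V (t (Suc k)))" by (rule vnorm_sum)
  also have "\<dots> \<le> (\<Sum>k\<le>d. vnorm V w * (real (Suc (Suc k)) * x ^ Suc k))" by (intro sum_mono t)
  also have "\<dots> = vnorm V w * ((\<Sum>k\<le>Suc d. real (Suc k) * x ^ k) - 1)"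
    by (simp add: sum_distrib_left sum.atMost_Suc_shift del: sum.atMost_Suc)
  also have "\<dots> \<le> vnorm V w * (1 / (1 - x)\<^sup>2 - 1)"
    using x by (intro mult_left_mono diff_right_mono sum_Suc_mult_power_le) auto
  finally show ?thesis by (simp add: x_def mult.commute)
qed

lemma vnorm_second_deriv:
  assumes "v \<in> cspace V" "w1 \<in> cspace V" "w2 \<in> cspace V" "\<gamma> * vnorm V v < 1"
  shows "vnorm V (\<lambda>a. dir_deriv w1 (dir_deriv w2 (G a)) (\<lambda>b. p0 b + v b))
    \<le> 2 * \<gamma> / (1 - \<gamma> * vnorm V v) ^ 3 * (vnorm V w1 * vnorm V w2)"
proof -
  define x where "x = \<gamma> * vnorm V v"
  have x: "0 \<le> x" "x < 1" using assms \<gamma>_nonneg by (auto simp: x_def)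
  define t where "t k a = foldr dir_deriv (replicate k v @ [w1, w2]) (G a) p0 / fact k" for k a
  define c where "c = \<gamma> * (vnorm V w1 * vnorm V w2)"
  have c: "0 \<le> c" using \<gamma>_nonneg by (simp add: c_def)
  have t: "vnorm V (t k) \<le> c * (real (Suc (Suc k)) * real (Suc k) * x ^ k)" for k
  proof -
    have "vnorm V (t k) = vnorm V (\<lambda>a. foldr dir_deriv (replicate k v @ [w1, w2]) (G a) p0) / fact k"
      by (simp only: t_def[abs_def] vnorm_divide_fact)
    also have "\<dots> \<le> (fact (Suc (Suc k)) * \<gamma> ^ Suc k * (vnorm V v ^ k * (vnorm V w1 * vnorm V w2))) / fact k"
      using higher[of "replicate k v @ [w1, w2]"] assms(1-3)
      by (intro divide_right_mono) (auto simp: prod_list_replicate simp del: fact_Suc)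
    also have "\<dots> = c * (real (Suc (Suc k)) * real (Suc k) * x ^ k)"
      by (simp add: x_def c_def power_mult_distrib mult_ac fact_Suc[of "Suc k"] fact_Suc[of k] del: fact_Suc of_nat_Suc)
    finally show ?thesis .
  qed
  have "vnorm V (\<lambda>a. dir_deriv w1 (dir_deriv w2 (G a)) (\<lambda>b. p0 b + v b)) = vnorm V (\<lambda>a. \<Sum>k\<le>d. t k a)"
    using polyfun_taylor[OF polyfun_G, of _ "[w1, w2]" p0 v] by (intro vnorm_cong) (simp add: t_def)
  also have "\<dots> \<le> (\<Sum>k\<le>d. vnorm V (t k))" by (rule vnorm_sum)
  also have "\<dots> \<le> (\<Sum>k\<le>d. c * (real (Suc (Suc k)) * real (Suc k) * x ^ k))" by (intro sum_mono t)
  also have "\<dots> = c * (\<Sum>k\<le>d. real (Suc (Suc k)) * real (Suc k) * x ^ k)" by (simp add: sum_distrib_left)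
  also have "\<dots> \<le> c * (2 / (1 - x) ^ 3)"
    using x c by (intro mult_left_mono sum_Suc_Suc_mult_power_le) auto
  finally show ?thesis by (simp add: x_def c_def mult_ac)
qed

lemma vnorm_segment:
  assumes "vnorm V v \<le> \<rho>" "vnorm V w \<le> \<rho>" "0 \<le> t" "t \<le> 1"
  shows "vnorm V (\<lambda>a. w a + complex_of_real t * (v a - w a)) \<le> \<rho>"
proof -
  have "vnorm V (\<lambda>a. w a + complex_of_real t * (v a - w a)) =
      vnorm V (\<lambda>a. complex_of_real (1 - t) * w a + complex_of_real t * v a)"
    by (intro vnorm_cong) (simp add: algebra_simps)
  also have "\<dots> \<le> cmod (complex_of_real (1 - t)) * vnorm V w + cmod (complex_of_real t) * vnorm V v"
    using vnorm_triangle vnorm_scale by metis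
  also have "\<dots> = (1 - t) * vnorm V w + t * vnorm V v"
    using assms by (simp only: norm_of_real)
  also have "\<dots> \<le> \<rho>" using assms by (intro convex_bound_le) auto
  finally show ?thesis .
qed

text \<open>At the extreme value 1/5 one has \<open>1 / (4 / 5)^2 - 1 = 9 / 16\<close> and
  \<open>(4 / 5)^3 = 64 / 125\<close>. The first is the contraction factor, the second enters the
  bound on the second derivative.\<close>

lemma bounds_mono:
  assumes "\<gamma> * \<rho> \<le> 1 / 5" "vnorm V v \<le> \<rho>"
  shows "\<gamma> * vnorm V v < 1" "1 / (1 - \<gamma> * vnorm V v)\<^sup>2 - 1 \<le> 9 / 16"
    "2 * \<gamma> / (1 - \<gamma> * vnorm V v) ^ 3 \<le> 2 * \<gamma> / (64 / 125)"
proof -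
  have "\<gamma> * vnorm V v \<le> \<gamma> * \<rho>" using assms \<gamma>_nonneg by (intro mult_left_mono)
  then have x: "\<gamma> * vnorm V v \<le> 1 / 5" using assms by simp
  then show "\<gamma> * vnorm V v < 1" by simp
  have "(4 / 5)\<^sup>2 \<le> (1 - \<gamma> * vnorm V v)\<^sup>2" using x by (intro power_mono) auto
  then have "1 / (1 - \<gamma> * vnorm V v)\<^sup>2 \<le> 1 / (4 / 5)\<^sup>2"
    using x by (intro divide_left_mono mult_pos_pos) auto
  then show "1 / (1 - \<gamma> * vnorm V v)\<^sup>2 - 1 \<le> 9 / 16" by (simp add: power2_eq_square)
  have "(4 / 5) ^ 3 \<le> (1 - \<gamma> * vnorm V v) ^ 3" using x by (intro power_mono) auto
  then show "2 * \<gamma> / (1 - \<gamma> * vnorm V v) ^ 3 \<le> 2 * \<gamma> / (64 / 125)"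
    using \<gamma>_nonneg x by (intro divide_left_mono) (auto simp: power3_eq_cube)
qed

text \<open>The derivative of the deviation is the identity minus the derivative of
  \<open>G\<close>, of norm at most 9/16 on the ball; the mean value estimate is applied along the
  segment from \<open>w\<close> to \<open>v\<close>.\<close>

lemma deviation_contraction:
  assumes \<rho>: "\<gamma> * \<rho> \<le> 1 / 5" and v: "v \<in> cspace V" "vnorm V v \<le> \<rho>"
    and w: "w \<in> cspace V" "vnorm V w \<le> \<rho>"
  shows "vnorm V (\<lambda>a. (v a - G a (\<lambda>b. p0 b + v b)) - (w a - G a (\<lambda>b. p0 b + w b)))
    \<le> 9 / 16 * vnorm V (\<lambda>a. v a - w a)"
proof -
  define h where "h = (\<lambda>a. v a - w a)"
  have h: "h \<in> cspace V" using v w by (auto simp: h_def)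
  define q where "q t = (\<lambda>a. w a + complex_of_real t * h a)" for t
  have q: "q t \<in> cspace V" "vnorm V (q t) \<le> \<rho>" if "0 \<le> t" "t \<le> 1" for t
    using vnorm_segment[of v \<rho> w t] that v w h by (auto simp: q_def h_def)
  have "vnorm V (\<lambda>a. (q 1 a - G a (\<lambda>b. p0 b + q 1 b)) - (q 0 a - G a (\<lambda>b. p0 b + q 0 b)))
      \<le> 9 / 16 * vnorm V h"
  proof (rule vnorm_mean_value[where g = "\<lambda>t a. q t a - G a (\<lambda>b. p0 b + q t b)"
        and g' = "\<lambda>t a. h a - dir_deriv h (G a) (\<lambda>b. p0 b + q t b)"])
    fix t :: real assume t: "0 \<le> t" "t \<le> 1"
    show "((\<lambda>t. q t a - G a (\<lambda>b. p0 b + q t b)) has_vector_derivative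
        h a - dir_deriv h (G a) (\<lambda>b. p0 b + q t b)) (at t)" if "a \<in> V" for a
    proof (rule has_vector_derivative_diff)
      show "((\<lambda>t. q t a) has_vector_derivative h a) (at t)"
        unfolding q_def
        by (auto intro!: derivative_eq_intros simp: has_vector_derivative_def scaleR_conv_of_real)
      show "((\<lambda>t. G a (\<lambda>b. p0 b + q t b)) has_vector_derivative
          dir_deriv h (G a) (\<lambda>b. p0 b + q t b)) (at t)"
        using has_vector_derivative_line[OF polyfun_G[OF that], of "\<lambda>b. p0 b + w b" h t]
        by (simp add: q_def add.assoc)
    qed
    have "vnorm V (\<lambda>a. h a - dir_deriv h (G a) (\<lambda>b. p0 b + q t b))
        \<le> (1 / (1 - \<gamma> * vnorm V (q t))\<^sup>2 - 1) * vnorm V h"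
      using vnorm_remainder_1[OF q(1)[OF t] h bounds_mono(1)[OF \<rho> q(2)[OF t]]]
      by (simp add: vnorm_minus_commute)
    also have "\<dots> \<le> 9 / 16 * vnorm V h"
      by (intro mult_right_mono bounds_mono(2)[OF \<rho> q(2)[OF t]]) simp
    finally show "vnorm V (\<lambda>a. h a - dir_deriv h (G a) (\<lambda>b. p0 b + q t b)) \<le> 9 / 16 * vnorm V h" .
  qed
  then show ?thesis by (simp add: q_def h_def)
qed

text \<open>Two mean value estimates replace the integral form of Taylor's formula: the outer one
  follows the segment from \<open>v\<close> to \<open>w\<close> with the linear part subtracted, the
  inner one bounds the resulting difference of first derivatives by the second derivative. The
  factor 1/2 of Taylor's formula is given away.\<close>

lemma quadratic_remainder:
  assumes \<rho>: "\<gamma> * \<rho> \<le> 1 / 5" and v: "v \<in> cspace V" "vnorm V v \<le> \<rho>"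
    and w: "w \<in> cspace V" "vnorm V w \<le> \<rho>"
  shows "vnorm V (\<lambda>a. G a (\<lambda>b. p0 b + w b) - G a (\<lambda>b. p0 b + v b)
      - dir_deriv (\<lambda>b. w b - v b) (G a) (\<lambda>b. p0 b + v b))
    \<le> 2 * \<gamma> / (64 / 125) * (vnorm V (\<lambda>a. w a - v a))\<^sup>2"
proof -
  define h where "h = (\<lambda>a. w a - v a)"
  have h: "h \<in> cspace V" using v w by (auto simp: h_def)
  define q where "q t = (\<lambda>a. v a + complex_of_real t * h a)" for t
  have q: "q t \<in> cspace V" "vnorm V (q t) \<le> \<rho>" if "0 \<le> t" "t \<le> 1" for t
    using vnorm_segment[of w \<rho> v t] that v w h by (auto simp: q_def h_def)
  define K where "K = 2 * \<gamma> / (64 / 125)"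
  have inner: "vnorm V (\<lambda>a. dir_deriv h (G a) (\<lambda>b. p0 b + q t b) - dir_deriv h (G a) (\<lambda>b. p0 b + v b))
      \<le> K * (vnorm V h)\<^sup>2" if t: "0 \<le> t" "t \<le> 1" for t
  proof -
    define k where "k = (\<lambda>a. complex_of_real t * h a)"
    have k: "k \<in> cspace V" using h by (auto simp: k_def)
    define q' where "q' s = (\<lambda>a. v a + complex_of_real s * k a)" for s
    have q': "q' s \<in> cspace V" "vnorm V (q' s) \<le> \<rho>" if "0 \<le> s" "s \<le> 1" for s
    proof -
      \<comment> \<open>The inner segment is an initial piece of the outer one, so it stays in the
        same ball.\<close>
      have "q' s = q (s * t)" by (simp add: q'_def q_def k_def mult.assoc)
      moreover have "0 \<le> s * t" "s * t \<le> 1" using that t by (auto simp: mult_le_one)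
      ultimately show "q' s \<in> cspace V" "vnorm V (q' s) \<le> \<rho>" using q by auto
    qed
    have "vnorm V (\<lambda>a. dir_deriv h (G a) (\<lambda>b. p0 b + q' 1 b) - dir_deriv h (G a) (\<lambda>b. p0 b + q' 0 b))
        \<le> K * (vnorm V h)\<^sup>2"
    proof (rule vnorm_mean_value[where g = "\<lambda>s a. dir_deriv h (G a) (\<lambda>b. p0 b + q' s b)"
          and g' = "\<lambda>s a. dir_deriv k (dir_deriv h (G a)) (\<lambda>b. p0 b + q' s b)"])
      fix s :: real assume s: "0 \<le> s" "s \<le> 1"
      show "((\<lambda>s. dir_deriv h (G a) (\<lambda>b. p0 b + q' s b)) has_vector_derivative
          dir_deriv k (dir_deriv h (G a)) (\<lambda>b. p0 b + q' s b)) (at s)" if "a \<in> V" for a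
        using has_vector_derivative_line[OF polyfun_dir_deriv[OF polyfun_G[OF that]], of h "\<lambda>b. p0 b + v b" k s]
        by (simp add: q'_def add.assoc)
      have "vnorm V (\<lambda>a. dir_deriv k (dir_deriv h (G a)) (\<lambda>b. p0 b + q' s b))
          \<le> 2 * \<gamma> / (1 - \<gamma> * vnorm V (q' s)) ^ 3 * (vnorm V k * vnorm V h)"
        by (rule vnorm_second_deriv[OF q'(1)[OF s] k h bounds_mono(1)[OF \<rho> q'(2)[OF s]]])
      also have "\<dots> \<le> K * (vnorm V k * vnorm V h)"
        unfolding K_def by (intro mult_right_mono bounds_mono(3)[OF \<rho> q'(2)[OF s]]) simp
      also have "\<dots> \<le> K * (vnorm V h * vnorm V h)"
      proof -
        have "vnorm V k \<le> vnorm V h"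
          using t by (simp add: k_def vnorm_scale mult_left_le_one_le)
        then show ?thesis using \<gamma>_nonneg by (intro mult_left_mono mult_right_mono) (auto simp: K_def)
      qed
      finally show "vnorm V (\<lambda>a. dir_deriv k (dir_deriv h (G a)) (\<lambda>b. p0 b + q' s b)) \<le> K * (vnorm V h)\<^sup>2"
        by (simp add: power2_eq_square)
    qed
    then show ?thesis by (simp add: q'_def q_def k_def)
  qed
  define D where "D a = dir_deriv h (G a) (\<lambda>b. p0 b + v b)" for a
  have "vnorm V (\<lambda>a. (G a (\<lambda>b. p0 b + q 1 b) - complex_of_real 1 * D a)
      - (G a (\<lambda>b. p0 b + q 0 b) - complex_of_real 0 * D a)) \<le> K * (vnorm V h)\<^sup>2"
  proof (rule vnorm_mean_value[where g = "\<lambda>t a. G a (\<lambda>b. p0 b + q t b) - complex_of_real t * D a"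
        and g' = "\<lambda>t a. dir_deriv h (G a) (\<lambda>b. p0 b + q t b) - D a"])
    fix t :: real assume t: "0 \<le> t" "t \<le> 1"
    show "((\<lambda>t. G a (\<lambda>b. p0 b + q t b) - complex_of_real t * D a) has_vector_derivative
        dir_deriv h (G a) (\<lambda>b. p0 b + q t b) - D a) (at t)" if "a \<in> V" for a
    proof (rule has_vector_derivative_diff)
      show "((\<lambda>t. complex_of_real t * D a) has_vector_derivative D a) (at t)"
        by (auto intro!: derivative_eq_intros simp: has_vector_derivative_def scaleR_conv_of_real)
      show "((\<lambda>t. G a (\<lambda>b. p0 b + q t b)) has_vector_derivative
          dir_deriv h (G a) (\<lambda>b. p0 b + q t b)) (at t)"
        using has_vector_derivative_line[OF polyfun_G[OF that], of "\<lambda>b. p0 b + v b" h t]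
        by (simp add: q_def add.assoc)
    qed
    show "vnorm V (\<lambda>a. dir_deriv h (G a) (\<lambda>b. p0 b + q t b) - D a) \<le> K * (vnorm V h)\<^sup>2"
      unfolding D_def by (rule inner[OF t])
  qed
  then show ?thesis
    by (simp add: q_def h_def K_def D_def algebra_simps)
qed

lemma deriv_lower_bound:
  assumes \<rho>: "\<gamma> * \<rho> \<le> 1 / 5" and v: "v \<in> cspace V" "vnorm V v \<le> \<rho>" and w: "w \<in> cspace V"
  shows "7 / 16 * vnorm V w \<le> vnorm V (\<lambda>a. dir_deriv w (G a) (\<lambda>b. p0 b + v b))"
proof -
  let ?D = "\<lambda>a. dir_deriv w (G a) (\<lambda>b. p0 b + v b)"
  have "vnorm V (\<lambda>a. ?D a - w a) \<le> (1 / (1 - \<gamma> * vnorm V v)\<^sup>2 - 1) * vnorm V w"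
    by (rule vnorm_remainder_1[OF v(1) w bounds_mono(1)[OF \<rho> v(2)]])
  also have "\<dots> \<le> 9 / 16 * vnorm V w"
    by (intro mult_right_mono bounds_mono(2)[OF \<rho> v(2)]) simp
  finally have "vnorm V (\<lambda>a. w a - ?D a) \<le> 9 / 16 * vnorm V w" by (simp add: vnorm_minus_commute)
  moreover have "vnorm V w \<le> vnorm V (\<lambda>a. w a - ?D a) + vnorm V ?D"
    using vnorm_triangle[of V "\<lambda>a. w a - ?D a" ?D] by simp
  ultimately show ?thesis by simp
qed

text \<open>Injectivity comes from \<open>deriv_lower_bound\<close>. For surjectivity,
  \<open>D w = y\<close> is read as the fixed point equation \<open>w = w - D w + y\<close> of a
  contraction; it preserves the ball of radius 16/7 times the norm of \<open>y\<close>, because 9/16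
  * 16/7 + 1 = 16/7.\<close>

lemma deriv_bij:
  assumes \<rho>: "\<gamma> * \<rho> \<le> 1 / 5" and v: "v \<in> cspace V" "vnorm V v \<le> \<rho>"
  shows "bij_betw (\<lambda>w a. if a \<in> V then dir_deriv w (G a) (\<lambda>b. p0 b + v b) else 0) (cspace V) (cspace V)"
proof -
  define D where "D w = (\<lambda>a. if a \<in> V then dir_deriv w (G a) (\<lambda>b. p0 b + v b) else 0)" for w
  have D_diff: "D (\<lambda>a. u a - w a) = (\<lambda>a. D u a - D w a)" for u w
    by (auto simp: D_def dir_deriv_diff_arg[OF polyfun_G])
  have D_in: "D w \<in> cspace V" for w by (auto simp: D_def cspace_def)
  have vnorm_D: "vnorm V (D w) = vnorm V (\<lambda>a. dir_deriv w (G a) (\<lambda>b. p0 b + v b))" for w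
    by (rule vnorm_cong) (simp add: D_def)
  have "inj_on D (cspace V)"
  proof (rule inj_onI)
    fix u w assume uw: "u \<in> cspace V" "w \<in> cspace V" "D u = D w"
    then have "7 / 16 * vnorm V (\<lambda>a. u a - w a) \<le> vnorm V (D (\<lambda>a. u a - w a))"
      unfolding vnorm_D by (intro deriv_lower_bound[OF \<rho> v]) auto
    also have "\<dots> = 0" using uw(3) by (simp add: D_diff)
    finally have "vnorm V (\<lambda>a. u a - w a) = 0" using vnorm_nonneg[of V "\<lambda>a. u a - w a"] by linarith
    then have "(\<lambda>a. u a - w a) = (\<lambda>a. 0)"
      using cspace_zero_iff[OF cspace_diff finite_V] uw by blast
    then show "u = w" by (auto simp: fun_eq_iff)
  qed
  moreover have "\<exists>w. w \<in> cspace V \<and> D w = y" if y: "y \<in> cspace V" for y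
  proof -
    define T where "T w = (\<lambda>a. w a - D w a + y a)" for w
    have rem: "vnorm V (\<lambda>a. w a - D w a) \<le> 9 / 16 * vnorm V w" if "w \<in> cspace V" for w
    proof -
      have "vnorm V (\<lambda>a. w a - D w a) = vnorm V (\<lambda>a. dir_deriv w (G a) (\<lambda>b. p0 b + v b) - w a)"
        by (subst vnorm_minus_commute) (rule vnorm_cong, simp add: D_def)
      also have "\<dots> \<le> (1 / (1 - \<gamma> * vnorm V v)\<^sup>2 - 1) * vnorm V w"
        by (rule vnorm_remainder_1[OF v(1) that bounds_mono(1)[OF \<rho> v(2)]])
      also have "\<dots> \<le> 9 / 16 * vnorm V w"
        by (intro mult_right_mono bounds_mono(2)[OF \<rho> v(2)]) simp
      finally show ?thesis .
    qed
    have "\<exists>w. w \<in> cspace V \<and> vnorm V w \<le> 16 / 7 * vnorm V y \<and> T w = w"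
    proof (rule vnorm_contraction_fixpoint[OF finite_V, of "9 / 16"])
      fix w assume w: "w \<in> cspace V" "vnorm V w \<le> 16 / 7 * vnorm V y"
      have "vnorm V (T w) \<le> vnorm V (\<lambda>a. w a - D w a) + vnorm V y"
        unfolding T_def by (rule vnorm_triangle)
      then show "T w \<in> cspace V \<and> vnorm V (T w) \<le> 16 / 7 * vnorm V y"
        using rem[OF w(1)] w y D_in[of w] by (auto simp: T_def)
    next
      fix u w assume uw: "u \<in> cspace V" "w \<in> cspace V"
      have "(\<lambda>a. T u a - T w a) = (\<lambda>a. (u a - w a) - D (\<lambda>a. u a - w a) a)"
        by (simp add: T_def D_diff fun_eq_iff)
      then show "vnorm V (\<lambda>a. T u a - T w a) \<le> 9 / 16 * vnorm V (\<lambda>a. u a - w a)"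
        using rem[OF cspace_diff[OF uw]] by simp
    qed auto
    then obtain w where "w \<in> cspace V" "T w = w" by blast
    then show ?thesis by (intro exI[of _ w]) (auto simp: T_def fun_eq_iff)
  qed
  then have "D ` cspace V = cspace V" using D_in by auto
  ultimately show ?thesis unfolding bij_betw_def D_def[abs_def] by blast
qed

text \<open>2/15 times 3/2 is 1/5, and 2/15 times 5/4 is 1/6: the iterates will stay within 3/2 *
  \<beta>, the root within 5/4 * \<beta>.\<close>

lemma radius: "\<gamma> * (3 / 2 * \<beta>) \<le> 1 / 5" "\<gamma> * (5 / 4 * \<beta>) \<le> 1 / 6" "0 \<le> \<beta>"
  using \<alpha> by (auto simp: \<beta> mult.commute)

text \<open>For \<open>x \<le> 1 / 6\<close> the factor \<open>x / (1 - x)\<close> is at most 1/5,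
  and 5/4 * 1/5 = 1/4. The quarter serves twice: it keeps the ball of radius 5/4 * \<beta>
  invariant, and it places the first Newton iterate within \<beta> / 4 of the root.\<close>

lemma remainder_quarter:
  assumes "v \<in> cspace V" "vnorm V v \<le> 5 / 4 * \<beta>"
  shows "vnorm V (\<lambda>a. G a (\<lambda>b. p0 b + v b) - G a p0 - v a) \<le> \<beta> / 4"
proof -
  define x where "x = \<gamma> * vnorm V v"
  have "x \<le> \<gamma> * (5 / 4 * \<beta>)" unfolding x_def using assms \<gamma>_nonneg by (intro mult_left_mono)
  then have x: "x \<le> 1 / 6" using radius(2) by linarith
  then have "x / (1 - x) \<le> 1 / 5" by (simp add: field_simps)
  moreover have "0 \<le> x / (1 - x)" using x \<gamma>_nonneg by (intro divide_nonneg_pos) (auto simp: x_def)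
  ultimately have "vnorm V v * (x / (1 - x)) \<le> 5 / 4 * \<beta> * (1 / 5)"
    using assms(2) radius(3) by (intro mult_mono) auto
  also have "\<dots> = \<beta> / 4" by simp
  finally show ?thesis
    unfolding x_def using x by (intro order_trans[OF vnorm_remainder_0] assms) (simp_all add: x_def)
qed

text \<open>The contraction \<open>T\<close> is the simplified Newton iteration, with the derivative
  frozen at \<open>p0\<close>. It yields the root before the true Newton sequence is
  studied.\<close>

lemma root_exists: "\<exists>v. v \<in> cspace V \<and> vnorm V v \<le> 5 / 4 * \<beta> \<and> (\<forall>a\<in>V. G a (\<lambda>b. p0 b + v b) = 0)"
proof -
  define T where "T v = (\<lambda>a. if a \<in> V then v a - G a (\<lambda>b. p0 b + v b) else 0)" for v
  have \<rho>: "\<gamma> * (5 / 4 * \<beta>) \<le> 1 / 5" using radius(2) by linarith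
  have "\<exists>v. v \<in> cspace V \<and> vnorm V v \<le> 5 / 4 * \<beta> \<and> T v = v"
  proof (rule vnorm_contraction_fixpoint[OF finite_V, of "9 / 16"])
    fix v assume v: "v \<in> cspace V" "vnorm V v \<le> 5 / 4 * \<beta>"
    have "vnorm V (T v) = vnorm V (\<lambda>a. (-1) * ((G a (\<lambda>b. p0 b + v b) - G a p0 - v a) + G a p0))"
      by (rule vnorm_cong) (simp add: T_def)
    also have "\<dots> \<le> vnorm V (\<lambda>a. G a (\<lambda>b. p0 b + v b) - G a p0 - v a) + vnorm V (\<lambda>a. G a p0)"
      unfolding vnorm_scale norm_minus_cancel norm_one mult_1_left by (rule vnorm_triangle)
    also have "\<dots> \<le> 5 / 4 * \<beta>" using remainder_quarter[OF v] by (simp add: \<beta>)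
    finally show "T v \<in> cspace V \<and> vnorm V (T v) \<le> 5 / 4 * \<beta>"
      by (auto simp: T_def cspace_def)
  next
    fix v w assume vw: "v \<in> cspace V" "w \<in> cspace V" "vnorm V v \<le> 5 / 4 * \<beta>" "vnorm V w \<le> 5 / 4 * \<beta>"
    have "vnorm V (\<lambda>a. T v a - T w a) =
        vnorm V (\<lambda>a. (v a - G a (\<lambda>b. p0 b + v b)) - (w a - G a (\<lambda>b. p0 b + w b)))"
      by (rule vnorm_cong) (simp add: T_def)
    then show "vnorm V (\<lambda>a. T v a - T w a) \<le> 9 / 16 * vnorm V (\<lambda>a. v a - w a)"
      using deviation_contraction[OF \<rho> vw(1,3) vw(2,4)] by simp
  qed (use radius in auto)
  then obtain v where v: "v \<in> cspace V" "vnorm V v \<le> 5 / 4 * \<beta>" "T v = v" by blast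
  have "G a (\<lambda>b. p0 b + v b) = 0" if "a \<in> V" for a
    using fun_cong[OF v(3), of a] that by (simp add: T_def)
  then show ?thesis using v by blast
qed

text \<open>The derivative at \<open>v\<close>, applied to the new error
  \<open>e = v - u - z\<close>, gives exactly the quadratic Taylor remainder between
  \<open>v\<close> and the root \<open>z\<close>. Inverting the derivative costs 16/7, and 16/7 * 2
  * 125/64 is below 9.\<close>

lemma newton_error:
  assumes v: "v \<in> cspace V" "vnorm V v \<le> 3 / 2 * \<beta>"
    and z: "z \<in> cspace V" "vnorm V z \<le> 5 / 4 * \<beta>" "\<And>a. a \<in> V \<Longrightarrow> G a (\<lambda>b. p0 b + z b) = 0"
    and u: "u \<in> cspace V" "\<And>a. a \<in> V \<Longrightarrow> dir_deriv u (G a) (\<lambda>b. p0 b + v b) = G a (\<lambda>b. p0 b + v b)"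
  shows "vnorm V (\<lambda>a. v a - u a - z a) \<le> 9 * \<gamma> * (vnorm V (\<lambda>a. v a - z a))\<^sup>2"
proof -
  have z': "vnorm V z \<le> 3 / 2 * \<beta>" using z(2) radius(3) by linarith
  define e where "e = (\<lambda>a. v a - u a - z a)"
  have e: "e \<in> cspace V" unfolding e_def using u v z by auto
  have De: "dir_deriv e (G a) (\<lambda>b. p0 b + v b) =
      G a (\<lambda>b. p0 b + z b) - G a (\<lambda>b. p0 b + v b) - dir_deriv (\<lambda>b. z b - v b) (G a) (\<lambda>b. p0 b + v b)"
    if "a \<in> V" for a
    using u(2)[OF that] z(3)[OF that]
    by (simp add: e_def dir_deriv_diff_arg[OF polyfun_G[OF that]])
  have "7 / 16 * vnorm V e \<le> vnorm V (\<lambda>a. dir_deriv e (G a) (\<lambda>b. p0 b + v b))"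
    by (rule deriv_lower_bound[OF radius(1) v e])
  also have "\<dots> = vnorm V (\<lambda>a. G a (\<lambda>b. p0 b + z b) - G a (\<lambda>b. p0 b + v b)
      - dir_deriv (\<lambda>b. z b - v b) (G a) (\<lambda>b. p0 b + v b))"
    by (rule vnorm_cong) (rule De)
  also have "\<dots> \<le> 2 * \<gamma> / (64 / 125) * (vnorm V (\<lambda>a. z a - v a))\<^sup>2"
    by (rule quadratic_remainder[OF radius(1) v z(1) z'])
  also have "vnorm V (\<lambda>a. z a - v a) = vnorm V (\<lambda>a. v a - z a)" by (rule vnorm_minus_commute)
  finally have "vnorm V e \<le> 16 / 7 * (2 * \<gamma> / (64 / 125)) * (vnorm V (\<lambda>a. v a - z a))\<^sup>2" by simp
  also have "\<dots> \<le> 9 * \<gamma> * (vnorm V (\<lambda>a. v a - z a))\<^sup>2"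
    using \<gamma>_nonneg by (intro mult_right_mono) auto
  finally show ?thesis by (simp add: e_def)
qed

end

text \<open>\<open>step\<close> is assumed only inside the ball, since only there is the Newton
  direction known to exist; so membership has to be carried along in the induction. The initial
  error may be as large as 5/4 * \<beta>, so the halving starts after the first step.\<close>

lemma (in normalised_system) newton_iteration:
  assumes x0: "x 0 = (\<lambda>a. 0)"
    and step: "\<And>m. x m \<in> cspace V \<Longrightarrow> vnorm V (x m) \<le> 3 / 2 * \<beta> \<Longrightarrow>
      u m \<in> cspace V \<and> (\<forall>a\<in>V. dir_deriv (u m) (G a) (\<lambda>b. p0 b + x m b) = G a (\<lambda>b. p0 b + x m b)) \<and>
      x (Suc m) = (\<lambda>a. x m a - u m a)"
  shows "\<exists>z. z \<in> cspace V \<and> vnorm V z \<le> 5 / 4 * \<beta> \<and> (\<forall>a\<in>V. G a (\<lambda>b. p0 b + z b) = 0) \<and>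
    (\<forall>m. x m \<in> cspace V \<and> vnorm V (x m) \<le> 3 / 2 * \<beta>) \<and>
    (\<lambda>m. vnorm V (\<lambda>a. x m a - z a)) \<longlonglongrightarrow> 0 \<and>
    (\<forall>m. vnorm V (\<lambda>a. x (Suc m) a - z a) \<le> 9 * \<gamma> * (vnorm V (\<lambda>a. x m a - z a))\<^sup>2)"
proof -
  obtain z where z: "z \<in> cspace V" "vnorm V z \<le> 5 / 4 * \<beta>" "\<And>a. a \<in> V \<Longrightarrow> G a (\<lambda>b. p0 b + z b) = 0"
    using root_exists by blast
  define e where "e m = vnorm V (\<lambda>a. x m a - z a)" for m
  have quad: "e (Suc m) \<le> 9 * \<gamma> * (e m)\<^sup>2" if "x m \<in> cspace V" "vnorm V (x m) \<le> 3 / 2 * \<beta>" for m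
    using step[OF that] newton_error[OF that z, of "u m"] by (simp add: e_def)
  have near: "vnorm V (x m) \<le> 3 / 2 * \<beta>" if "e m \<le> \<beta> / 4" for m
    using that z(2) vnorm_triangle[of V "\<lambda>a. x m a - z a" z] by (simp add: e_def)
  have xin: "x (Suc m) \<in> cspace V" if "x m \<in> cspace V" "vnorm V (x m) \<le> 3 / 2 * \<beta>" for m
    using step[OF that] that by auto
  have start: "x 0 \<in> cspace V" "vnorm V (x 0) \<le> 3 / 2 * \<beta>" using radius(3) by (auto simp: x0)
  have "e 1 \<le> \<beta> / 4"
  proof -
    have "u 0 a = G a p0" if "a \<in> V" for a
      using step[OF start] deriv_p0[of "u 0" a] that by (simp add: x0)
    then have "e 1 = vnorm V (\<lambda>a. G a (\<lambda>b. p0 b + z b) - G a p0 - z a)"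
      unfolding e_def using step[OF start] z(3) by (intro vnorm_cong) (simp add: x0)
    then show ?thesis using remainder_quarter[OF z(1,2)] by simp
  qed
  \<comment> \<open>With error at most \<beta> / 4 the quadratic bound has the factor 9/4 * \<beta>
    * \<gamma>, at most 3/10 and hence below 1/2.\<close>
  have half: "e (Suc m) \<le> e m / 2" if "x m \<in> cspace V" "e m \<le> \<beta> / 4" for m
  proof -
    have "e (Suc m) \<le> 9 * \<gamma> * e m * e m"
      using quad[OF that(1) near[OF that(2)]] by (simp add: power2_eq_square mult.assoc)
    also have "\<dots> \<le> 9 * \<gamma> * (\<beta> / 4) * e m"
      using that(2) \<gamma>_nonneg by (intro mult_right_mono mult_left_mono) (auto simp: e_def)
    also have "\<dots> \<le> 1 / 2 * e m"
      using \<alpha> by (intro mult_right_mono) (auto simp: e_def mult.commute)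
    finally show ?thesis by simp
  qed
  have inv: "x (Suc m) \<in> cspace V \<and> e (Suc m) \<le> \<beta> / 4 \<and> e (Suc m) \<le> (1 / 2) ^ m * \<beta>" for m
  proof (induction m)
    case 0
    then show ?case using xin[OF start] \<open>e 1 \<le> \<beta> / 4\<close> radius(3) by simp
  next
    case (Suc m)
    then have "e (Suc (Suc m)) \<le> e (Suc m) / 2" by (intro half) auto
    then show ?case using Suc xin[of "Suc m"] near radius(3) by auto
  qed
  have all: "x m \<in> cspace V \<and> vnorm V (x m) \<le> 3 / 2 * \<beta>" for m
    by (cases m) (use start inv near in auto)
  have "(\<lambda>m. e (Suc m)) \<longlonglongrightarrow> 0"
  proof (rule tendsto_sandwich[OF _ _ tendsto_const])
    have "(\<lambda>m. (1 / 2) ^ m * \<beta>) \<longlonglongrightarrow> 0 * \<beta>"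
      by (intro tendsto_intros LIMSEQ_power_zero) simp
    then show "(\<lambda>m. (1 / 2) ^ m * \<beta>) \<longlonglongrightarrow> 0" by simp
  qed (use inv in \<open>auto simp: e_def\<close>)
  then have "e \<longlonglongrightarrow> 0" by (rule LIMSEQ_imp_Suc)
  then show ?thesis
    using z all quad unfolding e_def by blast
qed

section \<open>Reduction of a square system to a normalised one\<close>

context
  fixes V :: "'u set" and E :: "'e set" and F :: "'e \<Rightarrow> ('u \<Rightarrow> complex) \<Rightarrow> complex" and p0 :: "'u \<Rightarrow> complex"
    and d :: nat
  assumes fin: "finite V" "finite E"
    and pf: "\<And>e. e \<in> E \<Longrightarrow> polyfun d (F e)"
    and inv: "jac_invertible V E F p0"
begin

lemma sys_deriv_in_cspace: "sys_deriv E F p vs \<in> cspace E"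
  by (simp add: sys_deriv_def cspace_def)

lemma sys_deriv_sum_arg:
  "sys_deriv E F p [\<lambda>a. \<Sum>i\<in>I. c i * v i a] = (\<lambda>e. \<Sum>i\<in>I. c i * sys_deriv E F p [v i] e)"
  by (auto simp: sys_deriv_def fun_eq_iff dir_deriv_sum_arg[OF pf])

text \<open>The columns of the inverse Jacobian at \<open>p0\<close>. \<open>jac_inv\<close> is
  merely the set-theoretic inverse of a bijection; its linearity is recovered from these
  columns.\<close>

definition inv_col :: "'e \<Rightarrow> 'u \<Rightarrow> complex"
  where "inv_col e = jac_inv V E F p0 (\<lambda>e'. if e' = e then 1 else 0)"

lemma jac_inv_sys_deriv: "v \<in> cspace V \<Longrightarrow> jac_inv V E F p0 (sys_deriv E F p0 [v]) = v"
  using inv the_inv_into_f_f[of "\<lambda>v. sys_deriv E F p0 [v]" "cspace V" v]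
  unfolding jac_invertible_def jac_inv_def bij_betw_def by blast

lemma sys_deriv_jac_inv: "w \<in> cspace E \<Longrightarrow> sys_deriv E F p0 [jac_inv V E F p0 w] = w"
  using inv f_the_inv_into_f_bij_betw unfolding jac_invertible_def jac_inv_def by fast

lemma jac_inv_in_cspace: "w \<in> cspace E \<Longrightarrow> jac_inv V E F p0 w \<in> cspace V"
  using bij_betwE[OF bij_betw_the_inv_into[OF inv[unfolded jac_invertible_def]]]
  unfolding jac_inv_def by blast

lemma jac_inv_eq_sum:
  assumes w: "w \<in> cspace E"
  shows "jac_inv V E F p0 w = (\<lambda>a. \<Sum>e\<in>E. w e * inv_col e a)"
proof -
  have e: "(\<lambda>e'. if e' = e then 1 else 0) \<in> cspace E" if "e \<in> E" for e
    using that by (auto simp: cspace_def)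
  have "(\<lambda>a. \<Sum>e\<in>E. w e * inv_col e a) \<in> cspace V"
    using jac_inv_in_cspace[OF e] by (auto simp: cspace_def inv_col_def intro!: sum.neutral)
  moreover have "sys_deriv E F p0 [\<lambda>a. \<Sum>e\<in>E. w e * inv_col e a] = w"
  proof
    fix e'
    have "sys_deriv E F p0 [\<lambda>a. \<Sum>e\<in>E. w e * inv_col e a] e' =
        (\<Sum>e\<in>E. w e * sys_deriv E F p0 [inv_col e] e')"
      by (simp add: sys_deriv_sum_arg)
    also have "\<dots> = (\<Sum>e\<in>E. w e * (if e' = e then 1 else 0))"
      using sys_deriv_jac_inv[OF e] by (intro sum.cong) (auto simp: inv_col_def)
    also have "\<dots> = (\<Sum>e\<in>E. if e' = e then w e else 0)" by (intro sum.cong) auto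
    also have "\<dots> = w e'" using w fin by (auto simp: cspace_def)
    finally show "sys_deriv E F p0 [\<lambda>a. \<Sum>e\<in>E. w e * inv_col e a] e' = w e'" .
  qed
  ultimately show ?thesis using jac_inv_sys_deriv by metis
qed

text \<open>\<open>F\<close> followed by the inverse Jacobian at the fixed point \<open>p0\<close>.
  Zeros and Newton steps remain the same, while the derivative at \<open>p0\<close> becomes the
  identity.\<close>

definition normalised :: "'u \<Rightarrow> ('u \<Rightarrow> complex) \<Rightarrow> complex"
  where "normalised a p = (\<Sum>e\<in>E. inv_col e a * F e p)"

lemma polyfun_normalised: "polyfun d (normalised a)"
  unfolding normalised_def[abs_def] by (intro polyfun_sum polyfun_cmult pf)

lemma foldr_dir_deriv_normalised:
  "foldr dir_deriv vs (normalised a) p = jac_inv V E F p0 (sys_deriv E F p vs) a"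
proof -
  have "foldr dir_deriv vs (\<lambda>p. \<Sum>e\<in>E. inv_col e a * F e p) =
      (\<lambda>p. \<Sum>e\<in>E. inv_col e a * foldr dir_deriv vs (F e) p)"
    by (rule foldr_dir_deriv_lincomb) (rule pf)
  then show ?thesis
    unfolding normalised_def[abs_def] jac_inv_eq_sum[OF sys_deriv_in_cspace]
    by (auto simp: sys_deriv_def intro!: sum.cong)
qed

text \<open>The supremum over \<open>k\<close> is finite because derivatives of order above
  \<open>d\<close> vanish; the bound on unit vectors then extends to all vectors by
  homogeneity.\<close>

lemma gamma_tilde_nonneg: "0 \<le> gamma_tilde V E F p0"
  and gamma_tilde_bound: "2 \<le> length vs \<Longrightarrow> \<forall>v\<in>set vs. v \<in> cspace V \<Longrightarrow> vnorm V (\<lambda>a. foldr dir_deriv vs (normalised a) p0)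
    \<le> fact (length vs) * gamma_tilde V E F p0 ^ (length vs - 1) * (\<Prod>v\<leftarrow>vs. vnorm V v)"
proof -
  define T where "T k vs = jac_inv V E F p0 (\<lambda>e. sys_deriv E F p0 vs e / fact k)"
    for k and vs :: "('u \<Rightarrow> complex) list"
  have T: "T k vs a = foldr dir_deriv vs (normalised a) p0 / fact k" for k vs a
  proof -
    have "(\<lambda>e. sys_deriv E F p0 vs e / fact k) \<in> cspace E"
      by (simp add: sys_deriv_def cspace_def)
    then show ?thesis
      unfolding T_def foldr_dir_deriv_normalised jac_inv_eq_sum[OF sys_deriv_in_cspace]
      by (simp add: jac_inv_eq_sum sum_divide_distrib)
  qed
  define unit where "unit vs \<longleftrightarrow> (\<forall>v\<in>set vs. v \<in> cspace V \<and> vnorm V v \<le> 1)" for vs :: "('u \<Rightarrow> complex) list"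
  define N where "N k = multilinear_norm V V k (T k)" for k
  have N_alt: "N k = (SUP vs\<in>{vs. length vs = k \<and> unit vs}. vnorm V (T k vs))" for k
    unfolding N_def multilinear_norm_def unit_def by (rule arg_cong[of _ _ Sup]) blast
  have bdd: "bdd_above ((\<lambda>vs. vnorm V (T k vs)) ` {vs. length vs = k \<and> unit vs})" for k
  proof -
    have "\<exists>C. \<forall>vs. length vs = k \<longrightarrow> unit vs \<longrightarrow> cmod (foldr dir_deriv vs (normalised a) p0) \<le> C" for a
      unfolding unit_def by (rule foldr_dir_deriv_bounded[OF polyfun_normalised fin(1)])
    then obtain C where C: "\<And>a vs. length vs = k \<Longrightarrow> unit vs \<Longrightarrow> cmod (foldr dir_deriv vs (normalised a) p0) \<le> C a"
      using choice[of "\<lambda>a C. \<forall>vs. length vs = k \<longrightarrow> unit vs \<longrightarrow> cmod (foldr dir_deriv vs (normalised a) p0) \<le> C"]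
      by auto
    have "vnorm V (T k vs) \<le> (\<Sum>a\<in>V. C a / fact k)" if "length vs = k" "unit vs" for vs
    proof -
      have "vnorm V (T k vs) \<le> (\<Sum>a\<in>V. cmod (T k vs a))" by (rule vnorm_le_sum)
      also have "\<dots> \<le> (\<Sum>a\<in>V. C a / fact k)"
        using C[OF that] by (intro sum_mono) (simp add: T norm_divide divide_right_mono)
      finally show ?thesis .
    qed
    then show ?thesis by (intro bdd_aboveI2[where M = "\<Sum>a\<in>V. C a / fact k"]) simp
  qed
  have T_le: "vnorm V (T k vs) \<le> N k" if "length vs = k" "unit vs" for k vs
    unfolding N_alt using that by (intro cSUP_upper bdd) auto
  have N_nonneg: "0 \<le> N k" for k
    using T_le[of "replicate k (\<lambda>a. 0)" k] order_trans[OF vnorm_nonneg] by (simp add: unit_def)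
  have N_0: "N k = 0" if "d < k" for k
  proof -
    have "vnorm V (T k vs) = 0" if "length vs = k" for vs
      using foldr_dir_deriv_eq_0[OF polyfun_normalised, of vs] \<open>d < k\<close> that by (simp add: T[abs_def])
    moreover have "{vs. length vs = k \<and> unit vs} \<noteq> {}"
      by (auto simp: unit_def intro!: exI[of _ "replicate k (\<lambda>a. 0)"])
    ultimately show ?thesis unfolding N_alt by (simp add: cSUP_const cong: SUP_cong_simp)
  qed
  have gamma: "gamma_tilde V E F p0 = (SUP k\<in>{2..}. root (k - 1) (N k))"
    by (simp add: gamma_tilde_def N_def T_def[abs_def])
  have "bdd_above ((\<lambda>k. root (k - 1) (N k)) ` {2..})"
  proof (rule bdd_above_mono)
    show "bdd_above ((\<lambda>k. root (k - 1) (N k)) ` {..d} \<union> {0})" by simp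
    show "(\<lambda>k. root (k - 1) (N k)) ` {2..} \<subseteq> (\<lambda>k. root (k - 1) (N k)) ` {..d} \<union> {0}"
    proof
      fix y assume "y \<in> (\<lambda>k. root (k - 1) (N k)) ` {2..}"
      then obtain k where "y = root (k - 1) (N k)" by blast
      then show "y \<in> (\<lambda>k. root (k - 1) (N k)) ` {..d} \<union> {0}"
        using N_0[of k] by (cases "k \<le> d") auto
    qed
  qed
  then have root_le: "root (k - 1) (N k) \<le> gamma_tilde V E F p0" if "2 \<le> k" for k
    unfolding gamma using that by (intro cSUP_upper) auto
  have N_le: "N k \<le> gamma_tilde V E F p0 ^ (k - 1)" if "2 \<le> k" for k
  proof -
    have "N k = root (k - 1) (N k) ^ (k - 1)" using that N_nonneg by (simp add: real_root_pow_pos2)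
    also have "\<dots> \<le> gamma_tilde V E F p0 ^ (k - 1)"
      using root_le[OF that] N_nonneg by (intro power_mono) (auto simp: real_root_ge_zero)
    finally show ?thesis .
  qed
  show "0 \<le> gamma_tilde V E F p0"
    using root_le[of 2] N_nonneg[of 2] by simp
  assume vs: "2 \<le> length vs" "\<forall>v\<in>set vs. v \<in> cspace V"
  \<comment> \<open>The default for vectors of norm zero keeps the decomposition of \<open>v\<close>
    into norm times direction valid in all cases.\<close>
  define u where "u v = (\<lambda>a. if vnorm V v = 0 then 0 else v a / vnorm V v)" for v
  have u: "v = (\<lambda>a. complex_of_real (vnorm V v) * u v a)" if "v \<in> cspace V" for v
  proof (cases "vnorm V v = 0")
    case True
    then show ?thesis using that fin by (auto simp: cspace_zero_iff u_def)
  next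
    case False
    then show ?thesis by (simp add: u_def fun_eq_iff)
  qed
  have unit_u: "vnorm V (u v) \<le> 1" for v
  proof (cases "vnorm V v = 0")
    case True
    then show ?thesis by (simp add: u_def)
  next
    case False
    then have "u v = (\<lambda>a. complex_of_real (1 / vnorm V v) * v a)" by (simp add: u_def fun_eq_iff)
    then have "vnorm V (u v) = cmod (complex_of_real (1 / vnorm V v)) * vnorm V v"
      by (simp only: vnorm_scale)
    then show ?thesis using False by (simp only: norm_of_real) simp
  qed
  let ?k = "length vs"
  have map_u: "map (\<lambda>v a. complex_of_real (vnorm V v) * u v a) vs = vs"
    using vs(2) u by (intro map_idI) metis
  have "foldr dir_deriv vs (normalised a) p0 = of_real (\<Prod>v\<leftarrow>vs. vnorm V v) * (fact ?k * T ?k (map u vs) a)" for a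
  proof -
    have "foldr dir_deriv vs (normalised a) p0 =
        (\<Prod>v\<leftarrow>vs. complex_of_real (vnorm V v)) * foldr dir_deriv (map u vs) (normalised a) p0"
      using foldr_dir_deriv_scale[OF polyfun_normalised, of "\<lambda>v. complex_of_real (vnorm V v)" u vs a]
      unfolding map_u by simp
    also have "(\<Prod>v\<leftarrow>vs. complex_of_real (vnorm V v)) = of_real (\<Prod>v\<leftarrow>vs. vnorm V v)"
      by (induction vs) auto
    finally show ?thesis by (simp add: T)
  qed
  then have "vnorm V (\<lambda>a. foldr dir_deriv vs (normalised a) p0) =
      (\<Prod>v\<leftarrow>vs. vnorm V v) * (fact ?k * vnorm V (T ?k (map u vs)))"
  proof -
    have "(0::real) \<le> (\<Prod>v\<leftarrow>vs. vnorm V v)" by (induction vs) auto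
    moreover have "cmod (fact ?k) = fact ?k" by (simp add: norm_fact)
    ultimately show ?thesis
      using \<open>\<And>a. foldr dir_deriv vs (normalised a) p0 = _ a\<close> by (simp only: vnorm_scale norm_of_real abs_of_nonneg)
  qed
  also have "\<dots> \<le> (\<Prod>v\<leftarrow>vs. vnorm V v) * (fact ?k * gamma_tilde V E F p0 ^ (?k - 1))"
  proof (intro mult_left_mono)
    have "unit (map u vs)" using vs(2) unit_u by (auto simp: unit_def u_def cspace_def)
    then show "vnorm V (T ?k (map u vs)) \<le> gamma_tilde V E F p0 ^ (?k - 1)"
      using T_le[of "map u vs" ?k] N_le[OF vs(1)] by simp
    show "(0::real) \<le> (\<Prod>v\<leftarrow>vs. vnorm V v)" by (induction vs) auto
  qed simp
  finally show "vnorm V (\<lambda>a. foldr dir_deriv vs (normalised a) p0)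
      \<le> fact ?k * gamma_tilde V E F p0 ^ (?k - 1) * (\<Prod>v\<leftarrow>vs. vnorm V v)"
    by (simp add: mult_ac)
qed

lemma newton_alpha:
  assumes \<alpha>: "beta_tilde V E F p0 * gamma_tilde V E F p0 < 0.26141" and p0: "p0 \<in> cspace V"
  shows "\<exists>p. p \<in> cspace V \<and> newton_converges_quadratically V E F p0 p \<and>
    vnorm V (p - p0) \<le> beta_tilde V E F p0 \<and> (\<forall>e\<in>E. F e p = 0)"
proof -
  define \<beta> where "\<beta> = vnorm V (\<lambda>a. normalised a p0)"
  define \<gamma> where "\<gamma> = gamma_tilde V E F p0"
  have val: "normalised a p = jac_inv V E F p0 (sys_val E F p) a" for a p
  proof -
    have "sys_deriv E F p [] = sys_val E F p" by (auto simp: sys_deriv_def sys_val_def fun_eq_iff)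
    then show ?thesis using foldr_dir_deriv_normalised[of "[]" a p] by simp
  qed
  have bt: "beta_tilde V E F p0 = 2 * \<beta>"
    by (simp add: beta_tilde_def \<beta>_def val)
  interpret normalised_system V normalised p0 d \<beta> \<gamma>
  proof
    show "dir_deriv v (normalised a) p0 = v a" if "v \<in> cspace V" for v a
      using foldr_dir_deriv_normalised[of "[v]" a p0] jac_inv_sys_deriv[OF that] by simp
    have "\<beta> * \<gamma> < 0.26141 / 2" using \<alpha> by (simp add: bt \<gamma>_def)
    then show "\<beta> * \<gamma> \<le> 2 / 15" by simp
  qed (use fin polyfun_normalised gamma_tilde_nonneg gamma_tilde_bound in \<open>auto simp: \<gamma>_def \<beta>_def\<close>)
  define x where "x m = (\<lambda>a. (newton_step V E F ^^ m) p0 a - p0 a)" for m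
  have px: "(newton_step V E F ^^ m) p0 = (\<lambda>b. p0 b + x m b)" for m
    by (simp add: x_def)
  \<comment> \<open>The derivative of \<open>normalised\<close> is the Jacobian at the shifted point
    followed by the inverse Jacobian at \<open>p0\<close>. The composite and the second factor are
    bijective, hence so is the first.\<close>
  have jac: "jac_invertible V E F (\<lambda>b. p0 b + v b)"
    if v: "v \<in> cspace V" "vnorm V v \<le> 3 / 2 * \<beta>" for v
  proof -
    let ?p = "\<lambda>b. p0 b + v b"
    let ?J = "\<lambda>w. sys_deriv E F ?p [w]"
    let ?D = "\<lambda>w a. if a \<in> V then dir_deriv w (normalised a) ?p else 0"
    have D: "?D w = jac_inv V E F p0 (?J w)" for w
    proof
      fix a show "?D w a = jac_inv V E F p0 (?J w) a"
        using foldr_dir_deriv_normalised[of "[w]" a ?p] jac_inv_in_cspace[OF sys_deriv_in_cspace, of ?p "[w]"]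
        by (auto simp: cspace_def)
    qed
    have bij: "bij_betw ?D (cspace V) (cspace V)" by (rule deriv_bij[OF radius(1) v])
    have inj0: "y = y'" if "y \<in> cspace E" "y' \<in> cspace E" "jac_inv V E F p0 y = jac_inv V E F p0 y'" for y y'
      using that sys_deriv_jac_inv by metis
    have "inj_on ?J (cspace V)"
    proof (rule inj_onI)
      fix w w' assume w: "w \<in> cspace V" "w' \<in> cspace V" "?J w = ?J w'"
      then have "?D w = ?D w'" unfolding D by simp
      then show "w = w'" using bij_betw_imp_inj_on[OF bij] w by (auto dest: inj_onD)
    qed
    moreover have "y \<in> ?J ` cspace V" if y: "y \<in> cspace E" for y
    proof -
      have "jac_inv V E F p0 y \<in> ?D ` cspace V"
        using jac_inv_in_cspace[OF y] bij_betw_imp_surj_on[OF bij] by blast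
      then obtain w where w: "w \<in> cspace V" "jac_inv V E F p0 y = ?D w" by blast
      then have "y = ?J w" unfolding D by (intro inj0 y sys_deriv_in_cspace)
      then show ?thesis using w(1) by blast
    qed
    ultimately show ?thesis
      unfolding jac_invertible_def bij_betw_def using sys_deriv_in_cspace by blast
  qed
  define u where "u m = jac_inv V E F (\<lambda>b. p0 b + x m b) (sys_val E F (\<lambda>b. p0 b + x m b))" for m
  have x0: "x 0 = (\<lambda>a. 0)" by (simp add: x_def)
  have step: "u m \<in> cspace V \<and>
      (\<forall>a\<in>V. dir_deriv (u m) (normalised a) (\<lambda>b. p0 b + x m b) = normalised a (\<lambda>b. p0 b + x m b)) \<and>
      x (Suc m) = (\<lambda>a. x m a - u m a)"
    if xm: "x m \<in> cspace V" "vnorm V (x m) \<le> 3 / 2 * \<beta>" for m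
  proof -
    let ?p = "\<lambda>b. p0 b + x m b"
    have bij: "bij_betw (\<lambda>w. sys_deriv E F ?p [w]) (cspace V) (cspace E)"
      using jac[OF xm] by (simp add: jac_invertible_def)
    have s: "sys_val E F ?p \<in> cspace E" by (simp add: sys_val_def cspace_def)
    have uV: "u m \<in> cspace V"
      unfolding u_def jac_inv_def using bij_betwE[OF bij_betw_the_inv_into[OF bij]] s by blast
    have "sys_deriv E F ?p [u m] = sys_val E F ?p"
      unfolding u_def jac_inv_def using f_the_inv_into_f_bij_betw[OF bij] s by fast
    then have "dir_deriv (u m) (normalised a) ?p = normalised a ?p" for a
      using foldr_dir_deriv_normalised[of "[u m]" a ?p] by (simp add: val)
    moreover have "x (Suc m) = (\<lambda>a. x m a - u m a)"
      unfolding x_def[of "Suc m"] funpow.simps o_def px newton_step_def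
      by (simp add: u_def fun_eq_iff)
    ultimately show ?thesis using uV by blast
  qed
  obtain z where z: "z \<in> cspace V" "vnorm V z \<le> 5 / 4 * \<beta>"
      "\<And>a. a \<in> V \<Longrightarrow> normalised a (\<lambda>b. p0 b + z b) = 0"
    and x: "\<And>m. x m \<in> cspace V \<and> vnorm V (x m) \<le> 3 / 2 * \<beta>"
    and lim: "(\<lambda>m. vnorm V (\<lambda>a. x m a - z a)) \<longlonglongrightarrow> 0"
    and quad: "\<And>m. vnorm V (\<lambda>a. x (Suc m) a - z a) \<le> 9 * \<gamma> * (vnorm V (\<lambda>a. x m a - z a))\<^sup>2"
    using newton_iteration[of x u, OF x0 step] by blast
  define p where "p = (\<lambda>b. p0 b + z b)"
  have diff: "(newton_step V E F ^^ m) p0 - p = (\<lambda>a. x m a - z a)" for m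
    by (simp add: px p_def fun_eq_iff)
  have "newton_converges_quadratically V E F p0 p"
    unfolding newton_converges_quadratically_def diff
    using jac[of "x m" for m] x lim quad by (auto simp: px)
  moreover have "p \<in> cspace V" using p0 z(1) by (auto simp: p_def)
  moreover have "vnorm V (p - p0) \<le> beta_tilde V E F p0"
  proof -
    have "p - p0 = z" by (simp add: p_def fun_eq_iff)
    then show ?thesis using z(2) radius(3) by (simp add: bt)
  qed
  moreover have "F e p = 0" if "e \<in> E" for e
  proof -
    have s: "sys_val E F p \<in> cspace E" by (simp add: sys_val_def cspace_def)
    have "jac_inv V E F p0 (sys_val E F p) = (\<lambda>a. 0)"
      using z(3) jac_inv_in_cspace[OF s] by (auto simp: p_def val cspace_def)
    also have "\<dots> = jac_inv V E F p0 (\<lambda>e. 0)"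
      by (simp add: jac_inv_eq_sum cspace_def)
    finally have "sys_val E F p = (\<lambda>e. 0)"
      using sys_deriv_jac_inv s by (metis cspace_0)
    then show ?thesis using that by (auto simp: sys_val_def fun_eq_iff split: if_splits)
  qed
  ultimately show ?thesis by blast
qed

end

section \<open>Evaluation and differentiation of polynomials\<close>

abbreviation (input) "lookup \<equiv> Poly_Mapping.lookup"
abbreviation (input) "keys \<equiv> Poly_Mapping.keys"
abbreviation (input) "single \<equiv> Poly_Mapping.single"

lemma poly_eq_sum_single: "p = (\<Sum>m\<in>keys p. single m (lookup p m))"
  by (rule poly_mapping_eqI)
    (simp add: lookup_sum lookup_single when_def in_keys_iff del: lookup_not_eq_zero_eq_in_keys)

lemma mpoly_induct [case_names single add]:
  assumes "\<And>m c. P (single m c)" "\<And>p q. P p \<Longrightarrow> P q \<Longrightarrow> P (p + q)"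
  shows "P (p :: 'v mpoly)"
proof -
  have "P (\<Sum>m\<in>S. single m (lookup p m))" if "finite S" for S
    using that
  proof induction
    case empty
    show ?case using assms(1)[of 0 0] by simp
  qed (use assms in simp)
  from this[of "keys p"] show ?thesis by (simp flip: poly_eq_sum_single)
qed

definition mon_ev :: "'v mon \<Rightarrow> ('v \<Rightarrow> complex) \<Rightarrow> complex"
  where "mon_ev m x = (\<Prod>v\<in>keys m. x v ^ lookup m v)"

lemma mon_ev_superset: "finite S \<Longrightarrow> keys m \<subseteq> S \<Longrightarrow> mon_ev m x = (\<Prod>v\<in>S. x v ^ lookup m v)"
  unfolding mon_ev_def by (rule prod.mono_neutral_left) (auto simp: in_keys_iff)

lemma mon_ev_0 [simp]: "mon_ev 0 x = 1"
  by (simp add: mon_ev_def)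

lemma mon_ev_add: "mon_ev (m + m') x = mon_ev m x * mon_ev m' x"
proof -
  let ?S = "keys m \<union> keys m'"
  have "mon_ev (m + m') x = (\<Prod>v\<in>?S. x v ^ lookup (m + m') v)"
    by (intro mon_ev_superset keys_add) simp
  also have "\<dots> = mon_ev m x * mon_ev m' x"
    by (simp add: mon_ev_superset[of ?S] lookup_add power_add prod.distrib)
  finally show ?thesis .
qed

lemma mon_ev_unit_mon [simp]: "mon_ev (unit_mon k) x = x k"
  by (simp add: mon_ev_def unit_mon_def)

lemma ev_superset: "finite S \<Longrightarrow> keys p \<subseteq> S \<Longrightarrow> ev p x = (\<Sum>m\<in>S. lookup p m * mon_ev m x)"
  unfolding ev_def mon_ev_def by (rule sum.mono_neutral_left) (auto simp: in_keys_iff)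

lemma ev_add [simp]: "ev (p + q) x = ev p x + ev q x"
proof -
  let ?S = "keys p \<union> keys q"
  have "ev (p + q) x = (\<Sum>m\<in>?S. lookup (p + q) m * mon_ev m x)"
    by (intro ev_superset keys_add) simp
  then show ?thesis
    by (simp add: ev_superset[of ?S] lookup_add distrib_right sum.distrib)
qed

lemma ev_single [simp]: "ev (single m c) x = c * mon_ev m x"
  by (simp add: ev_def mon_ev_def)

lemma ev_0 [simp]: "ev 0 x = 0"
  by (simp add: ev_def)

lemma ev_mult [simp]: "ev (p * q) x = ev p x * ev q x"
proof (induction p rule: mpoly_induct)
  case (single m c)
  show ?case
    by (induction q rule: mpoly_induct) (simp_all add: mult_single mon_ev_add algebra_simps)
qed (simp add: algebra_simps)

lemma ev_Const [simp]: "ev (Const c) x = c"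
  by (simp add: Const_def)

lemma ev_Var [simp]: "ev (Var k) x = x k"
  by (simp add: Var_def monom_poly_def)

lemma Const_0 [simp]: "Const 0 = 0" and Const_1 [simp]: "Const 1 = 1"
  by (simp_all add: Const_def)

lemma Const_add: "Const (a + b) = Const a + Const b"
  and Const_mult: "Const (a * b) = Const a * Const b"
  and Const_minus: "Const (- a) = - Const a"
  by (simp_all add: Const_def single_add mult_single single_uminus)

lemma ev_1 [simp]: "ev 1 x = 1"
  using ev_Const[of 1 x] by simp

lemma ev_minus [simp]: "ev (- p) x = - ev p x"
  using ev_add[of p "- p" x] by (simp add: eq_neg_iff_add_eq_0 add.commute del: ev_add)

lemma ev_diff [simp]: "ev (p - q) x = ev p x - ev q x"
  using ev_add[of p "- q"] by simp

lemma ev_sum [simp]: "ev (\<Sum>i\<in>I. p i) x = (\<Sum>i\<in>I. ev (p i) x)"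
  by (induction I rule: infinite_finite_induct) simp_all

lemma lookup_Const_mult [simp]: "lookup (Const c * p) m = c * lookup p m"
  by (induction p arbitrary: m rule: mpoly_induct)
    (auto simp: Const_def mult_single lookup_single lookup_add algebra_simps when_def)

lemma lookup_Const: "lookup (Const c) m = (if m = 0 then c else 0)"
  by (simp add: Const_def lookup_single when_def)

lemma lookup_unit_mon: "lookup (unit_mon k) l = (if l = k then 1 else 0)"
  by (simp add: unit_mon_def lookup_single when_def)

lemma add_unit_mon_neq_0: "m + unit_mon k \<noteq> 0"
proof
  assume "m + unit_mon k = 0"
  then have "lookup (m + unit_mon k) k = 0" by simp
  then show False by (simp add: lookup_add lookup_unit_mon)
qed

lemma minus_unit_mon_add: "0 < lookup m k \<Longrightarrow> m - unit_mon k + unit_mon k = m"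
  by (intro poly_mapping_eqI) (auto simp: lookup_unit_mon lookup_add lookup_minus)

lemma lookup_Var_mult:
  "lookup (Var k * p) m = (if 0 < lookup m k then lookup p (m - unit_mon k) else 0)"
proof (induction p arbitrary: m rule: mpoly_induct)
  case (single m' c)
  have "unit_mon k + m' = m \<longleftrightarrow> 0 < lookup m k \<and> m' = m - unit_mon k"
    using minus_unit_mon_add[of m k] by (auto simp: add.commute[of "unit_mon k"] lookup_add lookup_unit_mon)
  then show ?case by (auto simp: Var_def monom_poly_def mult_single lookup_single when_def)
qed (simp add: algebra_simps lookup_add)

lemma mon_induct [case_names zero add]:
  fixes m :: "'v mon"
  assumes "P 0" "\<And>m k. P m \<Longrightarrow> P (m + unit_mon k)"
  shows "P m"
proof (induction "\<Sum>k\<in>keys m. lookup m k" arbitrary: m)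
  case 0
  then have "m = 0" by (simp add: poly_mapping_eqI in_keys_iff)
  then show ?case using assms by simp
next
  case (Suc n)
  then obtain k where k: "k \<in> keys m" by (metis sum.empty nat.distinct(1) ex_in_conv)
  then have pos: "0 < lookup m k" by (simp add: in_keys_iff)
  define m' where "m' = m - unit_mon k"
  have m: "m = m' + unit_mon k" unfolding m'_def using minus_unit_mon_add[OF pos] by simp
  have "(\<Sum>l\<in>keys m. lookup m l) = (\<Sum>l\<in>keys m. lookup m' l) + 1"
    using k by (simp add: m lookup_add lookup_unit_mon sum.distrib in_keys_iff)
  also have "(\<Sum>l\<in>keys m. lookup m' l) = (\<Sum>l\<in>keys m'. lookup m' l)"
    by (rule sum.mono_neutral_right) (auto simp: m'_def in_keys_iff lookup_minus)
  finally have "P m'" using Suc by simp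
  then show ?case unfolding m by (rule assms(2))
qed

lemma pd_add [simp]: "pd k (p + q) = pd k p + pd k q"
  by (rule poly_mapping_eqI) (simp add: lookup_pd lookup_add algebra_simps)

lemma pd_0 [simp]: "pd k 0 = 0"
  by (rule poly_mapping_eqI) (simp add: lookup_pd)

lemma pd_Const_mult [simp]: "pd k (Const c * p) = Const c * pd k p"
  by (rule poly_mapping_eqI) (simp add: lookup_pd mult.left_commute del: of_nat_Suc)

lemma pd_minus [simp]: "pd k (- p) = - pd k p"
  by (rule poly_mapping_eqI) (simp add: lookup_pd)

lemma pd_diff [simp]: "pd k (p - q) = pd k p - pd k q"
  using pd_add[of k p "- q"] by (simp del: pd_add)

lemma pd_sum: "pd k (\<Sum>i\<in>I. p i) = (\<Sum>i\<in>I. pd k (p i))"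
  by (induction I rule: infinite_finite_induct) simp_all

lemma pd_commute: "pd k (pd l p) = pd l (pd k p)"
  by (rule poly_mapping_eqI) (auto simp: lookup_pd lookup_add lookup_unit_mon add_ac)

lemma pd_Const [simp]: "pd k (Const c) = 0"
  by (rule poly_mapping_eqI) (simp add: lookup_pd lookup_Const add_unit_mon_neq_0)

lemma pd_1 [simp]: "pd k 1 = 0"
  using pd_Const[of k 1] by simp

lemma pd_Var_mult: "pd l (Var k * q) = Var k * pd l q + (if l = k then q else 0)"
proof (rule poly_mapping_eqI)
  fix m
  have *: "m + unit_mon l - unit_mon k = m - unit_mon k + unit_mon l" if "0 < lookup m k"
    using that by (intro poly_mapping_eqI) (auto simp: lookup_add lookup_minus lookup_unit_mon)
  show "lookup (pd l (Var k * q)) m = lookup (Var k * pd l q + (if l = k then q else 0)) m"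
  proof (cases "0 < lookup m k")
    case True
    have "of_nat (Suc (lookup m k - Suc 0)) = (of_nat (lookup m k) :: complex)"
      using True by simp
    then show ?thesis
      using True minus_unit_mon_add[OF True]
      by (auto simp: lookup_pd lookup_Var_mult lookup_add * lookup_minus lookup_unit_mon
          distrib_right simp del: of_nat_Suc) (simp add: distrib_right)
  next
    case False
    then show ?thesis
      by (auto simp: lookup_pd lookup_Var_mult lookup_add lookup_minus lookup_unit_mon)
  qed
qed

lemma pd_linear_mult:
  "pd l ((Var k - Const c) * q) = (Var k - Const c) * pd l q + (if l = k then q else 0)"
  by (simp add: left_diff_distrib pd_Var_mult)

lemma pd_single: "pd k (single m c) = single (m - unit_mon k) (of_nat (lookup m k) * c)"
  by (cases "c = 0") (auto simp: pd_def)

lemma pd_funpow_commute: "(pd k ^^ n) (pd l p) = pd l ((pd k ^^ n) p)"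
  by (induction n) (simp_all add: pd_commute)

lemma fold_pd_commute:
  "fold (\<lambda>k. pd k ^^ f k) xs (pd l p) = pd l (fold (\<lambda>k. pd k ^^ f k) xs p)"
  by (induction xs arbitrary: p) (simp_all add: pd_funpow_commute)

lemma fold_pd_Suc:
  "distinct xs \<Longrightarrow> fold (\<lambda>k. pd k ^^ (f k + (if k = l then 1 else 0))) xs p =
    (if l \<in> set xs then pd l (fold (\<lambda>k. pd k ^^ f k) xs p) else fold (\<lambda>k. pd k ^^ f k) xs p)"
  by (induction xs arbitrary: p) (auto simp: fold_pd_commute pd_funpow_commute)

lemma pd_mon_0 [simp]: "pd_mon 0 p = p"
proof -
  have "fold (\<lambda>k. pd k ^^ 0) xs p = p" for xs :: "'a list" by (induction xs) auto
  then show ?thesis by (simp add: pd_mon_def)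
qed

lemma pd_mon_add_unit: "pd_mon (m + unit_mon k) p = pd k (pd_mon m p)"
  using fold_pd_Suc[of "sorted_list_of_set UNIV" "lookup m" k p]
  by (simp add: pd_mon_def lookup_add lookup_unit_mon)

lemma pd_mon_add [simp]: "pd_mon m (p + q) = pd_mon m p + pd_mon m q"
  and pd_mon_Const_mult [simp]: "pd_mon m (Const c * p) = Const c * pd_mon m p"
  by (induction m rule: mon_induct) (simp_all add: pd_mon_add_unit)

lemma pd_mon_1: "pd_mon m 1 = (if m = 0 then 1 else 0)"
proof (induction m rule: mon_induct)
  case (add m k)
  show ?case using add by (simp add: pd_mon_add_unit add_unit_mon_neq_0)
qed simp

text \<open>Leibniz's rule: a linear factor can be differentiated only once. If
  \<open>lookup m k = 0\<close>, the truncated exponent \<open>m - unit_mon k\<close> has no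
  meaning, but its coefficient vanishes.\<close>

lemma pd_mon_linear_mult:
  "pd_mon m ((Var k - Const c) * q) =
    (Var k - Const c) * pd_mon m q + Const (of_nat (lookup m k)) * pd_mon (m - unit_mon k) q"
proof (induction m rule: mon_induct)
  case (add m l)
  have 1: "Const (of_nat (lookup m k)) * pd l (pd_mon (m - unit_mon k) q) =
      Const (of_nat (lookup m k)) * pd_mon (m + unit_mon l - unit_mon k) q" if "l \<noteq> k"
  proof (cases "lookup m k = 0")
    case False
    then have "m + unit_mon l - unit_mon k = m - unit_mon k + unit_mon l"
      by (intro poly_mapping_eqI) (auto simp: lookup_add lookup_minus lookup_unit_mon)
    then show ?thesis by (simp add: pd_mon_add_unit)
  qed simp
  have 2: "Const (of_nat (lookup m k)) * pd k (pd_mon (m - unit_mon k) q) =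
      Const (of_nat (lookup m k)) * pd_mon m q"
  proof (cases "lookup m k = 0")
    case False
    then show ?thesis using minus_unit_mon_add[of m k] pd_mon_add_unit[of "m - unit_mon k" k q] by simp
  qed simp
  show ?case
  proof (cases "l = k")
    case True
    then show ?thesis
      using 2 by (simp add: pd_mon_add_unit add pd_linear_mult lookup_add lookup_unit_mon Const_add
          distrib_right add_ac)
  next
    case False
    then show ?thesis
      using 1 by (simp add: pd_mon_add_unit add pd_linear_mult lookup_add lookup_unit_mon)
  qed
qed simp

section \<open>Dual polynomials as functionals\<close>

lemma act_superset:
  "finite S \<Longrightarrow> keys \<Lambda> \<subseteq> S \<Longrightarrow> act \<xi> \<Lambda> p = (\<Sum>m\<in>S. lookup \<Lambda> m * ev (pd_mon m p) \<xi>)"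
  unfolding act_def by (rule sum.mono_neutral_left) (auto simp: in_keys_iff)

lemma act_add_left [simp]: "act \<xi> (\<Lambda> + \<Lambda>') p = act \<xi> \<Lambda> p + act \<xi> \<Lambda>' p"
proof -
  let ?S = "keys \<Lambda> \<union> keys \<Lambda>'"
  have "act \<xi> (\<Lambda> + \<Lambda>') p = (\<Sum>m\<in>?S. lookup (\<Lambda> + \<Lambda>') m * ev (pd_mon m p) \<xi>)"
    by (intro act_superset keys_add) simp
  then show ?thesis
    by (simp add: act_superset[of ?S] lookup_add distrib_right sum.distrib)
qed

lemma act_single: "act \<xi> (single m c) p = c * ev (pd_mon m p) \<xi>"
  by (simp add: act_def)

lemma act_0_left [simp]: "act \<xi> 0 p = 0"
  by (simp add: act_def)

lemma act_Const_mult_left [simp]: "act \<xi> (Const c * \<Lambda>) p = c * act \<xi> \<Lambda> p"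
  by (induction \<Lambda> rule: mpoly_induct)
    (simp_all add: Const_def mult_single act_single algebra_simps)

lemma act_minus_left [simp]: "act \<xi> (- \<Lambda>) p = - act \<xi> \<Lambda> p"
  using act_add_left[of \<xi> \<Lambda> "- \<Lambda>" p] by (simp add: eq_neg_iff_add_eq_0 add.commute del: act_add_left)

lemma act_diff_left [simp]: "act \<xi> (\<Lambda> - \<Lambda>') p = act \<xi> \<Lambda> p - act \<xi> \<Lambda>' p"
  using act_add_left[of \<xi> \<Lambda> "- \<Lambda>'"] by (simp del: act_add_left)

lemma act_sum_left: "act \<xi> (\<Sum>i\<in>I. \<Lambda> i) p = (\<Sum>i\<in>I. act \<xi> (\<Lambda> i) p)"
  by (induction I rule: infinite_finite_induct) simp_all

lemma act_add_right [simp]: "act \<xi> \<Lambda> (p + q) = act \<xi> \<Lambda> p + act \<xi> \<Lambda> q"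
  by (simp add: act_def algebra_simps sum.distrib)

lemma act_Const_mult_right [simp]: "act \<xi> \<Lambda> (Const c * p) = c * act \<xi> \<Lambda> p"
  by (simp add: act_def sum_distrib_left mult.left_commute)

lemma act_0_right [simp]: "act \<xi> \<Lambda> 0 = 0"
  using act_Const_mult_right[of \<xi> \<Lambda> 0] by simp

lemma act_minus_right [simp]: "act \<xi> \<Lambda> (- p) = - act \<xi> \<Lambda> p"
  using act_add_right[of \<xi> \<Lambda> p "- p"] by (simp add: eq_neg_iff_add_eq_0 add.commute del: act_add_right)

lemma act_diff_right [simp]: "act \<xi> \<Lambda> (p - q) = act \<xi> \<Lambda> p - act \<xi> \<Lambda> q"
  using act_add_right[of \<xi> \<Lambda> p "- q"] by (simp del: act_add_right)

lemma act_sum_right: "act \<xi> \<Lambda> (\<Sum>i\<in>I. p i) = (\<Sum>i\<in>I. act \<xi> \<Lambda> (p i))"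
  by (induction I rule: infinite_finite_induct) simp_all

lemma act_1_left [simp]: "act \<xi> 1 p = ev p \<xi>"
  using act_single[of \<xi> 0 1 p] by simp

lemma act_1_right [simp]: "act \<xi> \<Lambda> 1 = lookup \<Lambda> 0"
  by (induction \<Lambda> rule: mpoly_induct) (auto simp: act_single pd_mon_1 lookup_single lookup_add when_def)

text \<open>The transpose of multiplication by a centred variable is differentiation in the dual
  variable. Every passage between ideals and stable spaces of dual elements rests on this.\<close>

lemma act_linear_mult: "act \<xi> \<Lambda> ((Var k - Const (\<xi> k)) * p) = act \<xi> (pd k \<Lambda>) p"
  by (induction \<Lambda> rule: mpoly_induct) (simp_all add: act_single pd_single pd_mon_linear_mult)

lemma shifted_monom_0 [simp]: "shifted_monom \<xi> 0 = 1"
  by (simp add: shifted_monom_def)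

lemma shifted_monom_add_unit:
  "shifted_monom \<xi> (m + unit_mon k) = (Var k - Const (\<xi> k)) * shifted_monom \<xi> m"
proof -
  have "(\<Prod>l\<in>UNIV. (Var l - Const (\<xi> l)) ^ lookup (unit_mon k) l) =
      (\<Prod>l\<in>UNIV. if l = k then Var k - Const (\<xi> k) else 1)"
    by (intro prod.cong) (auto simp: lookup_unit_mon)
  also have "\<dots> = Var k - Const (\<xi> k)" by simp
  finally show ?thesis
    by (simp add: shifted_monom_def lookup_add power_add prod.distrib mult.commute)
qed

definition mon_fact :: "'n::finite mon \<Rightarrow> complex"
  where "mon_fact m = (\<Prod>k\<in>UNIV. fact (lookup m k))"

lemma mon_fact_0 [simp]: "mon_fact 0 = 1"
  by (simp add: mon_fact_def)

lemma mon_fact_nonzero [simp]: "mon_fact m \<noteq> 0"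
  by (simp add: mon_fact_def)

lemma mon_fact_add_unit: "mon_fact (m + unit_mon k) = of_nat (Suc (lookup m k)) * mon_fact m"
proof -
  have "mon_fact (m + unit_mon k) =
      (\<Prod>l\<in>UNIV. (if l = k then of_nat (Suc (lookup m k)) else 1) * fact (lookup m l))"
    unfolding mon_fact_def by (intro prod.cong) (auto simp: lookup_add lookup_unit_mon)
  then show ?thesis by (simp add: prod.distrib mon_fact_def)
qed

text \<open>Each linear factor becomes a derivative in the dual variables, and the constant term is
  read off at the end. The factorials remain because the functionals are undivided
  derivatives.\<close>

lemma act_shifted_monom: "act \<xi> \<Lambda> (shifted_monom \<xi> m) = mon_fact m * lookup \<Lambda> m"
  by (induction m arbitrary: \<Lambda> rule: mon_induct)
    (simp_all add: shifted_monom_add_unit act_linear_mult mon_fact_add_unit lookup_pd mult.assoc mult.left_commute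
      del: of_nat_Suc)

lemma monom_poly_eq_shifted: "monom_poly m = shifted_monom (\<lambda>_. 0) m"
proof (induction m rule: mon_induct)
  case (add m k)
  have "monom_poly (m + unit_mon k) = Var k * monom_poly m"
    by (simp add: monom_poly_def Var_def mult_single add.commute)
  then show ?case using add by (simp add: shifted_monom_add_unit)
qed (simp add: monom_poly_def)

lemma act_monom_poly: "act (\<lambda>_. 0) \<Lambda> (monom_poly m) = mon_fact m * lookup \<Lambda> m"
  by (simp add: monom_poly_eq_shifted act_shifted_monom)

text \<open>Taylor expansion at \<open>\<xi>\<close> without computing coefficients: the span of the
  shifted monomials contains 1 and is closed under multiplication by variables.\<close>

lemma shifted_monom_expansion:
  fixes p :: "'n::{finite,linorder} mpoly"
  shows "\<exists>S c. finite S \<and> p = (\<Sum>m\<in>S. Const (c m) * shifted_monom \<xi> m)"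
proof -
  define X where "X = pvec.span (range (shifted_monom \<xi> :: 'n mon \<Rightarrow> _))"
  have base: "shifted_monom \<xi> m \<in> X" for m by (auto simp: X_def pvec.span_base)
  have Var_mult: "Var k * q \<in> X" if "q \<in> X" for k q
    using that unfolding X_def
  proof (induction rule: pvec.span_induct_alt)
    case base
    show ?case by (simp add: pvec.span_zero)
  next
    case (step c s q)
    then obtain m where "s = shifted_monom \<xi> m" by auto
    then have "Var k * s = shifted_monom \<xi> (m + unit_mon k) + Const (\<xi> k) * shifted_monom \<xi> m"
      by (simp add: shifted_monom_add_unit algebra_simps)
    moreover have "shifted_monom \<xi> (m + unit_mon k) + Const (\<xi> k) * shifted_monom \<xi> m \<in> X"
      unfolding X_def by (intro pvec.span_add pvec.span_scale pvec.span_base) auto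
    ultimately have "Var k * s \<in> X" by simp
    then have "Const c * (Var k * s) + Var k * q \<in> X"
      using step(2) unfolding X_def by (intro pvec.span_add pvec.span_scale) auto
    moreover have "Var k * (Const c * s + q) = Const c * (Var k * s) + Var k * q"
      by (simp only: distrib_left mult.left_commute)
    ultimately show ?case by (simp only: X_def)
  qed
  have mono: "monom_poly m \<in> X" for m
  proof (induction m rule: mon_induct)
    case zero
    show ?case using base[of 0] by (simp add: monom_poly_def)
  next
    case (add m k)
    have "monom_poly (m + unit_mon k) = Var k * monom_poly m"
      by (simp add: monom_poly_def Var_def mult_single add.commute)
    then show ?case using Var_mult[OF add] by simp
  qed
  have "p \<in> X"
  proof (induction p rule: mpoly_induct)
    case (single m c)
    have "single m c = Const c * monom_poly m" by (simp add: Const_def monom_poly_def mult_single)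
    then show ?case using mono[of m] unfolding X_def by (simp add: pvec.span_scale)
  qed (auto simp: X_def pvec.span_add)
  then have "p \<in> pvec.span (range (shifted_monom \<xi>))" by (simp add: X_def)
  then show ?thesis
  proof (induction rule: pvec.span_induct_alt)
    case base
    show ?case by (intro exI[of _ "{}"]) simp
  next
    case (step a s q)
    then obtain m S c where s: "s = shifted_monom \<xi> m" and "finite S"
      and q: "q = (\<Sum>m\<in>S. Const (c m) * shifted_monom \<xi> m)" by auto
    define c' where "c' n = (if n \<in> S then c n else 0) + (if n = m then a else 0)" for n
    have "(\<Sum>n\<in>insert m S. Const (c' n) * shifted_monom \<xi> n) =
        (\<Sum>n\<in>insert m S. Const (if n \<in> S then c n else 0) * shifted_monom \<xi> n) +
        (\<Sum>n\<in>insert m S. Const (if n = m then a else 0) * shifted_monom \<xi> n)"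
      by (simp only: c'_def Const_add distrib_right sum.distrib)
    also have "(\<Sum>n\<in>insert m S. Const (if n \<in> S then c n else 0) * shifted_monom \<xi> n) = q"
      unfolding q using \<open>finite S\<close> by (intro sum.mono_neutral_cong_right) auto
    also have "(\<Sum>n\<in>insert m S. Const (if n = m then a else 0) * shifted_monom \<xi> n) = Const a * s"
      unfolding s using \<open>finite S\<close> by (subst sum.remove[of _ m]) (auto intro!: sum.neutral)
    finally show ?case using \<open>finite S\<close>
      by (intro exI[of _ "insert m S"] exI[of _ c']) (simp add: add.commute)
  qed
qed

section \<open>Integration of dual polynomials\<close>

lemma lookup_trunc_vars:
  "lookup (trunc_vars k \<Lambda>) m = (if \<forall>l>k. lookup m l = 0 then lookup \<Lambda> m else 0)"
proof -
  have "lookup (trunc_vars k \<Lambda>) m =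
      (\<Sum>m'\<in>{m \<in> keys \<Lambda>. \<forall>l>k. lookup m l = 0}. if m' = m then lookup \<Lambda> m else 0)"
    unfolding trunc_vars_def lookup_sum by (intro sum.cong) (auto simp: lookup_single when_def)
  then show ?thesis by (auto simp: sum.delta in_keys_iff)
qed

lemma lookup_dint:
  "lookup (dint k \<Lambda>) m =
    (if 0 < lookup m k \<and> (\<forall>l>k. lookup m l = 0)
     then lookup \<Lambda> (m - unit_mon k) / of_nat (lookup m k) else 0)"
proof (cases "0 < lookup m k")
  case True
  have "lookup (pd k (dint k \<Lambda>)) (m - unit_mon k) = of_nat (lookup m k) * lookup (dint k \<Lambda>) m"
    using True minus_unit_mon_add[OF True]
    by (simp add: lookup_pd lookup_minus lookup_unit_mon del: of_nat_Suc)
  moreover have "(\<forall>l>k. lookup (m - unit_mon k) l = 0) \<longleftrightarrow> (\<forall>l>k. lookup m l = 0)"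
    by (auto simp: lookup_minus lookup_unit_mon)
  then have "lookup (pd k (dint k \<Lambda>)) (m - unit_mon k) =
      (if \<forall>l>k. lookup m l = 0 then lookup \<Lambda> (m - unit_mon k) else 0)"
    by (simp only: dint_props lookup_trunc_vars)
  ultimately have "of_nat (lookup m k) * lookup (dint k \<Lambda>) m =
      (if \<forall>l>k. lookup m l = 0 then lookup \<Lambda> (m - unit_mon k) else 0)" by simp
  then show ?thesis
    using True by (cases "\<forall>l>k. lookup m l = 0") (simp_all only: if_True if_False simp_thms, simp_all add: field_simps)
next
  case False
  then show ?thesis using dint_props(1)[of k \<Lambda>] by (simp add: Var_dvd_iff)
qed

lemma dint_add: "dint k (\<Lambda> + \<Lambda>') = dint k \<Lambda> + dint k \<Lambda>'"
  by (rule poly_mapping_eqI) (auto simp: lookup_dint lookup_add add_divide_distrib)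

lemma dint_Const_mult: "dint k (Const c * \<Lambda>) = Const c * dint k \<Lambda>"
  by (rule poly_mapping_eqI) (auto simp: lookup_dint)

lemma dint_0 [simp]: "dint k 0 = 0"
  by (rule poly_mapping_eqI) (simp add: lookup_dint)

lemma dint_lincomb: "dint k (\<Sum>i\<in>I. Const (c i) * \<Lambda> i) = (\<Sum>i\<in>I. Const (c i) * dint k (\<Lambda> i))"
  by (induction I rule: infinite_finite_induct) (simp_all add: dint_add dint_Const_mult)

lemma top_var_ex1:
  fixes m :: "'n::{finite,linorder} mon"
  assumes "m \<noteq> 0"
  shows "\<exists>k. 0 < lookup m k \<and> (\<forall>l>k. lookup m l = 0)"
proof -
  have "keys m \<noteq> {}" using assms by simp
  then have "Max (keys m) \<in> keys m" by (intro Max_in) simp_all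
  moreover have "lookup m l = 0" if "Max (keys m) < l" for l
    using that by (metis Max_ge finite_keys in_keys_iff leD)
  ultimately show ?thesis by (auto simp: in_keys_iff)
qed

text \<open>\<open>dint l\<close> produces only monomials whose last variable is \<open>l\<close>,
  so at most one summand contributes to a given monomial.\<close>

lemma lookup_sum_dint:
  fixes g :: "'n::{finite,linorder} \<Rightarrow> 'n mpoly"
  assumes "0 < lookup m k" "\<forall>l>k. lookup m l = 0"
  shows "lookup (\<Sum>l\<in>UNIV. dint l (g l)) m = lookup (g k) (m - unit_mon k) / of_nat (lookup m k)"
proof -
  have "lookup (\<Sum>l\<in>UNIV. dint l (g l)) m =
      (\<Sum>l\<in>UNIV. if l = k then lookup (g k) (m - unit_mon k) / of_nat (lookup m k) else 0)"
    unfolding lookup_sum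
  proof (intro sum.cong)
    fix l
    have "\<not> (0 < lookup m l \<and> (\<forall>l'>l. lookup m l' = 0))" if "l \<noteq> k"
      using assms that by (metis linorder_neqE less_irrefl)
    then show "lookup (dint l (g l)) m =
        (if l = k then lookup (g k) (m - unit_mon k) / of_nat (lookup m k) else 0)"
      using assms by (auto simp: lookup_dint)
  qed simp
  then show ?thesis by simp
qed

text \<open>
  Poincare's lemma: \<open>dint l\<close> integrates along the \<open>l\<close>-th edge of a coordinate path, so a monomial of the
  sum comes from its last variable only.
\<close>

lemma pd_sum_dint:
  fixes g :: "'n::{finite,linorder} \<Rightarrow> 'n mpoly"
  assumes comm: "\<And>k l. pd l (g k) = pd k (g l)"
  shows "pd k (\<Sum>l\<in>UNIV. dint l (g l)) = g k"
proof (rule poly_mapping_eqI)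
  fix m
  let ?P = "\<Sum>l\<in>UNIV. dint l (g l)" and ?m = "m + unit_mon k"
  have "lookup ?m k \<noteq> 0" by (simp add: lookup_add lookup_unit_mon)
  then have "?m \<noteq> 0" by (metis lookup_zero)
  from top_var_ex1[OF this] obtain l where l: "0 < lookup ?m l" "\<forall>l'>l. lookup ?m l' = 0" by blast
  have P: "lookup ?P ?m = lookup (g l) (?m - unit_mon l) / of_nat (lookup ?m l)"
    by (rule lookup_sum_dint[OF l])
  show "lookup (pd k ?P) m = lookup (g k) m"
  proof (cases "l = k")
    case True
    then show ?thesis
      by (simp add: lookup_pd P lookup_add lookup_unit_mon del: of_nat_Suc)
  next
    case False
    then have ml: "0 < lookup m l" using l(1) by (auto simp: lookup_add lookup_unit_mon)
    define n where "n = m - unit_mon l"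
    have m: "m = n + unit_mon l" using minus_unit_mon_add[OF ml] by (simp add: n_def)
    have "?m - unit_mon l = n + unit_mon k"
      by (intro poly_mapping_eqI) (simp add: m lookup_add lookup_minus)
    moreover have "lookup (pd k (g l)) n = lookup (pd l (g k)) n" using comm by simp
    ultimately show ?thesis
      using False
      by (simp add: lookup_pd P lookup_add lookup_unit_mon m[symmetric] del: of_nat_Suc)
        (simp add: m lookup_add lookup_unit_mon field_simps del: of_nat_Suc)
  qed
qed

lemma pd_all_0_imp_Const:
  fixes \<Lambda> :: "'n::{finite,linorder} mpoly"
  assumes "\<And>k. pd k \<Lambda> = 0"
  shows "\<Lambda> = Const (lookup \<Lambda> 0)"
proof (rule poly_mapping_eqI)
  fix m
  show "lookup \<Lambda> m = lookup (Const (lookup \<Lambda> 0)) m"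
  proof (cases "m = 0")
    case False
    then obtain k where k: "0 < lookup m k" using top_var_ex1 by blast
    have "lookup (pd k \<Lambda>) (m - unit_mon k) = 0" by (simp add: assms)
    then show ?thesis
      using False minus_unit_mon_add[OF k] by (simp add: lookup_pd lookup_Const del: of_nat_Suc)
  qed (simp add: lookup_Const)
qed

text \<open>By \<open>pd_sum_dint\<close> the difference of \<open>\<Lambda>\<close> and the sum has
  zero gradient, hence is constant, and no \<open>dint\<close> has a constant term. In this way a
  dual element is rebuilt from its derivatives.\<close>

lemma eq_Const_plus_sum_dint:
  fixes \<Lambda> :: "'n::{finite,linorder} mpoly"
  shows "\<Lambda> = Const (lookup \<Lambda> 0) + (\<Sum>k\<in>UNIV. dint k (pd k \<Lambda>))"
proof -
  let ?P = "\<Sum>k\<in>UNIV. dint k (pd k \<Lambda>)"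
  have "pd k (\<Lambda> - ?P) = 0" for k
    using pd_sum_dint[of "\<lambda>k. pd k \<Lambda>" k, OF pd_commute] by simp
  then have "\<Lambda> - ?P = Const (lookup (\<Lambda> - ?P) 0)" by (rule pd_all_0_imp_Const)
  moreover have "lookup ?P 0 = 0" by (simp add: lookup_sum lookup_dint)
  ultimately show ?thesis by (simp add: lookup_minus algebra_simps)
qed

lemma mdeg_0 [simp]: "mdeg 0 = 0"
  by (simp add: mdeg_def)

lemma mdeg_add: "mdeg (m + m') = mdeg m + mdeg m'"
  by (simp add: mdeg_def lookup_add sum.distrib)

lemma mdeg_unit_mon [simp]: "mdeg (unit_mon k) = 1"
  by (simp add: mdeg_def lookup_unit_mon)

lemma mdeg_eq_0_iff [simp]: "mdeg m = 0 \<longleftrightarrow> m = 0"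
  by (auto simp: mdeg_def intro!: poly_mapping_eqI)

lemma polys_le_iff: "p \<in> polys_le t \<longleftrightarrow> (\<forall>m. t < mdeg m \<longrightarrow> lookup p m = 0)"
  by (auto simp: polys_le_def in_keys_iff not_le[symmetric])

lemma subspace_polys_le: "pvec.subspace (polys_le t)"
  by (auto simp: pvec.subspace_def polys_le_iff lookup_add)

lemma polys_le_mono: "s \<le> t \<Longrightarrow> polys_le s \<subseteq> polys_le t"
  by (auto simp: polys_le_iff)

lemma pd_polys_le: "p \<in> polys_le (Suc t) \<Longrightarrow> pd k p \<in> polys_le t"
  by (auto simp: polys_le_iff lookup_pd mdeg_add)

lemma dint_polys_le: "p \<in> polys_le t \<Longrightarrow> dint k p \<in> polys_le (Suc t)"
proof -
  assume p: "p \<in> polys_le t"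
  have "mdeg m = Suc (mdeg (m - unit_mon k))" if "0 < lookup m k" for m
    using minus_unit_mon_add[OF that] mdeg_add[of "m - unit_mon k" "unit_mon k"] by simp
  then show ?thesis using p by (auto simp: polys_le_iff lookup_dint)
qed

lemma finite_mdeg_le: "finite {m :: 'n::finite mon. mdeg m \<le> t}"
proof (rule finite_subset)
  show "{m :: 'n mon. mdeg m \<le> t} \<subseteq> Abs_poly_mapping ` {f. \<forall>k. f k \<in> {..t}}"
  proof
    fix m :: "'n mon" assume "m \<in> {m. mdeg m \<le> t}"
    then have "lookup m k \<le> t" for k
      using member_le_sum[of k UNIV "lookup m"] by (simp add: mdeg_def)
    then show "m \<in> Abs_poly_mapping ` {f. \<forall>k. f k \<in> {..t}}"
      by (intro image_eqI[of _ _ "lookup m"]) (auto simp: lookup_inverse)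
  qed
  have "{f :: 'n \<Rightarrow> nat. \<forall>k. f k \<in> {..t}} = UNIV \<rightarrow>\<^sub>E {..t}" by (auto simp: PiE_UNIV_domain)
  then show "finite (Abs_poly_mapping ` {f :: 'n \<Rightarrow> nat. \<forall>k. f k \<in> {..t}})"
    by (metis finite_PiE finite_atMost finite_imageI finite)
qed

lemma ex_polys_le: "\<exists>t. p \<in> polys_le t"
proof
  show "p \<in> polys_le (Max (mdeg ` keys p))" by (simp add: polys_le_def)
qed

section \<open>Linear algebra\<close>

context vector_space
begin

text \<open>Were a generator outside the span of \<open>S\<close>, adding it to \<open>S\<close>
  would give more independent vectors than there are generators.\<close>

lemma generators_subset_span:
  assumes "independent S" "finite T" "S \<subseteq> span T" "card T \<le> card S"
  shows "T \<subseteq> span S"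
proof
  fix t assume t: "t \<in> T"
  show "t \<in> span S"
  proof (rule ccontr)
    assume "t \<notin> span S"
    then have "independent (insert t S)" "t \<notin> S"
      using assms(1) by (auto simp: independent_insert span_base)
    moreover have "insert t S \<subseteq> span T" using assms(3) t by (auto simp: span_base)
    ultimately have "finite (insert t S)" "card (insert t S) \<le> card T"
      using independent_span_bound[OF assms(2), of "insert t S"] by auto
    then show False using assms(4) \<open>t \<notin> S\<close> by simp
  qed
qed

text \<open>Stated for an indexed family so that independence can be checked on coefficients; the
  injectivity that is needed to pass to sets of vectors comes out as a conclusion.\<close>

lemma family_basis:
  assumes "finite J"
    and spanning: "\<And>d. d \<in> D \<Longrightarrow> \<exists>c. d = (\<Sum>x\<in>J. scale (c x) (e x))"
    and indep: "\<And>c. (\<Sum>x\<in>J. scale (c x) (e x)) = 0 \<Longrightarrow> \<forall>x\<in>J. c x = 0"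
    and D: "subspace D" "\<And>x. x \<in> J \<Longrightarrow> e x \<in> D"
  shows "inj_on e J" "independent (e ` J)" "span (e ` J) = D" "dim D = card J"
proof -
  show inj: "inj_on e J"
  proof (rule inj_onI, rule ccontr)
    fix x y assume xy: "x \<in> J" "y \<in> J" "e x = e y" "x \<noteq> y"
    define c :: "_ \<Rightarrow> 'a" where "c z = (if z = x then 1 else 0) - (if z = y then 1 else 0)" for z
    have "(\<Sum>z\<in>J. scale (c z) (e z)) =
        (\<Sum>z\<in>J. if z = x then e x else 0) - (\<Sum>z\<in>J. if z = y then e y else 0)"
      unfolding c_def scale_left_diff_distrib sum_subtractf
      by (intro arg_cong2[where f = "(-)"] sum.cong) auto
    then have "(\<Sum>z\<in>J. scale (c z) (e z)) = 0" using xy assms(1) by simp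
    then have "c x = 0" using indep xy by blast
    then show False using xy by (simp add: c_def)
  qed
  show ind: "independent (e ` J)"
  proof
    assume "dependent (e ` J)"
    then obtain u where u: "\<exists>v\<in>e ` J. u v \<noteq> 0" "(\<Sum>v\<in>e ` J. scale (u v) v) = 0"
      using dependent_finite[of "e ` J"] assms(1) by blast
    then have "(\<Sum>x\<in>J. scale (u (e x)) (e x)) = 0" using inj by (simp add: sum.reindex)
    then show False using indep[of "\<lambda>x. u (e x)"] u(1) by auto
  qed
  show span: "span (e ` J) = D"
  proof
    show "span (e ` J) \<subseteq> D" using D by (intro span_minimal) auto
    show "D \<subseteq> span (e ` J)"
    proof
      fix d assume "d \<in> D"
      then obtain c where "d = (\<Sum>x\<in>J. scale (c x) (e x))" using spanning by blast
      then show "d \<in> span (e ` J)" by (simp only:) (intro span_sum span_scale span_base imageI)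
    qed
  qed
  show "dim D = card J"
    using dim_span_eq_card_independent[OF ind] inj by (simp add: span card_image)
qed

lemma independent_family_zero:
  assumes "independent (e ` J)" "inj_on e J" "finite J" "(\<Sum>x\<in>J. scale (c x) (e x)) = 0" "x \<in> J"
  shows "c x = 0"
proof -
  define u where "u v = c (inv_into J e v)" for v
  have "(\<Sum>v\<in>e ` J. scale (u v) v) = (\<Sum>x\<in>J. scale (c x) (e x))"
    unfolding sum.reindex[OF assms(2)] o_def using assms(2) by (intro sum.cong) (auto simp: u_def)
  then have "(\<Sum>v\<in>e ` J. scale (u v) v) = 0" using assms(4) by simp
  then have "\<not> (\<exists>v\<in>e ` J. u v \<noteq> 0)"
    using assms(1,3) dependent_finite[of "e ` J"] by auto
  then have "u (e x) = 0" using assms(5) by blast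
  then show ?thesis using assms(2,5) by (simp add: u_def)
qed

lemma span_family:
  assumes "finite J" "d \<in> span (e ` J)"
  shows "\<exists>c. d = (\<Sum>x\<in>J. scale (c x) (e x))"
  using assms(2)
proof (induction rule: span_induct_alt)
  case base
  show ?case by (intro exI[of _ "\<lambda>_. 0"]) simp
next
  case (step a v y)
  then obtain x c where x: "x \<in> J" "v = e x" and y: "y = (\<Sum>x\<in>J. scale (c x) (e x))" by blast
  have "scale a v = (\<Sum>z\<in>J. scale (if z = x then a else 0) (e z))"
    using x assms(1) by (subst sum.remove[of _ x]) (auto intro!: sum.neutral[symmetric])
  then have "scale a v + y = (\<Sum>z\<in>J. scale ((if z = x then a else 0) + c z) (e z))"
    by (simp add: y scale_left_distrib sum.distrib)
  then show ?case by (intro exI)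
qed

lemma subspace_has_basis_list:
  assumes "subspace D" "0 < dim D"
  shows "\<exists>us. distinct us \<and> independent (set us) \<and> span (set us) = D \<and> length us = dim D"
proof -
  obtain B where B: "B \<subseteq> D" "independent B" "D \<subseteq> span B" "card B = dim D" by (rule basis_exists)
  then have "finite B" using assms(2) by (metis card.infinite less_irrefl)
  then obtain us where us: "set us = B" "distinct us" using finite_distinct_list by blast
  have "span B = D" using B span_minimal[OF B(1) assms(1)] by blast
  then show ?thesis using us B distinct_card[of us] by auto
qed

end

interpretation pvec_pair: vector_space_pair
  "\<lambda>(c::complex) (p::'v mpoly). Const c * p" "\<lambda>(c::complex) (p::'v mpoly). Const c * p" ..

section \<open>Coordinates with respect to a finite set of monomials\<close>

definition restrict_mons :: "'v mon set \<Rightarrow> 'v mpoly \<Rightarrow> 'v mpoly"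
  where "restrict_mons S p = (\<Sum>m\<in>S. Const (lookup p m) * monom_poly m)"

lemma Const_mult_monom_poly: "Const c * monom_poly m = single m c"
  by (simp add: Const_def monom_poly_def mult_single)

lemma lookup_restrict_mons:
  "finite S \<Longrightarrow> lookup (restrict_mons S p) m = (if m \<in> S then lookup p m else 0)"
  unfolding restrict_mons_def Const_mult_monom_poly by (simp add: lookup_sum lookup_single when_def)

lemma linear_restrict_mons:
  assumes "finite S"
  shows "Vector_Spaces.linear (\<lambda>(c::complex) p. Const c * p) (\<lambda>(c::complex) p. Const c * p) (restrict_mons S)"
  by unfold_locales (auto intro!: poly_mapping_eqI simp: lookup_restrict_mons[OF assms] lookup_add)

lemma inj_on_restrict_mons:
  assumes "finite S" "pvec.subspace D" "\<And>e. e \<in> D \<Longrightarrow> \<forall>m\<in>S. lookup e m = 0 \<Longrightarrow> e = 0"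
  shows "inj_on (restrict_mons S) D"
proof (rule inj_onI)
  fix d e assume de: "d \<in> D" "e \<in> D" "restrict_mons S d = restrict_mons S e"
  have "lookup d m = lookup e m" if "m \<in> S" for m
    using arg_cong[OF de(3), of "\<lambda>p. lookup p m"] that assms(1) by (simp add: lookup_restrict_mons)
  then have "d - e = 0"
    using de by (intro assms(3) pvec.subspace_diff assms(2)) (simp_all add: lookup_minus)
  then show "d = e" by simp
qed

lemma restrict_mons_in_span: "restrict_mons S p \<in> pvec.span (monom_poly ` S)"
  unfolding restrict_mons_def by (intro pvec.span_sum pvec.span_scale pvec.span_base) auto

lemma dim_le_card_mons:
  assumes "finite S" "pvec.subspace D" "\<And>e. e \<in> D \<Longrightarrow> \<forall>m\<in>S. lookup e m = 0 \<Longrightarrow> e = 0"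
  shows "pvec.dim D \<le> card S"
proof -
  obtain B where B: "B \<subseteq> D" "pvec.independent B" "D \<subseteq> pvec.span B" "card B = pvec.dim D"
    by (rule pvec.basis_exists)
  have sp: "pvec.span B \<subseteq> D" by (rule pvec.span_minimal[OF B(1) assms(2)])
  have inj: "inj_on (restrict_mons S) D" by (rule inj_on_restrict_mons[OF assms])
  have "pvec.independent (restrict_mons S ` B)"
    by (rule pvec_pair.linear_independent_injective_image[OF linear_restrict_mons[OF assms(1)] B(2)
          inj_on_subset[OF inj sp]])
  then have "card (restrict_mons S ` B) \<le> card (monom_poly ` S)"
    using pvec.independent_span_bound[of "monom_poly ` S" "restrict_mons S ` B"] assms(1)
      image_subsetI[of B "restrict_mons S", OF restrict_mons_in_span] by simp
  also have "\<dots> \<le> card S" using assms(1) by (rule card_image_le)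
  finally show ?thesis
    using B(4) card_image[OF inj_on_subset[OF inj B(1)]] by simp
qed

text \<open>An injective linear map between spaces of equal dimension is onto, so
  \<open>restrict_mons S\<close> maps \<open>D\<close> onto the span of the monomials in
  \<open>S\<close>; a preimage of the monomial \<open>m\<close> is the required element.\<close>

lemma dual_family_exists:
  assumes "finite S" "pvec.subspace D" "\<And>e. e \<in> D \<Longrightarrow> \<forall>m\<in>S. lookup e m = 0 \<Longrightarrow> e = 0"
    and "pvec.dim D = card S" "m \<in> S"
  shows "\<exists>w\<in>D. \<forall>m'\<in>S. lookup w m' = (if m' = m then 1 else 0)"
proof -
  obtain B where B: "B \<subseteq> D" "pvec.independent B" "D \<subseteq> pvec.span B" "card B = pvec.dim D"
    by (rule pvec.basis_exists)
  have sp: "pvec.span B = D" using pvec.span_minimal[OF B(1) assms(2)] B(3) by blast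
  have inj: "inj_on (restrict_mons S) D" by (rule inj_on_restrict_mons[OF assms(1-3)])
  have "pvec.independent (restrict_mons S ` B)"
    using pvec_pair.linear_independent_injective_image[OF linear_restrict_mons[OF assms(1)] B(2)] inj
    by (simp add: sp)
  moreover have "card (monom_poly ` S) \<le> card (restrict_mons S ` B)"
    using card_image_le[OF assms(1), of monom_poly] card_image[OF inj_on_subset[OF inj B(1)]]
      B(4) assms(4) by simp
  moreover have "restrict_mons S ` B \<subseteq> pvec.span (monom_poly ` S)"
    by (rule image_subsetI, rule restrict_mons_in_span)
  ultimately have "monom_poly ` S \<subseteq> pvec.span (restrict_mons S ` B)"
    using pvec.generators_subset_span[of "restrict_mons S ` B" "monom_poly ` S"] assms(1) by simp
  moreover have "pvec.span (restrict_mons S ` B) = restrict_mons S ` D"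
    unfolding sp[symmetric] by (rule pvec_pair.linear_span_image[OF linear_restrict_mons[OF assms(1)]])
  ultimately have "monom_poly m \<in> restrict_mons S ` D" using assms(5) by blast
  then obtain w where w: "w \<in> D" "monom_poly m = restrict_mons S w" by blast
  have "lookup w m' = (if m' = m then 1 else 0)" if "m' \<in> S" for m'
    using arg_cong[OF w(2), of "\<lambda>p. lookup p m'"] that assms(1)
    by (auto simp: lookup_restrict_mons monom_poly_def lookup_single when_def)
  then show ?thesis using w(1) by blast
qed

section \<open>Determinants and Cramer's rule\<close>

lemma sub_det_eq_det:
  assumes "length rs = n" "length cs = n"
  shows "sub_det M rs cs = Determinant.det (Matrix.mat n n (\<lambda>(a, b). M (rs ! a) (cs ! b)))"
proof -
  let ?A = "Matrix.mat n n (\<lambda>(a, b). M (rs ! a) (cs ! b))"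
  have "Determinant.det ?A = (\<Sum>\<pi> | \<pi> permutes {0..<n}. of_int (sign \<pi>) * (\<Prod>a = 0..<n. ?A $$ (a, \<pi> a)))"
    by (simp add: Determinant.det_def)
  also have "\<dots> = sub_det M rs cs"
    unfolding sub_det_def assms(1) lessThan_atLeast0
  proof (intro sum.cong arg_cong2[where f = "(*)"] prod.cong refl)
    fix \<pi> a assume "\<pi> \<in> {\<pi>. \<pi> permutes {0..<n}}" "a \<in> {0..<n}"
    then show "?A $$ (a, \<pi> a) = M (rs ! a) (cs ! \<pi> a)"
      using permutes_in_image[of \<pi> "{0..<n}" a] by simp
  qed
  finally show ?thesis by simp
qed

lemma sub_det_eq_0_iff:
  assumes "length rs = n" "length cs = n"
  shows "sub_det M rs cs = 0 \<longleftrightarrow> (\<exists>v. (\<exists>b<n. v b \<noteq> 0) \<and> (\<forall>a<n. (\<Sum>b<n. M (rs ! a) (cs ! b) * v b) = 0))"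
proof -
  let ?A = "Matrix.mat n n (\<lambda>(a, b). M (rs ! a) (cs ! b))"
  have A: "?A \<in> carrier_mat n n" by simp
  have mv: "?A *\<^sub>v v = 0\<^sub>v n \<longleftrightarrow> (\<forall>a<n. (\<Sum>b<n. M (rs ! a) (cs ! b) * v $ b) = 0)"
    if "v \<in> carrier_vec n" for v
    using that by (auto simp: vec_eq_iff scalar_prod_def lessThan_atLeast0)
  show ?thesis
    unfolding sub_det_eq_det[OF assms] det_0_iff_vec_prod_zero_field[OF A]
  proof
    assume "\<exists>v. v \<in> carrier_vec n \<and> v \<noteq> 0\<^sub>v n \<and> ?A *\<^sub>v v = 0\<^sub>v n"
    then obtain v where v: "v \<in> carrier_vec n" "v \<noteq> 0\<^sub>v n" "?A *\<^sub>v v = 0\<^sub>v n" by blast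
    then have "\<exists>b<n. v $ b \<noteq> 0" by (auto simp: vec_eq_iff)
    then show "\<exists>v. (\<exists>b<n. v b \<noteq> 0) \<and> (\<forall>a<n. (\<Sum>b<n. M (rs ! a) (cs ! b) * v b) = 0)"
      using v(3) mv[OF v(1)] by (intro exI[of _ "\<lambda>b. v $ b"]) auto
  next
    assume "\<exists>v. (\<exists>b<n. v b \<noteq> 0) \<and> (\<forall>a<n. (\<Sum>b<n. M (rs ! a) (cs ! b) * v b) = 0)"
    then obtain v where v: "\<exists>b<n. v b \<noteq> 0" "\<forall>a<n. (\<Sum>b<n. M (rs ! a) (cs ! b) * v b) = 0" by blast
    let ?v = "Matrix.vec n v"
    have "?v \<noteq> 0\<^sub>v n" using v(1) by (auto simp: vec_eq_iff)
    then show "\<exists>v. v \<in> carrier_vec n \<and> v \<noteq> 0\<^sub>v n \<and> ?A *\<^sub>v v = 0\<^sub>v n"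
      using v(2) mv[of ?v] by (intro exI[of _ ?v]) auto
  qed
qed

lemma sub_det_transpose:
  assumes "length rs = n" "length cs = n"
  shows "sub_det M rs cs = sub_det (\<lambda>c r. M r c) cs rs"
proof -
  let ?A = "Matrix.mat n n (\<lambda>(a, b). M (rs ! a) (cs ! b))"
  have "transpose_mat ?A = Matrix.mat n n (\<lambda>(a, b). M (rs ! b) (cs ! a))"
    by (intro eq_matI) auto
  then show ?thesis
    using Determinant.det_transpose[of ?A n] sub_det_eq_det[OF assms, of M]
      sub_det_eq_det[OF assms(2,1), of "\<lambda>c r. M r c"] by simp
qed

lemma sub_det_replace_column:
  assumes "length rs = n" "length cs = n" "k < n"
    and c: "\<And>a. a < n \<Longrightarrow> M (rs ! a) c = (\<Sum>b<n. M (rs ! a) (cs ! b) * x b)"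
  shows "sub_det M rs (cs[k := c]) = x k * sub_det M rs cs"
proof -
  let ?A = "Matrix.mat n n (\<lambda>(a, b). M (rs ! a) (cs ! b))" and ?x = "Matrix.vec n x"
  have "replace_col ?A (?A *\<^sub>v ?x) k = Matrix.mat n n (\<lambda>(a, b). M (rs ! a) (cs[k := c] ! b))"
    using assms(2,3) c
    by (intro eq_matI) (auto simp: replace_col_def scalar_prod_def lessThan_atLeast0 nth_list_update)
  then show ?thesis
    using cramer_lemma_mat[of ?A n ?x k] assms sub_det_eq_det[OF assms(1), of "cs[k := c]" M]
      sub_det_eq_det[OF assms(1,2), of M] by simp
qed

section \<open>Bases of subspaces and Plucker coordinates\<close>

lemma basis_list_sum:
  assumes "basis_list E us" "e \<in> E"
  shows "\<exists>v. e = (\<Sum>a<length us. Const (v a) * us ! a)"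
proof -
  have "e \<in> pvec.span ((!) us ` {..<length us})"
  proof -
    have "(!) us ` {..<length us} = set us" by (auto simp: set_conv_nth)
    then show ?thesis using assms by (simp add: basis_list_def)
  qed
  then show ?thesis using pvec.span_family[of "{..<length us}" e "(!) us"] by simp
qed

lemma basis_list_nth: "basis_list E us \<Longrightarrow> a < length us \<Longrightarrow> us ! a \<in> E"
  by (auto simp: basis_list_def pvec.span_base)

lemma basis_list_subspace: "basis_list E us \<Longrightarrow> pvec.subspace E"
  by (auto simp: basis_list_def)

lemma basis_list_length: "basis_list E us \<Longrightarrow> length us = pvec.dim E"
  using pvec.dim_span_eq_card_independent[of "set us"] distinct_card[of us]
  by (simp add: basis_list_def)

lemma basis_list_exists:
  assumes "pvec.subspace E" "0 < pvec.dim E"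
  shows "\<exists>us. basis_list E us"
  using pvec.subspace_has_basis_list[OF assms] by (auto simp: basis_list_def)

text \<open>A vector in the kernel of the transposed coefficient matrix is the coordinate vector, in
  the basis \<open>us\<close>, of an element of \<open>E\<close> whose coefficients at all of
  \<open>ms\<close> vanish.\<close>

lemma pluecker_neq_0_iff:
  assumes us: "basis_list E us" and len: "length ms = length us"
  shows "pluecker us ms \<noteq> 0 \<longleftrightarrow> (\<forall>e\<in>E. (\<forall>m\<in>set ms. lookup e m = 0) \<longrightarrow> e = 0)"
proof -
  let ?n = "length us"
  have inj: "inj_on ((!) us) {..<?n}" using us by (auto simp: basis_list_def inj_on_nth)
  have img: "(!) us ` {..<?n} = set us" by (auto simp: set_conv_nth)
  have comb_0: "(\<Sum>a<?n. Const (v a) * us ! a) = 0 \<longleftrightarrow> (\<forall>a<?n. v a = 0)" for v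
    using pvec.independent_family_zero[of "(!) us" "{..<?n}" v] us inj
    by (auto simp: img basis_list_def)
  have "pluecker us ms = 0 \<longleftrightarrow>
      (\<exists>v. (\<exists>a<?n. v a \<noteq> 0) \<and> (\<forall>b<?n. (\<Sum>a<?n. lookup (us ! a) (ms ! b) * v a) = 0))"
    unfolding pluecker_def
    by (subst sub_det_transpose[of _ ?n]) (simp_all add: len sub_det_eq_0_iff[of _ ?n])
  also have "\<dots> \<longleftrightarrow> (\<exists>v. (\<Sum>a<?n. Const (v a) * us ! a) \<noteq> 0 \<and>
      (\<forall>m\<in>set ms. lookup (\<Sum>a<?n. Const (v a) * us ! a) m = 0))"
    unfolding comb_0 by (simp add: lookup_sum all_set_conv_all_nth len mult.commute)
  also have "\<dots> \<longleftrightarrow> \<not> (\<forall>e\<in>E. (\<forall>m\<in>set ms. lookup e m = 0) \<longrightarrow> e = 0)"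
  proof
    assume "\<exists>v. (\<Sum>a<?n. Const (v a) * us ! a) \<noteq> 0 \<and>
      (\<forall>m\<in>set ms. lookup (\<Sum>a<?n. Const (v a) * us ! a) m = 0)"
    then obtain v where v: "(\<Sum>a<?n. Const (v a) * us ! a) \<noteq> 0"
      "\<forall>m\<in>set ms. lookup (\<Sum>a<?n. Const (v a) * us ! a) m = 0" by blast
    have "(\<Sum>a<?n. Const (v a) * us ! a) \<in> E"
      using basis_list_nth[OF us]
      by (intro pvec.subspace_sum pvec.subspace_scale basis_list_subspace[OF us]) auto
    then show "\<not> (\<forall>e\<in>E. (\<forall>m\<in>set ms. lookup e m = 0) \<longrightarrow> e = 0)" using v by blast
  next
    assume "\<not> (\<forall>e\<in>E. (\<forall>m\<in>set ms. lookup e m = 0) \<longrightarrow> e = 0)"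
    then obtain e where e: "e \<in> E" "\<forall>m\<in>set ms. lookup e m = 0" "e \<noteq> 0" by blast
    then show "\<exists>v. (\<Sum>a<?n. Const (v a) * us ! a) \<noteq> 0 \<and>
      (\<forall>m\<in>set ms. lookup (\<Sum>a<?n. Const (v a) * us ! a) m = 0)"
      using basis_list_sum[OF us e(1)] by blast
  qed
  finally show ?thesis by blast
qed

text \<open>Cramer's rule in the family \<open>w\<close> dual to \<open>ms\<close>: the coefficients
  of the dual family are quotients of Plucker coordinates, that is, the affine coordinates on this
  chart of the Grassmannian.\<close>

lemma pluecker_replace:
  assumes us: "basis_list E us" and len: "length ms = length us" and k: "k < length us"
    and w: "\<And>b. b < length us \<Longrightarrow> w b \<in> E"
      "\<And>b b'. b < length us \<Longrightarrow> b' < length us \<Longrightarrow> lookup (w b) (ms ! b') = (if b = b' then 1 else 0)"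
    and inj: "\<And>e. e \<in> E \<Longrightarrow> \<forall>m\<in>set ms. lookup e m = 0 \<Longrightarrow> e = 0"
  shows "pluecker us (ms[k := m]) = lookup (w k) m * pluecker us ms"
  unfolding pluecker_def
proof (rule sub_det_replace_column[of _ "length us"])
  fix a assume a: "a < length us"
  let ?e = "us ! a - (\<Sum>b<length us. Const (lookup (us ! a) (ms ! b)) * w b)"
  have "?e = 0"
  proof (rule inj)
    show "?e \<in> E"
      using basis_list_nth[OF us a] w(1)
      by (intro pvec.subspace_diff pvec.subspace_sum pvec.subspace_scale basis_list_subspace[OF us]) auto
    show "\<forall>m\<in>set ms. lookup ?e m = 0"
    proof
      fix m assume "m \<in> set ms"
      then obtain b' where b': "b' < length us" "m = ms ! b'" by (auto simp: in_set_conv_nth len)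
      have "lookup (\<Sum>b<length us. Const (lookup (us ! a) (ms ! b)) * w b) m =
          (\<Sum>b<length us. if b = b' then lookup (us ! a) (ms ! b') else 0)"
        unfolding lookup_sum by (intro sum.cong) (use b' w(2) in auto)
      then show "lookup ?e m = 0" using b' by (simp add: lookup_minus)
    qed
  qed
  then have "us ! a = (\<Sum>b<length us. Const (lookup (us ! a) (ms ! b)) * w b)" by simp
  then have "lookup (us ! a) m = lookup (\<Sum>b<length us. Const (lookup (us ! a) (ms ! b)) * w b) m"
    by (rule arg_cong)
  also have "\<dots> = (\<Sum>b<length us. lookup (us ! a) (ms ! b) * lookup (w b) m)"
    by (simp add: lookup_sum)
  finally have "lookup (us ! a) m = (\<Sum>b<length us. lookup (us ! a) (ms ! b) * lookup (w b) m)" .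
  then show "lookup (us ! ([0..<length us] ! a)) m =
      (\<Sum>b<length us. lookup (us ! ([0..<length us] ! a)) (ms ! b) * lookup (w b) m)"
    using a by simp
qed (use len k in auto)


subsection \<open>Rank and kernel\<close>

lemma sum_fun_apply: "(\<Sum>i\<in>I. f i) x = (\<Sum>i\<in>I. f i x)"
  by (induction I rule: infinite_finite_induct) simp_all

text \<open>Pivot columns are chosen as indices and not as vectors, because equal columns coincide
  in the set whose dimension defines \<open>mat_rank\<close>.\<close>

lemma mat_rank_columns:
  assumes "finite C"
  obtains C1 where "C1 \<subseteq> C" "card C1 = mat_rank R C M"
    "\<And>a. (\<And>\<rho>. \<rho> \<in> R \<Longrightarrow> (\<Sum>c\<in>C1. M \<rho> c * a c) = 0) \<Longrightarrow> \<forall>c\<in>C1. a c = 0"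
    "\<And>c. c \<in> C \<Longrightarrow> \<exists>a. \<forall>\<rho>\<in>R. M \<rho> c = (\<Sum>c'\<in>C1. M \<rho> c' * a c')"
proof -
  define col where "col c = (\<lambda>\<rho>. if \<rho> \<in> R then M \<rho> c else 0)" for c
  obtain B where B: "B \<subseteq> col ` C" "cvec.independent B" "col ` C \<subseteq> cvec.span B" "card B = cvec.dim (col ` C)"
    by (rule cvec.basis_exists)
  obtain C1 where C1: "C1 \<subseteq> C" "inj_on col C1" "B = col ` C1"
    using B(1) by (auto simp: subset_image_inj)
  have fin: "finite C1" using C1(1) assms by (rule finite_subset)
  have col_sum: "(\<Sum>c\<in>C1. (\<lambda>i. a c * col c i)) \<rho> = (if \<rho> \<in> R then \<Sum>c\<in>C1. M \<rho> c * a c else 0)" for a \<rho>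
    by (simp add: sum_fun_apply col_def mult.commute)
  show thesis
  proof
    show "C1 \<subseteq> C" by fact
    show "card C1 = mat_rank R C M"
      using B(4) C1 by (simp add: mat_rank_def col_def[abs_def] card_image)
  next
    fix a assume a: "\<And>\<rho>. \<rho> \<in> R \<Longrightarrow> (\<Sum>c\<in>C1. M \<rho> c * a c) = 0"
    have "(\<Sum>c\<in>C1. (\<lambda>i. a c * col c i)) = 0"
      by (rule ext) (simp add: col_sum a)
    then show "\<forall>c\<in>C1. a c = 0"
      using cvec.independent_family_zero[of col C1 a] B(2) C1 fin by blast
  next
    fix c assume "c \<in> C"
    then have "col c \<in> cvec.span (col ` C1)" using B(3) C1(3) by blast
    then obtain a where a: "col c = (\<Sum>c\<in>C1. (\<lambda>i. a c * col c i))"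
      using cvec.span_family[OF fin] by blast
    have "M \<rho> c = (\<Sum>c'\<in>C1. M \<rho> c' * a c')" if "\<rho> \<in> R" for \<rho>
      using fun_cong[OF a, of \<rho>] that by (simp add: col_sum) (simp add: col_def)
    then show "\<exists>a. \<forall>\<rho>\<in>R. M \<rho> c = (\<Sum>c'\<in>C1. M \<rho> c' * a c')" by blast
  qed
qed

lemma mat_rank_le_card: "finite C \<Longrightarrow> mat_rank R C M \<le> card C"
  by (rule mat_rank_columns[of C R M]) (auto dest: card_mono)

text \<open>The non-pivot columns \<open>C2\<close> are the free variables;
  \<open>\<kappa> c\<close> has entry 1 at \<open>c\<close> and, at the pivots, the negated
  coefficients that express column \<open>c\<close>. A kernel vector is determined by its free
  entries.\<close>

lemma kernel_basis:
  assumes fin: "finite C"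
  obtains C2 \<kappa> where "C2 \<subseteq> C" "card C2 + mat_rank R C M = card C"
    "\<And>c. c \<in> C2 \<Longrightarrow> \<kappa> c \<in> cspace C"
    "\<And>c \<rho>. c \<in> C2 \<Longrightarrow> \<rho> \<in> R \<Longrightarrow> (\<Sum>c'\<in>C. M \<rho> c' * \<kappa> c c') = 0"
    "\<And>c c'. c \<in> C2 \<Longrightarrow> c' \<in> C2 \<Longrightarrow> \<kappa> c c' = (if c' = c then 1 else 0)"
    "\<And>\<nu> c'. (\<And>\<rho>. \<rho> \<in> R \<Longrightarrow> (\<Sum>c\<in>C. M \<rho> c * \<nu> c) = 0) \<Longrightarrow> c' \<in> C \<Longrightarrow>
        \<nu> c' = (\<Sum>c\<in>C2. \<nu> c * \<kappa> c c')"
proof -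
  obtain C1 where C1: "C1 \<subseteq> C" "card C1 = mat_rank R C M"
    and ind: "\<And>a. (\<And>\<rho>. \<rho> \<in> R \<Longrightarrow> (\<Sum>c\<in>C1. M \<rho> c * a c) = 0) \<Longrightarrow> \<forall>c\<in>C1. a c = 0"
    and span: "\<And>c. c \<in> C \<Longrightarrow> \<exists>a. \<forall>\<rho>\<in>R. M \<rho> c = (\<Sum>c'\<in>C1. M \<rho> c' * a c')"
    by (rule mat_rank_columns[OF fin, of R M]) blast
  have "\<forall>c. \<exists>a. c \<in> C \<longrightarrow> (\<forall>\<rho>\<in>R. M \<rho> c = (\<Sum>c'\<in>C1. M \<rho> c' * a c'))" using span by blast
  then obtain a where a: "\<And>c \<rho>. c \<in> C \<Longrightarrow> \<rho> \<in> R \<Longrightarrow> M \<rho> c = (\<Sum>c'\<in>C1. M \<rho> c' * a c c')"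
    using choice[of "\<lambda>c a. c \<in> C \<longrightarrow> (\<forall>\<rho>\<in>R. M \<rho> c = (\<Sum>c'\<in>C1. M \<rho> c' * a c'))"] by blast
  define C2 where "C2 = C - C1"
  define \<kappa> where "\<kappa> c c' = (if c' \<in> C1 then - a c c' else if c' = c then 1 else 0)" for c c'
  have fins: "finite C1" "finite C2" using fin C1 by (auto simp: C2_def intro: finite_subset)
  have C: "C = C1 \<union> C2" "C1 \<inter> C2 = {}" using C1 by (auto simp: C2_def)
  have ker: "(\<Sum>c'\<in>C. M \<rho> c' * \<kappa> c c') = 0" if "c \<in> C2" "\<rho> \<in> R" for c \<rho>
  proof -
    have "(\<Sum>c'\<in>C1. M \<rho> c' * \<kappa> c c') = - M \<rho> c"
      using a[of c \<rho>] that by (simp add: \<kappa>_def C2_def sum_negf)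
    moreover have "(\<Sum>c'\<in>C2. M \<rho> c' * \<kappa> c c') = M \<rho> c"
    proof -
      have "(\<Sum>c'\<in>C2. M \<rho> c' * \<kappa> c c') = (\<Sum>c'\<in>C2. if c' = c then M \<rho> c else 0)"
        by (intro sum.cong) (auto simp: \<kappa>_def C2_def)
      then show ?thesis using that fins by simp
    qed
    ultimately show ?thesis unfolding C(1) using fins C(2) by (simp add: sum.union_disjoint)
  qed
  show thesis
  proof
    show "C2 \<subseteq> C" by (auto simp: C2_def)
    show "card C2 + mat_rank R C M = card C"
      using C1 fin fins card_mono[OF fin C1(1)] by (simp add: C2_def card_Diff_subset)
    show "\<kappa> c \<in> cspace C" if "c \<in> C2" for c
      using that C1 by (auto simp: \<kappa>_def cspace_def C2_def)
    show "(\<Sum>c'\<in>C. M \<rho> c' * \<kappa> c c') = 0" if "c \<in> C2" "\<rho> \<in> R" for c \<rho>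
      by (rule ker[OF that])
    show "\<kappa> c c' = (if c' = c then 1 else 0)" if "c \<in> C2" "c' \<in> C2" for c c'
      using that by (auto simp: \<kappa>_def C2_def)
    fix \<nu> c' assume \<nu>: "\<And>\<rho>. \<rho> \<in> R \<Longrightarrow> (\<Sum>c\<in>C. M \<rho> c * \<nu> c) = 0" and c': "c' \<in> C"
    define \<delta> where "\<delta> c' = \<nu> c' - (\<Sum>c\<in>C2. \<nu> c * \<kappa> c c')" for c'
    have \<delta>2: "\<delta> c' = 0" if "c' \<in> C2" for c'
    proof -
      have "(\<Sum>c\<in>C2. \<nu> c * \<kappa> c c') = (\<Sum>c\<in>C2. if c = c' then \<nu> c' else 0)"
        using that by (intro sum.cong) (auto simp: \<kappa>_def C2_def)
      then show ?thesis using that fins by (simp add: \<delta>_def)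
    qed
    have "(\<Sum>c\<in>C1. M \<rho> c * \<delta> c) = 0" if \<rho>: "\<rho> \<in> R" for \<rho>
    proof -
      have "(\<Sum>c\<in>C1. M \<rho> c * \<delta> c) = (\<Sum>c\<in>C. M \<rho> c * \<delta> c)"
        unfolding C(1) using fins C(2) \<delta>2 by (simp add: sum.union_disjoint)
      also have "\<dots> = (\<Sum>c'\<in>C. M \<rho> c' * \<nu> c') - (\<Sum>c'\<in>C. \<Sum>c\<in>C2. \<nu> c * (M \<rho> c' * \<kappa> c c'))"
        by (simp add: \<delta>_def right_diff_distrib sum_subtractf sum_distrib_left mult.left_commute)
      also have "(\<Sum>c'\<in>C. \<Sum>c\<in>C2. \<nu> c * (M \<rho> c' * \<kappa> c c')) = (\<Sum>c\<in>C2. \<nu> c * (\<Sum>c'\<in>C. M \<rho> c' * \<kappa> c c'))"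
        unfolding sum_distrib_left by (rule sum.swap)
      finally show ?thesis using \<nu>[OF \<rho>] ker \<rho> by simp
    qed
    then have "\<delta> c = 0" if "c \<in> C1" for c using ind that by blast
    then have "\<delta> c' = 0" using \<delta>2 c' C(1) by blast
    then show "\<nu> c' = (\<Sum>c\<in>C2. \<nu> c * \<kappa> c c')" by (simp add: \<delta>_def)
  qed
qed

text \<open>The columns \<open>C0\<close> are independent already on the rows \<open>R0\<close>, and
  the rank is at most their number; so they span all columns. Hence \<open>M \<nu>\<close> equals
  \<open>M a\<close> for some \<open>a\<close> supported on \<open>C0\<close>. Vanishing on
  \<open>R0\<close> forces \<open>a = 0\<close>, and then every row vanishes. This is what turns the
  few selected equations into all of them.\<close>

lemma kernel_of_detecting_rows:
  assumes fin: "finite C" and R0: "R0 \<subseteq> R" and C0: "C0 \<subseteq> C" and card: "mat_rank R C M \<le> card C0"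
    and inj: "\<And>a. (\<And>\<rho>. \<rho> \<in> R0 \<Longrightarrow> (\<Sum>c\<in>C0. M \<rho> c * a c) = 0) \<Longrightarrow> \<forall>c\<in>C0. a c = 0"
  shows "mat_rank R C M = card C0"
    and "(\<And>\<rho>. \<rho> \<in> R0 \<Longrightarrow> (\<Sum>c\<in>C. M \<rho> c * \<nu> c) = 0) \<Longrightarrow> \<rho> \<in> R \<Longrightarrow> (\<Sum>c\<in>C. M \<rho> c * \<nu> c) = 0"
proof -
  define col where "col c = (\<lambda>\<rho>. if \<rho> \<in> R then M \<rho> c else 0)" for c
  have fin0: "finite C0" using C0 fin by (rule finite_subset)
  have col_sum: "(\<Sum>c\<in>S. (\<lambda>i. a c * col c i)) \<rho> = (if \<rho> \<in> R then \<Sum>c\<in>S. M \<rho> c * a c else 0)" for a \<rho> S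
    by (simp add: sum_fun_apply col_def mult.commute)
  obtain B where B: "B \<subseteq> col ` C" "cvec.independent B" "col ` C \<subseteq> cvec.span B" "card B = cvec.dim (col ` C)"
    by (rule cvec.basis_exists)
  have finB: "finite B" using B(1) fin by (auto intro: finite_subset)
  have rank: "card B = mat_rank R C M" using B(4) by (simp add: mat_rank_def col_def[abs_def])
  have bound: "finite S \<and> card S \<le> mat_rank R C M" if "cvec.independent S" "S \<subseteq> cvec.span B" for S
    using cvec.independent_span_bound[OF finB that] rank by simp
  have fam: "inj_on col C0" "cvec.independent (col ` C0)"
  proof -
    have 1: "\<exists>c. d = (\<Sum>x\<in>C0. (\<lambda>i. c x * col x i))" if "d \<in> cvec.span (col ` C0)" for d
      using cvec.span_family[OF fin0 that] .
    have 2: "\<forall>x\<in>C0. c x = 0" if "(\<Sum>x\<in>C0. (\<lambda>i. c x * col x i)) = 0" for c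
    proof (rule inj)
      fix \<rho> assume "\<rho> \<in> R0"
      then show "(\<Sum>x\<in>C0. M \<rho> x * c x) = 0"
        using fun_cong[OF that, of \<rho>] R0 by (auto simp: col_sum)
    qed
    show "inj_on col C0" "cvec.independent (col ` C0)"
      by (rule cvec.family_basis[OF fin0 1 2 cvec.subspace_span cvec.span_base], assumption+, rule imageI, assumption)+
  qed
  have sub: "col ` C0 \<subseteq> cvec.span B" using B(3) C0 by blast
  show eq: "mat_rank R C M = card C0"
    using bound[OF fam(2) sub] card fam(1) by (simp add: card_image)
  assume \<nu>: "\<And>\<rho>. \<rho> \<in> R0 \<Longrightarrow> (\<Sum>c\<in>C. M \<rho> c * \<nu> c) = 0" and \<rho>: "\<rho> \<in> R"
  define x where "x = (\<Sum>c\<in>C. (\<lambda>i. \<nu> c * col c i))"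
  have xB: "x \<in> cvec.span B"
    unfolding x_def using B(3) by (intro cvec.span_sum cvec.span_scale) auto
  have "x \<in> cvec.span (col ` C0)"
  proof (rule ccontr)
    assume "x \<notin> cvec.span (col ` C0)"
    then have "cvec.independent (insert x (col ` C0))" "x \<notin> col ` C0"
      using fam(2) by (auto simp: cvec.independent_insert cvec.span_base)
    moreover have "insert x (col ` C0) \<subseteq> cvec.span B" using sub xB by simp
    ultimately have "card (insert x (col ` C0)) \<le> card C0" "x \<notin> col ` C0"
      using bound eq by auto
    then show False using fin0 fam(1) by (simp add: card_image)
  qed
  then obtain a where a: "x = (\<Sum>c\<in>C0. (\<lambda>i. a c * col c i))"
    using cvec.span_family[OF fin0] by blast
  have val: "(\<Sum>c\<in>C. M \<rho> c * \<nu> c) = (\<Sum>c\<in>C0. M \<rho> c * a c)" if "\<rho> \<in> R" for \<rho>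
    using fun_cong[OF a, of \<rho>] that by (simp add: x_def col_sum)
  have "\<forall>c\<in>C0. a c = 0"
  proof (rule inj)
    fix \<rho> assume "\<rho> \<in> R0"
    then show "(\<Sum>c\<in>C0. M \<rho> c * a c) = 0" using val[of \<rho>] \<nu>[of \<rho>] R0 by auto
  qed
  then show "(\<Sum>c\<in>C. M \<rho> c * \<nu> c) = 0" using val[OF \<rho>] by simp
qed

subsection \<open>Norms of matrices and invertibility\<close>

lemma vnorm_mat_apply_le:
  assumes fin: "finite R" "finite C" and v: "v \<in> cspace C"
  shows "vnorm R (mat_apply R C M v) \<le> mat_norm R C M * vnorm C v"
proof -
  let ?N = "{vnorm R (mat_apply R C M v) | v. v \<in> cspace C \<and> vnorm C v \<le> 1}"
  have bdd: "bdd_above ?N"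
  proof (rule bdd_aboveI)
    fix y assume "y \<in> ?N"
    then obtain v where v: "v \<in> cspace C" "vnorm C v \<le> 1" and y: "y = vnorm R (mat_apply R C M v)" by blast
    have "y \<le> (\<Sum>\<rho>\<in>R. cmod (\<Sum>c\<in>C. M \<rho> c * v c))"
      unfolding y using vnorm_le_sum[of R "mat_apply R C M v"] by (simp add: mat_apply_def)
    also have "\<dots> \<le> (\<Sum>\<rho>\<in>R. \<Sum>c\<in>C. cmod (M \<rho> c))"
    proof (rule sum_mono)
      fix \<rho>
      have "cmod (\<Sum>c\<in>C. M \<rho> c * v c) \<le> (\<Sum>c\<in>C. cmod (M \<rho> c * v c))" by (rule norm_sum)
      also have "\<dots> \<le> (\<Sum>c\<in>C. cmod (M \<rho> c))"
        using v cmod_le_vnorm[OF fin(2), of _ v]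
        by (intro sum_mono) (auto simp: norm_mult intro!: mult_right_le_one_le intro: order_trans)
      finally show "cmod (\<Sum>c\<in>C. M \<rho> c * v c) \<le> (\<Sum>c\<in>C. cmod (M \<rho> c))" .
    qed
    finally show "y \<le> (\<Sum>\<rho>\<in>R. \<Sum>c\<in>C. cmod (M \<rho> c))" .
  qed
  show ?thesis
  proof (cases "vnorm C v = 0")
    case True
    then have "v = (\<lambda>a. 0)" using cspace_zero_iff[OF v fin(2)] by simp
    then have "mat_apply R C M v = (\<lambda>\<rho>. 0)" by (auto simp: mat_apply_def)
    then show ?thesis using True by simp
  next
    case False
    define s where "s = complex_of_real (1 / vnorm C v)"
    have s: "cmod s = 1 / vnorm C v" unfolding s_def norm_of_real by simp
    have "vnorm C (\<lambda>a. s * v a) = 1" using False by (simp add: vnorm_scale s)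
    then have "vnorm R (mat_apply R C M (\<lambda>a. s * v a)) \<le> mat_norm R C M"
      unfolding mat_norm_def using v by (intro cSup_upper bdd) auto
    moreover have "mat_apply R C M (\<lambda>a. s * v a) = (\<lambda>\<rho>. s * mat_apply R C M v \<rho>)"
      by (auto simp: mat_apply_def sum_distrib_left mult.left_commute)
    ultimately show ?thesis using False by (simp add: vnorm_scale s field_simps less_le)
  qed
qed

lemma sigma_min_le:
  assumes fin: "finite R" "finite C" and v: "v \<in> cspace C"
  shows "sigma_min R C M * vnorm C v \<le> vnorm R (mat_apply R C M v)"
proof (cases "vnorm C v = 0")
  case False
  let ?N = "{vnorm R (mat_apply R C M v) | v. v \<in> cspace C \<and> vnorm C v = 1}"
  have bdd: "bdd_below ?N" by (rule bdd_belowI[of _ 0]) auto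
  define s where "s = complex_of_real (1 / vnorm C v)"
  have s: "cmod s = 1 / vnorm C v" unfolding s_def norm_of_real by simp
  have "vnorm C (\<lambda>a. s * v a) = 1" using False by (simp add: vnorm_scale s)
  then have "sigma_min R C M \<le> vnorm R (mat_apply R C M (\<lambda>a. s * v a))"
    unfolding sigma_min_def using v by (intro cInf_lower bdd) auto
  moreover have "mat_apply R C M (\<lambda>a. s * v a) = (\<lambda>\<rho>. s * mat_apply R C M v \<rho>)"
    by (auto simp: mat_apply_def sum_distrib_left mult.left_commute)
  ultimately show ?thesis using False by (simp add: vnorm_scale s field_simps less_le)
qed simp

text \<open>On the kernel of \<open>M'\<close> the difference \<open>M' - M\<close> acts as
  \<open>- M\<close>, so a nonzero kernel vector would force \<open>sigma_min\<close> of
  \<open>M\<close> to be at most the norm of the difference.\<close>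

lemma perturbation_injective:
  assumes fin: "finite R" "finite C" and lt: "mat_norm R C (M' - M) < sigma_min R C M"
    and ker: "\<And>\<rho>. \<rho> \<in> R \<Longrightarrow> (\<Sum>c\<in>C. M' \<rho> c * v c) = 0"
  shows "\<forall>c\<in>C. v c = 0"
proof -
  define w where "w = (\<lambda>c. if c \<in> C then v c else 0)"
  have w: "w \<in> cspace C" by (auto simp: w_def cspace_def)
  have "(\<Sum>c\<in>C. M' \<rho> c * w c) = 0" if "\<rho> \<in> R" for \<rho>
    using ker[OF that] by (simp add: w_def cong: sum.cong)
  then have "mat_apply R C (M' - M) w = (\<lambda>\<rho>. (-1) * mat_apply R C M w \<rho>)"
    by (auto simp: mat_apply_def left_diff_distrib sum_subtractf)
  then have "vnorm R (mat_apply R C M w) = vnorm R (mat_apply R C (M' - M) w)"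
    using vnorm_scale[of R "-1" "mat_apply R C M w"] by simp
  also have "\<dots> \<le> mat_norm R C (M' - M) * vnorm C w" by (rule vnorm_mat_apply_le[OF fin w])
  finally have "sigma_min R C M * vnorm C w \<le> mat_norm R C (M' - M) * vnorm C w"
    using sigma_min_le[OF fin w, of M] by linarith
  then have "vnorm C w = 0"
    using lt vnorm_nonneg[of C w] by (metis mult_le_cancel_right_pos not_le order_le_less)
  then show ?thesis using vnorm_eq_0_iff[OF fin(2), of w] by (auto simp: w_def)
qed

lemma mat_norm_nonneg:
  assumes "finite R" "finite C"
  shows "0 \<le> mat_norm R C M"
proof (cases "C = {}")
  case True
  have "{vnorm R (mat_apply R C M v) | v. v \<in> cspace C \<and> vnorm C v \<le> 1} = {0}"
    unfolding True by (auto simp: mat_apply_def vnorm_def L2_set_def intro!: exI[of _ "\<lambda>_. 0"])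
  then show ?thesis by (simp add: mat_norm_def)
next
  case False
  then obtain c where c: "c \<in> C" by blast
  define v :: "_ \<Rightarrow> complex" where "v c' = (if c' = c then 1 else 0)" for c'
  have v: "v \<in> cspace C" using c by (auto simp: v_def cspace_def)
  have "vnorm C v \<noteq> 0" using vnorm_eq_0_iff[OF assms(2), of v] c by (auto simp: v_def)
  moreover have "0 \<le> mat_norm R C M * vnorm C v"
    using vnorm_mat_apply_le[OF assms v] vnorm_nonneg order_trans by blast
  ultimately show ?thesis using vnorm_nonneg[of C v] by (simp add: zero_le_mult_iff)
qed

text \<open>
  Over a nonempty set of varied coordinates a Lipschitz constant of a nonnegative quantity is
  nonnegative unless the radius is \<open>0\<close>; over an empty one it is arbitrary.
\<close>

lemma lipschitz_bound_le:
  assumes L: "lipschitz_bound U p0 b d L" and fin: "finite U" "U \<noteq> {}" and b: "0 \<le> b"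
    and d: "\<And>p. 0 \<le> d p" and p: "\<And>a. a \<notin> U \<Longrightarrow> p a = p0 a" "vnorm U (p - p0) \<le> b"
  shows "d p \<le> L * b"
proof -
  have dp: "d p \<le> L * vnorm U (p - p0)" using L p by (simp add: lipschitz_bound_def)
  show ?thesis
  proof (cases "b = 0")
    case True
    then have "vnorm U (p - p0) = 0" using p(2) vnorm_nonneg[of U "p - p0"] by linarith
    then show ?thesis using dp True by simp
  next
    case False
    obtain u where u: "u \<in> U" using fin by blast
    \<comment> \<open>A point at distance exactly \<open>b\<close>; nonnegativity of
      \<open>d\<close> there forces \<open>L \<ge> 0\<close>.\<close>
    define q where "q = (\<lambda>a. p0 a + (if a = u then complex_of_real b else 0))"
    have "vnorm U (q - p0) = L2_set (\<lambda>a. if a = u then b else 0) U"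
      unfolding vnorm_def using b by (intro L2_set_cong) (auto simp: q_def)
    also have "\<dots> = b"
      using u fin b by (simp add: L2_set_def if_distrib[of "\<lambda>x. x\<^sup>2"] cong: if_cong)
    finally have "vnorm U (q - p0) = b" .
    moreover have "\<forall>a. a \<notin> U \<longrightarrow> q a = p0 a" using u by (auto simp: q_def)
    ultimately have "d q \<le> L * b"
      using L[unfolded lipschitz_bound_def, THEN spec, of q] by simp
    then have "0 \<le> L * b" using d[of q] by linarith
    then have "0 \<le> L" using b False by (simp add: zero_le_mult_iff)
    then have "L * vnorm U (p - p0) \<le> L * b" by (intro mult_left_mono p(2))
    then show ?thesis using dp by linarith
  qed
qed

section \<open>Dual bases of inverse systems\<close>

text \<open>Each linear factor is traded for a derivative of \<open>\<Lambda>\<close>, and more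
  derivatives than the degree leave nothing.\<close>

lemma act_linear_power:
  assumes "\<Lambda> \<in> polys_le t" "t < length ks"
  shows "act \<xi> \<Lambda> (prod_list (map (\<lambda>k. Var k - Const (\<xi> k)) ks) * p) = 0"
  using assms
proof (induction ks arbitrary: \<Lambda> t)
  case (Cons k ks)
  have "act \<xi> \<Lambda> (prod_list (map (\<lambda>k. Var k - Const (\<xi> k)) (k # ks)) * p) =
      act \<xi> (pd k \<Lambda>) (prod_list (map (\<lambda>k. Var k - Const (\<xi> k)) ks) * p)"
    by (simp only: list.map prod_list.Cons mult.assoc act_linear_mult)
  also have "\<dots> = 0"
  proof (cases t)
    case 0
    have "pd k \<Lambda> = 0"
      using Cons.prems(1) unfolding 0
      by (intro poly_mapping_eqI) (simp add: lookup_pd polys_le_iff mdeg_add)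
    then show ?thesis by simp
  next
    case (Suc s)
    then show ?thesis
      using Cons.prems Cons.IH[of "pd k \<Lambda>" s] by (simp add: pd_polys_le)
  qed
  finally show ?case .
qed simp

lemma act_max_ideal_power:
  assumes "\<Lambda> \<in> polys_le t" "q \<in> max_ideal_power (Suc t)"
  shows "act (\<lambda>_. 0) \<Lambda> q = 0"
  using assms(2) unfolding max_ideal_power_def
proof (induction rule: pideal.span_induct_alt)
  case (step c v y)
  then obtain ks where ks: "v = prod_list (map Var ks)" "length ks = Suc t" by blast
  have "act (\<lambda>_. 0) \<Lambda> (c * v) = 0"
    using act_linear_power[OF assms(1), of ks "\<lambda>_. 0" c] ks by (simp add: mult.commute)
  then show ?case using step by simp
qed simp

lemma monom_poly_add_unit: "monom_poly (m + unit_mon k) = Var k * monom_poly m"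
  by (simp add: monom_poly_def Var_def mult_single add.commute)

lemma act_monom_add_unit:
  "act (\<lambda>_. 0) \<Lambda> (monom_poly (m + unit_mon k)) = act (\<lambda>_. 0) (pd k \<Lambda>) (monom_poly m)"
  using act_linear_mult[of "\<lambda>_. 0" \<Lambda> k "monom_poly m"] by (simp add: monom_poly_add_unit)

lemma monom_poly_in_max_ideal_power:
  fixes m :: "'n::{finite,linorder} mon"
  assumes "n \<le> mdeg m"
  shows "monom_poly m \<in> max_ideal_power n"
proof -
  have "\<exists>ks p. length ks = n \<and> monom_poly m = p * prod_list (map Var ks)"
    using assms
  proof (induction n arbitrary: m)
    case (Suc n)
    then have "m \<noteq> 0" by auto
    from top_var_ex1[OF this] obtain k where k: "0 < lookup m k" by blast
    define m' where "m' = m - unit_mon k"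
    have m: "m = m' + unit_mon k" using minus_unit_mon_add[OF k] by (simp add: m'_def)
    have "n \<le> mdeg m'" using Suc.prems arg_cong[OF m, of mdeg] by (simp add: mdeg_add)
    from Suc.IH[OF this] obtain ks p where ks: "length ks = n" "monom_poly m' = p * prod_list (map Var ks)"
      by blast
    have "monom_poly m = p * prod_list (map Var (k # ks))"
      by (simp only: m monom_poly_add_unit ks(2) list.map prod_list.Cons mult.left_commute)
    then show ?case using ks(1) by (intro exI[of _ "k # ks"] exI[of _ p]) simp
  qed simp
  then obtain ks p where ks: "length ks = n" "monom_poly m = p * prod_list (map Var ks)" by blast
  show ?thesis
    unfolding max_ideal_power_def ks(2) by (intro pideal.span_scale pideal.span_base) (use ks(1) in blast)
qed

lemma act_eq_imp_eq:
  assumes "\<And>m. act (\<lambda>_. 0) \<Lambda> (monom_poly m) = 0"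
  shows "\<Lambda> = 0"
  using assms by (intro poly_mapping_eqI) (simp add: act_monom_poly)

text \<open>The coefficients of \<open>p\<close> modulo \<open>J\<close> are the values of the dual
  functionals at \<open>p\<close>. The lemma serves at the origin for \<open>Hilb_B\<close> and at
  the computed root for the multiplicity.\<close>

lemma basis_mod_dual:
  assumes fin: "finite I"
    and dual: "\<And>i j. i \<in> I \<Longrightarrow> j \<in> I \<Longrightarrow> act \<xi> (\<Lambda> i) (s j) = (if i = j then 1 else 0)"
    and J: "\<And>p. p \<in> J \<longleftrightarrow> (\<forall>i\<in>I. act \<xi> (\<Lambda> i) p = 0)"
  shows "inj_on s I" "basis_mod J (s ` I)"
proof -
  show inj: "inj_on s I"
  proof (rule inj_onI)
    fix i j assume "i \<in> I" "j \<in> I" "s i = s j"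
    then show "i = j" using dual[of i i] dual[of i j] by (auto split: if_splits)
  qed
  have J_iff: "p - (\<Sum>q\<in>s ` I. Const (c q) * q) \<in> J \<longleftrightarrow> (\<forall>i\<in>I. c (s i) = act \<xi> (\<Lambda> i) p)" for c p
  proof -
    have "act \<xi> (\<Lambda> i) (p - (\<Sum>q\<in>s ` I. Const (c q) * q)) = act \<xi> (\<Lambda> i) p - c (s i)" if "i \<in> I" for i
    proof -
      have "act \<xi> (\<Lambda> i) (\<Sum>q\<in>s ` I. Const (c q) * q) = (\<Sum>j\<in>I. if j = i then c (s i) else 0)"
        unfolding sum.reindex[OF inj] act_sum_right using dual that by (intro sum.cong) auto
      then show ?thesis using fin that by simp
    qed
    then show ?thesis unfolding J by auto
  qed
  have "\<exists>!c. c \<in> cspace (s ` I) \<and> p - (\<Sum>q\<in>s ` I. Const (c q) * q) \<in> J" for p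
    unfolding J_iff
  proof (rule ex1I)
    define c where "c q = (if q \<in> s ` I then act \<xi> (\<Lambda> (inv_into I s q)) p else 0)" for q
    show "c \<in> cspace (s ` I) \<and> (\<forall>i\<in>I. c (s i) = act \<xi> (\<Lambda> i) p)"
      using inj by (auto simp: c_def cspace_def)
    fix c' assume c': "c' \<in> cspace (s ` I) \<and> (\<forall>i\<in>I. c' (s i) = act \<xi> (\<Lambda> i) p)"
    show "c' = c"
    proof
      fix q show "c' q = c q"
        using c' inj by (cases "q \<in> s ` I") (auto simp: c_def cspace_def)
    qed
  qed
  then show "basis_mod J (s ` I)" using fin by (simp add: basis_mod_def)
qed

text \<open>The candidate for a primitive whose \<open>k\<close>-th derivative is the combination of
  the \<open>\<Lambda> j\<close> with coefficients \<open>\<nu> (j, k)\<close>; it has this gradient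
  once the mixed derivatives agree. It is also the defining sum of \<open>lam\<close> with the
  summations exchanged.\<close>

definition prim :: "nat set \<Rightarrow> (nat \<Rightarrow> 'n::{finite,linorder} mpoly) \<Rightarrow> (nat \<times> 'n \<Rightarrow> complex) \<Rightarrow> 'n mpoly"
  where "prim J \<Lambda> \<nu> = (\<Sum>k\<in>UNIV. dint k (\<Sum>j\<in>J. Const (\<nu> (j, k)) * \<Lambda> j))"

lemma prim_lincomb:
  "prim J \<Lambda> (\<lambda>c. \<Sum>x\<in>S. b x * \<nu> x c) = (\<Sum>x\<in>S. Const (b x) * prim J \<Lambda> (\<nu> x))"
proof -
  have Const_sum: "Const (\<Sum>x\<in>S. b x * \<nu> x c) = (\<Sum>x\<in>S. Const (b x) * Const (\<nu> x c))" for c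
    by (induction S rule: infinite_finite_induct) (simp_all add: Const_add Const_mult)
  have "(\<Sum>j\<in>J. Const (\<Sum>x\<in>S. b x * \<nu> x (j, k)) * \<Lambda> j) =
      (\<Sum>x\<in>S. Const (b x) * (\<Sum>j\<in>J. Const (\<nu> x (j, k)) * \<Lambda> j))" for k
    unfolding Const_sum sum_distrib_left sum_distrib_right mult.assoc by (rule sum.swap)
  then have "prim J \<Lambda> (\<lambda>c. \<Sum>x\<in>S. b x * \<nu> x c) =
      (\<Sum>k\<in>UNIV. dint k (\<Sum>x\<in>S. Const (b x) * (\<Sum>j\<in>J. Const (\<nu> x (j, k)) * \<Lambda> j)))"
    by (simp only: prim_def)
  also have "\<dots> = (\<Sum>x\<in>S. Const (b x) * prim J \<Lambda> (\<nu> x))"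
    unfolding prim_def unfolding dint_lincomb unfolding sum_distrib_left by (rule sum.swap)
  finally show ?thesis .
qed

lemma lookup_prim_0 [simp]: "lookup (prim J \<Lambda> \<nu>) 0 = 0"
  by (simp add: prim_def lookup_sum lookup_dint)

lemma prim_cong: "(\<And>j k. j \<in> J \<Longrightarrow> \<nu> (j, k) = \<nu>' (j, k)) \<Longrightarrow> prim J \<Lambda> \<nu> = prim J \<Lambda> \<nu>'"
  by (simp add: prim_def)

lemma prim_polys_le:
  assumes "\<And>j. j \<in> J \<Longrightarrow> \<Lambda> j \<in> polys_le t"
  shows "prim J \<Lambda> \<nu> \<in> polys_le (Suc t)"
  unfolding prim_def using assms
  by (intro pvec.subspace_sum[OF subspace_polys_le] dint_polys_le pvec.subspace_scale[OF subspace_polys_le])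

section \<open>Indices and degrees in a monomial set closed under division\<close>

locale mon_basis =
  fixes r :: nat and \<beta> :: "nat \<Rightarrow> 'n::{finite,linorder} mon"
  assumes ms: "monomial_set r \<beta>" and cd: "closed_under_division r \<beta>"
begin

abbreviation rt :: "nat \<Rightarrow> nat" where "rt \<equiv> num_le r \<beta>"

lemma r_pos: "1 \<le> r" and \<beta>_1 [simp]: "\<beta> (Suc 0) = 0" and inj_\<beta>: "inj_on \<beta> {1..r}"
  and mdeg_mono: "1 \<le> i \<Longrightarrow> i \<le> j \<Longrightarrow> j \<le> r \<Longrightarrow> mdeg (\<beta> i) \<le> mdeg (\<beta> j)"
  using ms by (auto simp: monomial_set_def)

lemma rt_le: "rt t \<le> r"
proof -
  have "rt t \<le> card {1..r}" unfolding num_le_def by (intro card_mono) auto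
  then show ?thesis by simp
qed

text \<open>Since \<open>\<beta>\<close> is sorted by degree, the indices of degree at most
  \<open>t\<close> form an initial segment, so \<open>num_le\<close> is a count and a last index at
  once.\<close>

lemma idx_iff: "{1..rt t} = {i \<in> {1..r}. mdeg (\<beta> i) \<le> t}"
proof -
  let ?A = "{i \<in> {1..r}. mdeg (\<beta> i) \<le> t}"
  have fin: "finite ?A" by simp
  have "Suc 0 \<in> ?A" using r_pos by simp
  then have ne: "?A \<noteq> {}" by blast
  define n where "n = Max ?A"
  have n: "n \<in> ?A" unfolding n_def by (rule Max_in[OF fin ne])
  have "?A = {1..n}"
  proof
    show "?A \<subseteq> {1..n}" unfolding n_def using Max_ge[OF fin] by auto
    show "{1..n} \<subseteq> ?A"
    proof
      fix i assume i: "i \<in> {1..n}"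
      then show "i \<in> ?A" using n mdeg_mono[of i n] by auto
    qed
  qed
  moreover then have "rt t = n" by (simp add: num_le_def)
  ultimately show ?thesis by simp
qed

lemma in_idx_iff: "i \<in> {1..rt t} \<longleftrightarrow> i \<in> {1..r} \<and> mdeg (\<beta> i) \<le> t"
  unfolding idx_iff by simp

lemma rt_pos: "1 \<le> rt t"
  using in_idx_iff[of "Suc 0" t] r_pos by simp

lemma rt_mono: "s \<le> t \<Longrightarrow> rt s \<le> rt t"
  using in_idx_iff[of "rt s" s] in_idx_iff[of "rt s" t] rt_pos[of s] by auto

lemma inj_\<beta>_idx: "inj_on \<beta> {1..rt t}"
  by (rule inj_on_subset[OF inj_\<beta>]) (use rt_le in auto)

lemma \<beta>_eq_iff: "i \<in> {1..r} \<Longrightarrow> j \<in> {1..r} \<Longrightarrow> \<beta> i = \<beta> j \<longleftrightarrow> i = j"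
  using inj_\<beta> by (auto dest: inj_onD)

lemma rt_0: "rt 0 = 1"
proof -
  have "i = 1" if "i \<in> {1..rt 0}" for i
    using that in_idx_iff[of i 0] \<beta>_eq_iff[of i 1] r_pos by simp
  then show ?thesis using rt_pos[of 0] by (metis atLeastAtMost_iff order_refl)
qed

lemma mdeg_le_top: "i \<in> {1..r} \<Longrightarrow> mdeg (\<beta> i) \<le> top_deg r \<beta>"
  unfolding top_deg_def by (intro mdeg_mono) auto

lemma rt_top: "rt (top_deg r \<beta>) = r"
  using in_idx_iff[of r "top_deg r \<beta>"] rt_le[of "top_deg r \<beta>"] r_pos by (simp add: top_deg_def)

lemma divide:
  assumes "i \<in> {1..r}" "mdeg (\<beta> i) = Suc t"
  obtains j k where "j \<in> {1..r}" "mdeg (\<beta> j) = t" "\<beta> i = \<beta> j + unit_mon k"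
proof -
  have "\<beta> i \<noteq> 0" using assms by auto
  from top_var_ex1[OF this] obtain k where k: "0 < lookup (\<beta> i) k" by blast
  then obtain j where j: "j \<in> {1..r}" "\<beta> i - unit_mon k = \<beta> j"
    using cd assms(1) unfolding closed_under_division_def by blast
  then have "\<beta> i = \<beta> j + unit_mon k" using minus_unit_mon_add[OF k] by simp
  then show thesis using that[OF j(1), of k] assms(2) by (simp add: mdeg_add)
qed

text \<open>Closure under division puts a monomial into every degree up to the top one. The estimate
  is wanted because \<open>Hilb m\<close> bounds degrees by \<open>m - 1\<close> instead of
  \<open>t\<close>.\<close>

lemma Suc_le_rt:
  assumes "t \<le> top_deg r \<beta>"
  shows "Suc t \<le> rt t"
proof -
  have ex: "\<exists>i\<in>{1..r}. mdeg (\<beta> i) = top_deg r \<beta> - s" if "s \<le> top_deg r \<beta>" for s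
    using that
  proof (induction s)
    case 0
    show ?case using r_pos by (intro bexI[of _ r]) (auto simp: top_deg_def)
  next
    case (Suc s)
    then obtain i where i: "i \<in> {1..r}" "mdeg (\<beta> i) = Suc (top_deg r \<beta> - Suc s)" by auto
    then show ?case by (metis divide)
  qed
  have "{0..t} \<subseteq> (\<lambda>i. mdeg (\<beta> i)) ` {1..rt t}"
  proof
    fix s assume "s \<in> {0..t}"
    then obtain i where "i \<in> {1..r}" "mdeg (\<beta> i) = s"
      using ex[of "top_deg r \<beta> - s"] assms by auto
    then show "s \<in> (\<lambda>i. mdeg (\<beta> i)) ` {1..rt t}"
      using \<open>s \<in> {0..t}\<close> by (intro image_eqI[of _ _ i]) (simp_all only: in_idx_iff, auto)
  qed
  then have "card {0..t} \<le> card {1..rt t}" by (rule surj_card_le[rotated]) simp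
  then show ?thesis by simp
qed

section \<open>Stable spaces with a basis dual to the monomials\<close>

abbreviation co :: "'n mpoly \<Rightarrow> nat \<Rightarrow> complex"
  where "co d i \<equiv> act (\<lambda>_. 0) d (monom_poly (\<beta> i))"

text \<open>A point of the punctual Hilbert scheme in the chart of the monomials of degree at most
  \<open>t\<close>, together with its dual basis. The degree bound records that the basis is
  triangular, which is what separates the stages of the tower.\<close>

definition dual_sys :: "nat \<Rightarrow> 'n mpoly set \<Rightarrow> (nat \<Rightarrow> 'n mpoly) \<Rightarrow> bool"
  where "dual_sys t D \<Lambda> \<longleftrightarrow> pvec.subspace D \<and> (\<forall>k. \<forall>d\<in>D. pd k d \<in> D) \<and>
    (\<forall>i\<in>{1..rt t}. \<Lambda> i \<in> D \<and> \<Lambda> i \<in> polys_le (mdeg (\<beta> i)) \<and>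
      (\<forall>j\<in>{1..rt t}. co (\<Lambda> i) j = (if i = j then 1 else 0))) \<and>
    (\<forall>d\<in>D. d = (\<Sum>i\<in>{1..rt t}. Const (co d i) * \<Lambda> i))"

end

locale dual_system = mon_basis +
  fixes t :: nat and D :: "'a mpoly set" and \<Lambda> :: "nat \<Rightarrow> 'a mpoly"
  assumes dual_sys: "dual_sys t D \<Lambda>"
begin

lemma subspace_D: "pvec.subspace D"
  and pd_D: "d \<in> D \<Longrightarrow> pd k d \<in> D"
  and \<Lambda>_D: "i \<in> {1..rt t} \<Longrightarrow> \<Lambda> i \<in> D"
  and \<Lambda>_polys_le: "i \<in> {1..rt t} \<Longrightarrow> \<Lambda> i \<in> polys_le (mdeg (\<beta> i))"
  and co_\<Lambda>: "i \<in> {1..rt t} \<Longrightarrow> j \<in> {1..rt t} \<Longrightarrow> co (\<Lambda> i) j = (if i = j then 1 else 0)"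
  and expand: "d \<in> D \<Longrightarrow> d = (\<Sum>i\<in>{1..rt t}. Const (co d i) * \<Lambda> i)"
  using dual_sys unfolding dual_sys_def by blast+

lemma co_sum: "j \<in> {1..rt t} \<Longrightarrow> co (\<Sum>i\<in>{1..rt t}. Const (c i) * \<Lambda> i) j = c j"
proof -
  assume j: "j \<in> {1..rt t}"
  have "co (\<Sum>i\<in>{1..rt t}. Const (c i) * \<Lambda> i) j = (\<Sum>i\<in>{1..rt t}. if i = j then c j else 0)"
    unfolding act_sum_left using j co_\<Lambda> by (intro sum.cong) auto
  then show ?thesis using j by simp
qed

lemma eq_by_co: "d \<in> D \<Longrightarrow> e \<in> D \<Longrightarrow> (\<And>i. i \<in> {1..rt t} \<Longrightarrow> co d i = co e i) \<Longrightarrow> d = e"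
  using expand[of d] expand[of e] by simp

lemma sum_\<Lambda>_D: "(\<Sum>i\<in>{1..rt t}. Const (c i) * \<Lambda> i) \<in> D"
  by (intro pvec.subspace_sum pvec.subspace_scale subspace_D \<Lambda>_D)

lemma D_polys_le: "D \<subseteq> polys_le t"
proof
  fix d assume "d \<in> D"
  have "\<Lambda> i \<in> polys_le t" if "i \<in> {1..rt t}" for i
    using \<Lambda>_polys_le[OF that] polys_le_mono[of "mdeg (\<beta> i)" t] that in_idx_iff[of i t] by blast
  then have "(\<Sum>i\<in>{1..rt t}. Const (co d i) * \<Lambda> i) \<in> polys_le t"
    by (intro pvec.subspace_sum pvec.subspace_scale subspace_polys_le)
  then show "d \<in> polys_le t" using expand[OF \<open>d \<in> D\<close>] by simp
qed

lemma family_D: "inj_on \<Lambda> {1..rt t}" "pvec.independent (\<Lambda> ` {1..rt t})"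
    "pvec.span (\<Lambda> ` {1..rt t}) = D" "pvec.dim D = rt t"
proof -
  have 1: "\<exists>c. d = (\<Sum>i\<in>{1..rt t}. Const (c i) * \<Lambda> i)" if "d \<in> D" for d
    by (intro exI) (rule expand[OF that])
  have 2: "\<forall>i\<in>{1..rt t}. c i = 0" if "(\<Sum>i\<in>{1..rt t}. Const (c i) * \<Lambda> i) = 0" for c
    using co_sum[of _ c] that by simp
  show "inj_on \<Lambda> {1..rt t}" "pvec.independent (\<Lambda> ` {1..rt t})" "pvec.span (\<Lambda> ` {1..rt t}) = D"
    "pvec.dim D = rt t"
    using pvec.family_basis[of "{1..rt t}" D \<Lambda>, OF _ 1 2 subspace_D \<Lambda>_D] by simp_all
qed

text \<open>By \<open>act_monom_add_unit\<close> this is the value of \<open>\<Lambda> j\<close> at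
  the monomial with exponent \<open>\<beta> s + unit_mon l\<close>. So the \<mu>-coordinates are the
  structure constants of differentiation on \<open>D\<close>.\<close>

abbreviation \<mu> :: "nat \<Rightarrow> nat \<Rightarrow> 'a \<Rightarrow> complex"
  where "\<mu> j s l \<equiv> co (pd l (\<Lambda> j)) s"

lemma pd_\<Lambda>: "j \<in> {1..rt t} \<Longrightarrow> pd l (\<Lambda> j) = (\<Sum>s\<in>{1..rt t}. Const (\<mu> j s l) * \<Lambda> s)"
  by (intro expand pd_D \<Lambda>_D)

lemma \<mu>_eq_0: "j \<in> {1..rt t} \<Longrightarrow> mdeg (\<beta> j) \<le> mdeg (\<beta> s) \<Longrightarrow> \<mu> j s l = 0"
  unfolding act_monom_add_unit[symmetric]
  using \<Lambda>_polys_le[of j] by (simp add: act_monom_poly polys_le_iff mdeg_add)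

lemma dual_basis_eq: "i \<in> {1..rt t} \<Longrightarrow> dual_basis r \<beta> t D i = \<Lambda> i"
  unfolding dual_basis_def
  by (rule the_equality) (use co_\<Lambda> \<Lambda>_D eq_by_co in auto)

lemma mu_coord_eq: "i \<in> {1..rt t} \<Longrightarrow> mu_coord r \<beta> t D i j k = \<mu> i j k"
  by (simp add: mu_coord_def dual_basis_eq act_monom_add_unit)

lemma H_entry_sum_RComm:
  assumes "\<And>j. j \<in> {1..rt t} \<Longrightarrow> mdeg (\<beta> j) < t'"
  shows "(\<Sum>c\<in>{1..rt t} \<times> UNIV. H_entry \<beta> t' m (RComm s k l) c * \<nu> c) =
    (\<Sum>j\<in>{1..rt t}. if mdeg (\<beta> s) < mdeg (\<beta> j) then m j s l * \<nu> (j, k) - m j s k * \<nu> (j, l) else 0)"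
proof -
  have "(\<Sum>c\<in>{1..rt t} \<times> UNIV. H_entry \<beta> t' m (RComm s k l) c * \<nu> c) =
      (\<Sum>j\<in>{1..rt t}. \<Sum>i\<in>UNIV. H_entry \<beta> t' m (RComm s k l) (j, i) * \<nu> (j, i))"
    unfolding sum.cartesian_product by (intro sum.cong) (simp_all only: case_prod_beta prod.collapse)
  also have "\<dots> = (\<Sum>j\<in>{1..rt t}. if mdeg (\<beta> s) < mdeg (\<beta> j) then m j s l * \<nu> (j, k) - m j s k * \<nu> (j, l) else 0)"
  proof (rule sum.cong)
    fix j assume j: "j \<in> {1..rt t}"
    have "(\<Sum>i\<in>UNIV. ((if i = k then m j s l else 0) - (if i = l then m j s k else 0)) * \<nu> (j, i)) =
        (\<Sum>i\<in>UNIV. if i = k then m j s l * \<nu> (j, k) else 0) - (\<Sum>i\<in>UNIV. if i = l then m j s k * \<nu> (j, l) else 0)"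
      unfolding sum_subtractf[symmetric] by (intro sum.cong) auto
    then show "(\<Sum>i\<in>UNIV. H_entry \<beta> t' m (RComm s k l) (j, i) * \<nu> (j, i)) =
        (if mdeg (\<beta> s) < mdeg (\<beta> j) then m j s l * \<nu> (j, k) - m j s k * \<nu> (j, l) else 0)"
      using assms[OF j] by simp
  qed simp
  finally show ?thesis .
qed

lemma H_entry_sum_RDual:
  assumes "i \<in> {1..rt t}"
  shows "(\<Sum>c\<in>{1..rt t} \<times> UNIV. H_entry \<beta> t' m (RDual i k) c * \<nu> c) = \<nu> (i, k)"
proof -
  have "(\<Sum>c\<in>{1..rt t} \<times> UNIV. H_entry \<beta> t' m (RDual i k) c * \<nu> c) =
      (\<Sum>c\<in>{1..rt t} \<times> UNIV. if c = (i, k) then \<nu> (i, k) else 0)"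
    by (intro sum.cong) (auto split: if_splits)
  then show ?thesis using assms by simp
qed

text \<open>The equations (1)--(2) at the coordinates of \<open>D\<close>.\<close>

definition H_kernel :: "(nat \<times> 'a \<Rightarrow> complex) \<Rightarrow> bool"
  where "H_kernel \<nu> \<longleftrightarrow>
    (\<forall>s\<in>{1..rt t}. \<forall>k l. (\<Sum>j\<in>{1..rt t}. \<mu> j s l * \<nu> (j, k)) = (\<Sum>j\<in>{1..rt t}. \<mu> j s k * \<nu> (j, l))) \<and>
    (\<forall>j\<in>{1..rt t}. \<forall>k. \<forall>i\<in>{1..rt t}. \<beta> j + unit_mon k = \<beta> i \<longrightarrow> \<nu> (j, k) = 0)"

text \<open>Rows exist only for \<open>k < l\<close>, but the equations are antisymmetric in
  \<open>k\<close> and \<open>l\<close>. Agreement of \<open>m\<close> with the coordinates of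
  \<open>D\<close> is needed only towards lower degree, because \<open>H_entry\<close> reads nothing
  else and the other coordinates vanish; thus \<open>m\<close> may come from the unknowns or from
  \<open>mu_coord\<close>.\<close>

lemma H_kernel_iff:
  assumes m: "\<And>j s l. j \<in> {1..rt t} \<Longrightarrow> s \<in> {1..rt t} \<Longrightarrow> mdeg (\<beta> s) < mdeg (\<beta> j) \<Longrightarrow> m j s l = \<mu> j s l"
  shows "H_kernel \<nu> \<longleftrightarrow>
    (\<forall>\<rho>\<in>H_rows r \<beta> (Suc t). (\<Sum>c\<in>cols r \<beta> (Suc t). H_entry \<beta> (Suc t) m \<rho> c * \<nu> c) = 0)"
proof -
  have cols: "cols r \<beta> (Suc t) = {1..rt t} \<times> UNIV" by (simp add: Defs.cols_def)
  have deg: "mdeg (\<beta> j) < Suc t" if "j \<in> {1..rt t}" for j using that in_idx_iff[of j t] by simp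
  have comm_val: "(\<Sum>c\<in>cols r \<beta> (Suc t). H_entry \<beta> (Suc t) m (RComm s k l) c * \<nu> c) =
      (\<Sum>j\<in>{1..rt t}. \<mu> j s l * \<nu> (j, k)) - (\<Sum>j\<in>{1..rt t}. \<mu> j s k * \<nu> (j, l))"
    if "s \<in> {1..rt t}" for s k l
  proof -
    have "(\<Sum>c\<in>cols r \<beta> (Suc t). H_entry \<beta> (Suc t) m (RComm s k l) c * \<nu> c) =
        (\<Sum>j\<in>{1..rt t}. if mdeg (\<beta> s) < mdeg (\<beta> j) then m j s l * \<nu> (j, k) - m j s k * \<nu> (j, l) else 0)"
      unfolding cols by (rule H_entry_sum_RComm) (rule deg)
    also have "\<dots> = (\<Sum>j\<in>{1..rt t}. \<mu> j s l * \<nu> (j, k) - \<mu> j s k * \<nu> (j, l))"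
      using m[OF _ that] \<mu>_eq_0 by (intro sum.cong) (auto simp: not_less)
    finally show ?thesis by (simp only: sum_subtractf)
  qed
  have dual_val: "(\<Sum>c\<in>cols r \<beta> (Suc t). H_entry \<beta> (Suc t) m (RDual i k) c * \<nu> c) = \<nu> (i, k)"
    if "i \<in> {1..rt t}" for i k
    unfolding cols by (rule H_entry_sum_RDual[OF that])
  show ?thesis
  proof
    assume ker: "H_kernel \<nu>"
    show "\<forall>\<rho>\<in>H_rows r \<beta> (Suc t). (\<Sum>c\<in>cols r \<beta> (Suc t). H_entry \<beta> (Suc t) m \<rho> c * \<nu> c) = 0"
    proof
      fix \<rho> assume "\<rho> \<in> H_rows r \<beta> (Suc t)"
      then consider (comm) s k l where "\<rho> = RComm s k l" "s \<in> {1..rt t}"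
        | (dual) j k i where "\<rho> = RDual j k" "j \<in> {1..rt t}" "i \<in> {1..rt t}" "\<beta> j + unit_mon k = \<beta> i"
        unfolding H_rows_def by auto
      then show "(\<Sum>c\<in>cols r \<beta> (Suc t). H_entry \<beta> (Suc t) m \<rho> c * \<nu> c) = 0"
      proof cases
        case comm
        then show ?thesis using ker comm_val[of s k l] by (simp add: H_kernel_def)
      next
        case dual
        then have "\<nu> (j, k) = 0" using ker unfolding H_kernel_def by blast
        then show ?thesis using dual by (simp add: dual_val)
      qed
    qed
  next
    assume rows: "\<forall>\<rho>\<in>H_rows r \<beta> (Suc t). (\<Sum>c\<in>cols r \<beta> (Suc t). H_entry \<beta> (Suc t) m \<rho> c * \<nu> c) = 0"
    have lt: "(\<Sum>j\<in>{1..rt t}. \<mu> j s l * \<nu> (j, k)) = (\<Sum>j\<in>{1..rt t}. \<mu> j s k * \<nu> (j, l))"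
      if "s \<in> {1..rt t}" "k < l" for s k l
    proof -
      have "RComm s k l \<in> H_rows r \<beta> (Suc t)" using that by (simp add: H_rows_def)
      then show ?thesis using rows comm_val[OF that(1), of k l] by simp
    qed
    have "(\<Sum>j\<in>{1..rt t}. \<mu> j s l * \<nu> (j, k)) = (\<Sum>j\<in>{1..rt t}. \<mu> j s k * \<nu> (j, l))"
      if "s \<in> {1..rt t}" for s k l
      using lt[OF that, of k l] lt[OF that, of l k] by (cases k l rule: linorder_cases) auto
    moreover have "\<nu> (j, k) = 0" if "j \<in> {1..rt t}" "i \<in> {1..rt t}" "\<beta> j + unit_mon k = \<beta> i" for j k i
    proof -
      have "RDual j k \<in> H_rows r \<beta> (Suc t)" using that by (auto simp: H_rows_def)
      then show ?thesis using rows dual_val[OF that(1), of k] by simp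
    qed
    ultimately show "H_kernel \<nu>" unfolding H_kernel_def by blast
  qed
qed

abbreviation g :: "(nat \<times> 'a \<Rightarrow> complex) \<Rightarrow> 'a \<Rightarrow> 'a mpoly"
  where "g \<nu> k \<equiv> \<Sum>j\<in>{1..rt t}. Const (\<nu> (j, k)) * \<Lambda> j"

lemma pd_g: "pd l (g \<nu> k) = (\<Sum>s\<in>{1..rt t}. Const (\<Sum>j\<in>{1..rt t}. \<mu> j s l * \<nu> (j, k)) * \<Lambda> s)"
proof (rule eq_by_co)
  show "pd l (g \<nu> k) \<in> D" by (intro pd_D sum_\<Lambda>_D)
  fix s assume s: "s \<in> {1..rt t}"
  have "co (pd l (g \<nu> k)) s = (\<Sum>j\<in>{1..rt t}. \<nu> (j, k) * \<mu> j s l)"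
    by (simp add: pd_sum act_sum_left)
  then show "co (pd l (g \<nu> k)) s = co (\<Sum>s\<in>{1..rt t}. Const (\<Sum>j\<in>{1..rt t}. \<mu> j s l * \<nu> (j, k)) * \<Lambda> s) s"
    using co_sum[OF s] by (simp add: mult.commute)
qed (rule sum_\<Lambda>_D)

text \<open>Both sides express integrability of the prescribed gradient, once for polynomials and
  once in coordinates; the latter are the \<open>RComm\<close> equations.\<close>

lemma pd_g_commute_iff:
  "(\<forall>k l. pd l (g \<nu> k) = pd k (g \<nu> l)) \<longleftrightarrow>
   (\<forall>s\<in>{1..rt t}. \<forall>k l. (\<Sum>j\<in>{1..rt t}. \<mu> j s l * \<nu> (j, k)) = (\<Sum>j\<in>{1..rt t}. \<mu> j s k * \<nu> (j, l)))"
    (is "?L \<longleftrightarrow> ?R")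
proof
  assume ?L
  show ?R
  proof (intro ballI allI)
    fix s k l assume s: "s \<in> {1..rt t}"
    have "co (pd l (g \<nu> k)) s = co (pd k (g \<nu> l)) s" using \<open>?L\<close> by simp
    then show "(\<Sum>j\<in>{1..rt t}. \<mu> j s l * \<nu> (j, k)) = (\<Sum>j\<in>{1..rt t}. \<mu> j s k * \<nu> (j, l))"
      unfolding pd_g co_sum[OF s] .
  qed
next
  assume ?R
  then show ?L unfolding pd_g by (auto intro!: sum.cong)
qed

abbreviation \<Phi> :: "(nat \<times> 'a \<Rightarrow> complex) \<Rightarrow> 'a mpoly"
  where "\<Phi> \<equiv> prim {1..rt t} \<Lambda>"

lemma pd_\<Phi>:
  assumes "H_kernel \<nu>"
  shows "pd k (\<Phi> \<nu>) = g \<nu> k"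
proof -
  have "\<forall>k l. pd l (g \<nu> k) = pd k (g \<nu> l)"
    using assms unfolding pd_g_commute_iff H_kernel_def by blast
  then show ?thesis unfolding prim_def by (intro pd_sum_dint) blast
qed

text \<open>A nonconstant monomial of the set has exponent \<open>\<beta> j + unit_mon k\<close>,
  and the value there is \<open>\<nu> (j, k)\<close>, which the \<open>RDual\<close> equations set
  to zero.\<close>

lemma co_\<Phi>:
  assumes "H_kernel \<nu>" "i \<in> {1..rt t}"
  shows "co (\<Phi> \<nu>) i = 0"
proof (cases "mdeg (\<beta> i)")
  case 0
  then have "\<beta> i = 0" by simp
  then show ?thesis by (simp add: act_monom_poly)
next
  case (Suc n)
  have i: "i \<in> {1..r}" "mdeg (\<beta> i) \<le> t" using assms(2) in_idx_iff[of i t] by auto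
  obtain j k where jk: "j \<in> {1..r}" "mdeg (\<beta> j) = n" "\<beta> i = \<beta> j + unit_mon k"
    using divide[OF i(1) Suc] .
  then have j: "j \<in> {1..rt t}" using i(2) Suc in_idx_iff[of j t] by simp
  have "co (\<Phi> \<nu>) i = co (g \<nu> k) j"
    unfolding jk(3) act_monom_add_unit pd_\<Phi>[OF assms(1)] ..
  also have "\<dots> = \<nu> (j, k)" by (rule co_sum[OF j])
  also have "\<dots> = 0" using assms j jk(3) unfolding H_kernel_def by metis
  finally show ?thesis .
qed

text \<open>Converse of \<open>pd_\<Phi>\<close> and \<open>co_\<Phi>\<close>: symmetry of the mixed
  derivatives of \<open>P\<close> gives one half of the kernel equations, vanishing at the monomials
  the other. So the integrals of \<open>D\<close> modulo \<open>D\<close> are parametrised by the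
  kernel of \<open>H\<close>.\<close>

lemma integral_eq_\<Phi>:
  assumes P: "\<And>k. pd k P \<in> D" "\<And>i. i \<in> {1..rt t} \<Longrightarrow> co P i = 0"
  defines "\<nu> \<equiv> \<lambda>(j, k). co (pd k P) j"
  shows "H_kernel \<nu>" "P = \<Phi> \<nu>" "\<And>k. pd k P = g \<nu> k"
proof -
  show g: "pd k P = g \<nu> k" for k using expand[OF P(1)[of k]] by (simp add: \<nu>_def)
  have "\<forall>k l. pd l (g \<nu> k) = pd k (g \<nu> l)" unfolding g[symmetric] by (simp add: pd_commute)
  moreover have "\<nu> (j, k) = 0" if "i \<in> {1..rt t}" "\<beta> j + unit_mon k = \<beta> i" for j k i
    using P(2)[OF that(1)] that(2)[symmetric] by (simp add: \<nu>_def act_monom_add_unit)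
  ultimately show "H_kernel \<nu>" unfolding pd_g_commute_iff H_kernel_def by blast
  have "lookup P 0 = co P 1" by (simp add: act_monom_poly)
  also have "\<dots> = 0" using rt_pos by (intro P(2)) simp
  finally have "P = (\<Sum>k\<in>UNIV. dint k (pd k P))" using eq_Const_plus_sum_dint[of P] by simp
  then show "P = \<Phi> \<nu>" unfolding prim_def g[symmetric] .
qed

text \<open>The integrals are the direct sum of \<open>D\<close> and the image under
  \<open>\<Phi>\<close> of the kernel of \<open>H\<close>, and rank plus nullity is the number of
  columns. As the right-hand side does not involve \<open>D\<close>, small dimension of the
  integrals means large rank.\<close>

lemma dim_integrals:
  "pvec.dim (integrals (Suc t) D) + H_rank r \<beta> (Suc t) D = rt t + card (cols r \<beta> (Suc t))"
proof -
  let ?C = "cols r \<beta> (Suc t)" and ?R = "H_rows r \<beta> (Suc t)" and ?M = "H_at r \<beta> (Suc t) D"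
  have finC: "finite ?C" by (simp add: Defs.cols_def)
  have mu: "mu_coord r \<beta> t D j s l = \<mu> j s l" if "j \<in> {1..rt t}" for j s l
    using mu_coord_eq[OF that] .
  have ker: "H_kernel \<nu> \<longleftrightarrow> (\<forall>\<rho>\<in>?R. (\<Sum>c\<in>?C. ?M \<rho> c * \<nu> c) = 0)" for \<nu>
    unfolding H_at_def using H_kernel_iff[of "mu_coord r \<beta> t D" \<nu>] mu by simp
  obtain C2 \<kappa> where C2: "C2 \<subseteq> ?C" "card C2 + mat_rank ?R ?C ?M = card ?C"
    and \<kappa>C: "\<And>c. c \<in> C2 \<Longrightarrow> \<kappa> c \<in> cspace ?C"
    and \<kappa>0: "\<And>c \<rho>. c \<in> C2 \<Longrightarrow> \<rho> \<in> ?R \<Longrightarrow> (\<Sum>c'\<in>?C. ?M \<rho> c' * \<kappa> c c') = 0"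
    and \<kappa>1: "\<And>c c'. c \<in> C2 \<Longrightarrow> c' \<in> C2 \<Longrightarrow> \<kappa> c c' = (if c' = c then 1 else 0)"
    and \<kappa>2: "\<And>\<nu> c'. (\<And>\<rho>. \<rho> \<in> ?R \<Longrightarrow> (\<Sum>c\<in>?C. ?M \<rho> c * \<nu> c) = 0) \<Longrightarrow> c' \<in> ?C \<Longrightarrow>
        \<nu> c' = (\<Sum>c\<in>C2. \<nu> c * \<kappa> c c')"
    by (rule kernel_basis[OF finC, of ?R ?M]) blast
  have fin2: "finite C2" using C2(1) finC by (rule finite_subset)
  have \<kappa>ker: "H_kernel (\<kappa> c)" if "c \<in> C2" for c unfolding ker using \<kappa>0[OF that] by blast
  let ?J = "{1..rt t} <+> C2"
  define e where "e x = (case x of Inl i \<Rightarrow> \<Lambda> i | Inr c \<Rightarrow> \<Phi> (\<kappa> c))" for x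
  have finJ: "finite ?J" using fin2 by simp
  have sumJ: "(\<Sum>x\<in>?J. Const (a x) * e x) =
      (\<Sum>i\<in>{1..rt t}. Const (a (Inl i)) * \<Lambda> i) + \<Phi> (\<lambda>c'. \<Sum>c\<in>C2. a (Inr c) * \<kappa> c c')" for a
    using fin2 by (simp add: sum.Plus e_def prim_lincomb)
  have sub: "pvec.subspace (integrals (Suc t) D)"
    using subspace_D subspace_polys_le[of "Suc t"]
    by (auto simp: integrals_def pvec.subspace_def)
  have D_int: "D \<subseteq> integrals (Suc t) D"
    using D_polys_le polys_le_mono[of t "Suc t"] pd_D by (auto simp: integrals_def)
  have \<Phi>_int: "\<Phi> \<nu> \<in> integrals (Suc t) D" if "H_kernel \<nu>" for \<nu>
    using pd_\<Phi>[OF that] sum_\<Lambda>_D D_polys_le \<Lambda>_D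
    by (auto simp: integrals_def intro!: prim_polys_le)
  have "pvec.dim (integrals (Suc t) D) = card ?J"
  proof (rule pvec.family_basis(4)[OF finJ _ _ sub])
    show "e x \<in> integrals (Suc t) D" if "x \<in> ?J" for x
      using that D_int \<Lambda>_D \<Phi>_int \<kappa>ker by (auto simp: e_def)
  next
    fix P assume P: "P \<in> integrals (Suc t) D"
    define S where "S = (\<Sum>i\<in>{1..rt t}. Const (co P i) * \<Lambda> i)"
    have SD: "S \<in> D" unfolding S_def by (rule sum_\<Lambda>_D)
    define P' where "P' = P - S"
    have P': "pd k P' \<in> D" for k
      using P SD pd_D subspace_D by (auto simp: P'_def integrals_def intro!: pvec.subspace_diff)
    have coP': "co P' i = 0" if "i \<in> {1..rt t}" for i
      using co_sum[OF that] by (simp add: P'_def S_def)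
    define \<nu> where "\<nu> = (\<lambda>(j, k). co (pd k P') j)"
    have \<nu>: "H_kernel \<nu>" "P' = \<Phi> \<nu>"
      using integral_eq_\<Phi>(1,2)[of P', OF P' coP'] by (simp_all add: \<nu>_def)
    have "\<nu> c' = (\<Sum>c\<in>C2. \<nu> c * \<kappa> c c')" if "c' \<in> ?C" for c'
      using \<kappa>2[of \<nu> c'] \<nu>(1) that by (simp add: ker)
    then have "\<Phi> \<nu> = \<Phi> (\<lambda>c'. \<Sum>c\<in>C2. \<nu> c * \<kappa> c c')"
      by (intro prim_cong) (simp add: Defs.cols_def)
    then have "P = (\<Sum>x\<in>?J. Const (case_sum (co P) \<nu> x) * e x)"
      unfolding sumJ using \<nu>(2) by (simp add: P'_def S_def algebra_simps)
    then show "\<exists>a. P = (\<Sum>x\<in>?J. Const (a x) * e x)" by blast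
  next
    fix a :: "nat + nat \<times> 'a \<Rightarrow> complex" assume a: "(\<Sum>x\<in>?J. Const (a x) * e x) = 0"
    define \<nu> where "\<nu> c' = (\<Sum>c\<in>C2. a (Inr c) * \<kappa> c c')" for c'
    have \<nu>: "H_kernel \<nu>"
      unfolding ker
    proof
      fix \<rho> assume \<rho>: "\<rho> \<in> ?R"
      have "(\<Sum>c'\<in>?C. ?M \<rho> c' * \<nu> c') = (\<Sum>c\<in>C2. a (Inr c) * (\<Sum>c'\<in>?C. ?M \<rho> c' * \<kappa> c c'))"
        unfolding \<nu>_def sum_distrib_left by (subst sum.swap) (simp add: mult.left_commute)
      then show "(\<Sum>c'\<in>?C. ?M \<rho> c' * \<nu> c') = 0" using \<kappa>0 \<rho> by simp
    qed
    have z: "(\<Sum>i\<in>{1..rt t}. Const (a (Inl i)) * \<Lambda> i) + \<Phi> \<nu> = 0"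
      using a unfolding sumJ \<nu>_def .
    have aI: "a (Inl i) = 0" if "i \<in> {1..rt t}" for i
      using arg_cong[OF z, of "\<lambda>p. co p i"] co_sum[OF that] co_\<Phi>[OF \<nu> that] by simp
    then have "\<Phi> \<nu> = 0" using z by simp
    then have g0: "g \<nu> k = 0" for k using pd_\<Phi>[OF \<nu>, of k] by simp
    have "a (Inr c) = 0" if c: "c \<in> C2" for c
    proof -
      obtain j k where jk: "c = (j, k)" "j \<in> {1..rt t}" using c C2(1) by (auto simp: Defs.cols_def)
      have "\<nu> c = co (g \<nu> k) j" using co_sum[OF jk(2)] by (simp add: jk(1))
      then have "\<nu> c = 0" using g0 by simp
      moreover have "\<nu> c = (\<Sum>c'\<in>C2. if c' = c then a (Inr c) else 0)"
        unfolding \<nu>_def using \<kappa>1 c by (intro sum.cong) auto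
      ultimately show ?thesis using c fin2 by simp
    qed
    then show "\<forall>x\<in>?J. a x = 0" using aI by auto
  qed
  moreover have "card ?J = rt t + card C2" using fin2 by (simp add: card_Plus)
  ultimately show ?thesis using C2(2) by (simp add: H_rank_def)
qed

end

section \<open>The regular part of the punctual Hilbert scheme\<close>

context mon_basis
begin

text \<open>A basis-free form of the nonvanishing of the Plucker coordinate of the monomials of
  degree at most \<open>t\<close>; see \<open>pluecker_B_neq_0_iff\<close>.\<close>

definition inj_B :: "nat \<Rightarrow> 'n mpoly set \<Rightarrow> bool"
  where "inj_B t E \<longleftrightarrow> (\<forall>e\<in>E. (\<forall>i\<in>{1..rt t}. lookup e (\<beta> i) = 0) \<longrightarrow> e = 0)"

text \<open>Dual with respect to plain coefficients, as quotients of Plucker coordinates are.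
  \<open>dual_sys\<close> uses functional values instead, and the two normalisations differ by
  \<open>mon_fact\<close>.\<close>

definition dual_family :: "nat \<Rightarrow> 'n mpoly set \<Rightarrow> (nat \<Rightarrow> 'n mpoly) \<Rightarrow> bool"
  where "dual_family t E w \<longleftrightarrow> (\<forall>i\<in>{1..rt t}. w i \<in> E \<and>
    (\<forall>j\<in>{1..rt t}. lookup (w i) (\<beta> j) = (if i = j then 1 else 0)))"

lemma dual_family_ex:
  assumes "pvec.subspace E" "pvec.dim E = rt t" "inj_B t E"
  shows "\<exists>w. dual_family t E w"
proof -
  have "\<exists>w\<in>E. \<forall>m'\<in>\<beta> ` {1..rt t}. lookup w m' = (if m' = \<beta> i then 1 else 0)" if "i \<in> {1..rt t}" for i
  proof (rule dual_family_exists[OF _ assms(1)])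
    show "e = 0" if "e \<in> E" "\<forall>m\<in>\<beta> ` {1..rt t}. lookup e m = 0" for e
      using assms(3) that by (simp add: inj_B_def)
    show "pvec.dim E = card (\<beta> ` {1..rt t})"
      using assms(2) card_image[OF inj_\<beta>_idx[of t]] by simp
  qed (use that in auto)
  then have "\<forall>i. \<exists>w. i \<in> {1..rt t} \<longrightarrow> w \<in> E \<and>
      (\<forall>j\<in>{1..rt t}. lookup w (\<beta> j) = (if \<beta> j = \<beta> i then 1 else 0))" by blast
  then obtain w where w: "\<And>i. i \<in> {1..rt t} \<Longrightarrow> w i \<in> E \<and>
      (\<forall>j\<in>{1..rt t}. lookup (w i) (\<beta> j) = (if \<beta> j = \<beta> i then 1 else 0))"
    using choice[of "\<lambda>i w. i \<in> {1..rt t} \<longrightarrow> w \<in> E \<and>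
      (\<forall>j\<in>{1..rt t}. lookup w (\<beta> j) = (if \<beta> j = \<beta> i then 1 else 0))"] by blast
  have "\<beta> j = \<beta> i \<longleftrightarrow> i = j" if "i \<in> {1..rt t}" "j \<in> {1..rt t}" for i j
    using inj_\<beta>_idx[of t] that by (auto dest: inj_onD)
  then show ?thesis using w unfolding dual_family_def by (intro exI[of _ w]) simp
qed

lemma dual_family_expand:
  assumes w: "dual_family t E w" and E: "pvec.subspace E" "inj_B t E" and e: "e \<in> E"
  shows "e = (\<Sum>i\<in>{1..rt t}. Const (lookup e (\<beta> i)) * w i)"
proof -
  let ?s = "\<Sum>i\<in>{1..rt t}. Const (lookup e (\<beta> i)) * w i"
  have "?s \<in> E" using w by (intro pvec.subspace_sum pvec.subspace_scale E(1)) (auto simp: dual_family_def)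
  have "lookup ?s (\<beta> j) = lookup e (\<beta> j)" if "j \<in> {1..rt t}" for j
  proof -
    have "lookup ?s (\<beta> j) = (\<Sum>i\<in>{1..rt t}. if i = j then lookup e (\<beta> j) else 0)"
      unfolding lookup_sum using w that by (intro sum.cong) (auto simp: dual_family_def)
    then show ?thesis using that by simp
  qed
  then have "\<forall>j\<in>{1..rt t}. lookup (e - ?s) (\<beta> j) = 0" by (simp only: lookup_minus) simp
  moreover have "e - ?s \<in> E" by (rule pvec.subspace_diff[OF E(1) e \<open>?s \<in> E\<close>])
  ultimately have "e - ?s = 0" using E(2) unfolding inj_B_def by blast
  then show ?thesis by simp
qed

lemma dual_sysI:
  assumes w: "dual_family t E w" and E: "pvec.subspace E" "inj_B t E"
    and deg: "\<And>i. i \<in> {1..rt t} \<Longrightarrow> w i \<in> polys_le (mdeg (\<beta> i))"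
    and pd: "\<And>i k. i \<in> {1..rt t} \<Longrightarrow> pd k (w i) \<in> E"
  shows "dual_sys t E (\<lambda>i. Const (1 / mon_fact (\<beta> i)) * w i)"
proof -
  have "pd k d \<in> E" if d: "d \<in> E" for k d
  proof -
    have "pd k d = (\<Sum>i\<in>{1..rt t}. Const (lookup d (\<beta> i)) * pd k (w i))"
      by (subst dual_family_expand[OF w E d]) (simp add: pd_sum)
    then show ?thesis using pd by (auto intro!: pvec.subspace_sum pvec.subspace_scale E(1))
  qed
  moreover have "d = (\<Sum>i\<in>{1..rt t}. Const (co d i) * (Const (1 / mon_fact (\<beta> i)) * w i))" if "d \<in> E" for d
    by (subst dual_family_expand[OF w E that])
      (simp add: act_monom_poly Const_mult[symmetric] mult.assoc[symmetric])
  moreover have "Const (1 / mon_fact (\<beta> i)) * w i \<in> E" if "i \<in> {1..rt t}" for i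
    using w that by (intro pvec.subspace_scale E(1)) (simp add: dual_family_def)
  moreover have "Const (1 / mon_fact (\<beta> i)) * w i \<in> polys_le (mdeg (\<beta> i))" if "i \<in> {1..rt t}" for i
    by (intro pvec.subspace_scale subspace_polys_le deg that)
  moreover have "co (Const (1 / mon_fact (\<beta> i)) * w i) j = (if i = j then 1 else 0)"
    if "i \<in> {1..rt t}" "j \<in> {1..rt t}" for i j
    using w that by (simp add: dual_family_def act_monom_poly)
  ultimately show ?thesis unfolding dual_sys_def using E(1) by blast
qed

lemma dual_sys_imp_inj_B:
  assumes "dual_sys t D \<Lambda>"
  shows "inj_B t D"
  unfolding inj_B_def
proof (intro ballI impI)
  interpret dual_system r \<beta> t D \<Lambda> by unfold_locales (rule assms)
  fix e assume e: "e \<in> D" "\<forall>i\<in>{1..rt t}. lookup e (\<beta> i) = 0"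
  then show "e = 0" using expand[OF e(1)] by (simp add: act_monom_poly)
qed

lemma dual_sys_dual_family:
  assumes "dual_sys t D \<Lambda>"
  shows "dual_family t D (\<lambda>i. Const (mon_fact (\<beta> i)) * \<Lambda> i)"
  unfolding dual_family_def
proof (intro ballI conjI)
  interpret dual_system r \<beta> t D \<Lambda> by unfold_locales (rule assms)
  fix i assume i: "i \<in> {1..rt t}"
  show "Const (mon_fact (\<beta> i)) * \<Lambda> i \<in> D" by (intro pvec.subspace_scale subspace_D \<Lambda>_D i)
  fix j assume j: "j \<in> {1..rt t}"
  have "mon_fact (\<beta> j) * lookup (\<Lambda> i) (\<beta> j) = (if i = j then 1 else 0)"
    using co_\<Lambda>[OF i j] by (simp only: act_monom_poly)
  then show "lookup (Const (mon_fact (\<beta> i)) * \<Lambda> i) (\<beta> j) = (if i = j then 1 else 0)"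
    by (auto split: if_splits)
qed

lemma dual_sys_Gr: "dual_sys t D \<Lambda> \<Longrightarrow> D \<in> Gr (rt t) t"
proof -
  assume "dual_sys t D \<Lambda>"
  then interpret dual_system r \<beta> t D \<Lambda> by unfold_locales
  show ?thesis using subspace_D D_polys_le family_D(4) by (simp add: Gr_def)
qed

definition ms_list :: "nat \<Rightarrow> 'n mon list"
  where "ms_list t = map \<beta> [1..<Suc (rt t)]"

lemma length_ms_list [simp]: "length (ms_list t) = rt t"
  and nth_ms_list: "b < rt t \<Longrightarrow> ms_list t ! b = \<beta> (Suc b)"
  and set_ms_list: "set (ms_list t) = \<beta> ` {1..rt t}"
  by (auto simp: ms_list_def nth_append simp del: upt_Suc)

lemma pluecker_B_neq_0_iff:
  assumes "basis_list E us" "pvec.dim E = rt t"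
  shows "pluecker us (ms_list t) \<noteq> 0 \<longleftrightarrow> inj_B t E"
  using pluecker_neq_0_iff[OF assms(1), of "ms_list t"] basis_list_length[OF assms(1)] assms(2)
  by (simp add: set_ms_list inj_B_def)

lemma pluecker_B_replace:
  assumes us: "basis_list E us" "pvec.dim E = rt t" and inj: "inj_B t E" and w: "dual_family t E w"
    and j: "j \<in> {1..rt t}"
  shows "pluecker us ((ms_list t)[j - 1 := m]) = lookup (w j) m * pluecker us (ms_list t)"
proof -
  have len: "length us = rt t" using basis_list_length[OF us(1)] us(2) by simp
  have "pluecker us ((ms_list t)[j - 1 := m]) = lookup (w (Suc (j - 1))) m * pluecker us (ms_list t)"
  proof (rule pluecker_replace[OF us(1), where w = "\<lambda>b. w (Suc b)"])
    show "w (Suc b) \<in> E" if "b < length us" for b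
      using w that len by (simp add: dual_family_def)
    show "lookup (w (Suc b)) (ms_list t ! b') = (if b = b' then 1 else 0)"
      if "b < length us" "b' < length us" for b b'
      using w that len by (simp add: dual_family_def nth_ms_list)
    show "e = 0" if "e \<in> E" "\<forall>m\<in>set (ms_list t). lookup e m = 0" for e
      using inj that by (simp add: inj_B_def set_ms_list)
  qed (use j len in auto)
  then show ?thesis using j by simp
qed

text \<open>Elements of \<open>D\<close> have degree at most \<open>t\<close>, so their coefficients
  at the monomials of degree \<open>Suc t\<close> vanish of themselves.\<close>

lemma inj_B_sub:
  assumes "D \<subseteq> E" "D \<subseteq> polys_le t" "inj_B (Suc t) E"
  shows "inj_B t D"
  unfolding inj_B_def
proof (intro ballI impI)
  fix e assume e: "e \<in> D" "\<forall>i\<in>{1..rt t}. lookup e (\<beta> i) = 0"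
  have "lookup e (\<beta> i) = 0" if i: "i \<in> {1..rt (Suc t)}" for i
  proof (cases "i \<in> {1..rt t}")
    case False
    then have "t < mdeg (\<beta> i)" using i in_idx_iff[of i "Suc t"] in_idx_iff[of i t] by auto
    then show ?thesis using e(1) assms(2) by (auto simp: polys_le_iff)
  qed (use e in auto)
  then show "e = 0" using assms(1,3) e(1) unfolding inj_B_def by blast
qed

text \<open>The degree bounds are the point. For an old index the dual elements of \<open>E\<close>
  and of \<open>D\<close> coincide, because their difference vanishes at all monomials of the chart;
  for a new index the bound on \<open>E\<close> is the required one.\<close>

lemma dual_sys_extend:
  assumes D: "dual_sys t D \<Lambda>" and E: "E \<in> Gr (rt (Suc t)) (Suc t)" "D \<subseteq> E" "\<And>k. pd k ` E \<subseteq> D"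
    and inj: "inj_B (Suc t) E"
  shows "\<exists>\<Lambda>'. dual_sys (Suc t) E \<Lambda>'"
proof -
  interpret dual_system r \<beta> t D \<Lambda> by unfold_locales (rule D)
  have sub: "pvec.subspace E" and dim: "pvec.dim E = rt (Suc t)" and le: "E \<subseteq> polys_le (Suc t)"
    using E(1) by (auto simp: Gr_def)
  obtain w where w: "dual_family (Suc t) E w" using dual_family_ex[OF sub dim inj] by blast
  have "w i \<in> polys_le (mdeg (\<beta> i))" if i: "i \<in> {1..rt (Suc t)}" for i
  proof (cases "i \<in> {1..rt t}")
    case True
    define v where "v = Const (mon_fact (\<beta> i)) * \<Lambda> i"
    have v: "v \<in> D" "\<And>j. j \<in> {1..rt t} \<Longrightarrow> lookup v (\<beta> j) = (if i = j then 1 else 0)"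
      using dual_sys_dual_family[OF D] True unfolding dual_family_def v_def by blast+
    have "lookup (w i - v) (\<beta> j) = 0" if j: "j \<in> {1..rt (Suc t)}" for j
    proof (cases "j \<in> {1..rt t}")
      case True
      then show ?thesis using w v(2) i j by (simp add: dual_family_def lookup_minus)
    next
      case False
      then have "t < mdeg (\<beta> j)" using j in_idx_iff[of j "Suc t"] in_idx_iff[of j t] by auto
      then have "lookup v (\<beta> j) = 0" using v(1) D_polys_le by (auto simp: polys_le_iff)
      moreover have "i \<noteq> j" using False \<open>i \<in> {1..rt t}\<close> by blast
      ultimately show ?thesis using w i j by (simp add: dual_family_def lookup_minus)
    qed
    moreover have "w i - v \<in> E"
      using w i v(1) E(2) by (intro pvec.subspace_diff sub) (auto simp: dual_family_def)
    ultimately have "w i - v = 0" using inj unfolding inj_B_def by blast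
    moreover have "v \<in> polys_le (mdeg (\<beta> i))"
      unfolding v_def by (intro pvec.subspace_scale subspace_polys_le \<Lambda>_polys_le True)
    ultimately show ?thesis by simp
  next
    case False
    then have "mdeg (\<beta> i) = Suc t" using i in_idx_iff[of i "Suc t"] in_idx_iff[of i t] by auto
    then show ?thesis using w i le by (auto simp: dual_family_def)
  qed
  moreover have "pd k (w i) \<in> E" if "i \<in> {1..rt (Suc t)}" for i k
    using w that E(2,3) unfolding dual_family_def by blast
  ultimately show ?thesis using dual_sysI[OF w sub inj] by blast
qed

definition tower :: "nat \<Rightarrow> ('n mpoly set \<times> 'n mpoly set) set"
  where "tower t = {(D, E). D \<in> Hilb_reg r \<beta> t \<and>
            (\<forall>D'\<in>Hilb_reg r \<beta> t.
               pvec.dim (integrals (Suc t) D) \<le> pvec.dim (integrals (Suc t) D')) \<and>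
            E \<in> Gr (rt (Suc t)) (Suc t) \<and> D \<subseteq> E \<and> (\<forall>k. pd k ` E \<subseteq> D)}"

lemma Hilb_reg_Suc:
  "Hilb_reg r \<beta> (Suc t) = snd ` zariski_closure (rt t) t (rt (Suc t)) (Suc t) (tower t)"
  by (simp add: tower_def)

declare Hilb_reg.simps(2) [simp del]

text \<open>Transfers an identity from the tower to its closure. The applications involve only the
  second factor, so of the first Plucker vector mere existence is recorded.\<close>

lemma Hilb_reg_closure:
  fixes Q :: "('n mon list + 'n mon list) mpoly"
  assumes "E \<in> Hilb_reg r \<beta> (Suc t)"
  shows "E \<in> Gr (rt (Suc t)) (Suc t)"
    and "basis_list E ws \<Longrightarrow>
      (\<And>D' E' us' ws'. (D', E') \<in> tower t \<Longrightarrow> basis_list E' ws' \<Longrightarrow> ev Q (case_sum (pluecker us') (pluecker ws')) = 0)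
      \<Longrightarrow> \<exists>us. ev Q (case_sum (pluecker us) (pluecker ws)) = 0"
proof -
  obtain D where D: "(D, E) \<in> zariski_closure (rt t) t (rt (Suc t)) (Suc t) (tower t)"
    using assms unfolding Hilb_reg_Suc by auto
  then have D_Gr: "D \<in> Gr (rt t) t" and "E \<in> Gr (rt (Suc t)) (Suc t)"
    and van: "\<And>Q. (\<forall>(D', E')\<in>tower t. vanishes_at Q D' E') \<Longrightarrow> vanishes_at Q D E"
    by (auto simp: zariski_closure_def)
  then show "E \<in> Gr (rt (Suc t)) (Suc t)" by blast
  obtain us where us: "basis_list D us"
    using basis_list_exists[of D] D_Gr rt_pos[of t] by (auto simp: Gr_def)
  assume ws: "basis_list E ws"
    and Q: "\<And>D' E' us' ws'. (D', E') \<in> tower t \<Longrightarrow> basis_list E' ws' \<Longrightarrow> ev Q (case_sum (pluecker us') (pluecker ws')) = 0"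
  have "vanishes_at Q D E"
    by (rule van) (auto simp: vanishes_at_def intro: Q)
  then show "\<exists>us. ev Q (case_sum (pluecker us) (pluecker ws)) = 0"
    using us ws unfolding vanishes_at_def by blast
qed

lemma Hilb_reg_Gr: "E \<in> Hilb_reg r \<beta> t \<Longrightarrow> E \<in> Gr (rt t) t"
proof (cases t)
  case 0
  assume "E \<in> Hilb_reg r \<beta> t"
  then have E: "E = pvec.span {1}" by (simp add: 0)
  have "pvec.independent {1 :: 'n mpoly}" by simp
  then have "pvec.dim E = 1" unfolding E by (simp add: pvec.dim_eq_card_independent)
  moreover have "E \<subseteq> polys_le 0"
    unfolding E by (rule pvec.span_minimal[OF _ subspace_polys_le])
      (auto simp: polys_le_iff lookup_one when_def)
  ultimately show ?thesis using rt_0 by (simp add: Gr_def 0 E)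
next
  case (Suc s)
  assume "E \<in> Hilb_reg r \<beta> t"
  then show ?thesis using Hilb_reg_closure(1)[of E s] by (simp add: Suc)
qed

lemma Gr_D:
  assumes "E \<in> Gr m t" shows "pvec.subspace E" "pvec.dim E = m" "E \<subseteq> polys_le t"
  using assms by (auto simp: Gr_def)

text \<open>
  On the chart where the Plucker coordinate of \<open>B\<^sub>t\<close> does not vanish, the dual basis is a quotient of
  Plucker coordinates, so that its triangular shape and the stability under derivation are closed
  conditions. Multiplying them by that coordinate makes them hold on the whole closure.
\<close>

theorem Hilb_reg_dual_sys:
  assumes "E \<in> Hilb_reg r \<beta> t" "inj_B t E"
  shows "\<exists>\<Lambda>. dual_sys t E \<Lambda>"
  using assms
proof (induction t arbitrary: E)
  case 0
  then have E: "E = pvec.span {1}" by simp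
  have idx: "{1..rt 0} = {1}" by (simp add: rt_0)
  have "dual_family 0 E (\<lambda>_. 1)"
    unfolding dual_family_def idx by (auto simp: E pvec.span_base lookup_one)
  moreover have "pvec.subspace E" by (simp add: E)
  moreover have "(1 :: 'n mpoly) \<in> polys_le n" for n by (auto simp: polys_le_iff lookup_one when_def)
  moreover have "pd k 1 \<in> E" for k by (simp add: E pvec.span_zero)
  ultimately show ?case using dual_sysI[of 0 E "\<lambda>_. 1"] 0(2) by blast
next
  case (Suc t)
  let ?T = "rt (Suc t)" and ?ms = "ms_list (Suc t)"
  have E_Gr: "E \<in> Gr ?T (Suc t)" by (rule Hilb_reg_Gr[OF Suc.prems(1)])
  note E = Gr_D[OF E_Gr]
  obtain w where w: "dual_family (Suc t) E w" using dual_family_ex[OF E(1,2) Suc.prems(2)] by blast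
  obtain ws where ws: "basis_list E ws" using basis_list_exists[OF E(1)] E(2) rt_pos[of "Suc t"] by auto
  have p_neq: "pluecker ws ?ms \<noteq> 0" using pluecker_B_neq_0_iff[OF ws E(2)] Suc.prems(2) by simp
  have rep: "pluecker ws (?ms[j - 1 := m]) = lookup (w j) m * pluecker ws ?ms" if "j \<in> {1..?T}" for j m
    by (rule pluecker_B_replace[OF ws E(2) Suc.prems(2) w that])
  have tower_sys: "\<exists>\<Lambda>. dual_sys (Suc t) E' \<Lambda>" if S: "(D', E') \<in> tower t" and inj: "inj_B (Suc t) E'" for D' E'
  proof -
    have D': "D' \<in> Hilb_reg r \<beta> t" "E' \<in> Gr ?T (Suc t)" "D' \<subseteq> E'" "\<And>k. pd k ` E' \<subseteq> D'"
      using S by (auto simp: tower_def)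
    have "inj_B t D'" by (rule inj_B_sub[OF D'(3) Gr_D(3)[OF Hilb_reg_Gr[OF D'(1)]] inj])
    then obtain \<Lambda> where "dual_sys t D' \<Lambda>" using Suc.IH[OF D'(1)] by blast
    then show ?thesis by (rule dual_sys_extend[OF _ D'(2-4) inj])
  qed
  \<comment> \<open>Tower points off the chart satisfy the identity by \<open>B\<close>, those on
    the chart by \<open>Q\<close>, whose hypotheses \<open>tower_sys\<close> provides.\<close>
  have closed: "\<exists>us. ev Q (case_sum (pluecker us) (pluecker ws)) = 0"
    if Q: "\<And>E' us' ws' \<Lambda>. dual_sys (Suc t) E' \<Lambda> \<Longrightarrow> pvec.dim E' = ?T \<Longrightarrow> inj_B (Suc t) E' \<Longrightarrow> basis_list E' ws' \<Longrightarrow>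
      ev Q (case_sum (pluecker us') (pluecker ws')) = 0"
      and B: "\<And>us' ws'. pluecker ws' ?ms = 0 \<Longrightarrow> ev Q (case_sum (pluecker us') (pluecker ws')) = 0"
    for Q :: "('n mon list + 'n mon list) mpoly"
  proof (rule Hilb_reg_closure(2)[OF Suc.prems(1) ws])
    fix D' E' us' ws' assume S: "(D', E') \<in> tower t" and ws': "basis_list E' ws'"
    have dim: "pvec.dim E' = ?T" using S by (auto simp: tower_def Gr_def)
    show "ev Q (case_sum (pluecker us') (pluecker ws')) = 0"
    proof (cases "inj_B (Suc t) E'")
      case True
      then show ?thesis using tower_sys[OF S True] Q[OF _ dim True ws'] by blast
    next
      case False
      then show ?thesis using pluecker_B_neq_0_iff[OF ws' dim] B by blast
    qed
  qed
  have deg: "w j \<in> polys_le (mdeg (\<beta> j))" if j: "j \<in> {1..?T}" for j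
    unfolding polys_le_iff
  proof (intro allI impI)
    fix m :: "'n mon" assume m: "mdeg (\<beta> j) < mdeg m"
    \<comment> \<open>On the chart this is the square of the \<open>B\<close>-coordinate times the
      coefficient of \<open>m\<close> in the \<open>j\<close>-th dual element; the first factor
      makes it vanish off the chart.\<close>
    define Q :: "('n mon list + 'n mon list) mpoly" where "Q = Var (Inr ?ms) * Var (Inr (?ms[j - 1 := m]))"
    have ev_Q: "ev Q (case_sum (pluecker us) (pluecker ws)) =
        pluecker ws ?ms * pluecker ws (?ms[j - 1 := m])" for us ws by (simp add: Q_def)
    have "\<exists>us. ev Q (case_sum (pluecker us) (pluecker ws)) = 0"
    proof (rule closed)
      fix E' us' ws' \<Lambda>
      assume E': "dual_sys (Suc t) E' \<Lambda>" "pvec.dim E' = ?T" "inj_B (Suc t) E'" "basis_list E' ws'"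
      interpret dual_system r \<beta> "Suc t" E' \<Lambda> by unfold_locales (rule E')
      have "lookup (Const (mon_fact (\<beta> j)) * \<Lambda> j) m = 0"
        using \<Lambda>_polys_le[OF j] m by (simp add: polys_le_iff)
      then show "ev Q (case_sum (pluecker us') (pluecker ws')) = 0"
        using pluecker_B_replace[OF E'(4,2,3) dual_sys_dual_family[OF E'(1)] j, of m] by (simp add: ev_Q)
    qed (simp add: ev_Q)
    then show "lookup (w j) m = 0" using rep[OF j, of m] p_neq by (simp add: ev_Q)
  qed
  have pd: "pd k (w j) \<in> E" if j: "j \<in> {1..?T}" for j k
  proof -
    have coeff: "lookup (pd k (w j)) m = (\<Sum>l\<in>{1..?T}. lookup (pd k (w j)) (\<beta> l) * lookup (w l) m)" for m :: "'n mon"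
    proof -
      \<comment> \<open>The expansion of \<open>pd k (w j)\<close> in the dual family, compared at
        \<open>m\<close> and cleared of denominators. On the chart the value is the cube of the
        \<open>B\<close>-coordinate times the defect of that expansion.\<close>
      define Q :: "('n mon list + 'n mon list) mpoly" where "Q = Var (Inr ?ms) *
        (Const (of_nat (Suc (lookup m k))) * (Var (Inr ?ms) * Var (Inr (?ms[j - 1 := m + unit_mon k])))
        - (\<Sum>l\<in>{1..?T}. Const (of_nat (Suc (lookup (\<beta> l) k))) *
            (Var (Inr (?ms[j - 1 := \<beta> l + unit_mon k])) * Var (Inr (?ms[l - 1 := m])))))"
      have ev_Q: "ev Q (case_sum (pluecker us) (pluecker ws)) = pluecker ws ?ms *
        (of_nat (Suc (lookup m k)) * (pluecker ws ?ms * pluecker ws (?ms[j - 1 := m + unit_mon k]))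
        - (\<Sum>l\<in>{1..?T}. of_nat (Suc (lookup (\<beta> l) k)) *
            (pluecker ws (?ms[j - 1 := \<beta> l + unit_mon k]) * pluecker ws (?ms[l - 1 := m]))))" for us ws
        by (simp only: Q_def ev_mult ev_diff ev_sum ev_Const ev_Var sum.case)
      have dual_ev_Q: "ev Q (case_sum (pluecker us') (pluecker ws')) = pluecker ws' ?ms ^ 3 *
          (lookup (pd k (v j)) m - (\<Sum>l\<in>{1..?T}. lookup (pd k (v j)) (\<beta> l) * lookup (v l) m))"
        if "basis_list E' ws'" "pvec.dim E' = ?T" "inj_B (Suc t) E'" "dual_family (Suc t) E' v" for E' us' ws' v
      proof -
        let ?p = "pluecker ws' ?ms"
        note rep = pluecker_B_replace[OF that]
        have "(\<Sum>l\<in>{1..?T}. of_nat (Suc (lookup (\<beta> l) k)) *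
            (pluecker ws' (?ms[j - 1 := \<beta> l + unit_mon k]) * pluecker ws' (?ms[l - 1 := m]))) =
            ?p * ?p * (\<Sum>l\<in>{1..?T}. lookup (pd k (v j)) (\<beta> l) * lookup (v l) m)"
          unfolding sum_distrib_left
        proof (rule sum.cong[OF refl])
          fix l assume l: "l \<in> {1..?T}"
          show "of_nat (Suc (lookup (\<beta> l) k)) *
              (pluecker ws' (?ms[j - 1 := \<beta> l + unit_mon k]) * pluecker ws' (?ms[l - 1 := m])) =
              ?p * ?p * (lookup (pd k (v j)) (\<beta> l) * lookup (v l) m)"
            unfolding rep[OF j] rep[OF l] lookup_pd by (simp only: mult_ac)
        qed
        moreover have "of_nat (Suc (lookup m k)) * (?p * pluecker ws' (?ms[j - 1 := m + unit_mon k])) =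
            ?p * ?p * lookup (pd k (v j)) m"
          unfolding rep[OF j] lookup_pd by (simp only: mult_ac)
        ultimately show ?thesis
          unfolding ev_Q by (simp only: right_diff_distrib[symmetric] power3_eq_cube mult.assoc)
      qed
      have "\<exists>us. ev Q (case_sum (pluecker us) (pluecker ws)) = 0"
      proof (rule closed)
        fix E' us' ws' \<Lambda>
        assume E': "dual_sys (Suc t) E' \<Lambda>" "pvec.dim E' = ?T" "inj_B (Suc t) E'" "basis_list E' ws'"
        interpret dual_system r \<beta> "Suc t" E' \<Lambda> by unfold_locales (rule E')
        define v where "v = (\<lambda>i. Const (mon_fact (\<beta> i)) * \<Lambda> i)"
        have v: "dual_family (Suc t) E' v" unfolding v_def by (rule dual_sys_dual_family[OF E'(1)])
        have "v j \<in> E'" using v j by (simp add: dual_family_def)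
        then have "pd k (v j) = (\<Sum>l\<in>{1..?T}. Const (lookup (pd k (v j)) (\<beta> l)) * v l)"
          by (intro dual_family_expand[OF v subspace_D E'(3)] pd_D)
        then have "lookup (pd k (v j)) m = lookup (\<Sum>l\<in>{1..?T}. Const (lookup (pd k (v j)) (\<beta> l)) * v l) m"
          by (rule arg_cong)
        also have "\<dots> = (\<Sum>l\<in>{1..?T}. lookup (pd k (v j)) (\<beta> l) * lookup (v l) m)"
          by (simp add: lookup_sum)
        finally show "ev Q (case_sum (pluecker us') (pluecker ws')) = 0"
          unfolding dual_ev_Q[OF E'(4,2,3) v] by simp
      qed (simp add: ev_Q)
      then show ?thesis
        unfolding dual_ev_Q[OF ws E(2) Suc.prems(2) w] using p_neq by simp
    qed
    have "pd k (w j) = (\<Sum>l\<in>{1..?T}. Const (lookup (pd k (w j)) (\<beta> l)) * w l)"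
      by (rule poly_mapping_eqI) (subst coeff, simp add: lookup_sum)
    also have "\<dots> \<in> E" using w by (intro pvec.subspace_sum pvec.subspace_scale E(1)) (simp add: dual_family_def)
    finally show ?thesis .
  qed
  show ?case using dual_sysI[OF w E(1) Suc.prems(2) deg pd] by blast
qed

lemma dual_sys_Hilb_B:
  assumes D: "dual_sys t D \<Lambda>" and t: "t \<le> top_deg r \<beta>"
  shows "D \<in> Hilb_B r \<beta> t"
proof -
  interpret dual_system r \<beta> t D \<Lambda> by unfold_locales (rule D)
  have "D \<subseteq> polys_le (rt t - 1)"
  proof -
    have "t \<le> rt t - 1" using Suc_le_rt[OF t] by linarith
    then show ?thesis using D_polys_le polys_le_mono by blast
  qed
  then have "D \<in> Hilb (rt t)"
    using subspace_D family_D(4) pd_D by (auto simp: Hilb_def)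
  moreover have "basis_mod {p + q | p q. p \<in> annihilator D \<and> q \<in> max_ideal_power (s + 1)} (monoms_le r \<beta> s)"
    if s: "s \<le> t" for s
  proof -
    let ?J = "{p + q | p q. p \<in> annihilator D \<and> q \<in> max_ideal_power (s + 1)}"
    have sub: "{1..rt s} \<subseteq> {1..rt t}" using rt_mono[OF s] by auto
    have monoms: "monoms_le r \<beta> s = (\<lambda>i. monom_poly (\<beta> i)) ` {1..rt s}"
      unfolding monoms_le_def idx_iff[of s] by auto
    have "p \<in> ?J \<longleftrightarrow> (\<forall>i\<in>{1..rt s}. act (\<lambda>_. 0) (\<Lambda> i) p = 0)" for p
    proof
      assume "p \<in> ?J"
      then obtain a q where p: "p = a + q" "a \<in> annihilator D" "q \<in> max_ideal_power (Suc s)" by auto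
      show "\<forall>i\<in>{1..rt s}. act (\<lambda>_. 0) (\<Lambda> i) p = 0"
      proof
        fix i assume i: "i \<in> {1..rt s}"
        then have i': "i \<in> {1..rt t}" using sub by blast
        have "\<Lambda> i \<in> polys_le s"
          using \<Lambda>_polys_le[OF i'] polys_le_mono[of "mdeg (\<beta> i)" s] i in_idx_iff[of i s] by blast
        then have "act (\<lambda>_. 0) (\<Lambda> i) q = 0" using p(3) by (rule act_max_ideal_power)
        moreover have "act (\<lambda>_. 0) (\<Lambda> i) a = 0" using p(2) \<Lambda>_D[OF i'] by (simp add: annihilator_def)
        ultimately show "act (\<lambda>_. 0) (\<Lambda> i) p = 0" by (simp add: p(1))
      qed
    next
      assume p: "\<forall>i\<in>{1..rt s}. act (\<lambda>_. 0) (\<Lambda> i) p = 0"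
      \<comment> \<open>The component of \<open>p\<close> on the basis monomials of degree above
        \<open>s\<close>: it lies in the power of the maximal ideal, and subtracting it leaves a
        polynomial killed by every \<open>\<Lambda> i\<close>.\<close>
      define q where "q = (\<Sum>i\<in>{1..rt t} - {1..rt s}. Const (act (\<lambda>_. 0) (\<Lambda> i) p) * monom_poly (\<beta> i))"
      have "q \<in> max_ideal_power (s + 1)"
        unfolding q_def max_ideal_power_def
      proof (intro pideal.span_sum pideal.span_scale)
        fix i assume i: "i \<in> {1..rt t} - {1..rt s}"
        then have "s + 1 \<le> mdeg (\<beta> i)" using in_idx_iff[of i t] in_idx_iff[of i s] by auto
        then show "monom_poly (\<beta> i) \<in> pideal.span {prod_list (map Var ks) |ks. length ks = s + 1}"
          using monom_poly_in_max_ideal_power unfolding max_ideal_power_def by blast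
      qed
      moreover have "p - q \<in> annihilator D"
        unfolding annihilator_def
      proof (intro CollectI ballI)
        have \<Lambda>0: "act (\<lambda>_. 0) (\<Lambda> i) (p - q) = 0" if i: "i \<in> {1..rt t}" for i
        proof -
          have "act (\<lambda>_. 0) (\<Lambda> i) q = (\<Sum>j\<in>{1..rt t} - {1..rt s}. if j = i then act (\<lambda>_. 0) (\<Lambda> i) p else 0)"
            unfolding q_def act_sum_right using co_\<Lambda>[OF i] by (intro sum.cong) auto
          also have "\<dots> = act (\<lambda>_. 0) (\<Lambda> i) p" using p i by (cases "i \<in> {1..rt s}") auto
          finally show ?thesis by simp
        qed
        fix d assume "d \<in> D"
        have "act (\<lambda>_. 0) (\<Sum>i\<in>{1..rt t}. Const (co d i) * \<Lambda> i) (p - q) = 0"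
          unfolding act_sum_left using \<Lambda>0 by (simp del: act_diff_right)
        then show "act (\<lambda>_. 0) d (p - q) = 0" using expand[OF \<open>d \<in> D\<close>] by simp
      qed
      ultimately show "p \<in> ?J" by (intro CollectI exI[of _ "p - q"] exI[of _ q]) simp
    qed
    then show ?thesis
      unfolding monoms
      by (intro basis_mod_dual(2)[where \<xi> = "\<lambda>_. 0" and \<Lambda> = \<Lambda>]) (use co_\<Lambda> sub in auto)
  qed
  ultimately show ?thesis by (simp add: Hilb_B_def)
qed

text \<open>An \<open>e\<close> that vanishes at the monomials of the chart kills these, the
  annihilator of \<open>D\<close> and, by its degree, the power \<open>t + 1\<close> of the maximal
  ideal; together they contain every monomial in their span.\<close>

lemma Hilb_B_imp_inj_B:
  assumes "D \<in> Hilb_B r \<beta> t" "D \<subseteq> polys_le t"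
  shows "inj_B t D"
  unfolding inj_B_def
proof (intro ballI impI)
  fix e assume e: "e \<in> D" "\<forall>i\<in>{1..rt t}. lookup e (\<beta> i) = 0"
  let ?J = "{p + q | p q. p \<in> annihilator D \<and> q \<in> max_ideal_power (t + 1)}"
  have basis: "basis_mod ?J (monoms_le r \<beta> t)" using assms(1) by (auto simp: Hilb_B_def)
  show "e = 0"
  proof (rule act_eq_imp_eq)
    fix m
    obtain c where "monom_poly m - (\<Sum>s\<in>monoms_le r \<beta> t. Const (c s) * s) \<in> ?J"
      using basis unfolding basis_mod_def by blast
    then obtain a q where aq: "monom_poly m - (\<Sum>s\<in>monoms_le r \<beta> t. Const (c s) * s) = a + q"
      "a \<in> annihilator D" "q \<in> max_ideal_power (Suc t)" by auto
    have "act (\<lambda>_. 0) e a = 0" using aq(2) e(1) by (simp add: annihilator_def)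
    moreover have "act (\<lambda>_. 0) e q = 0" using assms(2) e(1) aq(3) by (intro act_max_ideal_power) auto
    moreover have "act (\<lambda>_. 0) e s = 0" if s: "s \<in> monoms_le r \<beta> t" for s
    proof -
      obtain i where "s = monom_poly (\<beta> i)" "i \<in> {1..r} \<and> mdeg (\<beta> i) \<le> t"
        using s unfolding monoms_le_def by blast
      then have "s = monom_poly (\<beta> i)" "i \<in> {1..rt t}" using in_idx_iff[of i t] by auto
      then show ?thesis using e(2) by (simp add: act_monom_poly)
    qed
    ultimately have "act (\<lambda>_. 0) e (monom_poly m - (\<Sum>s\<in>monoms_le r \<beta> t. Const (c s) * s)) = 0"
      "act (\<lambda>_. 0) e (\<Sum>s\<in>monoms_le r \<beta> t. Const (c s) * s) = 0"
      unfolding aq(1) by (simp_all add: act_sum_right)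
    then show "act (\<lambda>_. 0) e (monom_poly m) = 0" by simp
  qed
qed

lemma Hilb_reg_Hilb_B_dual_sys:
  "D \<in> Hilb_reg r \<beta> t \<Longrightarrow> D \<in> Hilb_B r \<beta> t \<Longrightarrow> \<exists>\<Lambda>. dual_sys t D \<Lambda>"
  using Hilb_reg_dual_sys Hilb_B_imp_inj_B Gr_D(3)[OF Hilb_reg_Gr] by blast

lemma H_rank_le_generic_rank:
  assumes "D \<in> Hilb_reg r \<beta> t" "D \<in> Hilb_B r \<beta> t"
  shows "H_rank r \<beta> (Suc t) D \<le> generic_rank r \<beta> (Suc t)"
proof -
  have "H_rank r \<beta> (Suc t) D' \<le> card (cols r \<beta> (Suc t))" for D'
    unfolding H_rank_def by (rule mat_rank_le_card) (simp add: Defs.cols_def)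
  then have "finite (H_rank r \<beta> (Suc t) ` (Hilb_reg r \<beta> t \<inter> Hilb_B r \<beta> t))"
    by (intro finite_subset[OF _ finite_atMost] image_subsetI) (simp only: atMost_iff)
  then show ?thesis using assms by (simp add: generic_rank_def)
qed

text \<open>
  The Plucker coordinate of \<open>B\<close> does not vanish at a regular point, hence not everywhere on the part of
  the tower over the minimal locus; so that locus meets the chart of \<open>B\<close>.
\<close>

lemma minimal_locus_meets_chart:
  assumes reg: "regular_at r \<beta> (Suc t) E"
  shows "\<exists>D \<Lambda>. D \<in> Hilb_reg r \<beta> t \<and> dual_sys t D \<Lambda> \<and>
    (\<forall>D'\<in>Hilb_reg r \<beta> t. pvec.dim (integrals (Suc t) D) \<le> pvec.dim (integrals (Suc t) D'))"
proof -
  have E: "E \<in> Hilb_reg r \<beta> (Suc t)" "E \<in> Hilb_B r \<beta> (Suc t)" using reg by (auto simp: regular_at_def)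
  note E_Gr = Gr_D[OF Hilb_reg_Gr[OF E(1)]]
  have inj: "inj_B (Suc t) E" by (rule Hilb_B_imp_inj_B[OF E(2) E_Gr(3)])
  obtain ws where ws: "basis_list E ws"
    using basis_list_exists[OF E_Gr(1)] E_Gr(2) rt_pos[of "Suc t"] by auto
  have "\<exists>D' E'. (D', E') \<in> tower t \<and> inj_B (Suc t) E'"
  proof (rule ccontr)
    assume none: "\<not> ?thesis"
    define Q :: "('n mon list + 'n mon list) mpoly" where "Q = Var (Inr (ms_list (Suc t)))"
    have "\<exists>us. ev Q (case_sum (pluecker us) (pluecker ws)) = 0"
    proof (rule Hilb_reg_closure(2)[OF E(1) ws])
      fix D' E' us' ws' assume S: "(D', E') \<in> tower t" and ws': "basis_list E' ws'"
      have "pvec.dim E' = rt (Suc t)" using S by (auto simp: tower_def Gr_def)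
      then show "ev Q (case_sum (pluecker us') (pluecker ws')) = 0"
        using pluecker_B_neq_0_iff[OF ws'] none S by (auto simp: Q_def)
    qed
    then show False using pluecker_B_neq_0_iff[OF ws E_Gr(2)] inj by (simp add: Q_def)
  qed
  then obtain D' E' where S: "(D', E') \<in> tower t" and inj': "inj_B (Suc t) E'" by blast
  then have D': "D' \<in> Hilb_reg r \<beta> t" "D' \<subseteq> E'" by (auto simp: tower_def)
  have "inj_B t D'" by (rule inj_B_sub[OF D'(2) Gr_D(3)[OF Hilb_reg_Gr[OF D'(1)]] inj'])
  then obtain \<Lambda> where "dual_sys t D' \<Lambda>" using Hilb_reg_dual_sys[OF D'(1)] by blast
  then show ?thesis using S D'(1) by (auto simp: tower_def)
qed

text \<open>By \<open>dim_integrals\<close> the rank hypothesis makes the integrals of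
  \<open>D\<close> no larger than those of the chart point \<open>D'\<close>, which is minimal in
  the whole of \<open>Hilb_reg\<close>. So the pair \<open>(D, E)\<close> lies in the tower, and
  trivially in its closure.\<close>

theorem Hilb_reg_extend:
  assumes reg: "regular_at r \<beta> (Suc t) E0" and t: "t \<le> top_deg r \<beta>"
    and D: "D \<in> Hilb_reg r \<beta> t" "dual_sys t D \<Lambda>"
    and rank: "generic_rank r \<beta> (Suc t) \<le> H_rank r \<beta> (Suc t) D"
    and E: "dual_sys (Suc t) E \<Lambda>'" "D \<subseteq> E" "\<And>k. pd k ` E \<subseteq> D"
  shows "E \<in> Hilb_reg r \<beta> (Suc t)"
proof -
  obtain D' \<Lambda>'' where D': "D' \<in> Hilb_reg r \<beta> t" "dual_sys t D' \<Lambda>''"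
    and min: "\<forall>D''\<in>Hilb_reg r \<beta> t. pvec.dim (integrals (Suc t) D') \<le> pvec.dim (integrals (Suc t) D'')"
    using minimal_locus_meets_chart[OF reg] by blast
  interpret D: dual_system r \<beta> t D \<Lambda> by unfold_locales (rule D)
  interpret D': dual_system r \<beta> t D' \<Lambda>'' by unfold_locales (rule D')
  have "H_rank r \<beta> (Suc t) D' \<le> H_rank r \<beta> (Suc t) D"
    using H_rank_le_generic_rank[OF D'(1) dual_sys_Hilb_B[OF D'(2) t]] rank by linarith
  then have "pvec.dim (integrals (Suc t) D) \<le> pvec.dim (integrals (Suc t) D')"
    using D.dim_integrals D'.dim_integrals by linarith
  then have "pvec.dim (integrals (Suc t) D) \<le> pvec.dim (integrals (Suc t) D'')" if "D'' \<in> Hilb_reg r \<beta> t" for D''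
    using min that le_trans by blast
  then have "(D, E) \<in> tower t"
    using D(1) E dual_sys_Gr[OF E(1)] by (auto simp: tower_def)
  then have "(D, E) \<in> zariski_closure (rt t) t (rt (Suc t)) (Suc t) (tower t)"
    using dual_sys_Gr[OF D(2)] dual_sys_Gr[OF E(1)] by (auto simp: zariski_closure_def)
  then show ?thesis unfolding Hilb_reg_Suc by force
qed

end

section \<open>Multiplicity structure of an isolated root\<close>

text \<open>Multiplication by a centred variable acts through a derivative, which stays in
  \<open>D\<close>; any multiplier is a combination of products of such factors.\<close>

lemma annihilated_ideal:
  assumes stable: "\<And>d k. d \<in> D \<Longrightarrow> pd k d \<in> D"
    and q: "\<And>d. d \<in> D \<Longrightarrow> act \<xi> d q = 0" and d: "d \<in> D"
  shows "act \<xi> d (p * q) = 0"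
proof -
  have sm: "act \<xi> d (shifted_monom \<xi> m * q) = 0" if "d \<in> D" for d m
    using that
  proof (induction m arbitrary: d rule: mon_induct)
    case (add m k)
    have "act \<xi> d (shifted_monom \<xi> (m + unit_mon k) * q) = act \<xi> (pd k d) (shifted_monom \<xi> m * q)"
      by (simp only: shifted_monom_add_unit mult.assoc act_linear_mult)
    then show ?case using add stable by simp
  qed (simp add: q)
  obtain S c where "p = (\<Sum>m\<in>S. Const (c m) * shifted_monom \<xi> m)"
    using shifted_monom_expansion[of p \<xi>] by blast
  then have "p * q = (\<Sum>m\<in>S. Const (c m) * (shifted_monom \<xi> m * q))"
    by (simp only: sum_distrib_right mult.assoc)
  then have "act \<xi> d (p * q) = (\<Sum>m\<in>S. c m * act \<xi> d (shifted_monom \<xi> m * q))"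
    by (simp only: act_sum_right act_Const_mult_right)
  then show ?thesis by (simp only: sm[OF d] mult_zero_right sum.neutral_const)
qed

text \<open>Hadamard's lemma for polynomials. It isolates the constant term of a multiplier that is
  a unit in the local ring at \<open>\<xi>\<close>.\<close>

lemma linear_expansion:
  fixes p :: "'n::{finite,linorder} mpoly"
  shows "\<exists>q. p = Const (ev p \<xi>) + (\<Sum>k\<in>UNIV. (Var k - Const (\<xi> k)) * q k)"
proof -
  define lin where "lin p \<longleftrightarrow> (\<exists>a q. p = Const a + (\<Sum>k\<in>UNIV. (Var k - Const (\<xi> k)) * q k))" for p :: "'n mpoly"
  have add: "lin (p + p')" if lin: "lin p" "lin p'" for p p'
  proof -
    obtain a q a' q' where "p = Const a + (\<Sum>k\<in>UNIV. (Var k - Const (\<xi> k)) * q k)"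
      "p' = Const a' + (\<Sum>k\<in>UNIV. (Var k - Const (\<xi> k)) * q' k)" using lin unfolding lin_def by blast
    then have "p + p' = Const (a + a') + (\<Sum>k\<in>UNIV. (Var k - Const (\<xi> k)) * (q k + q' k))"
      by (simp only: Const_add distrib_left sum.distrib add_ac)
    then show ?thesis unfolding lin_def by (intro exI[of _ "a + a'"] exI[of _ "\<lambda>k. q k + q' k"])
  qed
  have Const: "lin (Const a)" for a
    unfolding lin_def by (intro exI[of _ a] exI[of _ "\<lambda>_. 0"]) simp
  have mono: "lin (Const c * shifted_monom \<xi> m)" for c m
  proof (induction m rule: mon_induct)
    case zero
    show ?case using Const[of c] by simp
  next
    case (add m k)
    have "Const c * shifted_monom \<xi> (m + unit_mon k) =
        (\<Sum>l\<in>UNIV. (Var l - Const (\<xi> l)) * (if l = k then Const c * shifted_monom \<xi> m else 0))"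
    proof -
      have "(\<Sum>l\<in>UNIV. (Var l - Const (\<xi> l)) * (if l = k then Const c * shifted_monom \<xi> m else 0)) =
          (\<Sum>l\<in>UNIV. if l = k then (Var k - Const (\<xi> k)) * (Const c * shifted_monom \<xi> m) else 0)"
        by (intro sum.cong) auto
      also have "\<dots> = (Var k - Const (\<xi> k)) * (Const c * shifted_monom \<xi> m)" by simp
      finally show ?thesis by (simp only: shifted_monom_add_unit mult.left_commute)
    qed
    then have "Const c * shifted_monom \<xi> (m + unit_mon k) = Const 0 +
        (\<Sum>l\<in>UNIV. (Var l - Const (\<xi> l)) * (if l = k then Const c * shifted_monom \<xi> m else 0))" by simp
    then show ?case unfolding lin_def
      by (intro exI[of _ 0] exI[of _ "\<lambda>l. if l = k then Const c * shifted_monom \<xi> m else 0"])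
  qed
  obtain S c where S: "finite S" "p = (\<Sum>m\<in>S. Const (c m) * shifted_monom \<xi> m)"
    using shifted_monom_expansion[of p \<xi>] by blast
  have "lin (\<Sum>m\<in>S. Const (c m) * shifted_monom \<xi> m)"
    using S(1)
  proof induction
    case empty
    show ?case using Const[of 0] by simp
  next
    case (insert m S)
    then show ?case using add[OF mono] by simp
  qed
  then obtain a q where aq: "p = Const a + (\<Sum>k\<in>UNIV. (Var k - Const (\<xi> k)) * q k)"
    unfolding lin_def S(2) by blast
  have "ev p \<xi> = a" by (subst aq) simp
  then show ?thesis using aq by blast
qed

lemma ideal_mult: "p \<in> pideal.span G \<Longrightarrow> q * p \<in> pideal.span G"
  by (rule pideal.span_scale)

text \<open>One elimination step of \<open>nakayama\<close>: \<open>x\<close> is a remaining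
  generator, \<open>z\<close> the eliminated one, \<open>a\<close> and \<open>b\<close> are their
  coefficients at \<open>z\<close>, and \<open>A\<close>, \<open>B\<close> the sums over the
  remaining generators.\<close>

lemma elimination_identity:
  fixes x :: "'a::comm_ring_1"
  shows "x - (b * A + (1 - a) * B + a * x) = (1 - a) * (x - (b * z + B)) + b * ((1 - a) * z - A)"
  by (simp only: ring_distribs mult.assoc mult.left_commute) (simp add: add_ac)

text \<open>The generators \<open>y m\<close> are eliminated one at a time.\<close>

lemma nakayama:
  assumes "finite G"
    and "\<And>m. m \<in> G \<Longrightarrow> \<exists>a. (\<forall>m'\<in>G. ev (a m') \<xi> = 0) \<and> y m - (\<Sum>m'\<in>G. a m' * y m') \<in> pideal.span I"
  shows "\<exists>h. ev h \<xi> = 1 \<and> (\<forall>m\<in>G. h * y m \<in> pideal.span I)"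
  using assms
proof (induction G)
  case empty
  show ?case by (intro exI[of _ 1]) simp
next
  case (insert q G)
  let ?I = "pideal.span I"
  obtain a where a: "\<forall>m'\<in>insert q G. ev (a m') \<xi> = 0" "y q - (\<Sum>m'\<in>insert q G. a m' * y m') \<in> ?I"
    using insert.prems[of q] by blast
  \<comment> \<open>\<open>u\<close> has value 1 at \<open>\<xi>\<close>. Instead of dividing by it
    in the local ring, relations are multiplied by it, so everything stays polynomial.\<close>
  define u where "u = 1 - a q"
  have uq: "u * y q - (\<Sum>m'\<in>G. a m' * y m') \<in> ?I"
  proof -
    have "(\<Sum>m'\<in>insert q G. a m' * y m') = a q * y q + (\<Sum>m'\<in>G. a m' * y m')"
      by (rule sum.insert) fact+
    then have "u * y q - (\<Sum>m'\<in>G. a m' * y m') = y q - (\<Sum>m'\<in>insert q G. a m' * y m')"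
      by (simp only: u_def left_diff_distrib mult_1_left diff_diff_eq)
    then show ?thesis using a(2) by simp
  qed
  have "\<exists>h. ev h \<xi> = 1 \<and> (\<forall>m\<in>G. h * y m \<in> ?I)"
  proof (rule insert.IH)
    fix m assume m: "m \<in> G"
    obtain b where b: "\<forall>m'\<in>insert q G. ev (b m') \<xi> = 0" "y m - (\<Sum>m'\<in>insert q G. b m' * y m') \<in> ?I"
      using insert.prems[of m] m by blast
    \<comment> \<open>Multiplying the relation for \<open>y m\<close> by \<open>u = 1 - a q\<close>
      spoils its leading coefficient; the surplus \<open>a q * y m\<close> is moved into the sum,
      where its coefficient still vanishes at \<open>\<xi>\<close>.\<close>
    define c where "c m' = b q * a m' + u * b m' + (if m' = m then a q else 0)" for m'
    have "(\<Sum>m'\<in>G. (if m' = m then a q else 0) * y m') = (\<Sum>m'\<in>G. if m' = m then a q * y m else 0)"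
      by (intro sum.cong) auto
    then have delta: "(\<Sum>m'\<in>G. (if m' = m then a q else 0) * y m') = a q * y m"
      using m insert.hyps by simp
    have c_sum: "(\<Sum>m'\<in>G. c m' * y m') =
        b q * (\<Sum>m'\<in>G. a m' * y m') + u * (\<Sum>m'\<in>G. b m' * y m') + a q * y m"
      unfolding c_def distrib_right sum.distrib delta by (simp only: sum_distrib_left mult.assoc)
    have "y m - (\<Sum>m'\<in>G. c m' * y m') =
        u * (y m - (\<Sum>m'\<in>insert q G. b m' * y m')) + b q * (u * y q - (\<Sum>m'\<in>G. a m' * y m'))"
    proof -
      have b_sum: "(\<Sum>m'\<in>insert q G. b m' * y m') = b q * y q + (\<Sum>m'\<in>G. b m' * y m')"
        by (rule sum.insert) fact+
      show ?thesis unfolding c_sum b_sum u_def by (rule elimination_identity)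
    qed
    also have "\<dots> \<in> ?I" by (intro pideal.span_add pideal.span_scale b(2) uq)
    finally have "y m - (\<Sum>m'\<in>G. c m' * y m') \<in> ?I" .
    moreover have "\<forall>m'\<in>G. ev (c m') \<xi> = 0" using a(1) b(1) by (auto simp: c_def)
    ultimately show "\<exists>a. (\<forall>m'\<in>G. ev (a m') \<xi> = 0) \<and> y m - (\<Sum>m'\<in>G. a m' * y m') \<in> ?I" by blast
  qed
  then obtain h where h: "ev h \<xi> = 1" "\<And>m. m \<in> G \<Longrightarrow> h * y m \<in> ?I" by blast
  have "(\<Sum>m'\<in>G. a m' * (h * y m')) \<in> ?I" by (intro pideal.span_sum pideal.span_scale h(2))
  then have "h * (u * y q - (\<Sum>m'\<in>G. a m' * y m')) + (\<Sum>m'\<in>G. a m' * (h * y m')) \<in> ?I"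
    by (rule pideal.span_add[OF pideal.span_scale[OF uq]])
  moreover have "h * (u * y q - (\<Sum>m'\<in>G. a m' * y m')) + (\<Sum>m'\<in>G. a m' * (h * y m')) = (h * u) * y q"
  proof -
    have "h * (\<Sum>m'\<in>G. a m' * y m') = (\<Sum>m'\<in>G. a m' * (h * y m'))"
      unfolding sum_distrib_left by (simp only: mult.left_commute)
    then show ?thesis by (simp only: right_diff_distrib mult.assoc diff_add_cancel)
  qed
  ultimately have "(h * u) * y q \<in> ?I" by simp
  moreover have "(h * u) * y m \<in> ?I" if "m \<in> G" for m
  proof -
    have "(h * u) * y m = u * (h * y m)" by (simp only: mult_ac)
    then show ?thesis using pideal.span_scale[OF h(2)[OF that], of u] by (simp only:)
  qed
  moreover have "ev (h * u) \<xi> = 1" using h(1) a(1) by (simp add: u_def)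
  ultimately show ?case by (intro exI[of _ "h * u"]) simp
qed

interpretation pvec_functional: vector_space_pair
  "\<lambda>(c::complex) (p::'v mpoly). Const c * p" "(*) :: complex \<Rightarrow> complex \<Rightarrow> complex"
  by unfold_locales (simp_all only: distrib_left distrib_right mult.assoc mult_1_left)

lemma separating_functional:
  assumes W: "pvec.subspace W" and p: "p \<notin> W"
  shows "\<exists>\<phi>. Vector_Spaces.linear (\<lambda>(c::complex) (p::'v mpoly). Const c * p) (*) \<phi> \<and> (\<forall>q\<in>W. \<phi> q = 0) \<and> \<phi> p = 1"
proof -
  obtain B where B: "B \<subseteq> W" "pvec.independent B" "W \<subseteq> pvec.span B" "card B = pvec.dim W"
    by (rule pvec.basis_exists)
  have span: "pvec.span B = W" using B pvec.span_minimal[OF B(1) W] by blast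
  then have "pvec.independent (insert p B)" using B(2) p by (simp add: pvec.independent_insert)
  from pvec_functional.linear_independent_extend[OF this, of "\<lambda>x. if x = p then 1 else 0"]
  obtain \<phi> where \<phi>: "Vector_Spaces.linear (\<lambda>(c::complex) (p::'v mpoly). Const c * p) (*) \<phi>"
    "\<forall>x\<in>insert p B. \<phi> x = (if x = p then 1 else 0)" by blast
  have "p \<notin> B" using B(1) p by blast
  then have "\<phi> x = 0" if "x \<in> B" for x using \<phi>(2) that by auto
  then have "\<phi> q = 0" if "q \<in> W" for q
    using pvec_functional.linear_eq_0_on_span[OF \<phi>(1), of B q] that span by blast
  then show ?thesis using \<phi> by (intro exI[of _ \<phi>]) simp
qed

text \<open>The power \<open>s\<close> of the maximal ideal at \<open>\<xi>\<close>, given as a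
  vector space by spanning monomials, since linear functionals are to be evaluated on them.\<close>

definition order_ge :: "('n::finite \<Rightarrow> complex) \<Rightarrow> nat \<Rightarrow> 'n mpoly set"
  where "order_ge \<xi> s = pvec.span (shifted_monom \<xi> ` {m. s \<le> mdeg m})"

text \<open>A functional that kills the ideal and all terms of order at least \<open>s\<close> is given by a dual polynomial.\<close>

lemma in_ideal_plus_order:
  assumes p: "\<And>\<Lambda>. \<Lambda> \<in> inverse_system (pideal.span G) \<xi> \<Longrightarrow> act \<xi> \<Lambda> p = 0"
  shows "\<exists>a b. p = a + b \<and> a \<in> pideal.span G \<and> b \<in> order_ge \<xi> s"
proof (rule ccontr)
  assume none: "\<not> ?thesis"
  let ?I = "pideal.span G"
  define W where "W = {a + b | a b. a \<in> ?I \<and> b \<in> order_ge \<xi> s}"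
  have subI: "pvec.subspace ?I"
    by (auto simp: pvec.subspace_def pideal.span_zero pideal.span_add pideal.span_scale)
  have "pvec.subspace (order_ge \<xi> s)" by (simp add: order_ge_def)
  then have W: "pvec.subspace W" unfolding W_def using subI by (intro pvec.subspace_sums)
  have I_W: "a \<in> W" if "a \<in> ?I" for a
    using that pvec.subspace_0[OF \<open>pvec.subspace (order_ge \<xi> s)\<close>] unfolding W_def by force
  have O_W: "b \<in> W" if "b \<in> order_ge \<xi> s" for b
    using that pideal.span_zero[of G] unfolding W_def by force
  have "p \<notin> W" using none unfolding W_def by blast
  then obtain \<phi> where lin: "Vector_Spaces.linear (\<lambda>(c::complex) p. Const c * p) (*) \<phi>"
    and \<phi>0: "\<And>q. q \<in> W \<Longrightarrow> \<phi> q = 0" and \<phi>1: "\<phi> p = 1"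
    using separating_functional[OF W] by blast
  \<comment> \<open>Cutting off at order \<open>s\<close> makes this a polynomial and loses nothing,
    because \<open>\<phi>\<close> kills the terms of order \<open>s\<close> and above.\<close>
  define \<Lambda> where "\<Lambda> = (\<Sum>m\<in>{m. mdeg m \<le> s}. single m (if mdeg m < s then \<phi> (shifted_monom \<xi> m) / mon_fact m else 0))"
  have lookup_\<Lambda>: "lookup \<Lambda> m = (if mdeg m < s then \<phi> (shifted_monom \<xi> m) / mon_fact m else 0)" for m
    unfolding \<Lambda>_def lookup_sum lookup_single when_def by (simp add: finite_mdeg_le)
  have shifted: "act \<xi> \<Lambda> (shifted_monom \<xi> m) = \<phi> (shifted_monom \<xi> m)" for m
  proof (cases "mdeg m < s")
    case False
    then have "shifted_monom \<xi> m \<in> order_ge \<xi> s" by (auto simp: order_ge_def intro!: pvec.span_base)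
    then show ?thesis using False \<phi>0 O_W by (simp add: act_shifted_monom lookup_\<Lambda>)
  qed (simp add: act_shifted_monom lookup_\<Lambda>)
  have act_\<Lambda>: "act \<xi> \<Lambda> q = \<phi> q" for q
  proof -
    obtain S c where "q = (\<Sum>m\<in>S. Const (c m) * shifted_monom \<xi> m)"
      using shifted_monom_expansion[of q \<xi>] by blast
    then show ?thesis
      by (simp add: act_sum_right shifted pvec_functional.linear_sum[OF lin] pvec_functional.linear_scale[OF lin])
  qed
  have "\<Lambda> \<in> inverse_system ?I \<xi>" using act_\<Lambda> \<phi>0 I_W by (simp add: inverse_system_def)
  then show False using p[of \<Lambda>] act_\<Lambda>[of p] \<phi>1 by simp
qed

lemma mon_split:
  fixes m :: "'n::{finite,linorder} mon"
  assumes "s \<le> mdeg m"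
  shows "\<exists>m1 m2. m = m1 + m2 \<and> mdeg m1 = s"
  using assms
proof (induction "mdeg m - s" arbitrary: m)
  case 0
  then show ?case by (intro exI[of _ m] exI[of _ 0]) simp
next
  case (Suc n)
  then have "m \<noteq> 0" by auto
  from top_var_ex1[OF this] obtain k where k: "0 < lookup m k" by blast
  define m' where "m' = m - unit_mon k"
  have m: "m = m' + unit_mon k" using minus_unit_mon_add[OF k] by (simp add: m'_def)
  have deg: "mdeg m = Suc (mdeg m')" using arg_cong[OF m, of mdeg] by (simp add: mdeg_add)
  have "n = mdeg m' - s" "s \<le> mdeg m'" using Suc.hyps(2) Suc.prems deg by auto
  from Suc.hyps(1)[OF this] obtain m1 m2 where "m' = m1 + m2" "mdeg m1 = s" by blast
  then show ?case by (intro exI[of _ m1] exI[of _ "m2 + unit_mon k"]) (simp only: m add.assoc)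
qed

lemma shifted_monom_add: "shifted_monom \<xi> (m + m') = shifted_monom \<xi> m * shifted_monom \<xi> m'"
  by (simp add: shifted_monom_def lookup_add power_add prod.distrib)

lemma ev_shifted_monom:
  fixes m :: "'n::{finite,linorder} mon"
  shows "m \<noteq> 0 \<Longrightarrow> ev (shifted_monom \<xi> m) \<xi> = 0"
  using act_shifted_monom[of \<xi> 1 m] by (simp add: lookup_one when_def)

text \<open>Every shifted monomial of order at least \<open>s\<close> is a multiple of one of order
  exactly \<open>s\<close>, to which the multiplier \<open>h\<close> applies.\<close>

lemma order_ge_ideal:
  fixes b :: "'n::{finite,linorder} mpoly"
  assumes h: "\<And>m. mdeg m = s \<Longrightarrow> h * shifted_monom \<xi> m \<in> pideal.span G" and b: "b \<in> order_ge \<xi> s"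
  shows "h * b \<in> pideal.span G"
  using b unfolding order_ge_def
proof (induction rule: pvec.span_induct_alt)
  case base
  show ?case by (simp add: pideal.span_zero)
next
  case (step c x z)
  then obtain m where m: "x = shifted_monom \<xi> m" "s \<le> mdeg m" by blast
  obtain m1 m2 where m12: "m = m1 + m2" "mdeg m1 = s" using mon_split[OF m(2)] by blast
  have "h * (Const c * x + z) = (Const c * shifted_monom \<xi> m2) * (h * shifted_monom \<xi> m1) + h * z"
    by (simp only: m(1) m12(1) shifted_monom_add distrib_left mult_ac)
  also have "\<dots> \<in> pideal.span G" by (intro pideal.span_add pideal.span_scale h m12 step)
  finally show ?case .
qed

lemma ev_tendsto:
  fixes \<zeta> :: "nat \<Rightarrow> 'v \<Rightarrow> complex"
  assumes "\<And>k. (\<lambda>n. \<zeta> n k) \<longlonglongrightarrow> \<xi> k"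
  shows "(\<lambda>n. ev p (\<zeta> n)) \<longlonglongrightarrow> ev p \<xi>"
  unfolding ev_def by (intro tendsto_intros assms)

text \<open>Were the root not isolated, other roots would converge to it. At each of them some
  coordinate differs from that of \<open>\<xi>\<close>, so its power is nonzero and \<open>h\<close>
  must vanish there; by continuity \<open>h\<close> would vanish at \<open>\<xi>\<close>.\<close>

lemma isolated_root_if_local_power:
  fixes \<xi> :: "'n::{finite,linorder} \<Rightarrow> complex"
  assumes root: "\<And>i. i \<in> {1..N} \<Longrightarrow> ev (g i) \<xi> = 0" and h: "ev h \<xi> \<noteq> 0"
    and power: "\<And>m. mdeg m = s \<Longrightarrow> h * shifted_monom \<xi> m \<in> pideal.span (g ` {1..N})"
  shows "isolated_root N g \<xi>"
proof -
  have zero: "ev p \<zeta> = 0" if "\<forall>i\<in>{1..N}. ev (g i) \<zeta> = 0" "p \<in> pideal.span (g ` {1..N})" for p \<zeta>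
    using that(2)
  proof (induction rule: pideal.span_induct_alt)
    case (step c x y)
    then show ?case using that(1) by auto
  qed simp
  have ex_mon: "\<exists>m. mdeg m = s \<and> (\<forall>\<zeta>. ev (shifted_monom \<xi> m) \<zeta> = (\<zeta> k - \<xi> k) ^ s)" for k
  proof (induction s)
    case 0
    show ?case by (intro exI[of _ 0]) simp
  next
    case (Suc s)
    then obtain m where "mdeg m = s" "\<forall>\<zeta>. ev (shifted_monom \<xi> m) \<zeta> = (\<zeta> k - \<xi> k) ^ s" by blast
    then show ?case by (intro exI[of _ "m + unit_mon k"]) (simp add: mdeg_add shifted_monom_add_unit)
  qed
  have "\<exists>e>0. \<forall>\<zeta>. vnorm UNIV (\<zeta> - \<xi>) < e \<and> (\<forall>i\<in>{1..N}. ev (g i) \<zeta> = 0) \<longrightarrow> \<zeta> = \<xi>"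
  proof (rule ccontr)
    assume none: "\<not> ?thesis"
    have "\<exists>\<zeta>. vnorm UNIV (\<zeta> - \<xi>) < inverse (real (Suc n)) \<and> (\<forall>i\<in>{1..N}. ev (g i) \<zeta> = 0) \<and> \<zeta> \<noteq> \<xi>" for n
    proof -
      have "0 < inverse (real (Suc n))" by simp
      then show ?thesis using none by blast
    qed
    then obtain \<zeta> where \<zeta>: "\<forall>n. vnorm UNIV (\<zeta> n - \<xi>) < inverse (real (Suc n)) \<and>
        (\<forall>i\<in>{1..N}. ev (g i) (\<zeta> n) = 0) \<and> \<zeta> n \<noteq> \<xi>"
      using choice[of "\<lambda>n \<zeta>. vnorm UNIV (\<zeta> - \<xi>) < inverse (real (Suc n)) \<and> (\<forall>i\<in>{1..N}. ev (g i) \<zeta> = 0) \<and> \<zeta> \<noteq> \<xi>"]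
      by blast
    then have near: "vnorm UNIV (\<zeta> n - \<xi>) < inverse (real (Suc n))"
      and roots: "\<forall>i\<in>{1..N}. ev (g i) (\<zeta> n) = 0" and neq: "\<zeta> n \<noteq> \<xi>" for n by blast+
    have h0: "ev h (\<zeta> n) = 0" for n
    proof -
      obtain k where k: "\<zeta> n k \<noteq> \<xi> k" using neq[of n] by blast
      obtain m where m: "mdeg m = s" "\<forall>\<zeta>. ev (shifted_monom \<xi> m) \<zeta> = (\<zeta> k - \<xi> k) ^ s"
        using ex_mon by blast
      have "ev (h * shifted_monom \<xi> m) (\<zeta> n) = 0" by (rule zero[OF roots power[OF m(1)]])
      then show ?thesis using m(2) k by simp
    qed
    have "(\<lambda>n. \<zeta> n k) \<longlonglongrightarrow> \<xi> k" for k
    proof (rule Lim_transform2[where f = "\<lambda>n. \<xi> k"])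
      show "(\<lambda>n. \<xi> k - \<zeta> n k) \<longlonglongrightarrow> 0"
      proof (rule Lim_null_comparison[OF _ LIMSEQ_inverse_real_of_nat])
        show "\<forall>\<^sub>F n in sequentially. norm (\<xi> k - \<zeta> n k) \<le> inverse (real (Suc n))"
        proof (intro always_eventually allI)
          fix n
          have "cmod ((\<zeta> n - \<xi>) k) \<le> vnorm UNIV (\<zeta> n - \<xi>)" by (rule cmod_le_vnorm) auto
          then show "norm (\<xi> k - \<zeta> n k) \<le> inverse (real (Suc n))"
            using near[of n] by (simp add: norm_minus_commute)
        qed
      qed
    qed simp
    then have "(\<lambda>n. ev h (\<zeta> n)) \<longlonglongrightarrow> ev h \<xi>" by (rule ev_tendsto)
    then have "ev h \<xi> = 0" unfolding h0 by (simp add: LIMSEQ_const_iff)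
    then show False using h by simp
  qed
  then show ?thesis using root unfolding isolated_root_def by blast
qed

context dual_system
begin

lemma co_eq_act_shifted: "act \<xi> d (shifted_monom \<xi> (\<beta> i)) = co d i"
  by (simp add: act_shifted_monom act_monom_poly)

lemma \<Lambda>_1: "\<Lambda> (Suc 0) = 1"
proof (rule poly_mapping_eqI)
  fix m
  have 1: "Suc 0 \<in> {1..rt t}" using rt_pos[of t] by simp
  have "lookup (\<Lambda> (Suc 0)) 0 = 1" using co_\<Lambda>[OF 1 1] by (simp add: act_monom_poly)
  moreover have "lookup (\<Lambda> (Suc 0)) m = 0" if "m \<noteq> 0"
    using \<Lambda>_polys_le[OF 1] that mdeg_eq_0_iff[of m] by (auto simp: polys_le_iff)
  ultimately show "lookup (\<Lambda> (Suc 0)) m = lookup 1 m" by (cases "m = 0") (auto simp: lookup_one when_def)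
qed

lemma act_D_eq_0_iff: "(\<forall>d\<in>D. act \<xi> d p = 0) \<longleftrightarrow> (\<forall>i\<in>{1..rt t}. act \<xi> (\<Lambda> i) p = 0)"
proof
  assume p: "\<forall>i\<in>{1..rt t}. act \<xi> (\<Lambda> i) p = 0"
  show "\<forall>d\<in>D. act \<xi> d p = 0"
  proof
    fix d assume "d \<in> D"
    have "act \<xi> (\<Sum>i\<in>{1..rt t}. Const (co d i) * \<Lambda> i) p = 0" using p by (simp add: act_sum_left)
    then show "act \<xi> d p = 0" using expand[OF \<open>d \<in> D\<close>] by simp
  qed
qed (use \<Lambda>_D in blast)

text \<open>
  The injectivity hypothesis says that no integral of \<open>D\<close> outside \<open>D\<close> kills the system; it is what the
  full rank of \<open>K\<close> provides.
\<close>

theorem multiplicity_structure: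
  assumes rt: "rt t = r"
    and van: "\<And>i j. i \<in> {1..N} \<Longrightarrow> j \<in> {1..r} \<Longrightarrow> act \<xi> (\<Lambda> j) (fs i) = 0"
    and inj: "\<And>P. (\<And>k. pd k P \<in> D) \<Longrightarrow> (\<And>i. i \<in> {1..r} \<Longrightarrow> co P i = 0) \<Longrightarrow>
      (\<And>i. i \<in> {1..N} \<Longrightarrow> act \<xi> P (fs i) = 0) \<Longrightarrow> P = 0"
  shows "multiple_point_with_structure r \<beta> N fs \<xi> \<Lambda>"
proof -
  let ?G = "fs ` {1..N}"
  let ?I = "pideal.span ?G"
  have D_g: "act \<xi> d (fs i) = 0" if "d \<in> D" "i \<in> {1..N}" for d i
  proof -
    have "\<forall>j\<in>{1..rt t}. act \<xi> (\<Lambda> j) (fs i) = 0" unfolding rt using van[OF that(2)] by blast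
    then show ?thesis using act_D_eq_0_iff[of \<xi> "fs i"] that(1) by blast
  qed
  have D_I: "act \<xi> d p = 0" if "d \<in> D" "p \<in> ?I" for d p
    using that(2)
  proof (induction rule: pideal.span_induct_alt)
    case (step c x y)
    then obtain i where i: "i \<in> {1..N}" "x = fs i" by blast
    have "act \<xi> d (c * fs i) = 0"
      by (rule annihilated_ideal[where D = D]) (use pd_D D_g i(1) that(1) in auto)
    then show ?case using step i by simp
  qed simp
  have inv_stable: "pd k \<Lambda>' \<in> inverse_system ?I \<xi>" if "\<Lambda>' \<in> inverse_system ?I \<xi>" for \<Lambda>' k
    using that ideal_mult[of _ ?G "Var k - Const (\<xi> k)"]
    by (auto simp: inverse_system_def act_linear_mult[symmetric])
  \<comment> \<open>\<open>inj\<close> speaks of integrals with zero coordinates only; this is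
    arranged by subtracting the element of \<open>D\<close> with the same coordinates.\<close>
  have in_D: "\<Lambda>' \<in> D" if "\<Lambda>' \<in> inverse_system ?I \<xi>" "\<And>k. pd k \<Lambda>' \<in> D" for \<Lambda>'
  proof -
    define S where "S = (\<Sum>i\<in>{1..rt t}. Const (co \<Lambda>' i) * \<Lambda> i)"
    have S: "S \<in> D" unfolding S_def by (rule sum_\<Lambda>_D)
    have "\<Lambda>' - S = 0"
    proof (rule inj)
      show "pd k (\<Lambda>' - S) \<in> D" for k
        using that(2) pd_D[OF S] by (simp add: pvec.subspace_diff subspace_D)
      show "co (\<Lambda>' - S) i = 0" if "i \<in> {1..r}" for i
        using co_sum[of i "co \<Lambda>'"] that by (simp add: S_def rt)
      show "act \<xi> (\<Lambda>' - S) (fs i) = 0" if "i \<in> {1..N}" for i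
      proof -
        have "fs i \<in> ?I" using that by (auto intro: pideal.span_base)
        then show ?thesis using \<open>\<Lambda>' \<in> inverse_system ?I \<xi>\<close> D_I[OF S] by (simp add: inverse_system_def)
      qed
    qed
    then show ?thesis using S by simp
  qed
  \<comment> \<open>Derivatives stay in the inverse system and have lower degree, so by induction
    they lie in \<open>D\<close>; the element itself is then an integral of
    \<open>D\<close>.\<close>
  have inv_le: "\<Lambda>' \<in> D" if "\<Lambda>' \<in> inverse_system ?I \<xi>" "\<Lambda>' \<in> polys_le n" for \<Lambda>' n
    using that
  proof (induction n arbitrary: \<Lambda>')
    case 0
    have "pd k \<Lambda>' = 0" for k
      using 0(2) by (intro poly_mapping_eqI) (simp add: lookup_pd polys_le_iff mdeg_add)
    then show ?case using 0(1) in_D pvec.subspace_0[OF subspace_D] by simp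
  next
    case (Suc n)
    then show ?case using in_D inv_stable pd_polys_le by blast
  qed
  have inv: "inverse_system ?I \<xi> = D"
  proof
    show "inverse_system ?I \<xi> \<subseteq> D"
    proof
      fix \<Lambda>' assume "\<Lambda>' \<in> inverse_system ?I \<xi>"
      moreover obtain n where "\<Lambda>' \<in> polys_le n" using ex_polys_le by blast
      ultimately show "\<Lambda>' \<in> D" by (rule inv_le)
    qed
    show "D \<subseteq> inverse_system ?I \<xi>" using D_I by (auto simp: inverse_system_def)
  qed
  have in_I_plus: "\<exists>a b. p = a + b \<and> a \<in> ?I \<and> b \<in> order_ge \<xi> s" if "\<forall>d\<in>D. act \<xi> d p = 0" for p s
  proof (rule in_ideal_plus_order)
    fix \<Lambda>' assume "\<Lambda>' \<in> inverse_system ?I \<xi>"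
    then show "act \<xi> \<Lambda>' p = 0" unfolding inv using that by blast
  qed
  \<comment> \<open>\<open>D\<close> has degree at most \<open>t\<close>, so \<open>Suc t\<close> is
    an order in which it kills all shifted monomials.\<close>
  let ?M = "{m :: 'a mon. mdeg m = Suc t}"
  have finM: "finite ?M" by (rule finite_subset[OF _ finite_mdeg_le[of "Suc t"]]) auto
  have kill: "act \<xi> d (shifted_monom \<xi> m) = 0" if "d \<in> D" "t < mdeg m" for d m
    using that D_polys_le by (auto simp: act_shifted_monom polys_le_iff)
  \<comment> \<open>Modulo the ideal, a monomial of order \<open>Suc t\<close> can be replaced by
    terms of order at least \<open>Suc (Suc t)\<close>; over \<open>?M\<close> these have
    coefficients of positive order, which vanish at \<open>\<xi>\<close> as Nakayama's lemma
    requires.\<close>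
  have "\<exists>a. (\<forall>m'\<in>?M. ev (a m') \<xi> = 0) \<and> shifted_monom \<xi> m - (\<Sum>m'\<in>?M. a m' * shifted_monom \<xi> m') \<in> ?I"
    if m: "m \<in> ?M" for m
  proof -
    obtain a b where ab: "shifted_monom \<xi> m = a + b" "a \<in> ?I" "b \<in> order_ge \<xi> (Suc (Suc t))"
      using in_I_plus[of "shifted_monom \<xi> m" "Suc (Suc t)"] kill m by auto
    have "\<exists>c. (\<forall>m'\<in>?M. ev (c m') \<xi> = 0) \<and> b = (\<Sum>m'\<in>?M. c m' * shifted_monom \<xi> m')"
      using ab(3) unfolding order_ge_def
    proof (induction rule: pvec.span_induct_alt)
      case base
      show ?case by (intro exI[of _ "\<lambda>_. 0"]) simp
    next
      case (step c0 x z)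
      then obtain n c where n: "x = shifted_monom \<xi> n" "Suc (Suc t) \<le> mdeg n"
        and c: "\<forall>m'\<in>?M. ev (c m') \<xi> = 0" "z = (\<Sum>m'\<in>?M. c m' * shifted_monom \<xi> m')" by blast
      obtain m1 m2 where m12: "n = m1 + m2" "mdeg m1 = Suc t" using mon_split[of "Suc t" n] n(2) by auto
      have "m2 \<noteq> 0" using n(2) m12 by auto
      define c' where "c' m' = (if m' = m1 then Const c0 * shifted_monom \<xi> m2 else 0) + c m'" for m'
      have "(\<Sum>m'\<in>?M. (if m' = m1 then Const c0 * shifted_monom \<xi> m2 else 0) * shifted_monom \<xi> m') =
          (\<Sum>m'\<in>?M. if m' = m1 then Const c0 * shifted_monom \<xi> m2 * shifted_monom \<xi> m1 else 0)"
        by (intro sum.cong) auto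
      also have "\<dots> = Const c0 * shifted_monom \<xi> m2 * shifted_monom \<xi> m1"
        using finM m12(2) by simp
      also have "\<dots> = Const c0 * x"
        by (simp only: n(1) m12(1) shifted_monom_add mult_ac)
      finally have "Const c0 * x + z = (\<Sum>m'\<in>?M. c' m' * shifted_monom \<xi> m')"
        by (simp add: c'_def distrib_right sum.distrib c(2))
      moreover have "\<forall>m'\<in>?M. ev (c' m') \<xi> = 0"
        using c(1) ev_shifted_monom[OF \<open>m2 \<noteq> 0\<close>] by (auto simp: c'_def)
      ultimately show ?case by blast
    qed
    then obtain c where c: "\<forall>m'\<in>?M. ev (c m') \<xi> = 0" "b = (\<Sum>m'\<in>?M. c m' * shifted_monom \<xi> m')" by blast
    have "shifted_monom \<xi> m - (\<Sum>m'\<in>?M. c m' * shifted_monom \<xi> m') \<in> ?I"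
      using ab(1,2) c(2) by simp
    then show ?thesis using c(1) by blast
  qed
  from nakayama[OF finM this] obtain h where h: "ev h \<xi> = 1"
    "\<And>m. mdeg m = Suc t \<Longrightarrow> h * shifted_monom \<xi> m \<in> ?I" by auto
  have local_iff: "p \<in> local_component ?I \<xi> \<longleftrightarrow> (\<forall>i\<in>{1..r}. act \<xi> (\<Lambda> i) p = 0)" for p
  proof
    assume "p \<in> local_component ?I \<xi>"
    then obtain q where q: "ev q \<xi> \<noteq> 0" "q * p \<in> ?I" by (auto simp: local_component_def)
    obtain qs where qs: "q = Const (ev q \<xi>) + (\<Sum>k\<in>UNIV. (Var k - Const (\<xi> k)) * qs k)"
      using linear_expansion[of q \<xi>] by blast
    \<comment> \<open>Only the constant term of \<open>q\<close> contributes, since the derivatives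
      of \<open>d\<close> already kill all multiples of \<open>p\<close>; and that constant is
      nonzero.\<close>
    have main: "act \<xi> d p = 0" if "d \<in> D" "\<And>k p'. act \<xi> (pd k d) (p' * p) = 0" for d
    proof -
      have "0 = act \<xi> d (q * p)" using D_I[OF that(1) q(2)] by simp
      also have "q * p = Const (ev q \<xi>) * p + (\<Sum>k\<in>UNIV. (Var k - Const (\<xi> k)) * (qs k * p))"
        by (subst qs) (simp only: distrib_right sum_distrib_right mult.assoc)
      also have "act \<xi> d \<dots> = ev q \<xi> * act \<xi> d p"
        by (simp only: act_add_right act_Const_mult_right act_sum_right act_linear_mult that(2)
            sum.neutral_const add_0_right)
      finally show ?thesis using q(1) by simp
    qed
    have "act \<xi> d p = 0" if "d \<in> D \<inter> polys_le n" for d n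
      using that
    proof (induction n arbitrary: d)
      case 0
      have "pd k d = 0" for k
        using 0 by (intro poly_mapping_eqI) (simp add: lookup_pd polys_le_iff mdeg_add)
      then show ?case using 0 main[of d] by simp
    next
      case (Suc n)
      have "act \<xi> (pd k d) (p' * p) = 0" for k p'
      proof (rule annihilated_ideal[where D = "D \<inter> polys_le n"])
        fix d' k' assume "d' \<in> D \<inter> polys_le n"
        then show "pd k' d' \<in> D \<inter> polys_le n"
          using pd_D pd_polys_le[of d' n k'] polys_le_mono[of n "Suc n"] by auto
      qed (use Suc pd_D pd_polys_le in auto)
      then show ?case using Suc.prems main[of d] by simp
    qed
    then show "\<forall>i\<in>{1..r}. act \<xi> (\<Lambda> i) p = 0"
      using \<Lambda>_D \<Lambda>_polys_le unfolding rt by blast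
  next
    assume "\<forall>i\<in>{1..r}. act \<xi> (\<Lambda> i) p = 0"
    then have "\<forall>d\<in>D. act \<xi> d p = 0" using act_D_eq_0_iff[of \<xi> p] rt by simp
    then obtain a b where ab: "p = a + b" "a \<in> ?I" "b \<in> order_ge \<xi> (Suc t)"
      using in_I_plus[of p "Suc t"] by blast
    have "h * p = h * a + h * b" by (simp add: ab(1) distrib_left)
    also have "\<dots> \<in> ?I" by (intro pideal.span_add ideal_mult ab(2) order_ge_ideal[OF h(2) ab(3)])
    finally show "p \<in> local_component ?I \<xi>" using h(1) by (auto simp: local_component_def intro!: exI[of _ h])
  qed
  have duality: "act \<xi> (\<Lambda> i) (shifted_monom \<xi> (\<beta> j)) = (if i = j then 1 else 0)"
    if "i \<in> {1..r}" "j \<in> {1..r}" for i j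
    using co_\<Lambda>[of i j] that by (simp add: co_eq_act_shifted rt)
  have "has_multiplicity ?I \<xi> r"
    unfolding has_multiplicity_def
    using basis_mod_dual[of "{1..r}" \<xi> \<Lambda> "\<lambda>j. shifted_monom \<xi> (\<beta> j)", OF _ duality local_iff]
    by (intro exI[of _ "(\<lambda>j. shifted_monom \<xi> (\<beta> j)) ` {1..r}"]) (simp add: card_image)
  moreover have "isolated_root N fs \<xi>"
  proof (rule isolated_root_if_local_power[of N fs \<xi> h "Suc t"])
    show "ev (fs i) \<xi> = 0" if "i \<in> {1..N}" for i
      using van[OF that, of "Suc 0"] r_pos by (simp add: \<Lambda>_1)
  qed (use h in auto)
  ultimately show ?thesis
    unfolding multiple_point_with_structure_def Let_def inv
    using family_D(1-3) duality unfolding rt by blast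
qed

end

section \<open>The equations as polynomial functions of the unknowns\<close>

lemma polyfun_mu_of: "polyfun 1 (\<lambda>p. mu_of r \<beta> piv p i j k)"
proof -
  consider "mdeg (\<beta> j) \<ge> mdeg (\<beta> i) \<or> in_prev r \<beta> i j k \<or> (j, k) \<in> nu2 r \<beta> piv (mdeg (\<beta> i))"
    | "\<not> mdeg (\<beta> j) \<ge> mdeg (\<beta> i)" "\<not> in_prev r \<beta> i j k" "(j, k) \<notin> nu2 r \<beta> piv (mdeg (\<beta> i))"
    by blast
  then show ?thesis
  proof cases
    case 1
    then have "mu_of r \<beta> piv p i j k = mu_of r \<beta> piv q i j k" for p q
      by (auto simp: mu_of_def)
    then have "(\<lambda>p. mu_of r \<beta> piv p i j k) = (\<lambda>p. mu_of r \<beta> piv undefined i j k)" by blast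
    then show ?thesis by (simp only: polyfun.const)
  next
    case 2
    then have "(\<lambda>p. mu_of r \<beta> piv p i j k) = (\<lambda>p. p (Mu i j k))" by (simp add: mu_of_def)
    then show ?thesis using polyfun.coord[of 0] by (simp only: One_nat_def)
  qed
qed

lemma lam_polys_le: "lam r \<beta> \<mu> i \<in> polys_le (mdeg (\<beta> i))"
proof (induction "mdeg (\<beta> i)" arbitrary: i rule: less_induct)
  case less
  show ?case
  proof (cases "i = 1")
    case True
    then show ?thesis by (auto simp: lam.simps polys_le_iff lookup_one when_def)
  next
    case False
    have "dint k (lam r \<beta> \<mu> j) \<in> polys_le (mdeg (\<beta> i))" if "mdeg (\<beta> j) < mdeg (\<beta> i)" for j k
      using dint_polys_le[OF less[OF that]] polys_le_mono[of "Suc (mdeg (\<beta> j))" "mdeg (\<beta> i)"] that by auto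
    then show ?thesis
      using False by (subst lam.simps)
        (auto intro!: pvec.subspace_sum pvec.subspace_scale subspace_polys_le)
  qed
qed

lemma polyfun_lookup_lam:
  "polyfun (mdeg (\<beta> j)) (\<lambda>p. lookup (lam r \<beta> (mu_of r \<beta> piv p) j) m)"
proof (induction "mdeg (\<beta> j)" arbitrary: j m rule: less_induct)
  case less
  let ?\<mu> = "mu_of r \<beta> piv"
  show ?case
  proof (cases "j = 1")
    case True
    then have "(\<lambda>p. lookup (lam r \<beta> (?\<mu> p) j) m) = (\<lambda>p. lookup 1 m)" by (simp add: lam.simps)
    then show ?thesis by (simp only: polyfun.const)
  next
    case False
    let ?J = "{i \<in> {1..r}. mdeg (\<beta> i) < mdeg (\<beta> j)}"
    have dint: "polyfun (mdeg (\<beta> i)) (\<lambda>p. lookup (dint k (lam r \<beta> (?\<mu> p) i)) m)" if "i \<in> ?J" for i k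
    proof (cases "0 < lookup m k \<and> (\<forall>l>k. lookup m l = 0)")
      case True
      then have "(\<lambda>p. lookup (dint k (lam r \<beta> (?\<mu> p) i)) m) =
          (\<lambda>p. (1 / of_nat (lookup m k)) * lookup (lam r \<beta> (?\<mu> p) i) (m - unit_mon k))"
        by (simp add: lookup_dint)
      moreover have "polyfun (mdeg (\<beta> i)) (\<lambda>p. lookup (lam r \<beta> (?\<mu> p) i) (m - unit_mon k))"
        using less[of i] that by simp
      ultimately show ?thesis by (simp only: polyfun_cmult)
    next
      case False
      then have "(\<lambda>p. lookup (dint k (lam r \<beta> (?\<mu> p) i)) m) = (\<lambda>p. 0)" by (simp only: lookup_dint False if_False)
      then show ?thesis by (simp only: polyfun.const)
    qed
    have "polyfun (mdeg (\<beta> j)) (\<lambda>p. ?\<mu> p j i k * lookup (dint k (lam r \<beta> (?\<mu> p) i)) m)" if "i \<in> ?J" for i k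
      using polyfun_mono[OF polyfun.mult[OF polyfun_mu_of dint[OF that]]] that by simp
    then have "polyfun (mdeg (\<beta> j)) (\<lambda>p. \<Sum>i\<in>?J. \<Sum>k\<in>UNIV. ?\<mu> p j i k * lookup (dint k (lam r \<beta> (?\<mu> p) i)) m)"
      by (intro polyfun_sum)
    moreover have "(\<lambda>p. lookup (lam r \<beta> (?\<mu> p) j) m) =
        (\<lambda>p. \<Sum>i\<in>?J. \<Sum>k\<in>UNIV. ?\<mu> p j i k * lookup (dint k (lam r \<beta> (?\<mu> p) i)) m)"
      using False by (subst lam.simps) (simp add: lookup_sum)
    ultimately show ?thesis by (simp only:)
  qed
qed

lemma polyfun_ev_xi_of: "\<exists>d. polyfun d (\<lambda>p. ev q (xi_of p))"
proof (induction q rule: mpoly_induct)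
  case (single m c)
  have "\<exists>d. polyfun d (\<lambda>p. mon_ev m (xi_of p))"
  proof (induction m rule: mon_induct)
    case zero
    have "polyfun 0 (\<lambda>p. mon_ev 0 (xi_of p))" by (simp only: mon_ev_0 polyfun.const)
    then show ?case by (rule exI)
  next
    case (add m k)
    then obtain d where d: "polyfun d (\<lambda>p. mon_ev m (xi_of p))" by blast
    have "(\<lambda>p. mon_ev (m + unit_mon k) (xi_of p)) = (\<lambda>p. mon_ev m (xi_of p) * p (X k))"
      by (simp add: mon_ev_add xi_of_def)
    then show ?case using polyfun.mult[OF d polyfun.coord[of 0 "X k"]] by metis
  qed
  then obtain d where "polyfun d (\<lambda>p. mon_ev m (xi_of p))" by blast
  then have "polyfun d (\<lambda>p. c * mon_ev m (xi_of p))" by (rule polyfun_cmult)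
  then show ?case by (intro exI[of _ d]) (simp only: ev_single)
next
  case (add q q')
  then obtain d d' where "polyfun d (\<lambda>p. ev q (xi_of p))" "polyfun d' (\<lambda>p. ev q' (xi_of p))" by blast
  then have "polyfun (max d d') (\<lambda>p. ev q (xi_of p))" "polyfun (max d d') (\<lambda>p. ev q' (xi_of p))"
    by (auto intro: polyfun_mono)
  then have "polyfun (max d d') (\<lambda>p. ev q (xi_of p) + ev q' (xi_of p))" by (rule polyfun.add)
  then show ?case by (intro exI[of _ "max d d'"]) (simp only: ev_add)
qed

lemma polyfun_family:
  assumes "finite E" "\<And>e. e \<in> E \<Longrightarrow> \<exists>d. polyfun d (F e)"
  shows "\<exists>d. \<forall>e\<in>E. polyfun d (F e)"
  using assms
proof (induction E)
  case (insert e E)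
  then obtain d d' where "\<forall>e\<in>E. polyfun d (F e)" "polyfun d' (F e)" by blast
  then have "\<forall>e'\<in>insert e E. polyfun (max d d') (F e')"
    using polyfun_mono max.cobounded1 max.cobounded2 by blast
  then show ?case by blast
qed simp

lemma polyfun_eqn_val:
  fixes \<beta> :: "nat \<Rightarrow> 'n::{finite,linorder} mon"
  shows "\<exists>d. polyfun d (eqn_val r \<beta> piv f e)"
proof (cases e)
  case (Compat i s k l)
  let ?\<mu> = "mu_of r \<beta> piv"
  have "polyfun (1 + 1) (\<lambda>p. \<Sum>j\<in>{j\<in>{1..r}. mdeg (\<beta> s) < mdeg (\<beta> j) \<and> mdeg (\<beta> j) < mdeg (\<beta> i)}.
      ?\<mu> p i j k * ?\<mu> p j s l - ?\<mu> p i j l * ?\<mu> p j s k)"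
    by (intro polyfun_sum polyfun_diff polyfun.mult polyfun_mu_of)
  then show ?thesis unfolding Compat eqn_val.simps(1)[abs_def] by blast
next
  case (Vanish j i)
  let ?\<Lambda> = "\<lambda>p. lam r \<beta> (mu_of r \<beta> piv p) j"
  \<comment> \<open>The support of \<open>lam\<close> varies with \<open>p\<close>; this finite set
    always contains it, so that \<open>act\<close> becomes one fixed finite sum.\<close>
  let ?S = "{m :: 'n mon. mdeg m \<le> mdeg (\<beta> j)}"
  have fin: "finite ?S" by (rule finite_mdeg_le)
  obtain d where d: "\<forall>m\<in>?S. polyfun d (\<lambda>p. ev (pd_mon m (f i)) (xi_of p))"
    using polyfun_family[OF fin, of "\<lambda>m p. ev (pd_mon m (f i)) (xi_of p)"] polyfun_ev_xi_of by blast
  have "act (xi_of p) (?\<Lambda> p) (f i) = (\<Sum>m\<in>?S. lookup (?\<Lambda> p) m * ev (pd_mon m (f i)) (xi_of p))" for p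
    using lam_polys_le[of r \<beta> "mu_of r \<beta> piv p" j] by (intro act_superset fin) (auto simp: polys_le_def)
  then have "eqn_val r \<beta> piv f e = (\<lambda>p. \<Sum>m\<in>?S. lookup (?\<Lambda> p) m * ev (pd_mon m (f i)) (xi_of p))"
    by (simp add: Vanish fun_eq_iff)
  moreover have "polyfun (mdeg (\<beta> j) + d) (\<lambda>p. \<Sum>m\<in>?S. lookup (?\<Lambda> p) m * ev (pd_mon m (f i)) (xi_of p))"
    by (intro polyfun_sum polyfun.mult polyfun_lookup_lam) (use d in blast)
  ultimately show ?thesis by metis
qed

section \<open>From the equations to the inverse system\<close>

lemma mat_rank_cong:
  assumes "\<And>\<rho> c. \<rho> \<in> R \<Longrightarrow> c \<in> C \<Longrightarrow> M \<rho> c = M' \<rho> c"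
  shows "mat_rank R C M = mat_rank R C M'"
proof -
  have "(\<lambda>c \<rho>. if \<rho> \<in> R then M \<rho> c else 0) ` C = (\<lambda>c \<rho>. if \<rho> \<in> R then M' \<rho> c else 0) ` C"
    using assms by (intro image_cong) auto
  then show ?thesis by (simp add: mat_rank_def)
qed

lemma H_entry_cong:
  assumes "\<rho> \<in> H_rows r \<beta> t" "c \<in> cols r \<beta> t"
    and "\<And>j s l. j \<in> {1..num_le r \<beta> (t - 1)} \<Longrightarrow> s \<in> {1..num_le r \<beta> (t - 1)} \<Longrightarrow> mdeg (\<beta> s) < mdeg (\<beta> j) \<Longrightarrow> m j s l = m' j s l"
  shows "H_entry \<beta> t m \<rho> c = H_entry \<beta> t m' \<rho> c"
proof -
  obtain j i where c: "c = (j, i)" "j \<in> {1..num_le r \<beta> (t - 1)}" using assms(2) by (auto simp: Defs.cols_def)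
  show ?thesis
    using assms(1) assms(3)[OF c(2)] unfolding H_rows_def c(1) by auto
qed

context mon_basis
begin

lemma idx_Suc: "{j \<in> {1..r}. mdeg (\<beta> j) < Suc t} = {1..rt t}"
  unfolding idx_iff by auto

lemma lam_eq_prim:
  assumes "i \<in> {1..r}" "mdeg (\<beta> i) = Suc t"
  shows "lam r \<beta> \<mu> i = prim {1..rt t} (lam r \<beta> \<mu>) (\<lambda>(j, k). \<mu> i j k)"
proof -
  have "i \<noteq> 1" using assms(2) by auto
  then have "lam r \<beta> \<mu> i = (\<Sum>j\<in>{1..rt t}. \<Sum>k\<in>UNIV. Const (\<mu> i j k) * dint k (lam r \<beta> \<mu> j))"
    by (subst lam.simps) (simp only: assms(2) idx_Suc if_False)
  also have "\<dots> = (\<Sum>k\<in>UNIV. \<Sum>j\<in>{1..rt t}. Const (\<mu> i j k) * dint k (lam r \<beta> \<mu> j))"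
    by (rule sum.swap)
  also have "\<dots> = prim {1..rt t} (lam r \<beta> \<mu>) (\<lambda>(j, k). \<mu> i j k)"
    unfolding prim_def dint_lincomb by simp
  finally show ?thesis .
qed

lemma dual_sys_0:
  assumes "\<Lambda> 1 = 1"
  shows "dual_sys 0 (pvec.span {1}) \<Lambda>"
proof -
  have idx: "{1..rt 0} = {Suc 0}" using rt_0 by simp
  have coeff: "d = Const (lookup d 0)" if d: "d \<in> pvec.span {1}" for d :: "'n mpoly"
  proof -
    obtain c where "d = Const c * 1" using d by (auto simp: pvec.span_singleton)
    then show ?thesis by (simp add: lookup_Const)
  qed
  have pd: "pd k d = 0" if "d \<in> pvec.span {1}" for k and d :: "'n mpoly"
    by (subst coeff[OF that]) simp
  show ?thesis
    unfolding dual_sys_def idx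
    using assms pd coeff
    by (auto simp: pvec.span_zero pvec.span_base polys_le_iff lookup_one when_def act_monom_poly)
qed

text \<open>
  The induction step from \<open>\<D>\<^sub>t\<close> to \<open>\<D>\<^sub>t\<^sub>+\<^sub>1\<close>: the invertible submatrix forces the rank of \<open>H\<^sub>t\<^sub>+\<^sub>1\<close> to be
  the generic one, so the chosen equations imply all of (1)--(2).
\<close>

theorem tower_step:
  assumes D: "dual_sys t D \<Lambda>" "D \<in> Hilb_reg r \<beta> t" and t: "Suc t \<le> top_deg r \<beta>"
    and m: "\<And>j s l. j \<in> {1..rt t} \<Longrightarrow> s \<in> {1..rt t} \<Longrightarrow> mdeg (\<beta> s) < mdeg (\<beta> j) \<Longrightarrow> m j s l = co (pd l (\<Lambda> j)) s"
    and reg: "regular_at r \<beta> (Suc t) E0"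
    and \<Lambda>: "\<And>i. i \<in> {1..r} \<Longrightarrow> mdeg (\<beta> i) = Suc t \<Longrightarrow> \<Lambda> i = prim {1..rt t} \<Lambda> (\<lambda>(j, k). m i j k)"
    and old: "\<And>i j k l. i \<in> {1..r} \<Longrightarrow> mdeg (\<beta> i) = Suc t \<Longrightarrow> j \<in> {1..rt t} \<Longrightarrow> l \<in> {1..rt t} \<Longrightarrow>
      \<beta> j + unit_mon k = \<beta> l \<Longrightarrow> m i j k = 0"
    and new: "\<And>i l. i \<in> {1..r} \<Longrightarrow> mdeg (\<beta> i) = Suc t \<Longrightarrow> l \<in> {1..r} \<Longrightarrow> mdeg (\<beta> l) = Suc t \<Longrightarrow>
      \<exists>j k. j \<in> {1..rt t} \<and> \<beta> l = \<beta> j + unit_mon k \<and> m i j k = (if i = l then 1 else 0)"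
    and RR: "RR \<subseteq> H_rows r \<beta> (Suc t)" and CC: "CC \<subseteq> cols r \<beta> (Suc t)" "card CC = generic_rank r \<beta> (Suc t)"
    and comm: "\<And>i s k l. i \<in> {1..r} \<Longrightarrow> mdeg (\<beta> i) = Suc t \<Longrightarrow> RComm s k l \<in> RR \<Longrightarrow>
      (\<Sum>c\<in>cols r \<beta> (Suc t). H_entry \<beta> (Suc t) m (RComm s k l) c * (case c of (j, k) \<Rightarrow> m i j k)) = 0"
    and inj: "\<And>a. (\<And>\<rho>. \<rho> \<in> RR \<Longrightarrow> (\<Sum>c\<in>CC. H_entry \<beta> (Suc t) m \<rho> c * a c) = 0) \<Longrightarrow> \<forall>c\<in>CC. a c = 0"
  shows "\<exists>E. dual_sys (Suc t) E \<Lambda> \<and> E \<in> Hilb_reg r \<beta> (Suc t) \<and>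
    (\<forall>j\<in>{1..rt (Suc t)}. \<forall>s\<in>{1..rt (Suc t)}. \<forall>l. mdeg (\<beta> s) < mdeg (\<beta> j) \<longrightarrow> m j s l = co (pd l (\<Lambda> j)) s)"
proof -
  interpret dual_system r \<beta> t D \<Lambda> by unfold_locales (rule D(1))
  let ?C = "cols r \<beta> (Suc t)" and ?R = "H_rows r \<beta> (Suc t)" and ?H = "H_entry \<beta> (Suc t) m"
  have finC: "finite ?C" by (simp add: Defs.cols_def)
  have "mat_rank ?R ?C ?H = H_rank r \<beta> (Suc t) D"
    unfolding H_rank_def H_at_def
  proof (rule mat_rank_cong, rule H_entry_cong)
    fix j s l assume "j \<in> {1..rt (Suc t - 1)}" "s \<in> {1..rt (Suc t - 1)}" "mdeg (\<beta> s) < mdeg (\<beta> j)"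
    then show "m j s l = mu_coord r \<beta> (Suc t - 1) D j s l"
      using m[of j s l] mu_coord_eq[of j s l] by simp
  qed
  moreover have "H_rank r \<beta> (Suc t) D \<le> card CC"
    using H_rank_le_generic_rank[OF D(2) dual_sys_Hilb_B[OF D(1)]] t CC(2) by simp
  ultimately have rank_le: "mat_rank ?R ?C ?H \<le> card CC" by simp
  have rank: "generic_rank r \<beta> (Suc t) \<le> H_rank r \<beta> (Suc t) D"
    using kernel_of_detecting_rows(1)[OF finC RR CC(1) rank_le inj] CC(2)
      \<open>mat_rank ?R ?C ?H = H_rank r \<beta> (Suc t) D\<close> by simp
  define \<nu> where "\<nu> i = (\<lambda>(j, k). m i j k)" for i
  have ker: "H_kernel (\<nu> i)" if i: "i \<in> {1..r}" "mdeg (\<beta> i) = Suc t" for i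
  proof -
    \<comment> \<open>Only the selected rows need checking: for \<open>RComm\<close> they are the
      given equations \<open>comm\<close>, for \<open>RDual\<close> they hold by the substituted
      zeros \<open>old\<close>.\<close>
    have "(\<Sum>c\<in>?C. ?H \<rho> c * \<nu> i c) = 0" if \<rho>: "\<rho> \<in> ?R" for \<rho>
    proof (rule kernel_of_detecting_rows(2)[OF finC RR CC(1) rank_le inj _ \<rho>])
      fix \<rho> assume \<rho>: "\<rho> \<in> RR"
      then consider (rc) s k l where "\<rho> = RComm s k l"
        | (rd) j k l where "\<rho> = RDual j k" "j \<in> {1..rt t}" "l \<in> {1..rt t}" "\<beta> j + unit_mon k = \<beta> l"
        using RR unfolding H_rows_def by auto
      then show "(\<Sum>c\<in>?C. ?H \<rho> c * \<nu> i c) = 0"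
      proof cases
        case rc
        then show ?thesis using \<rho> comm[OF i, of s k l] by (simp add: \<nu>_def)
      next
        case rd
        have "(\<Sum>c\<in>{1..rt t} \<times> UNIV. ?H (RDual j k) c * \<nu> i c) = \<nu> i (j, k)"
          by (rule H_entry_sum_RDual[OF rd(2)])
        then show ?thesis using old[OF i rd(2-4)] by (simp add: rd(1) \<nu>_def Defs.cols_def)
      qed
    qed
    then show ?thesis using H_kernel_iff[OF m, of "\<nu> i"] by blast
  qed
  have \<Lambda>_new: "\<Lambda> i = \<Phi> (\<nu> i)" if "i \<in> {1..r}" "mdeg (\<beta> i) = Suc t" for i
    using \<Lambda>[OF that] by (simp only: \<nu>_def)
  have split: "i \<in> {1..rt t} \<or> (i \<in> {1..r} \<and> mdeg (\<beta> i) = Suc t)" if "i \<in> {1..rt (Suc t)}" for i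
    using that in_idx_iff[of i "Suc t"] in_idx_iff[of i t] by auto
  let ?I = "{1..rt (Suc t)}"
  define E where "E = pvec.span (\<Lambda> ` ?I)"
  have sub: "pvec.subspace E" by (simp add: E_def)
  have \<Lambda>_E: "\<Lambda> i \<in> E" if "i \<in> ?I" for i using that by (auto simp: E_def intro: pvec.span_base)
  have DE: "D \<subseteq> E"
    unfolding family_D(3)[symmetric] E_def
    using rt_mono[of t "Suc t"] by (intro pvec.span_mono image_mono) auto
  have pd_new: "pd k (\<Lambda> i) = g (\<nu> i) k" if "i \<in> {1..r}" "mdeg (\<beta> i) = Suc t" for i k
    unfolding \<Lambda>_new[OF that] by (rule pd_\<Phi>[OF ker[OF that]])
  have pd_\<Lambda>D: "pd k (\<Lambda> i) \<in> D" if "i \<in> ?I" for i k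
    using split[OF that] pd_D[OF \<Lambda>_D[of i]] pd_new[of i k] sum_\<Lambda>_D by auto
  have pd_E: "pd k e \<in> D" if "e \<in> E" for e k
    using that unfolding E_def
  proof (induction rule: pvec.span_induct_alt)
    case base
    show ?case by (simp add: pvec.subspace_0 subspace_D)
  next
    case (step c x y)
    then show ?case using pd_\<Lambda>D by (auto intro!: pvec.subspace_add pvec.subspace_scale subspace_D)
  qed
  have deg: "\<Lambda> i \<in> polys_le (mdeg (\<beta> i))" if "i \<in> ?I" for i
    using split[OF that]
  proof
    assume i: "i \<in> {1..r} \<and> mdeg (\<beta> i) = Suc t"
    have "\<Phi> (\<nu> i) \<in> polys_le (Suc t)"
      using \<Lambda>_D D_polys_le by (intro prim_polys_le) blast
    then show ?thesis using i \<Lambda>_new[of i] by simp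
  qed (rule \<Lambda>_polys_le)
  have dual: "co (\<Lambda> i) l = (if i = l then 1 else 0)" if i: "i \<in> ?I" and l: "l \<in> ?I" for i l
    using split[OF i]
  proof
    assume i: "i \<in> {1..rt t}"
    show ?thesis using split[OF l]
    proof
      assume l: "l \<in> {1..r} \<and> mdeg (\<beta> l) = Suc t"
      have "mdeg (\<beta> i) < mdeg (\<beta> l)" using i l in_idx_iff[of i t] by simp
      then show ?thesis using \<Lambda>_polys_le[OF i] by (auto simp: act_monom_poly polys_le_iff)
    qed (rule co_\<Lambda>[OF i])
  next
    assume i: "i \<in> {1..r} \<and> mdeg (\<beta> i) = Suc t"
    then have i1: "i \<in> {1..r}" and i2: "mdeg (\<beta> i) = Suc t" by auto
    show ?thesis using split[OF l]
    proof
      assume l: "l \<in> {1..rt t}"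
      then have "i \<noteq> l" using i2 in_idx_iff[of l t] by auto
      then show ?thesis unfolding \<Lambda>_new[OF i1 i2] using co_\<Phi>[OF ker[OF i1 i2] l] by simp
    next
      assume l: "l \<in> {1..r} \<and> mdeg (\<beta> l) = Suc t"
      then obtain j k where jk: "j \<in> {1..rt t}" "\<beta> l = \<beta> j + unit_mon k" "m i j k = (if i = l then 1 else 0)"
        using new[OF i1 i2, of l] by blast
      have "co (\<Lambda> i) l = co (g (\<nu> i) k) j"
        unfolding jk(2) act_monom_add_unit pd_new[OF i1 i2] ..
      also have "\<dots> = \<nu> i (j, k)" by (rule co_sum[OF jk(1)])
      finally show ?thesis using jk(3) by (simp add: \<nu>_def)
    qed
  qed
  have "d = (\<Sum>i\<in>?I. Const (co d i) * \<Lambda> i)" if d: "d \<in> E" for d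
  proof -
    obtain c where c: "d = (\<Sum>i\<in>?I. Const (c i) * \<Lambda> i)"
      using pvec.span_family[of ?I d \<Lambda>] d unfolding E_def by auto
    have "co d l = c l" if l: "l \<in> ?I" for l
    proof -
      have "co d l = (\<Sum>i\<in>?I. if i = l then c l else 0)"
        unfolding c act_sum_left using dual l by (intro sum.cong) auto
      then show ?thesis using l by simp
    qed
    then have "(\<Sum>i\<in>?I. Const (co d i) * \<Lambda> i) = (\<Sum>i\<in>?I. Const (c i) * \<Lambda> i)" by (intro sum.cong) auto
    then show ?thesis using c by (simp only:)
  qed
  then have E: "dual_sys (Suc t) E \<Lambda>"
    unfolding dual_sys_def using sub pd_E DE \<Lambda>_E deg dual by blast
  have "pd k ` E \<subseteq> D" for k using pd_E by blast
  then have "E \<in> Hilb_reg r \<beta> (Suc t)"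
    using t by (intro Hilb_reg_extend[OF reg _ D(2,1) rank E DE]) simp_all
  moreover have "m j s l = co (pd l (\<Lambda> j)) s"
    if j: "j \<in> ?I" and s: "s \<in> ?I" and lt: "mdeg (\<beta> s) < mdeg (\<beta> j)" for j s l
  proof -
    have s': "s \<in> {1..rt t}" using split[OF s] split[OF j] lt in_idx_iff[of j t] in_idx_iff[of s t] by auto
    show ?thesis using split[OF j]
    proof
      assume "j \<in> {1..rt t}"
      then show ?thesis using m[OF _ s' lt] by simp
    next
      assume j: "j \<in> {1..r} \<and> mdeg (\<beta> j) = Suc t"
      then have "co (pd l (\<Lambda> j)) s = \<nu> j (s, l)" using pd_new[of j l] co_sum[OF s'] by simp
      then show ?thesis by (simp add: \<nu>_def)
    qed
  qed
  ultimately show ?thesis using E by blast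
qed

section \<open>Substituted values and selected submatrices at the computed zero\<close>

lemma mu_of_cong:
  assumes "\<And>a. a \<in> mu_unknowns r \<beta> piv \<Longrightarrow> p a = q a" "i \<in> {1..r}" "j \<in> {1..r}"
  shows "mu_of r \<beta> piv p i j k = mu_of r \<beta> piv q i j k"
  using assms(1)[of "Mu i j k"] assms(2,3) by (auto simp: mu_of_def mu_unknowns_def)

lemma mu_of_old:
  assumes "i \<in> {1..r}" "mdeg (\<beta> i) = Suc t" "j \<in> {1..rt t}" "l \<in> {1..rt t}" "\<beta> j + unit_mon k = \<beta> l"
  shows "mu_of r \<beta> piv p i j k = 0"
proof -
  have "in_prev r \<beta> i j k"
    unfolding in_prev_def using assms(2,4,5) in_idx_iff[of l t] by (intro bexI[of _ l]) auto
  then show ?thesis by (simp add: mu_of_def)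
qed

text \<open>The chosen variable of \<open>\<beta> l\<close> is where the duality value was
  substituted. The rule for \<open>in_prev\<close> does not interfere, since
  \<open>\<beta> l\<close> has the full degree of stage \<open>Suc t\<close>.\<close>

lemma mu_of_new:
  assumes piv: "pivot_choice r \<beta> piv" and i: "i \<in> {1..r}" "mdeg (\<beta> i) = Suc t"
    and l: "l \<in> {1..r}" "mdeg (\<beta> l) = Suc t"
  shows "\<exists>j k. j \<in> {1..rt t} \<and> \<beta> l = \<beta> j + unit_mon k \<and> mu_of r \<beta> piv p i j k = (if i = l then 1 else 0)"
proof -
  obtain j k where jk: "piv l = (j, k)" by fastforce
  have j: "j \<in> {1..rt t}" "\<beta> j + unit_mon k = \<beta> l"
    using piv l jk unfolding pivot_choice_def by fastforce+
  have "\<not> in_prev r \<beta> i j k"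
    unfolding in_prev_def j(2) using i(2) l(2) by auto
  moreover have "(j, k) \<in> nu2 r \<beta> piv (mdeg (\<beta> i))"
    unfolding nu2_def using jk[symmetric] l i(2) by (intro image_eqI[of _ _ l]) auto
  moreover have "\<not> mdeg (\<beta> i) \<le> mdeg (\<beta> j)" using j(1) i(2) in_idx_iff[of j t] by auto
  moreover have "\<beta> j + unit_mon k = \<beta> i \<longleftrightarrow> i = l"
    unfolding j(2) using \<beta>_eq_iff[OF l(1) i(1)] by auto
  ultimately have "mu_of r \<beta> piv p i j k = (if i = l then 1 else 0)" by (simp add: mu_of_def)
  then show ?thesis using j by (intro exI[of _ j] exI[of _ k]) auto
qed

text \<open>
  If there are no unknowns \<open>\<mu>\<close>, then a Lipschitz constant may be negative and the bounds on \<open>A\<^sub>t\<close> say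
  nothing; but then \<open>A\<^sub>t\<close> is constant and invertible by its choice.
\<close>

lemma mu_of_eq_mu_coord:
  assumes piv: "pivot_choice r \<beta> piv" and none: "mu_unknowns r \<beta> piv = {}" and D: "dual_sys t D \<Lambda>"
    and j: "j \<in> {1..rt t}" and s: "s \<in> {1..rt t}" and lt: "mdeg (\<beta> s) < mdeg (\<beta> j)"
  shows "mu_of r \<beta> piv p j s l = mu_coord r \<beta> t D j s l"
proof -
  interpret dual_system r \<beta> t D \<Lambda> by unfold_locales (rule D)
  have jr: "j \<in> {1..r}" "s \<in> {1..r}" "mdeg (\<beta> j) \<le> t" using j s in_idx_iff by blast+
  have val: "mu_coord r \<beta> t D j s l = (if j = i then 1 else 0)"
    if "i \<in> {1..r}" "mdeg (\<beta> i) \<le> mdeg (\<beta> j)" "\<beta> i = \<beta> s + unit_mon l" for i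
  proof -
    have "i \<in> {1..rt t}" using that jr in_idx_iff[of i t] by simp
    then show ?thesis
      using mu_coord_eq[OF j, of s l] co_\<Lambda>[OF j, of i] by (simp add: that(3) act_monom_add_unit)
  qed
  have "Mu j s l \<notin> mu_unknowns r \<beta> piv" using none by simp
  then consider (old) "in_prev r \<beta> j s l" | (new) "\<not> in_prev r \<beta> j s l" "(s, l) \<in> nu2 r \<beta> piv (mdeg (\<beta> j))"
    using jr lt by (auto simp: mu_unknowns_def)
  then show ?thesis
  proof cases
    case old
    then obtain i where i: "i \<in> {1..r}" "mdeg (\<beta> i) \<le> mdeg (\<beta> j) - 1" "\<beta> i = \<beta> s + unit_mon l"
      by (auto simp: in_prev_def)
    have "j \<noteq> i" using i(2) lt by auto
    then show ?thesis using val[of i] i old lt by (simp add: mu_of_def)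
  next
    case new
    then obtain i where i: "i \<in> {1..r}" "mdeg (\<beta> i) = mdeg (\<beta> j)" "piv i = (s, l)"
      by (auto simp: nu2_def)
    then have \<beta>i: "\<beta> i = \<beta> s + unit_mon l"
      using piv lt unfolding pivot_choice_def by force
    have "\<beta> s + unit_mon l = \<beta> j \<longleftrightarrow> j = i" unfolding \<beta>i[symmetric] using \<beta>_eq_iff[OF i(1) jr(1)] by auto
    then show ?thesis using val[of i] i \<beta>i new lt by (simp add: mu_of_def)
  qed
qed

lemma finite_H_rows: "finite (H_rows r \<beta> t)"
proof (rule finite_subset)
  show "H_rows r \<beta> t \<subseteq> (\<Union>s\<in>{1..rt (t - 1)}. \<Union>k. range (RComm s k)) \<union> (\<Union>j\<in>{1..rt (t - 1)}. range (RDual j))"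
    unfolding H_rows_def by blast
qed simp

lemma submatrix_injective:
  assumes piv: "pivot_choice r \<beta> piv" and sub: "submatrix_choice r \<beta> piv rs cs" and t: "t \<in> {1..top_deg r \<beta>}"
    and lip: "lipschitz_bound (mu_unknowns r \<beta> piv) p0 bt
           (\<lambda>p. mat_norm (set (rs t)) (set (cs t)) (A_at r \<beta> piv t p - A_at r \<beta> piv t p0)) L"
    and sigma: "generic_rank r \<beta> t > 0 \<Longrightarrow> L * bt < sigma_min (set (rs t)) (set (cs t)) (A_at r \<beta> piv t p0)"
    and bt: "0 \<le> bt" and p: "vnorm (mu_unknowns r \<beta> piv) (p - p0) \<le> bt" and fin: "finite (mu_unknowns r \<beta> piv)"
    and ker: "\<And>\<rho>. \<rho> \<in> set (rs t) \<Longrightarrow> (\<Sum>c\<in>set (cs t). A_at r \<beta> piv t p \<rho> c * a c) = 0"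
  shows "\<forall>c\<in>set (cs t). a c = 0"
proof -
  let ?M = "mu_unknowns r \<beta> piv"
  have rs: "distinct (rs t)" "set (rs t) \<subseteq> H_rows r \<beta> t" "length (rs t) = generic_rank r \<beta> t"
    and cs: "distinct (cs t)" "set (cs t) \<subseteq> cols r \<beta> t" "length (cs t) = generic_rank r \<beta> t"
    and det: "\<exists>D \<in> Hilb_reg r \<beta> (t - 1) \<inter> Hilb_B r \<beta> (t - 1). sub_det (H_at r \<beta> t D) (rs t) (cs t) \<noteq> 0"
    using sub t unfolding submatrix_choice_def by auto
  have A_cong: "A_at r \<beta> piv t p \<rho> c = A_at r \<beta> piv t q \<rho> c"
    if "\<And>a. a \<in> ?M \<Longrightarrow> p a = q a" "\<rho> \<in> set (rs t)" "c \<in> set (cs t)" for p q \<rho> c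
    unfolding A_at_def
  proof (rule H_entry_cong)
    fix j s l assume "j \<in> {1..rt (t - 1)}" "s \<in> {1..rt (t - 1)}"
    then have "j \<in> {1..r}" "s \<in> {1..r}" using in_idx_iff by blast+
    then show "mu_of r \<beta> piv p j s l = mu_of r \<beta> piv q j s l" by (intro mu_of_cong that(1))
  qed (use that rs cs in auto)
  consider "generic_rank r \<beta> t = 0" | (unk) "?M \<noteq> {}" "generic_rank r \<beta> t > 0" | (none) "?M = {}" by blast
  then show ?thesis
  proof cases
    case 1
    then show ?thesis using cs(3) by simp
  next
    case unk
    \<comment> \<open>The Lipschitz bound varies only the unknowns in \<open>?M\<close>;
      \<open>q\<close> is the admissible point with the same submatrix as \<open>p\<close>.\<close>
    define q where "q = (\<lambda>a. if a \<in> ?M then p a else p0 a)"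
    have "vnorm ?M (q - p0) = vnorm ?M (p - p0)" by (rule vnorm_cong) (simp add: q_def)
    then have "mat_norm (set (rs t)) (set (cs t)) (A_at r \<beta> piv t q - A_at r \<beta> piv t p0) \<le> L * bt"
      using p by (intro lipschitz_bound_le[OF lip fin unk(1) bt]) (simp_all add: q_def mat_norm_nonneg)
    then have lt: "mat_norm (set (rs t)) (set (cs t)) (A_at r \<beta> piv t q - A_at r \<beta> piv t p0)
        < sigma_min (set (rs t)) (set (cs t)) (A_at r \<beta> piv t p0)"
      using sigma[OF unk(2)] by linarith
    show ?thesis
    proof (rule perturbation_injective[OF _ _ lt])
      fix \<rho> assume \<rho>: "\<rho> \<in> set (rs t)"
      have "(\<Sum>c\<in>set (cs t). A_at r \<beta> piv t q \<rho> c * a c) = (\<Sum>c\<in>set (cs t). A_at r \<beta> piv t p \<rho> c * a c)"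
        using A_cong[of q p \<rho>] \<rho> by (intro sum.cong) (auto simp: q_def)
      then show "(\<Sum>c\<in>set (cs t). A_at r \<beta> piv t q \<rho> c * a c) = 0" using ker[OF \<rho>] by simp
    qed auto
  next
    case none
    obtain D where D: "D \<in> Hilb_reg r \<beta> (t - 1)" "D \<in> Hilb_B r \<beta> (t - 1)"
      and det: "sub_det (H_at r \<beta> t D) (rs t) (cs t) \<noteq> 0" using det by blast
    obtain \<Lambda> where \<Lambda>: "dual_sys (t - 1) D \<Lambda>" using Hilb_reg_Hilb_B_dual_sys[OF D] by blast
    have entry: "A_at r \<beta> piv t p \<rho> c = H_at r \<beta> t D \<rho> c" if "\<rho> \<in> set (rs t)" "c \<in> set (cs t)" for \<rho> c
      unfolding A_at_def H_at_def
      by (rule H_entry_cong) (use that rs cs mu_of_eq_mu_coord[OF piv none \<Lambda>] in auto)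
    let ?n = "generic_rank r \<beta> t"
    have "(\<Sum>b<?n. H_at r \<beta> t D (rs t ! a') (cs t ! b) * a (cs t ! b)) = 0" if a': "a' < ?n" for a'
    proof -
      have \<rho>: "rs t ! a' \<in> set (rs t)" using a' rs(3) by simp
      have bij: "bij_betw ((!) (cs t)) {..<?n} (set (cs t))" using cs(1,3) by (intro bij_betw_nth) auto
      have "(\<Sum>b<?n. H_at r \<beta> t D (rs t ! a') (cs t ! b) * a (cs t ! b)) =
          (\<Sum>c\<in>set (cs t). H_at r \<beta> t D (rs t ! a') c * a c)"
        by (rule sum.reindex_bij_betw[OF bij])
      also have "\<dots> = 0" using ker[OF \<rho>] entry[OF \<rho>] by simp
      finally show ?thesis .
    qed
    then have "\<forall>b<?n. a (cs t ! b) = 0"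
      using det sub_det_eq_0_iff[OF rs(3) cs(3), of "H_at r \<beta> t D"] by auto
    then show ?thesis unfolding all_set_conv_all_nth cs(3) by simp
  qed
qed

lemma finite_mu_unknowns: "finite (mu_unknowns r \<beta> piv)"
proof -
  have "mu_unknowns r \<beta> piv \<subseteq> (\<lambda>(i, j, k). Mu i j k) ` ({1..r} \<times> {1..r} \<times> UNIV)"
    unfolding mu_unknowns_def by force
  then show ?thesis by (rule finite_subset) simp
qed

lemma finite_G0: "finite (G0 r \<beta> rs)"
proof -
  have "G0 r \<beta> rs \<subseteq> (\<Union>i\<in>{1..r}. (\<lambda>\<rho>. case \<rho> of RComm s k l \<Rightarrow> Compat i s k l | _ \<Rightarrow> undefined) ` set (rs (mdeg (\<beta> i))))"
    unfolding G0_def by force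
  then show ?thesis by (rule finite_subset) simp
qed

text \<open>Besides the dual system the induction must carry membership in \<open>Hilb_reg\<close>,
  for the rank bound at the next stage, and the agreement of the unknowns with the coordinates of
  \<open>D\<close>, so that both define the same matrix \<open>H\<close>.\<close>

theorem inverse_system_of_zero:
  assumes reg: "regular_set r \<beta>" and piv: "pivot_choice r \<beta> piv" and sub: "submatrix_choice r \<beta> piv rs cs"
    and zero: "\<And>e. e \<in> G0 r \<beta> rs \<Longrightarrow> eqn_val r \<beta> piv f e p = 0"
    and inj: "\<And>t a. t \<in> {1..top_deg r \<beta>} \<Longrightarrow>
      (\<And>\<rho>. \<rho> \<in> set (rs t) \<Longrightarrow> (\<Sum>c\<in>set (cs t). A_at r \<beta> piv t p \<rho> c * a c) = 0) \<Longrightarrow> \<forall>c\<in>set (cs t). a c = 0"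
    and t: "t \<le> top_deg r \<beta>"
  shows "\<exists>D. dual_sys t D (lam r \<beta> (mu_of r \<beta> piv p)) \<and> D \<in> Hilb_reg r \<beta> t \<and>
    (\<forall>j\<in>{1..rt t}. \<forall>s\<in>{1..rt t}. \<forall>l. mdeg (\<beta> s) < mdeg (\<beta> j) \<longrightarrow>
      mu_of r \<beta> piv p j s l = co (pd l (lam r \<beta> (mu_of r \<beta> piv p) j)) s)"
  using t
proof (induction t)
  case 0
  let ?\<Lambda> = "lam r \<beta> (mu_of r \<beta> piv p)"
  have "?\<Lambda> 1 = 1" by (simp add: lam.simps)
  from dual_sys_0[of ?\<Lambda>, OF this] show ?case
    using rt_0 by (intro exI[of _ "pvec.span {1}"]) auto
next
  case (Suc t)
  let ?\<mu> = "mu_of r \<beta> piv p"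
  let ?\<Lambda> = "lam r \<beta> ?\<mu>"
  obtain D where D: "dual_sys t D ?\<Lambda>" "D \<in> Hilb_reg r \<beta> t"
    and m: "\<And>j s l. j \<in> {1..rt t} \<Longrightarrow> s \<in> {1..rt t} \<Longrightarrow> mdeg (\<beta> s) < mdeg (\<beta> j) \<Longrightarrow> ?\<mu> j s l = co (pd l (?\<Lambda> j)) s"
    using Suc by auto
  interpret dual_system r \<beta> t D ?\<Lambda> by unfold_locales (rule D(1))
  have t: "Suc t \<in> {1..top_deg r \<beta>}" using Suc.prems by simp
  obtain E0 where E0: "regular_at r \<beta> (Suc t) E0" using reg t unfolding regular_set_def by blast
  have rs: "set (rs (Suc t)) \<subseteq> H_rows r \<beta> (Suc t)"
    and cs: "set (cs (Suc t)) \<subseteq> cols r \<beta> (Suc t)" "card (set (cs (Suc t))) = generic_rank r \<beta> (Suc t)"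
    using sub t unfolding submatrix_choice_def by (auto simp: distinct_card)
  have deg: "mdeg (\<beta> j) < Suc t" if "j \<in> {1..rt t}" for j using that in_idx_iff[of j t] by simp
  show ?case
  proof (rule tower_step[OF D Suc.prems m E0 lam_eq_prim mu_of_old mu_of_new[OF piv] rs cs])
    fix i s k l assume i: "i \<in> {1..r}" "mdeg (\<beta> i) = Suc t" and row: "RComm s k l \<in> set (rs (Suc t))"
    have "Compat i s k l \<in> G0 r \<beta> rs" using i row by (auto simp: G0_def)
    then have "0 = eqn_val r \<beta> piv f (Compat i s k l) p" by (rule zero[symmetric])
    also have "\<dots> = (\<Sum>j\<in>{1..rt t}. if mdeg (\<beta> s) < mdeg (\<beta> j) then ?\<mu> j s l * ?\<mu> i j k - ?\<mu> j s k * ?\<mu> i j l else 0)"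
    proof -
      have "{j\<in>{1..r}. mdeg (\<beta> s) < mdeg (\<beta> j) \<and> mdeg (\<beta> j) < mdeg (\<beta> i)} = {j\<in>{1..rt t}. mdeg (\<beta> s) < mdeg (\<beta> j)}"
        unfolding idx_Suc[symmetric] i(2) by auto
      then have "eqn_val r \<beta> piv f (Compat i s k l) p = (\<Sum>j\<in>{j\<in>{1..rt t}. mdeg (\<beta> s) < mdeg (\<beta> j)}. ?\<mu> j s l * ?\<mu> i j k - ?\<mu> j s k * ?\<mu> i j l)"
        unfolding eqn_val.simps by (simp only: mult.commute)
      also have "\<dots> = (\<Sum>j\<in>{1..rt t}. if mdeg (\<beta> s) < mdeg (\<beta> j) then ?\<mu> j s l * ?\<mu> i j k - ?\<mu> j s k * ?\<mu> i j l else 0)"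
        by (rule sum.inter_filter) simp
      finally show ?thesis .
    qed
    also have "\<dots> = (\<Sum>c\<in>{1..rt t} \<times> UNIV. H_entry \<beta> (Suc t) ?\<mu> (RComm s k l) c * (case c of (j, k) \<Rightarrow> ?\<mu> i j k))"
      using H_entry_sum_RComm[of "Suc t" ?\<mu> s k l "\<lambda>(j, k). ?\<mu> i j k", OF deg, symmetric]
      by (simp only: case_prod_conv diff_Suc_1)
    finally show "(\<Sum>c\<in>cols r \<beta> (Suc t). H_entry \<beta> (Suc t) ?\<mu> (RComm s k l) c * (case c of (j, k) \<Rightarrow> ?\<mu> i j k)) = 0"
      by (simp add: Defs.cols_def)
  next
    fix a assume "\<And>\<rho>. \<rho> \<in> set (rs (Suc t)) \<Longrightarrow> (\<Sum>c\<in>set (cs (Suc t)). H_entry \<beta> (Suc t) ?\<mu> \<rho> c * a c) = 0"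
    then show "\<forall>c\<in>set (cs (Suc t)). a c = 0" by (intro inj[OF t]) (simp add: A_at_def)
  qed
qed

end

context dual_system
begin

text \<open>A dual element sees the perturbation only through its coordinates:
  \<open>\<Lambda> j\<close> picks out the entry \<open>\<epsilon> (i, j)\<close>, while an integral
  with zero coordinates does not notice it. The latter is therefore tested on \<open>f\<close>
  itself, which is what the \<open>REval\<close> rows of \<open>K\<close> do.\<close>

theorem perturbed_multiplicity_structure:
  fixes f :: "nat \<Rightarrow> 'a mpoly"
  assumes rt: "rt t = r" and \<Lambda>: "\<Lambda> = lam r \<beta> m"
    and m: "\<And>j s l. j \<in> {1..rt t} \<Longrightarrow> s \<in> {1..rt t} \<Longrightarrow> mdeg (\<beta> s) < mdeg (\<beta> j) \<Longrightarrow> m j s l = \<mu> j s l"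
    and \<epsilon>: "\<And>i j. i \<in> {1..N} \<Longrightarrow> j \<in> {1..r} \<Longrightarrow> \<epsilon> (i, j) = act \<xi> (\<Lambda> j) (f i)"
    and K: "\<And>a. (\<And>\<rho>. \<rho> \<in> K_rows r \<beta> N (Suc t) \<Longrightarrow>
        (\<Sum>c\<in>cols r \<beta> (Suc t). K_entry r \<beta> f (Suc t) \<xi> m \<rho> c * a c) = 0) \<Longrightarrow> \<forall>c\<in>cols r \<beta> (Suc t). a c = 0"
  shows "multiple_point_with_structure r \<beta> N (perturbed r \<beta> f \<epsilon> \<xi>) \<xi> \<Lambda>"
proof (rule multiplicity_structure[OF rt])
  have act_perturbed: "act \<xi> P (perturbed r \<beta> f \<epsilon> \<xi> i) = act \<xi> P (f i) - (\<Sum>j\<in>{1..r}. \<epsilon> (i, j) * co P j)" for P i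
    by (simp only: perturbed_def act_diff_right act_sum_right act_Const_mult_right co_eq_act_shifted)
  show "act \<xi> (\<Lambda> j) (perturbed r \<beta> f \<epsilon> \<xi> i) = 0" if i: "i \<in> {1..N}" and j: "j \<in> {1..r}" for i j
  proof -
    have "(\<Sum>l\<in>{1..r}. \<epsilon> (i, l) * co (\<Lambda> j) l) = (\<Sum>l\<in>{1..r}. if l = j then \<epsilon> (i, j) else 0)"
      using j by (intro sum.cong refl) (simp add: co_\<Lambda> rt)
    also have "\<dots> = \<epsilon> (i, j)" using j by (simp only: sum.delta finite_atLeastAtMost if_True)
    finally show ?thesis unfolding act_perturbed using \<epsilon>[OF i j] by simp
  qed
  fix P assume P: "\<And>k. pd k P \<in> D" "\<And>i. i \<in> {1..r} \<Longrightarrow> co P i = 0"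
    and act0: "\<And>i. i \<in> {1..N} \<Longrightarrow> act \<xi> P (perturbed r \<beta> f \<epsilon> \<xi> i) = 0"
  define \<nu> where "\<nu> = (\<lambda>(j, k). co (pd k P) j)"
  have \<nu>: "H_kernel \<nu>" "P = \<Phi> \<nu>"
    using integral_eq_\<Phi>(1,2)[of P, OF P(1)] P(2) unfolding rt \<nu>_def by blast+
  have cols: "cols r \<beta> (Suc t) = {1..rt t} \<times> UNIV" by (simp add: Defs.cols_def)
  have "\<forall>c\<in>cols r \<beta> (Suc t). \<nu> c = 0"
  proof (rule K)
    fix \<rho> assume "\<rho> \<in> K_rows r \<beta> N (Suc t)"
    then consider (H) "\<rho> \<in> H_rows r \<beta> (Suc t)" | (E) l where "l \<in> {1..N}" "\<rho> = REval l"
      unfolding K_rows_def by blast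
    then show "(\<Sum>c\<in>cols r \<beta> (Suc t). K_entry r \<beta> f (Suc t) \<xi> m \<rho> c * \<nu> c) = 0"
    proof cases
      case H
      then have "K_entry r \<beta> f (Suc t) \<xi> m \<rho> c = H_entry \<beta> (Suc t) m \<rho> c" for c
        unfolding H_rows_def by auto
      then show ?thesis using H_kernel_iff[of m \<nu>, OF m] \<nu>(1) H by (simp only:) blast
    next
      case (E l)
      have "(\<Sum>c\<in>cols r \<beta> (Suc t). K_entry r \<beta> f (Suc t) \<xi> m \<rho> c * \<nu> c) =
          (\<Sum>j\<in>{1..rt t}. \<Sum>k\<in>UNIV. act \<xi> (dint k (\<Lambda> j)) (f l) * \<nu> (j, k))"
        unfolding E(2) cols \<Lambda> sum.cartesian_product
        by (intro sum.cong) (auto simp only: K_entry.simps case_prod_conv)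
      also have "\<dots> = (\<Sum>k\<in>UNIV. \<Sum>j\<in>{1..rt t}. \<nu> (j, k) * act \<xi> (dint k (\<Lambda> j)) (f l))"
        by (subst sum.swap) (simp only: mult.commute)
      also have "\<dots> = act \<xi> (\<Phi> \<nu>) (f l)"
        by (simp only: prim_def dint_lincomb act_sum_left act_Const_mult_left)
      also have "\<dots> = act \<xi> P (perturbed r \<beta> f \<epsilon> \<xi> l) + (\<Sum>j\<in>{1..r}. \<epsilon> (l, j) * co P j)"
        unfolding act_perturbed \<nu>(2)[symmetric] by simp
      also have "\<dots> = 0" by (simp only: act0[OF E(1)] P(2) mult_zero_right sum.neutral_const add_0_left cong: sum.cong)
      finally show ?thesis .
    qed
  qed
  then have "\<Phi> \<nu> = \<Phi> (\<lambda>c. 0)" unfolding cols by (intro prim_cong) simp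
  then show "P = 0" using \<nu>(2) by (simp add: prim_def)
qed

end

lemma vnorm_epsilon:
  assumes F1: "F1 \<subseteq> vanish_eqns r N" and \<epsilon>: "\<And>i j. \<epsilon> (i, j) = (if Vanish j i \<in> F1 then h (Vanish j i) else 0)"
  shows "vnorm ({1..N} \<times> {1..r}) \<epsilon> = vnorm F1 h"
proof -
  let ?S = "{(i, j). Vanish j i \<in> F1}"
  have S: "?S \<subseteq> {1..N} \<times> {1..r}" using F1 by (auto simp: vanish_eqns_def)
  have "bij_betw (\<lambda>(i, j). Vanish j i) ?S F1"
    unfolding bij_betw_def using F1 by (force simp: inj_on_def vanish_eqns_def)
  then have "(\<Sum>c\<in>?S. (cmod (h ((\<lambda>(i, j). Vanish j i) c)))\<^sup>2) = (\<Sum>e\<in>F1. (cmod (h e))\<^sup>2)"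
    by (rule sum.reindex_bij_betw)
  moreover have "(\<Sum>c\<in>?S. (cmod (h ((\<lambda>(i, j). Vanish j i) c)))\<^sup>2) = (\<Sum>c\<in>?S. (cmod (\<epsilon> c))\<^sup>2)"
    by (intro sum.cong) (auto simp: \<epsilon>)
  moreover have "(\<Sum>c\<in>?S. (cmod (\<epsilon> c))\<^sup>2) = (\<Sum>c\<in>{1..N} \<times> {1..r}. (cmod (\<epsilon> c))\<^sup>2)"
    using S by (intro sum.mono_neutral_left) (auto simp: \<epsilon> split: if_splits)
  ultimately show ?thesis by (simp add: vnorm_def L2_set_def)
qed

theorem theorem6p1:
  fixes r N :: nat
    and \<beta> :: "nat \<Rightarrow> 'n::{finite,linorder} mon"
    and f :: "nat \<Rightarrow> 'n mpoly"
    and piv :: "nat \<Rightarrow> nat \<times> 'n"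
    and rs :: "nat \<Rightarrow> 'n row list"
    and cs :: "nat \<Rightarrow> (nat \<times> 'n) list"
    and V M :: "'n unk set"
    and C0 F0 F1 :: "'n eqn set"
    and F :: "'n eqn \<Rightarrow> ('n unk \<Rightarrow> complex) \<Rightarrow> complex"
    and p0 :: "'n unk \<Rightarrow> complex"
    and bt gt LK LF :: real
    and LA :: "nat \<Rightarrow> real"
  assumes "monomial_set r \<beta>"
    and "closed_under_division r \<beta>"
    and "regular_set r \<beta>"
    and "pivot_choice r \<beta> piv"
    and "submatrix_choice r \<beta> piv rs cs"
    and "V = unknowns r \<beta> piv"
    and "M = mu_unknowns r \<beta> piv"
    and "F = eqn_val r \<beta> piv f"
    and "C0 \<subseteq> vanish_eqns r N"
    and "F0 = G0 r \<beta> rs \<union> C0"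
    and "F1 = vanish_eqns r N - C0"
    and "p0 \<in> cspace V"
    and "card F0 = card V"
    and "jac_invertible V F0 F p0"
    and "bt = beta_tilde V F0 F p0"
    and "gt = gamma_tilde V F0 F p0"
    and "bt * gt < 0.26141"
    and "lipschitz_bound V p0 bt
           (\<lambda>p. mat_norm (K_rows r \<beta> N (top_deg r \<beta> + 1)) (cols r \<beta> (top_deg r \<beta> + 1))
                  (K_at r \<beta> piv f (top_deg r \<beta> + 1) p - K_at r \<beta> piv f (top_deg r \<beta> + 1) p0))
           LK"
    and "LK * bt < sigma_min (K_rows r \<beta> N (top_deg r \<beta> + 1)) (cols r \<beta> (top_deg r \<beta> + 1))
                     (K_at r \<beta> piv f (top_deg r \<beta> + 1) p0)"
    and "\<And>t. t \<in> {1..top_deg r \<beta>} \<Longrightarrow> lipschitz_bound M p0 bt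
           (\<lambda>p. mat_norm (set (rs t)) (set (cs t)) (A_at r \<beta> piv t p - A_at r \<beta> piv t p0)) (LA t)"
    and "\<And>t. t \<in> {1..top_deg r \<beta>} \<Longrightarrow> generic_rank r \<beta> t > 0 \<Longrightarrow>
           LA t * bt < sigma_min (set (rs t)) (set (cs t)) (A_at r \<beta> piv t p0)"
    and "lipschitz_bound V p0 bt (\<lambda>p. vnorm F1 (sys_val F1 F p - sys_val F1 F p0)) LF"
  shows "\<exists>p \<epsilon>. p \<in> cspace V \<and>
           newton_converges_quadratically V F0 F p0 p \<and>
           (\<forall>i j. \<epsilon> (i, j) =
              (if Vanish j i \<in> F1
               then act (xi_of p) (lam r \<beta> (mu_of r \<beta> piv p) j) (f i) else 0)) \<and>
           multiple_point_with_structure r \<beta> N (perturbed r \<beta> f \<epsilon> (xi_of p)) (xi_of p)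
             (lam r \<beta> (mu_of r \<beta> piv p)) \<and>
           vnorm ({1..N} \<times> {1..r}) \<epsilon> \<le> vnorm F1 (sys_val F1 F p0) + LF * bt"
proof -
  note reg = assms(3) and piv = assms(4) and sub = assms(5) and V = assms(6) and M = assms(7) and F = assms(8)
    and C0 = assms(9) and F0 = assms(10) and F1 = assms(11) and p0 = assms(12) and inv = assms(14)
    and bt = assms(15) and gt = assms(16) and \<alpha> = assms(17) and lipK = assms(18) and sigmaK = assms(19)
    and lipA = assms(20) and sigmaA = assms(21) and lipF = assms(22)
  interpret mon_basis r \<beta> by unfold_locales (rule assms(1), rule assms(2))
  have finV: "finite V" unfolding V unknowns_def using finite_mu_unknowns by simp
  have V_ne: "V \<noteq> {}" unfolding V unknowns_def by simp
  have MV: "mu_unknowns r \<beta> piv \<subseteq> V" unfolding V unknowns_def by simp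
  have "vanish_eqns r N \<subseteq> (\<lambda>(j, i). Vanish j i) ` ({1..r} \<times> {1..N})" unfolding vanish_eqns_def by force
  then have finv: "finite (vanish_eqns r N :: 'n eqn set)" by (rule finite_subset) simp
  have finF0: "finite F0" unfolding F0 using finite_G0 finite_subset[OF C0 finv] by simp
  obtain d where d: "\<forall>e\<in>F0. polyfun d (F e)"
    using polyfun_family[OF finF0, of F] polyfun_eqn_val unfolding F by blast
  have bt0: "0 \<le> bt" unfolding bt beta_tilde_def by simp
  obtain p where p: "p \<in> cspace V" "newton_converges_quadratically V F0 F p0 p"
    and dist: "vnorm V (p - p0) \<le> bt" and zero: "\<forall>e\<in>F0. F e p = 0"
    using newton_alpha[OF finV finF0 d[rule_format] inv \<alpha>[unfolded bt gt] p0] unfolding bt by blast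
  \<comment> \<open>Makes \<open>p\<close> an admissible argument of the Lipschitz bounds over
    \<open>V\<close>.\<close>
  have off: "p a = p0 a" if "a \<notin> V" for a using p(1) p0 that by (simp add: cspace_def)
  have distM: "vnorm (mu_unknowns r \<beta> piv) (p - p0) \<le> bt"
    using vnorm_mono_set[OF finV MV, of "p - p0"] dist by linarith
  let ?o = "top_deg r \<beta>" and ?m = "mu_of r \<beta> piv p" and ?\<xi> = "xi_of p"
  let ?\<Lambda> = "lam r \<beta> ?m"
  obtain D where D: "dual_sys ?o D ?\<Lambda>"
    and m: "\<And>j s l. j \<in> {1..rt ?o} \<Longrightarrow> s \<in> {1..rt ?o} \<Longrightarrow> mdeg (\<beta> s) < mdeg (\<beta> j) \<Longrightarrow>
      ?m j s l = co (pd l (?\<Lambda> j)) s"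
  proof -
    have "\<exists>D. dual_sys ?o D ?\<Lambda> \<and> D \<in> Hilb_reg r \<beta> ?o \<and>
      (\<forall>j\<in>{1..rt ?o}. \<forall>s\<in>{1..rt ?o}. \<forall>l. mdeg (\<beta> s) < mdeg (\<beta> j) \<longrightarrow> ?m j s l = co (pd l (?\<Lambda> j)) s)"
    proof (rule inverse_system_of_zero[OF reg piv sub])
      show "eqn_val r \<beta> piv f e p = 0" if "e \<in> G0 r \<beta> rs" for e using zero that unfolding F F0 by blast
    next
      fix t a assume t: "t \<in> {1..?o}"
        and ker: "\<And>\<rho>. \<rho> \<in> set (rs t) \<Longrightarrow> (\<Sum>c\<in>set (cs t). A_at r \<beta> piv t p \<rho> c * a c) = 0"
      show "\<forall>c\<in>set (cs t). a c = 0"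
        by (rule submatrix_injective[OF piv sub t lipA[OF t, unfolded M] sigmaA[OF t] bt0 distM
              finite_mu_unknowns ker])
    qed simp
    then show ?thesis using that by blast
  qed
  interpret dual_system r \<beta> ?o D ?\<Lambda> by unfold_locales (rule D)
  define h where "h = sys_val F1 F p"
  define \<epsilon> where "\<epsilon> = (\<lambda>(i, j). if Vanish j i \<in> F1 then act ?\<xi> (?\<Lambda> j) (f i) else 0)"
  have h: "h (Vanish j i) = act ?\<xi> (?\<Lambda> j) (f i)" if "Vanish j i \<in> F1" for i j
    using that by (simp add: h_def sys_val_def F)
  let ?R = "K_rows r \<beta> N (?o + 1)" and ?C = "cols r \<beta> (?o + 1)" and ?K = "K_at r \<beta> piv f (?o + 1)"
  have finR: "finite ?R" unfolding K_rows_def using finite_H_rows by simp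
  have finC: "finite ?C" by (simp add: Defs.cols_def)
  have "mat_norm ?R ?C (?K p - ?K p0) \<le> LK * bt"
    by (rule lipschitz_bound_le[OF lipK finV V_ne bt0 mat_norm_nonneg[OF finR finC] off dist])
  then have lt: "mat_norm ?R ?C (?K p - ?K p0) < sigma_min ?R ?C (?K p0)" using sigmaK by linarith
  have "multiple_point_with_structure r \<beta> N (perturbed r \<beta> f \<epsilon> ?\<xi>) ?\<xi> ?\<Lambda>"
  proof (rule perturbed_multiplicity_structure[OF rt_top refl m])
    fix i j assume ij: "i \<in> {1..N}" "j \<in> {1..r}"
    then have v: "Vanish j i \<in> vanish_eqns r N" by (auto simp: vanish_eqns_def)
    show "\<epsilon> (i, j) = act ?\<xi> (?\<Lambda> j) (f i)"
    proof (cases "Vanish j i \<in> F1")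
      case False
      \<comment> \<open>An entry outside \<open>F1\<close> is set to 0, and rightly so: its equation
        belongs to the square system and holds at \<open>p\<close>.\<close>
      then have "Vanish j i \<in> F0" using v unfolding F0 F1 by blast
      then have "F (Vanish j i) p = 0" using zero by blast
      then show ?thesis using False by (simp add: \<epsilon>_def F)
    qed (simp add: \<epsilon>_def)
  next
    fix a
    assume ker: "\<And>\<rho>. \<rho> \<in> K_rows r \<beta> N (Suc ?o) \<Longrightarrow>
      (\<Sum>c\<in>cols r \<beta> (Suc ?o). K_entry r \<beta> f (Suc ?o) ?\<xi> ?m \<rho> c * a c) = 0"
    show "\<forall>c\<in>cols r \<beta> (Suc ?o). a c = 0"
      using perturbation_injective[OF finR finC lt, of a] ker by (simp add: K_at_def)
  qed
  moreover have "vnorm ({1..N} \<times> {1..r}) \<epsilon> \<le> vnorm F1 (sys_val F1 F p0) + LF * bt"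
  proof -
    have "vnorm ({1..N} \<times> {1..r}) \<epsilon> = vnorm F1 h"
      using h by (intro vnorm_epsilon) (auto simp: F1 \<epsilon>_def)
    also have "\<dots> = vnorm F1 (\<lambda>e. sys_val F1 F p0 e + (h - sys_val F1 F p0) e)" by simp
    also have "\<dots> \<le> vnorm F1 (sys_val F1 F p0) + vnorm F1 (h - sys_val F1 F p0)" by (rule vnorm_triangle)
    also have "vnorm F1 (h - sys_val F1 F p0) \<le> LF * bt"
      unfolding h_def by (rule lipschitz_bound_le[OF lipF finV V_ne bt0 vnorm_nonneg off dist])
    finally show ?thesis by simp
  qed
  ultimately show ?thesis
    using p by (intro exI[of _ p] exI[of _ \<epsilon>] conjI) (simp_all add: \<epsilon>_def)
qed

end
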